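(* Let $(\mathfrak g,\mathfrak k)$ be a Hermitian symmetric pair, set $\mathfrak l=\mathfrak k$ and $\mathfrak u=\mathfrak p^+$, $\bar{\mathfrak u}=\mathfrak p^-$, and let $V$ be an irreducible unitary $(\mathfrak g,K)$-module. Let $d,\delta, D=d+\delta$ be the operators on $V\otimes S$, $S=\bigwedge^\cdot\mathfrak p^+$, defined in the context. Then: (a) $V\otimes S=\operatorname{Ker} D\oplus\operatorname{Im} d\oplus\operatorname{Im}\delta$; (b) $\operatorname{Ker} d=\operatorname{Ker} D\oplus\operatorname{Im} d$; (c) $\operatorname{Ker}\delta=\operatorname{Ker} D\oplus\operatorname{Im}\delta$. In particular, the Dirac cohomology of $V$ (which equals $\operatorname{Ker} D$) is equal to the $\mathfrak p^-$-cohomology and to the $\mathfrak p^+$-homology of $V$ up to modular twists: as $\mathfrak k$-modules, $$\operatorname{Ker} D\cong H^\cdot(\mathfrak p^-,V)\otimes Z_{\rho(\mathfrak p^-)}\cong H_\cdot(\mathfrak p^+,V)\otimes Z_{\rho(\mathfrak p^-)} .$$ More precisely, up to these twists, $\operatorname{Ker} D$ is the space of harmonic representatives for both: each class of $\operatorname{Ker} d/\operatorname{Im} d$ and each class of $\operatorname{Ker}\delta/\operatorname{Im}\delta$ has a unique representative in $\operatorname{Ker} D$.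
   Context: $G$ is a connected semisimple Lie group with finite center, with Lie algebra $\mathfrak g_0$ and complexification $\mathfrak g$; $\theta$ is a Cartan involution, $K=G^\theta$ the maximal compact subgroup, $\mathfrak g=\mathfrak k\oplus\mathfrak p$ the complexified Cartan decomposition, $B$ the Killing form. $(\mathfrak g,\mathfrak k)$ is Hermitian symmetric: $\mathfrak p=\mathfrak p^+\oplus\mathfrak p^-$ with $\mathfrak p^\pm$ $K$-stable abelian subalgebras, complex conjugate to each other with respect to $\mathfrak g_0$, and $\mathfrak k\oplus\mathfrak p^{+}$ is a parabolic subalgebra with Levi factor $\mathfrak k$, nilradical $\mathfrak p^+$ and opposite parabolic $\mathfrak k\oplus\mathfrak p^-$. A $(\mathfrak g,K)$-module is unitary if it carries a positive definite $K$-invariant Hermitian form for which elements of $\mathfrak g_0$ act by skew-Hermitian operators. $C(\mathfrak p)$ is the Clifford algebra of $(\mathfrak p,B)$ with relations $vw+wv=2B(v,w)$. It acts on the spin module $S=\bigwedge^\cdot\mathfrak p^+$ by $u\cdot Y=u\wedge Y$ for $u\in\mathfrak p^+$ and $u^*\cdot (Y_1\wedge\dots\wedge Y_p)=2\sum_i(-1)^{i+1}B(u^*,Y_i)\,Y_1\wedge\dots\widehat{Y_i}\dots\wedge Y_p$ for $u^*\in\mathfrak p^-$; thus $U(\mathfrak g)\otimes C(\mathfrak p)$ acts on $V\otimes S$. Let $u_1,\dots,u_n$ be a basis of $\mathfrak p^+$ and $u_1^*,\dots,u_n^*$ the $B$-dual basis of $\mathfrak p^-$. Then $d$ is the action on $V\otimes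 S$ of $\sum_i u_i^*\otimes u_i$ and $\delta$ is the action of $\sum_i u_i\otimes u_i^*$. The operator $d$ is the differential of the complex $V\otimes\bigwedge^\cdot\mathfrak p^+\cong\operatorname{Hom}(\bigwedge^\cdot\mathfrak p^-,V)$ computing $H^\cdot(\mathfrak p^-,V)$, and $\delta=-2\partial$, where $\partial$ is the differential of the complex $V\otimes\bigwedge^\cdot\mathfrak p^+$ computing $H_\cdot(\mathfrak p^+,V)$. $D=d+\delta$ is the Dirac operator $D(\mathfrak g,\mathfrak k)$. The Dirac cohomology of $V$ is $\operatorname{Ker} D/(\operatorname{Im} D\cap\operatorname{Ker} D)$. $\mathfrak k$ acts on $V\otimes S$ by $X\mapsto X\otimes 1+1\otimes\alpha(X)$, where $\alpha:\mathfrak k\to\mathfrak{so}(\mathfrak p)\hookrightarrow C(\mathfrak p)$ is the standard Lie algebra map, characterized by: $\alpha(X)$ lies in the image of $\mathfrak{so}(\mathfrak p)\cong\bigwedge^2\mathfrak p$ in $C(\mathfrak p)$ and $[\alpha(X),v]=[X,v]$ for $v\in\mathfrak p$. On $H^\cdot(\mathfrak p^-,V)$ and $H_\cdot(\mathfrak p^+,V)$, $\mathfrak k$ acts through the given action on $V$ and the adjoint action on $\bigwedge^\cdot\mathfrak p^{\pm}$. $Z_{\rho(\mathfrak p^-)}$ is the one-dimensional $\mathfrak k$-module whose weight $\rho(\mathfrak p^-)$ is half the sum of the weights of $\mathfrak p^-$ (half the trace of the adjoint action on $\mathfrak p^-$). *)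

theory Defs
  imports
    "HOL-Analysis.Analysis"
    "HOL-Algebra.Group"
    "HOL-Library.Function_Algebras"
    "HOL-Library.Poly_Mapping"
begin

section \<open>Linear algebra\<close>

definition finite_dimensional :: "('k::field \<Rightarrow> 'x::ab_group_add \<Rightarrow> 'x) \<Rightarrow> bool" where
  "finite_dimensional s \<longleftrightarrow> (\<exists>B. finite B \<and> module.span s B = UNIV)"

text \<open>Trace on a finite-dimensional subspace \<open>W\<close> of an operator that maps \<open>W\<close> to itself; the
  value does not depend on the basis that is chosen.\<close>

definition trace_on ::
    "('k::field \<Rightarrow> 'x::ab_group_add \<Rightarrow> 'x) \<Rightarrow> 'x set \<Rightarrow> ('x \<Rightarrow> 'x) \<Rightarrow> 'k" where
  "trace_on s W f =
    (let B = (SOME B. \<not> module.dependent s B \<and> module.span s B = W)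
     in \<Sum>b\<in>B. module.representation s B (f b) b)"

text \<open>\<open>W\<close> is the internal direct sum of the subspaces in the list \<open>As\<close>: summation is a bijection
  from the product of the \<open>As\<close> onto \<open>W\<close>.\<close>

definition direct_sum ::
    "('k::field \<Rightarrow> 'x::ab_group_add \<Rightarrow> 'x) \<Rightarrow> 'x set \<Rightarrow> 'x set list \<Rightarrow> bool" where
  "direct_sum s W As \<longleftrightarrow>
    (\<forall>A\<in>set As. module.subspace s A) \<and> bij_betw sum_list (listset As) W"

definition ker_on :: "'x set \<Rightarrow> ('x \<Rightarrow> 'y::zero) \<Rightarrow> 'x set" where
  "ker_on W f = {x \<in> W. f x = 0}"

definition coset :: "'x::ab_group_add set \<Rightarrow> 'x \<Rightarrow> 'x set" where
  "coset B x = {x + b |b. b \<in> B}"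


section \<open>Lie algebras\<close>

locale lie_algebra = vector_space scale
  for scale :: "'k::field \<Rightarrow> 'x::ab_group_add \<Rightarrow> 'x" +
  fixes bracket :: "'x \<Rightarrow> 'x \<Rightarrow> 'x"
  assumes bracket_add_left: "bracket (x + y) z = bracket x z + bracket y z"
    and bracket_add_right: "bracket x (y + z) = bracket x y + bracket x z"
    and bracket_scale_left: "bracket (scale c x) y = scale c (bracket x y)"
    and bracket_scale_right: "bracket x (scale c y) = scale c (bracket x y)"
    and bracket_self: "bracket x x = 0"
    and jacobi: "bracket x (bracket y z) + bracket y (bracket z x) + bracket z (bracket x y) = 0"

definition killing ::
    "('k::field \<Rightarrow> 'x::ab_group_add \<Rightarrow> 'x) \<Rightarrow> ('x \<Rightarrow> 'x \<Rightarrow> 'x) \<Rightarrow> 'x \<Rightarrow> 'x \<Rightarrow> 'k" where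
  "killing s br x y = trace_on s UNIV (\<lambda>z. br x (br y z))"

definition lie_subalgebra ::
    "('k::field \<Rightarrow> 'x::ab_group_add \<Rightarrow> 'x) \<Rightarrow> ('x \<Rightarrow> 'x \<Rightarrow> 'x) \<Rightarrow> 'x set \<Rightarrow> bool" where
  "lie_subalgebra s br H \<longleftrightarrow> module.subspace s H \<and> (\<forall>x\<in>H. \<forall>y\<in>H. br x y \<in> H)"

definition lie_ideal ::
    "('k::field \<Rightarrow> 'x::ab_group_add \<Rightarrow> 'x) \<Rightarrow> ('x \<Rightarrow> 'x \<Rightarrow> 'x) \<Rightarrow> 'x set \<Rightarrow> 'x set \<Rightarrow> bool" where
  "lie_ideal s br H I \<longleftrightarrow> module.subspace s I \<and> I \<subseteq> H \<and> (\<forall>x\<in>H. \<forall>y\<in>I. br x y \<in> I)"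

definition bracket_span ::
    "('k::field \<Rightarrow> 'x::ab_group_add \<Rightarrow> 'x) \<Rightarrow> ('x \<Rightarrow> 'x \<Rightarrow> 'x) \<Rightarrow> 'x set \<Rightarrow> 'x set \<Rightarrow> 'x set" where
  "bracket_span s br H J = module.span s {br x y |x y. x \<in> H \<and> y \<in> J}"

definition solvable ::
    "('k::field \<Rightarrow> 'x::ab_group_add \<Rightarrow> 'x) \<Rightarrow> ('x \<Rightarrow> 'x \<Rightarrow> 'x) \<Rightarrow> 'x set \<Rightarrow> bool" where
  "solvable s br H \<longleftrightarrow> (\<exists>m. ((\<lambda>J. bracket_span s br J J) ^^ m) H = {0})"

definition nilpotent ::
    "('k::field \<Rightarrow> 'x::ab_group_add \<Rightarrow> 'x) \<Rightarrow> ('x \<Rightarrow> 'x \<Rightarrow> 'x) \<Rightarrow> 'x set \<Rightarrow> bool" where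
  "nilpotent s br H \<longleftrightarrow> (\<exists>m. (bracket_span s br H ^^ m) H = {0})"

definition semisimple ::
    "('k::field \<Rightarrow> 'x::ab_group_add \<Rightarrow> 'x) \<Rightarrow> ('x \<Rightarrow> 'x \<Rightarrow> 'x) \<Rightarrow> bool" where
  "semisimple s br \<longleftrightarrow> (\<forall>I. lie_ideal s br UNIV I \<and> solvable s br I \<longrightarrow> I = {0})"

definition reductive ::
    "('k::field \<Rightarrow> 'x::ab_group_add \<Rightarrow> 'x) \<Rightarrow> ('x \<Rightarrow> 'x \<Rightarrow> 'x) \<Rightarrow> 'x set \<Rightarrow> bool" where
  "reductive s br H \<longleftrightarrow>
    (\<forall>I. lie_ideal s br H I \<longrightarrow> (\<exists>J. lie_ideal s br H J \<and> direct_sum s H [I, J]))"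

definition borel_subalgebra ::
    "('k::field \<Rightarrow> 'x::ab_group_add \<Rightarrow> 'x) \<Rightarrow> ('x \<Rightarrow> 'x \<Rightarrow> 'x) \<Rightarrow> 'x set \<Rightarrow> bool" where
  "borel_subalgebra s br H \<longleftrightarrow>
    lie_subalgebra s br H \<and> solvable s br H \<and>
    (\<forall>H'. lie_subalgebra s br H' \<and> solvable s br H' \<and> H \<subseteq> H' \<longrightarrow> H' = H)"

definition parabolic_subalgebra ::
    "('k::field \<Rightarrow> 'x::ab_group_add \<Rightarrow> 'x) \<Rightarrow> ('x \<Rightarrow> 'x \<Rightarrow> 'x) \<Rightarrow> 'x set \<Rightarrow> bool" where
  "parabolic_subalgebra s br Q \<longleftrightarrow>
    lie_subalgebra s br Q \<and> (\<exists>H. borel_subalgebra s br H \<and> H \<subseteq> Q)"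

definition is_nilradical ::
    "('k::field \<Rightarrow> 'x::ab_group_add \<Rightarrow> 'x) \<Rightarrow> ('x \<Rightarrow> 'x \<Rightarrow> 'x) \<Rightarrow> 'x set \<Rightarrow> 'x set \<Rightarrow> bool" where
  "is_nilradical s br Q N \<longleftrightarrow>
    lie_ideal s br Q N \<and> nilpotent s br N \<and>
    (\<forall>M. lie_ideal s br Q M \<and> nilpotent s br M \<longrightarrow> M \<subseteq> N)"

text \<open>\<open>L + U\<close> is a parabolic subalgebra with Levi factor \<open>L\<close> and nilradical \<open>U\<close>.\<close>

definition parabolic_with_levi ::
    "('k::field \<Rightarrow> 'x::ab_group_add \<Rightarrow> 'x) \<Rightarrow> ('x \<Rightarrow> 'x \<Rightarrow> 'x) \<Rightarrow> 'x set \<Rightarrow> 'x set \<Rightarrow> bool" where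
  "parabolic_with_levi s br L U \<longleftrightarrow>
    (let Q = {x + y |x y. x \<in> L \<and> y \<in> U} in
      parabolic_subalgebra s br Q \<and> is_nilradical s br Q U \<and>
      lie_subalgebra s br L \<and> reductive s br L \<and> direct_sum s Q [L, U])"

text \<open>Complexification: the pair \<open>(x, y)\<close> stands for \<open>x + i y\<close>.\<close>

definition cscale :: "complex \<Rightarrow> 'a::real_vector \<times> 'a \<Rightarrow> 'a \<times> 'a" where
  "cscale c z = (Re c *\<^sub>R fst z - Im c *\<^sub>R snd z, Re c *\<^sub>R snd z + Im c *\<^sub>R fst z)"

definition cbracket :: "('a::real_vector \<Rightarrow> 'a \<Rightarrow> 'a) \<Rightarrow> 'a \<times> 'a \<Rightarrow> 'a \<times> 'a \<Rightarrow> 'a \<times> 'a" where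
  "cbracket br z w =
    (br (fst z) (fst w) - br (snd z) (snd w), br (fst z) (snd w) + br (snd z) (fst w))"

definition cconj :: "'a::real_vector \<times> 'a \<Rightarrow> 'a \<times> 'a" where
  "cconj z = (fst z, - snd z)"


section \<open>Lie groups\<close>

text \<open>For open \<open>S\<close> in a finite-dimensional space, \<open>Ck_on k S f\<close> says that \<open>f\<close> is of class
  \<open>C\<^sup>k\<close> on \<open>S\<close>.\<close>

fun Ck_on :: "nat \<Rightarrow> 'b::real_normed_vector set \<Rightarrow> ('b \<Rightarrow> 'c::real_normed_vector) \<Rightarrow> bool" where
  "Ck_on 0 S f = continuous_on S f"
| "Ck_on (Suc k) S f =
    ((\<forall>x\<in>S. f differentiable (at x)) \<and> (\<forall>v. Ck_on k S (\<lambda>x. frechet_derivative f (at x) v)))"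

definition smooth_on :: "'b::real_normed_vector set \<Rightarrow> ('b \<Rightarrow> 'c::real_normed_vector) \<Rightarrow> bool" where
  "smooth_on S f \<longleftrightarrow> (\<forall>k. Ck_on k S f)"

text \<open>A chart is a pair \<open>(U, \<phi>)\<close>. The model space is a normed space of arbitrary finite dimension
  (possibly 0).\<close>

definition smooth_atlas ::
    "('g::topological_space set \<times> ('g \<Rightarrow> 'e::real_normed_vector)) set \<Rightarrow> bool" where
  "smooth_atlas A \<longleftrightarrow>
    finite_dimensional (scaleR :: real \<Rightarrow> 'e \<Rightarrow> 'e) \<and> (\<Union>(U, \<phi>)\<in>A. U) = UNIV \<and>
    (\<forall>(U, \<phi>)\<in>A. open U \<and> open (\<phi> ` U) \<and> inj_on \<phi> U \<and> continuous_on U \<phi> \<and>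
        continuous_on (\<phi> ` U) (inv_into U \<phi>)) \<and>
    (\<forall>(U, \<phi>)\<in>A. \<forall>(U', \<phi>')\<in>A. smooth_on (\<phi> ` (U \<inter> U')) (\<phi>' \<circ> inv_into U \<phi>))"

definition smooth_functions ::
    "('g set \<times> ('g \<Rightarrow> 'e::real_normed_vector)) set \<Rightarrow> ('g \<Rightarrow> real) set" where
  "smooth_functions A = {f. \<forall>(U, \<phi>)\<in>A. smooth_on (\<phi> ` U) (f \<circ> inv_into U \<phi>)}"

definition smooth_map ::
    "('g::topological_space set \<times> ('g \<Rightarrow> 'e::real_normed_vector)) set \<Rightarrow> ('g \<Rightarrow> 'g) \<Rightarrow> bool" where
  "smooth_map A F \<longleftrightarrow> continuous_on UNIV F \<and>
    (\<forall>(U, \<phi>)\<in>A. \<forall>(U', \<phi>')\<in>A. smooth_on (\<phi> ` (U \<inter> F -` U')) (\<phi>' \<circ> F \<circ> inv_into U \<phi>))"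

locale lie_group = group G
  for G :: "'g::{t2_space, second_countable_topology} monoid" (structure) +
  fixes atlas :: "('g set \<times> ('g \<Rightarrow> 'e::real_normed_vector)) set"
  assumes carrier_UNIV: "carrier G = UNIV"
    and atlas: "smooth_atlas atlas"
    and continuous_mult: "continuous_on UNIV (\<lambda>(x, y). x \<otimes> y)"
    and smooth_mult: "\<lbrakk>(U, \<phi>) \<in> atlas; (V, \<psi>) \<in> atlas; (W, \<eta>) \<in> atlas\<rbrakk> \<Longrightarrow>
      smooth_on {(x, y). x \<in> \<phi> ` U \<and> y \<in> \<psi> ` V \<and> inv_into U \<phi> x \<otimes> inv_into V \<psi> y \<in> W}
        (\<lambda>(x, y). \<eta> (inv_into U \<phi> x \<otimes> inv_into V \<psi> y))"
    and smooth_inverse: "smooth_map atlas (\<lambda>x. inv x)"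

definition group_center :: "'g monoid \<Rightarrow> 'g set" where
  "group_center G = {z \<in> carrier G. \<forall>g\<in>carrier G. z \<otimes>\<^bsub>G\<^esub> g = g \<otimes>\<^bsub>G\<^esub> z}"

text \<open>Left-invariant vector fields, as derivations of the algebra of smooth functions. Functions that
  are not smooth are sent to 0, so that a vector field is determined by its values on smooth functions.\<close>

definition left_invariant_fields ::
    "'g monoid \<Rightarrow> ('g set \<times> ('g \<Rightarrow> 'e::real_normed_vector)) set \<Rightarrow> (('g \<Rightarrow> real) \<Rightarrow> 'g \<Rightarrow> real) set"
  where
  "left_invariant_fields G A =
    {X. (\<forall>f. f \<notin> smooth_functions A \<longrightarrow> X f = 0) \<and>
        (\<forall>f\<in>smooth_functions A. X f \<in> smooth_functions A) \<and>
        (\<forall>f\<in>smooth_functions A. \<forall>h\<in>smooth_functions A. X (f + h) = X f + X h) \<and>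
        (\<forall>c. \<forall>f\<in>smooth_functions A. X (\<lambda>g. c * f g) = (\<lambda>g. c * X f g)) \<and>
        (\<forall>f\<in>smooth_functions A. \<forall>h\<in>smooth_functions A. X (f * h) = X f * h + f * X h) \<and>
        (\<forall>a\<in>carrier G. \<forall>f\<in>smooth_functions A.
            X (\<lambda>g. f (a \<otimes>\<^bsub>G\<^esub> g)) = (\<lambda>g. X f (a \<otimes>\<^bsub>G\<^esub> g)))}"

text \<open>\<open>(\<gg>\<^sub>0, br)\<close>, carried by the type \<open>'a\<close>, is the Lie algebra of \<open>G\<close>, where \<open>L\<close> identifies its
  elements with the left-invariant vector fields on \<open>G\<close>.\<close>

definition lie_algebra_of ::
    "'g monoid \<Rightarrow> ('g set \<times> ('g \<Rightarrow> 'e::real_normed_vector)) set \<Rightarrow>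
      ('a::real_vector \<Rightarrow> 'a \<Rightarrow> 'a) \<Rightarrow> ('a \<Rightarrow> ('g \<Rightarrow> real) \<Rightarrow> 'g \<Rightarrow> real) \<Rightarrow> bool" where
  "lie_algebra_of G A br L \<longleftrightarrow>
    lie_algebra (scaleR :: real \<Rightarrow> 'a \<Rightarrow> 'a) br \<and>
    finite_dimensional (scaleR :: real \<Rightarrow> 'a \<Rightarrow> 'a) \<and>
    bij_betw L UNIV (left_invariant_fields G A) \<and>
    (\<forall>x y f. L (x + y) f = L x f + L y f) \<and>
    (\<forall>c x f. L (c *\<^sub>R x) f = (\<lambda>g. c * L x f g)) \<and>
    (\<forall>x y. \<forall>f\<in>smooth_functions A. L (br x y) f = L x (L y f) - L y (L x f))"

text \<open>The differential at the identity of a smooth map \<open>\<Phi>\<close> that fixes the identity. The tangent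
  vector at the identity that belongs to \<open>x\<close> is \<open>f \<mapsto> L x f \<one>\<close>.\<close>

definition differential ::
    "'g monoid \<Rightarrow> ('g set \<times> ('g \<Rightarrow> 'e::real_normed_vector)) set \<Rightarrow>
      ('a \<Rightarrow> ('g \<Rightarrow> real) \<Rightarrow> 'g \<Rightarrow> real) \<Rightarrow> ('g \<Rightarrow> 'g) \<Rightarrow> 'a \<Rightarrow> 'a" where
  "differential G A L \<Phi> x =
    (THE y. \<forall>f\<in>smooth_functions A. L y f \<one>\<^bsub>G\<^esub> = L x (f \<circ> \<Phi>) \<one>\<^bsub>G\<^esub>)"

definition Ad ::
    "'g monoid \<Rightarrow> ('g set \<times> ('g \<Rightarrow> 'e::real_normed_vector)) set \<Rightarrow>
      ('a \<Rightarrow> ('g \<Rightarrow> real) \<Rightarrow> 'g \<Rightarrow> real) \<Rightarrow> 'g \<Rightarrow> 'a \<Rightarrow> 'a" where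
  "Ad G A L g = differential G A L (\<lambda>h. g \<otimes>\<^bsub>G\<^esub> h \<otimes>\<^bsub>G\<^esub> inv\<^bsub>G\<^esub> g)"

definition cAd ::
    "'g monoid \<Rightarrow> ('g set \<times> ('g \<Rightarrow> 'e::real_normed_vector)) set \<Rightarrow>
      ('a \<Rightarrow> ('g \<Rightarrow> real) \<Rightarrow> 'g \<Rightarrow> real) \<Rightarrow> 'g \<Rightarrow> 'a \<times> 'a \<Rightarrow> 'a \<times> 'a" where
  "cAd G A L g = map_prod (Ad G A L g) (Ad G A L g)"


section \<open>Cartan involutions and Hermitian symmetric pairs\<close>

definition cartan_involution :: "('a::real_vector \<Rightarrow> 'a \<Rightarrow> 'a) \<Rightarrow> ('a \<Rightarrow> 'a) \<Rightarrow> bool" where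
  "cartan_involution br \<theta> \<longleftrightarrow>
    linear \<theta> \<and> (\<forall>x. \<theta> (\<theta> x) = x) \<and> (\<forall>x y. \<theta> (br x y) = br (\<theta> x) (\<theta> y)) \<and>
    (\<forall>x. x \<noteq> 0 \<longrightarrow> - killing scaleR br x (\<theta> x) > 0)"

text \<open>The involution of the group whose differential is the Cartan involution \<open>\<theta>\<close>.\<close>

definition global_cartan_involution ::
    "'g::topological_space monoid \<Rightarrow> ('g set \<times> ('g \<Rightarrow> 'e::real_normed_vector)) set \<Rightarrow>
      ('a::real_vector \<Rightarrow> 'a \<Rightarrow> 'a) \<Rightarrow> ('a \<Rightarrow> ('g \<Rightarrow> real) \<Rightarrow> 'g \<Rightarrow> real) \<Rightarrow>
      ('g \<Rightarrow> 'g) \<Rightarrow> ('a \<Rightarrow> 'a) \<Rightarrow> bool" where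
  "global_cartan_involution G A br L \<Theta> \<theta> \<longleftrightarrow>
    \<Theta> \<in> hom G G \<and> smooth_map A \<Theta> \<and> (\<forall>g\<in>carrier G. \<Theta> (\<Theta> g) = g) \<and>
    \<theta> = differential G A L \<Theta> \<and> cartan_involution br \<theta>"

definition kpart :: "('a::real_vector \<Rightarrow> 'a) \<Rightarrow> ('a \<times> 'a) set" where
  "kpart \<theta> = {z. map_prod \<theta> \<theta> z = z}"

definition ppart :: "('a::real_vector \<Rightarrow> 'a) \<Rightarrow> ('a \<times> 'a) set" where
  "ppart \<theta> = {z. map_prod \<theta> \<theta> z = - z}"

definition hermitian_symmetric ::
    "'g monoid \<Rightarrow> ('g set \<times> ('g \<Rightarrow> 'e::real_normed_vector)) set \<Rightarrow>
      ('a::real_vector \<Rightarrow> 'a \<Rightarrow> 'a) \<Rightarrow> ('a \<Rightarrow> ('g \<Rightarrow> real) \<Rightarrow> 'g \<Rightarrow> real) \<Rightarrow>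
      'g set \<Rightarrow> ('a \<Rightarrow> 'a) \<Rightarrow> ('a \<times> 'a) set \<Rightarrow> ('a \<times> 'a) set \<Rightarrow> bool" where
  "hermitian_symmetric G A br L K \<theta> Pp Pm \<longleftrightarrow>
    direct_sum cscale (ppart \<theta>) [Pp, Pm] \<and>
    (\<forall>P\<in>{Pp, Pm}. (\<forall>k\<in>K. cAd G A L k ` P \<subseteq> P) \<and> (\<forall>x\<in>P. \<forall>y\<in>P. cbracket br x y = 0)) \<and>
    Pm = cconj ` Pp \<and>
    parabolic_with_levi cscale (cbracket br) (kpart \<theta>) Pp \<and>
    parabolic_with_levi cscale (cbracket br) (kpart \<theta>) Pm"


section \<open>\<open>(\<gg>, K)\<close>-modules\<close>

text \<open>The vector space \<open>V\<close> is the type \<open>'v\<close> with scalar multiplication \<open>sV\<close>; \<open>\<pi>\<close> is the action of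
  the complexified Lie algebra and \<open>\<kappa>\<close> that of \<open>K\<close>. The orbit of each vector spans a
  finite-dimensional space on which \<open>K\<close> acts smoothly (equivalently, continuously). In terms of matrix
  coefficients, with smooth functions on the closed subgroup \<open>K\<close> being the restrictions of those on
  \<open>G\<close>: each function \<open>k \<mapsto> Re (\<xi> (\<kappa> k v))\<close> is smooth, and its derivative at the identity in the
  direction \<open>x \<in> \<kk>\<^sub>0\<close> is \<open>Re (\<xi> (\<pi> x v))\<close>. Imaginary parts are covered by replacing the linear functional \<open>\<xi>\<close>
  with \<open>- i \<xi>\<close>.\<close>

definition gK_module ::
    "'g monoid \<Rightarrow> ('g set \<times> ('g \<Rightarrow> 'e::real_normed_vector)) set \<Rightarrow>
      ('a::real_vector \<Rightarrow> 'a \<Rightarrow> 'a) \<Rightarrow> ('a \<Rightarrow> ('g \<Rightarrow> real) \<Rightarrow> 'g \<Rightarrow> real) \<Rightarrow>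
      'g set \<Rightarrow> ('a \<Rightarrow> 'a) \<Rightarrow> (complex \<Rightarrow> 'v::ab_group_add \<Rightarrow> 'v) \<Rightarrow>
      ('a \<times> 'a \<Rightarrow> 'v \<Rightarrow> 'v) \<Rightarrow> ('g \<Rightarrow> 'v \<Rightarrow> 'v) \<Rightarrow> bool" where
  "gK_module G A br L K \<theta> sV \<pi> \<kappa> \<longleftrightarrow>
    vector_space sV \<and>
    (\<forall>X. Vector_Spaces.linear sV sV (\<pi> X)) \<and>
    (\<forall>X Y v. \<pi> (X + Y) v = \<pi> X v + \<pi> Y v) \<and>
    (\<forall>c X v. \<pi> (cscale c X) v = sV c (\<pi> X v)) \<and>
    (\<forall>X Y v. \<pi> (cbracket br X Y) v = \<pi> X (\<pi> Y v) - \<pi> Y (\<pi> X v)) \<and>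
    (\<forall>k\<in>K. Vector_Spaces.linear sV sV (\<kappa> k)) \<and>
    (\<forall>v. \<kappa> \<one>\<^bsub>G\<^esub> v = v) \<and>
    (\<forall>k\<in>K. \<forall>k'\<in>K. \<forall>v. \<kappa> (k \<otimes>\<^bsub>G\<^esub> k') v = \<kappa> k (\<kappa> k' v)) \<and>
    (\<forall>v. \<exists>B. finite B \<and> (\<lambda>k. \<kappa> k v) ` K \<subseteq> module.span sV B) \<and>
    (\<forall>v \<xi>. Vector_Spaces.linear sV (*) \<xi> \<longrightarrow>
      (\<exists>f\<in>smooth_functions A. \<forall>k\<in>K. f k = Re (\<xi> (\<kappa> k v))) \<and>
      (\<forall>f\<in>smooth_functions A. (\<forall>k\<in>K. f k = Re (\<xi> (\<kappa> k v))) \<longrightarrow>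
        (\<forall>x. \<theta> x = x \<longrightarrow> L x f \<one>\<^bsub>G\<^esub> = Re (\<xi> (\<pi> (x, 0) v))))) \<and>
    (\<forall>k\<in>K. \<forall>X v. \<kappa> k (\<pi> X v) = \<pi> (cAd G A L k X) (\<kappa> k v))"

definition irreducible_gK ::
    "'g set \<Rightarrow> (complex \<Rightarrow> 'v::ab_group_add \<Rightarrow> 'v) \<Rightarrow> ('x \<Rightarrow> 'v \<Rightarrow> 'v) \<Rightarrow> ('g \<Rightarrow> 'v \<Rightarrow> 'v) \<Rightarrow> bool" where
  "irreducible_gK K sV \<pi> \<kappa> \<longleftrightarrow>
    (\<exists>v::'v. v \<noteq> 0) \<and>
    (\<forall>U. module.subspace sV U \<and> (\<forall>X. \<pi> X ` U \<subseteq> U) \<and> (\<forall>k\<in>K. \<kappa> k ` U \<subseteq> U) \<longrightarrow>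
      U = {0} \<or> U = UNIV)"

definition positive_hermitian_form ::
    "(complex \<Rightarrow> 'v::ab_group_add \<Rightarrow> 'v) \<Rightarrow> ('v \<Rightarrow> 'v \<Rightarrow> complex) \<Rightarrow> bool" where
  "positive_hermitian_form sV h \<longleftrightarrow>
    (\<forall>v v' w. h (v + v') w = h v w + h v' w) \<and> (\<forall>c v w. h (sV c v) w = c * h v w) \<and>
    (\<forall>v w. h w v = cnj (h v w)) \<and> (\<forall>v. v \<noteq> 0 \<longrightarrow> Re (h v v) > 0)"

definition unitary_gK ::
    "'g set \<Rightarrow> (complex \<Rightarrow> 'v::ab_group_add \<Rightarrow> 'v) \<Rightarrow> ('a::real_vector \<times> 'a \<Rightarrow> 'v \<Rightarrow> 'v) \<Rightarrow>
      ('g \<Rightarrow> 'v \<Rightarrow> 'v) \<Rightarrow> bool" where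
  "unitary_gK K sV \<pi> \<kappa> \<longleftrightarrow>
    (\<exists>h. positive_hermitian_form sV h \<and>
      (\<forall>k\<in>K. \<forall>v w. h (\<kappa> k v) (\<kappa> k w) = h v w) \<and>
      (\<forall>x v w. h (\<pi> (x, 0) v) w = - h v (\<pi> (x, 0) w)))"


section \<open>Exterior algebra\<close>

text \<open>Let \<open>b 0, \<dots>, b (n - 1)\<close> be a basis of a space \<open>\<aa>\<close>. An element of \<open>\<And>\<aa>\<close> is the
  family of its coefficients with respect to the monomials \<open>b\<^sub>I = b i\<^sub>1 \<and> \<dots> \<and> b i\<^sub>p\<close> for
  \<open>I = {i\<^sub>1 < \<dots> < i\<^sub>p} \<subseteq> {..<n}\<close>, and an element \<open>T\<close> of \<open>V \<otimes> \<And>\<aa>\<close> stands for the sum of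
  the \<open>T I \<otimes> b\<^sub>I\<close>.\<close>

definition monomial :: "nat set \<Rightarrow> nat set \<Rightarrow> complex" where
  "monomial I = (\<lambda>J. if J = I then 1 else 0)"

text \<open>The sign from moving a factor past those factors of \<open>b\<^sub>I\<close> that have smaller index.\<close>

definition move_sign :: "nat \<Rightarrow> nat set \<Rightarrow> complex" where
  "move_sign i I = (- 1) ^ card {k \<in> I. k < i}"

definition coord :: "(complex \<Rightarrow> 'x::ab_group_add \<Rightarrow> 'x) \<Rightarrow> (nat \<Rightarrow> 'x) \<Rightarrow> nat \<Rightarrow> 'x \<Rightarrow> nat \<Rightarrow> complex"
  where "coord s b n x j = module.representation s (b ` {..<n}) x (b j)"

definition wedge ::
    "(complex \<Rightarrow> 'x::ab_group_add \<Rightarrow> 'x) \<Rightarrow> (nat \<Rightarrow> 'x) \<Rightarrow> nat \<Rightarrow> 'x \<Rightarrow>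
      (nat set \<Rightarrow> complex) \<Rightarrow> nat set \<Rightarrow> complex" where
  "wedge s b n x Y = (\<lambda>J. \<Sum>I\<in>Pow {..<n}.
     Y I * (\<Sum>j\<in>{..<n} - I. coord s b n x j * move_sign j I * monomial (insert j I) J))"

text \<open>Contraction with the linear functional \<open>\<phi>\<close>.\<close>

definition contract ::
    "(nat \<Rightarrow> 'x) \<Rightarrow> nat \<Rightarrow> ('x \<Rightarrow> complex) \<Rightarrow> (nat set \<Rightarrow> complex) \<Rightarrow> nat set \<Rightarrow> complex" where
  "contract b n \<phi> Y = (\<lambda>J. \<Sum>I\<in>Pow {..<n}.
     Y I * (\<Sum>i\<in>I. move_sign i I * \<phi> (b i) * monomial (I - {i}) J))"

text \<open>The derivation of \<open>\<And>\<aa>\<close> that extends the endomorphism \<open>A\<close> of \<open>\<aa>\<close>.\<close>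

definition ext_derivation ::
    "(complex \<Rightarrow> 'x::ab_group_add \<Rightarrow> 'x) \<Rightarrow> (nat \<Rightarrow> 'x) \<Rightarrow> nat \<Rightarrow> ('x \<Rightarrow> 'x) \<Rightarrow>
      (nat set \<Rightarrow> complex) \<Rightarrow> nat set \<Rightarrow> complex" where
  "ext_derivation s b n A Y = (\<lambda>J. \<Sum>I\<in>Pow {..<n}.
     Y I * (\<Sum>i\<in>I. move_sign i I * wedge s b n (A (b i)) (monomial (I - {i})) J))"

definition tensor_space :: "nat \<Rightarrow> (nat set \<Rightarrow> 'v::ab_group_add) set" where
  "tensor_space n = {T. \<forall>I. \<not> I \<subseteq> {..<n} \<longrightarrow> T I = 0}"

definition tensor_scale ::
    "(complex \<Rightarrow> 'v \<Rightarrow> 'v) \<Rightarrow> complex \<Rightarrow> ('i \<Rightarrow> 'v) \<Rightarrow> 'i \<Rightarrow> 'v" where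
  "tensor_scale sV c T = (\<lambda>i. sV c (T i))"

text \<open>The operator \<open>A \<otimes> C\<close> on \<open>V \<otimes> \<And>\<aa>\<close>.\<close>

definition tensor_op ::
    "(complex \<Rightarrow> 'v::ab_group_add \<Rightarrow> 'v) \<Rightarrow> nat \<Rightarrow> ('v \<Rightarrow> 'v) \<Rightarrow>
      ((nat set \<Rightarrow> complex) \<Rightarrow> nat set \<Rightarrow> complex) \<Rightarrow> (nat set \<Rightarrow> 'v) \<Rightarrow> nat set \<Rightarrow> 'v" where
  "tensor_op sV n A C T = (\<lambda>J. \<Sum>I\<in>Pow {..<n}. sV (C (monomial I) J) (A (T I)))"


section \<open>Clifford algebra and spin module\<close>

text \<open>Lists form a monoid under concatenation, so \<open>'x list \<Rightarrow>\<^sub>0 complex\<close> is the free associative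
  algebra with generators \<open>'x\<close>. The Clifford algebra of \<open>(P, B)\<close> is the quotient of its subalgebra
  generated by \<open>P\<close> by the two-sided ideal \<open>clifford_ideal\<close>, which also contains the relations that make
  the map from \<open>P\<close> linear.\<close>

instantiation list :: (type) monoid_add
begin

definition zero_list :: "'a list" where "zero_list = []"

definition plus_list :: "'a list \<Rightarrow> 'a list \<Rightarrow> 'a list" where "plus_list xs ys = xs @ ys"

instance by standard (simp_all add: zero_list_def plus_list_def)

end

definition gen :: "'x \<Rightarrow> 'x list \<Rightarrow>\<^sub>0 complex" where
  "gen x = Poly_Mapping.single [x] 1"

definition const :: "complex \<Rightarrow> 'x list \<Rightarrow>\<^sub>0 complex" where
  "const c = Poly_Mapping.single [] c"

definition free_algebra :: "'x set \<Rightarrow> ('x list \<Rightarrow>\<^sub>0 complex) set" where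
  "free_algebra P = {a. Poly_Mapping.keys a \<subseteq> lists P}"

definition clifford_relators ::
    "(complex \<Rightarrow> 'x::ab_group_add \<Rightarrow> 'x) \<Rightarrow> ('x \<Rightarrow> 'x \<Rightarrow> complex) \<Rightarrow> 'x set \<Rightarrow>
      ('x list \<Rightarrow>\<^sub>0 complex) set" where
  "clifford_relators s B P =
    {gen (x + y) - gen x - gen y |x y. x \<in> P \<and> y \<in> P} \<union>
    {gen (s c x) - const c * gen x |c x. x \<in> P} \<union>
    {gen x * gen y + gen y * gen x - const (2 * B x y) |x y. x \<in> P \<and> y \<in> P}"

inductive_set clifford_ideal ::
    "(complex \<Rightarrow> 'x::ab_group_add \<Rightarrow> 'x) \<Rightarrow> ('x \<Rightarrow> 'x \<Rightarrow> complex) \<Rightarrow> 'x set \<Rightarrow>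
      ('x list \<Rightarrow>\<^sub>0 complex) set"
  for s :: "complex \<Rightarrow> 'x::ab_group_add \<Rightarrow> 'x" and B :: "'x \<Rightarrow> 'x \<Rightarrow> complex" and P :: "'x set"
  where
  zero: "0 \<in> clifford_ideal s B P"
| add: "\<lbrakk>a \<in> clifford_ideal s B P; b \<in> clifford_ideal s B P\<rbrakk> \<Longrightarrow> a + b \<in> clifford_ideal s B P"
| sandwich: "\<lbrakk>r \<in> clifford_relators s B P; a \<in> free_algebra P; b \<in> free_algebra P\<rbrakk> \<Longrightarrow>
    a * r * b \<in> clifford_ideal s B P"

text \<open>A representative in the free algebra of \<open>\<alpha> X\<close>. The image of \<open>v \<and> w\<close> in the Clifford algebra is
  \<open>(v w - w v) / 2\<close>.\<close>

definition alpha ::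
    "(complex \<Rightarrow> 'x::ab_group_add \<Rightarrow> 'x) \<Rightarrow> ('x \<Rightarrow> 'x \<Rightarrow> 'x) \<Rightarrow> ('x \<Rightarrow> 'x \<Rightarrow> complex) \<Rightarrow> 'x set \<Rightarrow>
      'x \<Rightarrow> 'x list \<Rightarrow>\<^sub>0 complex" where
  "alpha s br B P X =
    (SOME a. a \<in> module.span (\<lambda>c r. const c * r) {gen v * gen w - gen w * gen v |v w. v \<in> P \<and> w \<in> P} \<and>
      (\<forall>v\<in>P. (a * gen v - gen v * a) - gen (br X v) \<in> clifford_ideal s B P))"

text \<open>The action on \<open>\<And>P\<^sup>+\<close> of \<open>x = x\<^sup>+ + x\<^sup>-\<close>, where \<open>x\<^sup>+ \<in> P\<^sup>+\<close> acts by the exterior product and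
  \<open>x\<^sup>- \<in> P\<^sup>-\<close> by contraction.\<close>

definition spin_gen ::
    "(complex \<Rightarrow> 'x::ab_group_add \<Rightarrow> 'x) \<Rightarrow> ('x \<Rightarrow> 'x \<Rightarrow> complex) \<Rightarrow> 'x set \<Rightarrow> 'x set \<Rightarrow>
      (nat \<Rightarrow> 'x) \<Rightarrow> nat \<Rightarrow> 'x \<Rightarrow> (nat set \<Rightarrow> complex) \<Rightarrow> nat set \<Rightarrow> complex" where
  "spin_gen s B Pp Pm u n x Y =
    (let xp = (THE y. y \<in> Pp \<and> x - y \<in> Pm)
     in wedge s u n xp Y + contract u n (\<lambda>z. 2 * B (x - xp) z) Y)"

definition spin_action ::
    "(complex \<Rightarrow> 'x::ab_group_add \<Rightarrow> 'x) \<Rightarrow> ('x \<Rightarrow> 'x \<Rightarrow> complex) \<Rightarrow> 'x set \<Rightarrow> 'x set \<Rightarrow>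
      (nat \<Rightarrow> 'x) \<Rightarrow> nat \<Rightarrow> ('x list \<Rightarrow>\<^sub>0 complex) \<Rightarrow> (nat set \<Rightarrow> complex) \<Rightarrow> nat set \<Rightarrow> complex" where
  "spin_action s B Pp Pm u n a Y =
    (\<lambda>J. \<Sum>w\<in>Poly_Mapping.keys a.
       Poly_Mapping.lookup a w * foldr (spin_gen s B Pp Pm u n) w Y J)"


section \<open>Lie algebra cohomology and homology\<close>

text \<open>Cochains: the component of degree \<open>p\<close> in \<open>Hom (\<And>\<^sup>p \<aa>, V)\<close> is the restriction of \<open>f\<close> to
  lists of length \<open>p\<close> over \<open>\<aa>\<close>, an alternating multilinear map. All degrees are taken together; since
  \<open>\<aa>\<close> has finite dimension, only finitely many components are nonzero.\<close>

definition cochains ::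
    "(complex \<Rightarrow> 'x::ab_group_add \<Rightarrow> 'x) \<Rightarrow> (complex \<Rightarrow> 'v::ab_group_add \<Rightarrow> 'v) \<Rightarrow> 'x set \<Rightarrow>
      ('x list \<Rightarrow> 'v) set" where
  "cochains s sV \<aa> =
    {f. (\<forall>Ys. Ys \<notin> lists \<aa> \<longrightarrow> f Ys = 0) \<and>
        (\<forall>Ys\<in>lists \<aa>. \<forall>i<length Ys. \<forall>x\<in>\<aa>. \<forall>y\<in>\<aa>.
            f (Ys[i := x + y]) = f (Ys[i := x]) + f (Ys[i := y])) \<and>
        (\<forall>Ys\<in>lists \<aa>. \<forall>i<length Ys. \<forall>c. \<forall>x\<in>\<aa>. f (Ys[i := s c x]) = sV c (f (Ys[i := x]))) \<and>
        (\<forall>Ys\<in>lists \<aa>. \<forall>j<length Ys. \<forall>i<j. Ys ! i = Ys ! j \<longrightarrow> f Ys = 0)}"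

text \<open>The Chevalley-Eilenberg differential; \<open>nths Ys (- {i})\<close> is \<open>Ys\<close> with entry \<open>i\<close> omitted.\<close>

definition cochain_diff ::
    "('x \<Rightarrow> 'x \<Rightarrow> 'x) \<Rightarrow> (complex \<Rightarrow> 'v::ab_group_add \<Rightarrow> 'v) \<Rightarrow> ('x \<Rightarrow> 'v \<Rightarrow> 'v) \<Rightarrow> 'x set \<Rightarrow>
      ('x list \<Rightarrow> 'v) \<Rightarrow> 'x list \<Rightarrow> 'v" where
  "cochain_diff br sV \<pi> \<aa> f Ys =
    (if Ys \<in> lists \<aa> then
       (\<Sum>i<length Ys. sV ((- 1) ^ i) (\<pi> (Ys ! i) (f (nths Ys (- {i}))))) +
       (\<Sum>j<length Ys. \<Sum>i<j. sV ((- 1) ^ (i + j)) (f (br (Ys ! i) (Ys ! j) # nths Ys (- {i, j}))))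
     else 0)"

definition cochain_act ::
    "('x \<Rightarrow> 'x \<Rightarrow> 'x) \<Rightarrow> ('x \<Rightarrow> 'v::ab_group_add \<Rightarrow> 'v) \<Rightarrow> 'x set \<Rightarrow>
      'x \<Rightarrow> ('x list \<Rightarrow> 'v) \<Rightarrow> 'x list \<Rightarrow> 'v" where
  "cochain_act br \<pi> \<aa> X f Ys =
    (if Ys \<in> lists \<aa> then \<pi> X (f Ys) - (\<Sum>i<length Ys. f (Ys[i := br X (Ys ! i)])) else 0)"

text \<open>The boundary operator on \<open>V \<otimes> \<And>\<aa>\<close> for a subalgebra \<open>\<aa>\<close> with basis \<open>b\<close>:
  \<open>\<partial> (v \<otimes> Y\<^sub>1 \<and> \<dots> \<and> Y\<^sub>p) = (\<Sum>i. (- 1)\<^sup>i (Y\<^sub>i v) \<otimes> (\<dots> omit Y\<^sub>i \<dots>)) +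
   (\<Sum>i<j. (- 1)\<^sup>i\<^sup>+\<^sup>j v \<otimes> ([Y\<^sub>i, Y\<^sub>j] \<and> \<dots> omit Y\<^sub>i, Y\<^sub>j \<dots>))\<close>, with indices from 1.\<close>

definition chain_diff ::
    "(complex \<Rightarrow> 'x::ab_group_add \<Rightarrow> 'x) \<Rightarrow> ('x \<Rightarrow> 'x \<Rightarrow> 'x) \<Rightarrow>
      (complex \<Rightarrow> 'v::ab_group_add \<Rightarrow> 'v) \<Rightarrow> ('x \<Rightarrow> 'v \<Rightarrow> 'v) \<Rightarrow> (nat \<Rightarrow> 'x) \<Rightarrow> nat \<Rightarrow>
      (nat set \<Rightarrow> 'v) \<Rightarrow> nat set \<Rightarrow> 'v" where
  "chain_diff s br sV \<pi> b n T = (\<lambda>J. \<Sum>I\<in>Pow {..<n}.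
     (\<Sum>i\<in>I. sV (- move_sign i I * monomial (I - {i}) J) (\<pi> (b i) (T I))) +
     (\<Sum>j\<in>I. \<Sum>i\<in>{i\<in>I. i < j}.
        sV (move_sign i I * move_sign j I * wedge s b n (br (b i) (b j)) (monomial (I - {i, j})) J) (T I)))"

definition chain_act ::
    "(complex \<Rightarrow> 'x::ab_group_add \<Rightarrow> 'x) \<Rightarrow> ('x \<Rightarrow> 'x \<Rightarrow> 'x) \<Rightarrow>
      (complex \<Rightarrow> 'v::ab_group_add \<Rightarrow> 'v) \<Rightarrow> ('x \<Rightarrow> 'v \<Rightarrow> 'v) \<Rightarrow> (nat \<Rightarrow> 'x) \<Rightarrow> nat \<Rightarrow>
      'x \<Rightarrow> (nat set \<Rightarrow> 'v) \<Rightarrow> nat set \<Rightarrow> 'v" where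
  "chain_act s br sV \<pi> b n X T =
    tensor_op sV n (\<pi> X) id T + tensor_op sV n id (ext_derivation s b n (br X)) T"

text \<open>The identification \<open>V \<otimes> \<And>\<pp>\<^sup>+ \<cong> Hom (\<And>\<pp>\<^sup>-, V)\<close> given by
  \<open>(v \<otimes> X\<^sub>1 \<and> \<dots> \<and> X\<^sub>p) (Y\<^sub>1 \<and> \<dots> \<and> Y\<^sub>p) = det (B (Y\<^sub>i, X\<^sub>j)) v\<close>.\<close>

definition to_cochain ::
    "(complex \<Rightarrow> 'v::ab_group_add \<Rightarrow> 'v) \<Rightarrow> ('x \<Rightarrow> 'x \<Rightarrow> complex) \<Rightarrow> 'x set \<Rightarrow> (nat \<Rightarrow> 'x) \<Rightarrow> nat \<Rightarrow>
      (nat set \<Rightarrow> 'v) \<Rightarrow> 'x list \<Rightarrow> 'v" where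
  "to_cochain sV B \<aa> u n T Ys =
    (if Ys \<in> lists \<aa> then
       (\<Sum>I\<in>{I\<in>Pow {..<n}. card I = length Ys}.
          sV (\<Sum>\<sigma> | \<sigma> permutes {..<length Ys}. of_int (sign \<sigma>) *
                (\<Prod>i<length Ys. B (Ys ! i) (u (sorted_list_of_set I ! \<sigma> i))))
             (T I))
     else 0)"


section \<open>Modules over \<open>\<kk>\<close>\<close>

record ('x, 'm) lie_rep =
  space :: "'m set"
  add :: "'m \<Rightarrow> 'm \<Rightarrow> 'm"
  smul :: "complex \<Rightarrow> 'm \<Rightarrow> 'm"
  act :: "'x \<Rightarrow> 'm \<Rightarrow> 'm"

definition sub_rep ::
    "(complex \<Rightarrow> 'm::ab_group_add \<Rightarrow> 'm) \<Rightarrow> ('x \<Rightarrow> 'm \<Rightarrow> 'm) \<Rightarrow> 'm set \<Rightarrow> ('x, 'm) lie_rep" where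
  "sub_rep s a M = \<lparr>space = M, add = (+), smul = s, act = a\<rparr>"

text \<open>The quotient of \<open>M\<close> by \<open>N\<close>. The operations on cosets are the elementwise ones, followed by the
  addition of \<open>N\<close>.\<close>

definition quotient_rep ::
    "(complex \<Rightarrow> 'm::ab_group_add \<Rightarrow> 'm) \<Rightarrow> ('x \<Rightarrow> 'm \<Rightarrow> 'm) \<Rightarrow> 'm set \<Rightarrow> 'm set \<Rightarrow>
      ('x, 'm set) lie_rep" where
  "quotient_rep s a M N =
    \<lparr>space = coset N ` M,
     add = (\<lambda>C C'. {x + y |x y. x \<in> C \<and> y \<in> C'}),
     smul = (\<lambda>c C. {s c x + b |x b. x \<in> C \<and> b \<in> N}),
     act = (\<lambda>X C. {a X x + b |x b. x \<in> C \<and> b \<in> N})\<rparr>"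

text \<open>The tensor product with the one-dimensional module on which \<open>X\<close> acts by the scalar \<open>\<rho> X\<close>.\<close>

definition twist :: "('x \<Rightarrow> complex) \<Rightarrow> ('x, 'm) lie_rep \<Rightarrow> ('x, 'm) lie_rep" where
  "twist \<rho> M = M\<lparr>act := (\<lambda>X m. add M (act M X m) (smul M (\<rho> X) m))\<rparr>"

text \<open>For subquotients of a vector space as above the vector space axioms hold, so only closure and the
  properties of the action are stated.\<close>

definition is_lie_rep ::
    "(complex \<Rightarrow> 'x::ab_group_add \<Rightarrow> 'x) \<Rightarrow> ('x \<Rightarrow> 'x \<Rightarrow> 'x) \<Rightarrow> 'x set \<Rightarrow> ('x, 'm) lie_rep \<Rightarrow> bool" where
  "is_lie_rep s br \<kk> M \<longleftrightarrow>
    space M \<noteq> {} \<and>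
    (\<forall>m\<in>space M. \<forall>m'\<in>space M. add M m m' \<in> space M) \<and>
    (\<forall>c. \<forall>m\<in>space M. smul M c m \<in> space M) \<and>
    (\<forall>X\<in>\<kk>. \<forall>m\<in>space M. act M X m \<in> space M) \<and>
    (\<forall>X\<in>\<kk>. \<forall>m\<in>space M. \<forall>m'\<in>space M. act M X (add M m m') = add M (act M X m) (act M X m')) \<and>
    (\<forall>X\<in>\<kk>. \<forall>c. \<forall>m\<in>space M. act M X (smul M c m) = smul M c (act M X m)) \<and>
    (\<forall>X\<in>\<kk>. \<forall>Y\<in>\<kk>. \<forall>m\<in>space M. act M (X + Y) m = add M (act M X m) (act M Y m)) \<and>
    (\<forall>X\<in>\<kk>. \<forall>c. \<forall>m\<in>space M. act M (s c X) m = smul M c (act M X m)) \<and>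
    (\<forall>X\<in>\<kk>. \<forall>Y\<in>\<kk>. \<forall>m\<in>space M.
        add M (act M (br X Y) m) (act M Y (act M X m)) = act M X (act M Y m))"

definition lie_rep_iso ::
    "(complex \<Rightarrow> 'x::ab_group_add \<Rightarrow> 'x) \<Rightarrow> ('x \<Rightarrow> 'x \<Rightarrow> 'x) \<Rightarrow> 'x set \<Rightarrow>
      ('x, 'm) lie_rep \<Rightarrow> ('x, 'n) lie_rep \<Rightarrow> ('m \<Rightarrow> 'n) \<Rightarrow> bool" where
  "lie_rep_iso s br \<kk> M N \<phi> \<longleftrightarrow>
    is_lie_rep s br \<kk> M \<and> is_lie_rep s br \<kk> N \<and> bij_betw \<phi> (space M) (space N) \<and>
    (\<forall>m\<in>space M. \<forall>m'\<in>space M. \<phi> (add M m m') = add N (\<phi> m) (\<phi> m')) \<and>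
    (\<forall>c. \<forall>m\<in>space M. \<phi> (smul M c m) = smul N c (\<phi> m)) \<and>
    (\<forall>X\<in>\<kk>. \<forall>m\<in>space M. \<phi> (act M X m) = act N X (\<phi> m))"

definition cohomology_rep ::
    "(complex \<Rightarrow> 'x::ab_group_add \<Rightarrow> 'x) \<Rightarrow> ('x \<Rightarrow> 'x \<Rightarrow> 'x) \<Rightarrow>
      (complex \<Rightarrow> 'v::ab_group_add \<Rightarrow> 'v) \<Rightarrow> ('x \<Rightarrow> 'v \<Rightarrow> 'v) \<Rightarrow> 'x set \<Rightarrow>
      ('x, ('x list \<Rightarrow> 'v) set) lie_rep" where
  "cohomology_rep s br sV \<pi> \<aa> =
    quotient_rep (tensor_scale sV) (cochain_act br \<pi> \<aa>)
      (ker_on (cochains s sV \<aa>) (cochain_diff br sV \<pi> \<aa>))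
      (cochain_diff br sV \<pi> \<aa> ` cochains s sV \<aa>)"

definition homology_rep ::
    "(complex \<Rightarrow> 'x::ab_group_add \<Rightarrow> 'x) \<Rightarrow> ('x \<Rightarrow> 'x \<Rightarrow> 'x) \<Rightarrow>
      (complex \<Rightarrow> 'v::ab_group_add \<Rightarrow> 'v) \<Rightarrow> ('x \<Rightarrow> 'v \<Rightarrow> 'v) \<Rightarrow> (nat \<Rightarrow> 'x) \<Rightarrow> nat \<Rightarrow>
      ('x, (nat set \<Rightarrow> 'v) set) lie_rep" where
  "homology_rep s br sV \<pi> b n =
    quotient_rep (tensor_scale sV) (chain_act s br sV \<pi> b n)
      (ker_on (tensor_space n) (chain_diff s br sV \<pi> b n))
      (chain_diff s br sV \<pi> b n ` tensor_space n)"

definition half_trace_ad ::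
    "(complex \<Rightarrow> 'x::ab_group_add \<Rightarrow> 'x) \<Rightarrow> ('x \<Rightarrow> 'x \<Rightarrow> 'x) \<Rightarrow> 'x set \<Rightarrow> 'x \<Rightarrow> complex" where
  "half_trace_ad s br W X = trace_on s W (br X) / 2"


section \<open>The operators\<close>

definition dirac_d ::
    "(complex \<Rightarrow> 'x::ab_group_add \<Rightarrow> 'x) \<Rightarrow> ('x \<Rightarrow> 'x \<Rightarrow> complex) \<Rightarrow> 'x set \<Rightarrow> 'x set \<Rightarrow>
      (nat \<Rightarrow> 'x) \<Rightarrow> (nat \<Rightarrow> 'x) \<Rightarrow> nat \<Rightarrow> (complex \<Rightarrow> 'v::ab_group_add \<Rightarrow> 'v) \<Rightarrow> ('x \<Rightarrow> 'v \<Rightarrow> 'v) \<Rightarrow>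
      (nat set \<Rightarrow> 'v) \<Rightarrow> nat set \<Rightarrow> 'v" where
  "dirac_d s B Pp Pm u us n sV \<pi> T =
    (\<Sum>i<n. tensor_op sV n (\<pi> (us i)) (spin_gen s B Pp Pm u n (u i)) T)"

definition dirac_delta ::
    "(complex \<Rightarrow> 'x::ab_group_add \<Rightarrow> 'x) \<Rightarrow> ('x \<Rightarrow> 'x \<Rightarrow> complex) \<Rightarrow> 'x set \<Rightarrow> 'x set \<Rightarrow>
      (nat \<Rightarrow> 'x) \<Rightarrow> (nat \<Rightarrow> 'x) \<Rightarrow> nat \<Rightarrow> (complex \<Rightarrow> 'v::ab_group_add \<Rightarrow> 'v) \<Rightarrow> ('x \<Rightarrow> 'v \<Rightarrow> 'v) \<Rightarrow>
      (nat set \<Rightarrow> 'v) \<Rightarrow> nat set \<Rightarrow> 'v" where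
  "dirac_delta s B Pp Pm u us n sV \<pi> T =
    (\<Sum>i<n. tensor_op sV n (\<pi> (u i)) (spin_gen s B Pp Pm u n (us i)) T)"

text \<open>The diagonal action \<open>X \<mapsto> X \<otimes> 1 + 1 \<otimes> \<alpha> X\<close> of \<open>\<kk>\<close> on \<open>V \<otimes> S\<close>.\<close>

definition spin_diag_act ::
    "(complex \<Rightarrow> 'x::ab_group_add \<Rightarrow> 'x) \<Rightarrow> ('x \<Rightarrow> 'x \<Rightarrow> 'x) \<Rightarrow> ('x \<Rightarrow> 'x \<Rightarrow> complex) \<Rightarrow>
      'x set \<Rightarrow> 'x set \<Rightarrow> 'x set \<Rightarrow> (nat \<Rightarrow> 'x) \<Rightarrow> nat \<Rightarrow>
      (complex \<Rightarrow> 'v::ab_group_add \<Rightarrow> 'v) \<Rightarrow> ('x \<Rightarrow> 'v \<Rightarrow> 'v) \<Rightarrow>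
      'x \<Rightarrow> (nat set \<Rightarrow> 'v) \<Rightarrow> nat set \<Rightarrow> 'v" where
  "spin_diag_act s br B P Pp Pm u n sV \<pi> X T =
    tensor_op sV n (\<pi> X) id T +
    tensor_op sV n id (spin_action s B Pp Pm u n (alpha s br B P X)) T"

end

theory Submission
  imports
    Defs
    "HOL-Computational_Algebra.Fundamental_Theorem_Algebra"
    "Jordan_Normal_Form.Determinant"
begin

text \<open>The idea is that of Hodge theory, with a finiteness property of \<open>V\<close> in place of analysis.

Unitarity of \<open>V\<close> gives a positive definite form on \<open>V \<otimes> \<And>\<pp>\<^sup>+\<close> for which \<open>d\<close> and \<open>- \<delta> / 2\<close> are adjoint
(\<open>dd_adjoint\<close>). Both square to 0 because \<open>\<pp>\<^sup>+\<close> and \<open>\<pp>\<^sup>-\<close> are abelian. Hence \<open>D\<^sup>2 = d \<delta> + \<delta> d\<close> is symmetric, and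
its quadratic form is minus a sum of squares, so that its kernel is the common kernel of \<open>d\<close> and \<open>\<delta>\<close>, which is also the kernel of
\<open>D\<close>. The three spaces \<open>Ker D\<close>, \<open>Im d\<close> and \<open>Im \<delta>\<close> are orthogonal to each other. That they span is linear algebra as
soon as every vector lies in a finite-dimensional subspace that \<open>D\<^sup>2\<close> preserves, since there a symmetric operator
has an orthogonal complement of its image as kernel; \<open>V\<close> itself may have infinite dimension and need not be complete.

Finiteness comes from the formula \<open>laplacian\<close>: \<open>D\<^sup>2\<close> is built from operators on \<open>\<And>\<pp>\<^sup>+\<close>, from the action of \<open>\<kk>\<close> on \<open>V\<close>
and from \<open>\<Sum>\<^sub>i u\<^sub>i u\<^sub>i\<^sup>*\<close>. The action of \<open>\<kk>\<close> is locally finite because the vectors of \<open>V\<close> are \<open>K\<close>-finite. The last term is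
half of the Casimir element of \<open>\<gg>\<close> up to elements of the enveloping algebra of \<open>\<kk>\<close>, and the Casimir element acts on the
irreducible module \<open>V\<close> by a scalar (\<open>casimir_scalar\<close>). This is Schur's lemma for a space of countable dimension, where an
operator such that \<open>C - \<lambda>\<close> is invertible for all \<open>\<lambda>\<close> would produce uncountably many independent vectors
\<open>(C - \<lambda>)\<^sup>-\<^sup>1 v\<close> (\<open>countable_dimension_eigenvalue\<close>).

The isomorphisms rest on two identifications. The map \<open>to_cochain\<close> is a bijection that carries \<open>d\<close> to the
Chevalley-Eilenberg differential (\<open>to_cochain_bij\<close>, \<open>to_cochain_dd\<close>), and \<open>\<delta>\<close> is \<open>- 2\<close> times the boundary operator
(\<open>chain_diff_eq\<close>); so the direct sum decompositions say that \<open>Ker D\<close> represents cohomology and homology. The twist is the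
difference of the two actions of \<open>\<kk>\<close> on \<open>\<And>\<pp>\<^sup>+\<close>: the spin action and the adjoint action have the same commutators with
the Clifford generators, so they differ by a scalar, and a comparison in lowest and highest degree shows that the scalar is
\<open>\<rho>(\<pp>\<^sup>-)\<close> (\<open>spin_alpha\<close>).\<close>

section \<open>Creation and annihilation\<close>

(* Sums of tensors are to be rewritten by linearity, not to be unfolded pointwise. *)
declare plus_fun_def [simp del] zero_fun_def [simp del] fun_diff_def [simp del] fun_Compl_def [simp del]

lemma sum_fun_apply: "(\<Sum>i\<in>A. f i) x = (\<Sum>i\<in>A. f i x)"
  for f :: "'i \<Rightarrow> 'x \<Rightarrow> 'y::comm_monoid_add"
  by (induct A rule: infinite_finite_induct) auto

lemma move_sign_same [simp]:
  "move_sign i (insert i J) = move_sign i J" "move_sign i (J - {i}) = move_sign i J"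
  unfolding move_sign_def by (rule arg_cong[where f = "\<lambda>A. (-1) ^ card A"], auto)+

lemma move_sign_insert:
  assumes "j \<notin> J"
  shows "move_sign i (insert j J) = (if j < i then - move_sign i J else move_sign i J)"
proof -
  have fin: "finite {k \<in> J. k < i}" by (rule finite_subset[of _ "{..<i}"]) auto
  show ?thesis
  proof (cases "j < i")
    case True
    then have "{k \<in> insert j J. k < i} = insert j {k \<in> J. k < i}" by auto
    then show ?thesis using True assms fin by (simp add: move_sign_def)
  next
    case False
    then have "{k \<in> insert j J. k < i} = {k \<in> J. k < i}" by auto
    then show ?thesis using False by (simp add: move_sign_def)
  qed
qed

lemma move_sign_remove:
  assumes "j \<in> J"
  shows "move_sign i (J - {j}) = (if j < i then - move_sign i J else move_sign i J)"
  using move_sign_insert[of j "J - {j}" i] assms by (simp add: insert_absorb split: if_splits)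

lemma move_sign_square [simp]: "move_sign i J * move_sign i J = 1"
  by (simp add: move_sign_def flip: power_mult_distrib)

lemma move_sign_nonzero [simp]: "move_sign i J \<noteq> 0"
  by (simp add: move_sign_def)

text \<open>On the element \<open>v \<otimes> Y\<close> these are \<open>v \<otimes> (u\<^sub>i \<and> Y)\<close> and the contraction with the \<open>i\<close>-th vector of the dual basis. They are
defined on all families, with no bound on the index sets, so that the anticommutation relations hold without side
conditions.\<close>

definition creation :: "(complex \<Rightarrow> 'v::ab_group_add \<Rightarrow> 'v) \<Rightarrow> nat \<Rightarrow> (nat set \<Rightarrow> 'v) \<Rightarrow> nat set \<Rightarrow> 'v"
  where "creation s i T J = (if i \<in> J then s (move_sign i J) (T (J - {i})) else 0)"

definition annihilation :: "(complex \<Rightarrow> 'v::ab_group_add \<Rightarrow> 'v) \<Rightarrow> nat \<Rightarrow> (nat set \<Rightarrow> 'v) \<Rightarrow> nat set \<Rightarrow> 'v"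
  where "annihilation s i T J = (if i \<in> J then 0 else s (move_sign i J) (T (insert i J)))"

definition contraction ::
  "(complex \<Rightarrow> 'v::ab_group_add \<Rightarrow> 'v) \<Rightarrow> nat \<Rightarrow> (nat \<Rightarrow> complex) \<Rightarrow> (nat set \<Rightarrow> 'v) \<Rightarrow> nat set \<Rightarrow> 'v"
  where "contraction s n \<phi> T = (\<Sum>i<n. tensor_scale s (\<phi> i) (annihilation s i T))"

locale complex_space = vector_space scale
  for scale :: "complex \<Rightarrow> 'v::ab_group_add \<Rightarrow> 'v"
begin

abbreviation ts where "ts \<equiv> tensor_scale scale"
abbreviation cre where "cre \<equiv> creation scale"
abbreviation ann where "ann \<equiv> annihilation scale"
abbreviation ctr where "ctr \<equiv> contraction scale"

lemma ts_apply [simp]: "ts c T I = scale c (T I)"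
  by (simp add: tensor_scale_def)

lemma ts_vector_space: "vector_space ts"
  by standard (auto simp: fun_eq_iff scale_right_distrib scale_left_distrib)

sublocale tw: vector_space ts by (rule ts_vector_space)

lemma cre_add: "cre i (T + T') = cre i T + cre i T'"
  and cre_scale: "cre i (ts c T) = ts c (cre i T)"
  and cre_zero [simp]: "cre i 0 = 0"
  by (auto simp: fun_eq_iff creation_def scale_right_distrib mult.commute)

lemma ann_add: "ann i (T + T') = ann i T + ann i T'"
  and ann_scale: "ann i (ts c T) = ts c (ann i T)"
  and ann_zero [simp]: "ann i 0 = 0"
  by (auto simp: fun_eq_iff annihilation_def scale_right_distrib mult.commute)

lemma cre_sum: "cre i (\<Sum>k\<in>A. f k) = (\<Sum>k\<in>A. cre i (f k))"
  by (induct A rule: infinite_finite_induct)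
    (simp_all only: sum.infinite sum.empty sum.insert cre_add cre_zero not_False_eq_True)

lemma ann_sum: "ann i (\<Sum>k\<in>A. f k) = (\<Sum>k\<in>A. ann i (f k))"
  by (induct A rule: infinite_finite_induct)
    (simp_all only: sum.infinite sum.empty sum.insert ann_add ann_zero not_False_eq_True)

lemma cre_minus: "cre i (- T) = - cre i T" and ann_minus: "ann i (- T) = - ann i T"
  by (auto simp: fun_eq_iff creation_def annihilation_def)

lemma ann_ann: "ann i (ann j T) = - ann j (ann i T)"
proof
  fix J show "ann i (ann j T) J = (- ann j (ann i T)) J"
    by (cases i j rule: linorder_cases)
      (auto simp: annihilation_def insert_commute move_sign_insert mult.commute)
qed

lemma cre_cre: "cre i (cre j T) = - cre j (cre i T)"
proof
  fix J
  have *: "J - {i} - {j} = J - {j} - {i}" by auto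
  show "cre i (cre j T) J = (- cre j (cre i T)) J"
    by (cases i j rule: linorder_cases)
      (auto simp: creation_def * move_sign_remove mult.commute)
qed

text \<open>With \<open>cre_cre\<close> and \<open>ann_ann\<close> these are the canonical anticommutation relations. All later computations with signs of
monomials are reduced to them.\<close>

lemma ann_cre: "ann i (cre j T) = (if i = j then T else 0) - cre j (ann i T)"
proof
  fix J
  have *: "i \<noteq> j \<Longrightarrow> insert i (J - {j}) = insert i J - {j}" by auto
  show "ann i (cre j T) J = ((if i = j then T else 0) - cre j (ann i T)) J"
    by (cases i j rule: linorder_cases)
      (auto simp: creation_def annihilation_def * move_sign_remove move_sign_insert mult.commute
        insert_absorb)
qed

lemma cre_empty [simp]: "cre i T {} = 0"
  by (simp add: creation_def)

definition op_linear where "op_linear A \<longleftrightarrow> (\<forall>v w. A (v + w) = A v + A w) \<and> (\<forall>c v. A (scale c v) = scale c (A v))"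

lemma op_linear_0: "op_linear A \<Longrightarrow> A 0 = 0"
  unfolding op_linear_def by (metis scale_zero_left)

lemma op_linear_sum: "op_linear A \<Longrightarrow> A (\<Sum>k\<in>B. f k) = (\<Sum>k\<in>B. A (f k))"
  by (induct B rule: infinite_finite_induct) (auto simp: op_linear_0, auto simp: op_linear_def)

lemma comp_cre: "op_linear A \<Longrightarrow> A \<circ> cre i T = cre i (A \<circ> T)"
  and comp_ann: "op_linear A \<Longrightarrow> A \<circ> ann i T = ann i (A \<circ> T)"
  by (auto simp: fun_eq_iff creation_def annihilation_def op_linear_0) (auto simp: op_linear_def)

lemma comp_ts: "op_linear A \<Longrightarrow> A \<circ> ts c T = ts c (A \<circ> T)"
  by (auto simp: fun_eq_iff op_linear_def)

lemma comp_add: "op_linear A \<Longrightarrow> A \<circ> (T + T') = (A \<circ> T) + (A \<circ> T')"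
  by (auto simp: fun_eq_iff op_linear_def)

lemma comp_sum: "op_linear A \<Longrightarrow> A \<circ> (\<Sum>k\<in>B. f k) = (\<Sum>k\<in>B. A \<circ> f k)"
  by (auto simp: fun_eq_iff sum_fun_apply op_linear_sum)

lemma ctr_apply: "ctr n \<phi> T I = (\<Sum>i<n. scale (\<phi> i) (ann i T I))"
  by (simp add: contraction_def sum_fun_apply)

lemma ctr_add: "ctr n \<phi> (T + T') = ctr n \<phi> T + ctr n \<phi> T'"
  by (simp add: contraction_def ann_add tw.scale_right_distrib sum.distrib)

lemma ctr_scale: "ctr n \<phi> (ts c T) = ts c (ctr n \<phi> T)"
  by (simp add: contraction_def ann_scale tw.scale_sum_right mult.commute)

lemma ctr_zero [simp]: "ctr n \<phi> 0 = 0"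
  by (simp add: contraction_def)

lemma ctr_sum: "ctr n \<phi> (\<Sum>k\<in>A. f k) = (\<Sum>k\<in>A. ctr n \<phi> (f k))"
  by (induct A rule: infinite_finite_induct)
    (simp_all only: sum.infinite sum.empty sum.insert ctr_add ctr_zero not_False_eq_True)

lemma ann_ctr: "ann i (ctr n \<phi> T) = - ctr n \<phi> (ann i T)"
  by (simp add: contraction_def ann_sum ann_scale ann_ann[of i] sum_negf)

lemma ctr_ctr: "ctr n \<phi> (ctr n \<psi> T) = - ctr n \<psi> (ctr n \<phi> T)"
  by (subst (1 3) contraction_def)
    (simp add: ann_ctr sum_negf ctr_sum ctr_scale)

lemma ctr_ctr_self [simp]: "ctr n \<phi> (ctr n \<phi> T) = 0"
proof -
  have "ctr n \<phi> (ctr n \<phi> T) I = - ctr n \<phi> (ctr n \<phi> T) I" for I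
    using ctr_ctr[of n \<phi> \<phi> T] by (metis uminus_apply)
  then have "scale 2 (ctr n \<phi> (ctr n \<phi> T) I) = 0" for I
    by (metis add.right_inverse one_add_one scale_left_distrib scale_one)
  then show ?thesis by (auto simp: fun_eq_iff)
qed

lemma ctr_cre: "i < n \<Longrightarrow> ctr n \<phi> (cre i T) = ts (\<phi> i) T - cre i (ctr n \<phi> T)"
  by (simp add: contraction_def ann_cre tw.scale_right_diff_distrib sum_subtractf cre_sum cre_scale
      if_distrib[of "ts _"] cong: if_cong)

lemma comp_ctr: "op_linear A \<Longrightarrow> A \<circ> ctr n \<phi> T = ctr n \<phi> (A \<circ> T)"
  by (simp add: contraction_def comp_sum comp_ts comp_ann)

lemma ctr_linear_form:
  assumes "\<And>i. i < n \<Longrightarrow> \<phi> i = (\<Sum>k\<in>A. c k * \<psi> k i)"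
  shows "ctr n \<phi> T = (\<Sum>k\<in>A. ts (c k) (ctr n (\<psi> k) T))"
proof -
  have "ctr n \<phi> T = (\<Sum>i<n. \<Sum>k\<in>A. ts (c k * \<psi> k i) (ann i T))"
    unfolding contraction_def using assms by (intro sum.cong refl) (simp add: tw.scale_sum_left)
  also have "\<dots> = (\<Sum>k\<in>A. \<Sum>i<n. ts (c k * \<psi> k i) (ann i T))" by (rule sum.swap)
  finally show ?thesis by (simp add: contraction_def tw.scale_sum_right)
qed

end

section \<open>A Hermitian form on the tensor product\<close>

text \<open>Let column \<open>i\<close> of the matrix \<open>a\<close> contain the coordinates of \<open>u\<^sub>i\<close> in an orthonormal basis. Then this is the form that \<open>h\<close>
induces on \<open>V \<otimes> \<And>\<^sup>p\<close>: contracting both arguments with the vectors of the orthonormal basis lowers the degree, and each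
pair of monomials of degree \<open>p + 1\<close> is counted \<open>p + 1\<close> times. The recursion avoids the minors of the Gram matrix.\<close>

primrec degree_form ::
  "(complex \<Rightarrow> 'v::ab_group_add \<Rightarrow> 'v) \<Rightarrow> ('v \<Rightarrow> 'v \<Rightarrow> complex) \<Rightarrow> nat \<Rightarrow> (nat \<Rightarrow> nat \<Rightarrow> complex) \<Rightarrow> nat \<Rightarrow>
    (nat set \<Rightarrow> 'v) \<Rightarrow> (nat set \<Rightarrow> 'v) \<Rightarrow> complex" where
  "degree_form s h n a 0 Y Z = h (Y {}) (Z {})"
| "degree_form s h n a (Suc p) Y Z =
    (\<Sum>k<n. degree_form s h n a p (contraction s n (a k) Y) (contraction s n (a k) Z)) / of_nat (Suc p)"

definition tensor_form ::
  "(complex \<Rightarrow> 'v::ab_group_add \<Rightarrow> 'v) \<Rightarrow> ('v \<Rightarrow> 'v \<Rightarrow> complex) \<Rightarrow> nat \<Rightarrow> (nat \<Rightarrow> nat \<Rightarrow> complex) \<Rightarrow>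
    (nat set \<Rightarrow> 'v) \<Rightarrow> (nat set \<Rightarrow> 'v) \<Rightarrow> complex" where
  "tensor_form s h n a Y Z = (\<Sum>p\<le>n. degree_form s h n a p Y Z)"

locale hermitian_space = complex_space scale
  for scale :: "complex \<Rightarrow> 'v::ab_group_add \<Rightarrow> 'v" +
  fixes h :: "'v \<Rightarrow> 'v \<Rightarrow> complex"
  assumes h: "positive_hermitian_form scale h"
begin

lemma h_add_left: "h (v + v') w = h v w + h v' w"
  and h_scale_left: "h (scale c v) w = c * h v w"
  and h_sym: "h w v = cnj (h v w)"
  and h_pos: "v \<noteq> 0 \<Longrightarrow> 0 < Re (h v v)"
  using h unfolding positive_hermitian_form_def by blast+

lemma h_zero_left [simp]: "h 0 w = 0"
  using h_scale_left[of 0 0 w] by simp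

abbreviation df where "df \<equiv> degree_form scale h"

lemma df_add_left: "df n a p (Y + Y') Z = df n a p Y Z + df n a p Y' Z"
  by (induct p arbitrary: Y Y' Z) (auto simp: h_add_left ctr_add sum.distrib add_divide_distrib)

lemma df_scale_left: "df n a p (ts c Y) Z = c * df n a p Y Z"
  by (induct p arbitrary: Y Z) (auto simp: h_scale_left ctr_scale sum_distrib_left)

lemma df_sym: "df n a p Z Y = cnj (df n a p Y Z)"
proof (induct p arbitrary: Y Z)
  case 0
  show ?case by (simp add: h_sym[of "Z {}"])
next
  case (Suc p)
  show ?case by (simp add: Suc[of "contraction scale n _ Z"] del: of_nat_Suc)
qed

lemma df_add_right: "df n a p Y (Z + Z') = df n a p Y Z + df n a p Y Z'"
  by (metis df_sym df_add_left complex_cnj_add)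

lemma df_scale_right: "df n a p Y (ts c Z) = cnj c * df n a p Y Z"
  by (metis df_sym df_scale_left complex_cnj_mult)

lemma df_zero [simp]: "df n a p 0 Z = 0" "df n a p Y 0 = 0"
  using df_scale_left[of n a p 0 0 Z] df_scale_right[of n a p Y 0 0] by simp_all

lemma df_sum_right: "df n a p Y (\<Sum>k\<in>A. f k) = (\<Sum>k\<in>A. df n a p Y (f k))"
  by (induct A rule: infinite_finite_induct)
    (simp_all only: sum.infinite sum.empty sum.insert df_add_right df_zero not_False_eq_True)

lemma df_minus_right: "df n a p Y (- Z) = - df n a p Y Z"
  using df_scale_right[of n a p Y "- 1" Z] by simp

lemma df_diff_left: "df n a p (Y - Y') Z = df n a p Y Z - df n a p Y' Z"
  using df_add_left[of n a p "Y - Y'" Y' Z] by simp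

text \<open>The adjoint of exterior multiplication by \<open>u\<^sub>i\<close> is the contraction with the functional that the form assigns to \<open>u\<^sub>i\<close>. A
creation operator anticommutes with the contractions in the definition of the form up to scalars. Moving it through
yields the required term once directly and \<open>p\<close> times by induction, which cancels the denominator \<open>p + 1\<close>.\<close>

lemma df_adjoint:
  assumes "i < n"
  shows "df n a (Suc p) (cre i Y) Z = df n a p Y (ctr n (\<lambda>l. \<Sum>k<n. cnj (a k i) * a k l) Z)"
proof (induct p arbitrary: Y Z)
  have lin: "ctr n (\<lambda>l. \<Sum>k<n. cnj (a k i) * a k l) Z = (\<Sum>k<n. ts (cnj (a k i)) (ctr n (a k) Z))" for Z
    by (rule ctr_linear_form) simp
  have step: "df n a (Suc p) (cre i Y) Z =
      (df n a p Y (ctr n (\<lambda>l. \<Sum>k<n. cnj (a k i) * a k l) Z) -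
        (\<Sum>k<n. df n a p (cre i (ctr n (a k) Y)) (ctr n (a k) Z))) / of_nat (Suc p)" for p Y Z
    using assms
    by (simp add: ctr_cre df_diff_left df_scale_left sum_subtractf lin df_sum_right df_scale_right)
  case 0
  show ?case by (simp only: step) simp
next
  case (Suc p)
  have lin: "ctr n (\<lambda>l. \<Sum>k<n. cnj (a k i) * a k l) Z = (\<Sum>k<n. ts (cnj (a k i)) (ctr n (a k) Z))" for Z
    by (rule ctr_linear_form) simp
  let ?b = "\<lambda>l. \<Sum>k<n. cnj (a k i) * a k l"
  have step: "df n a (Suc p) (cre i Y) Z =
      (df n a p Y (ctr n (\<lambda>l. \<Sum>k<n. cnj (a k i) * a k l) Z) -
        (\<Sum>k<n. df n a p (cre i (ctr n (a k) Y)) (ctr n (a k) Z))) / of_nat (Suc p)" for p Y Z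
    using assms
    by (simp add: ctr_cre df_diff_left df_scale_left sum_subtractf lin df_sum_right df_scale_right)
  have "(\<Sum>k<n. df n a (Suc p) (cre i (ctr n (a k) Y)) (ctr n (a k) Z)) =
      (\<Sum>k<n. df n a p (ctr n (a k) Y) (ctr n ?b (ctr n (a k) Z)))"
    by (simp only: Suc)
  also have "\<dots> = - (\<Sum>k<n. df n a p (ctr n (a k) Y) (ctr n (a k) (ctr n ?b Z)))"
    by (subst ctr_ctr) (simp add: df_minus_right sum_negf)
  also have "\<dots> = - of_nat (Suc p) * df n a (Suc p) Y (ctr n ?b Z)"
    by (simp del: of_nat_Suc)
  finally have sum: "(\<Sum>k<n. df n a (Suc p) (cre i (ctr n (a k) Y)) (ctr n (a k) Z)) =
      - of_nat (Suc p) * df n a (Suc p) Y (ctr n ?b Z)" .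
  have arith: "(x - - of_nat (Suc p) * x) / of_nat (Suc (Suc p)) = x" for x :: complex
  proof -
    have "x - - of_nat (Suc p) * x = of_nat (Suc (Suc p)) * x" by (simp add: algebra_simps)
    then show ?thesis by (simp del: of_nat_Suc)
  qed
  show ?case by (simp only: step[of "Suc p"] sum arith)
qed

lemma df_vanish:
  assumes "\<And>I. I \<subseteq> {..<n} \<Longrightarrow> card I = p \<Longrightarrow> Y I = 0"
  shows "df n a p Y Z = 0"
  using assms
proof (induct p arbitrary: Y Z)
  case (Suc p)
  have "ctr n (a k) Y I = 0" if I: "I \<subseteq> {..<n}" "card I = p" for k I
  proof -
    have "finite I" using I finite_subset by blast
    then have "ann i Y I = 0" if "i < n" for i
      using Suc.prems[of "insert i I"] I that by (auto simp: annihilation_def)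
    then show ?thesis by (simp add: ctr_apply)
  qed
  then show ?case using Suc.hyps by simp
qed simp

lemma df_nonneg: "0 \<le> Re (df n a p Y Y)"
proof (induct p arbitrary: Y)
  case 0
  show ?case using h_pos[of "Y {}"] by (cases "Y {} = 0") auto
next
  case (Suc p)
  show ?case using Suc by (simp add: sum_nonneg del: of_nat_Suc)
qed

text \<open>A left inverse of \<open>a\<close> expresses the annihilation operators by the contractions that occur in the form, so the coefficients
vanish if all those contractions do.\<close>

lemma df_definite:
  assumes m: "\<And>i j. i < n \<Longrightarrow> j < n \<Longrightarrow> (\<Sum>k<n. m i k * a k j) = (if i = j then 1 else 0)"
    and "Re (df n a p Y Y) = 0" "I \<subseteq> {..<n}" "card I = p"
  shows "Y I = 0"
  using assms(2-4)
proof (induct p arbitrary: Y I)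
  case 0
  then show ?case using h_pos[of "Y {}"] finite_subset[of I "{..<n}"] by force
next
  case (Suc p)
  have fin: "finite I" using Suc.prems(2) finite_subset by blast
  then obtain i where i: "i \<in> I" using Suc.prems(3) by fastforce
  have I: "I - {i} \<subseteq> {..<n}" "card (I - {i}) = p" "i < n"
    using fin i Suc.prems by auto
  have "(\<Sum>k<n. Re (df n a p (ctr n (a k) Y) (ctr n (a k) Y))) = 0"
    using Suc.prems(1) by (simp del: of_nat_Suc)
  then have "Re (df n a p (ctr n (a k) Y) (ctr n (a k) Y)) = 0" if "k < n" for k
    using sum_nonneg_eq_0_iff[of "{..<n}" "\<lambda>k. Re (df n a p (ctr n (a k) Y) (ctr n (a k) Y))"] df_nonneg that
    by auto
  then have z: "ctr n (a k) Y (I - {i}) = 0" if "k < n" for k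
    using Suc.hyps I that by blast
  have "ctr n (\<lambda>j. if j = i then 1 else 0) Y = (\<Sum>k<n. ts (m i k) (ctr n (a k) Y))"
    by (rule ctr_linear_form) (use m[OF I(3)] in auto)
  moreover have "ctr n (\<lambda>j. if j = i then 1 else 0) Y = ann i Y"
    using I(3) by (simp add: contraction_def if_distrib[of "\<lambda>c. ts c _"] cong: if_cong)
  ultimately have "ann i Y (I - {i}) = 0" by (simp add: sum_fun_apply z)
  then show ?case using i by (simp add: annihilation_def insert_absorb)
qed

abbreviation tf where "tf \<equiv> tensor_form scale h"

lemma tf_add_left: "tf n a (Y + Y') Z = tf n a Y Z + tf n a Y' Z"
  by (simp add: tensor_form_def df_add_left sum.distrib)

lemma tf_scale_left: "tf n a (ts c Y) Z = c * tf n a Y Z"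
  by (simp add: tensor_form_def df_scale_left sum_distrib_left)

lemma tf_sym: "tf n a Z Y = cnj (tf n a Y Z)"
  unfolding tensor_form_def cnj_sum by (intro sum.cong refl df_sym)

lemma tf_positive:
  assumes m: "\<And>i j. i < n \<Longrightarrow> j < n \<Longrightarrow> (\<Sum>k<n. m i k * a k j) = (if i = j then 1 else 0)"
    and "Y \<in> tensor_space n" "Y \<noteq> 0"
  shows "0 < Re (tf n a Y Y)"
proof (rule ccontr)
  assume "\<not> 0 < Re (tf n a Y Y)"
  moreover have "0 \<le> Re (tf n a Y Y)" unfolding tensor_form_def Re_sum by (intro sum_nonneg df_nonneg)
  ultimately have "(\<Sum>p\<le>n. Re (df n a p Y Y)) = 0" by (simp add: tensor_form_def)
  then have *: "Re (df n a p Y Y) = 0" if "p \<le> n" for p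
    using sum_nonneg_eq_0_iff[of "{..n}" "\<lambda>p. Re (df n a p Y Y)"] df_nonneg that by auto
  have "Y I = 0" for I
  proof (cases "I \<subseteq> {..<n}")
    case True
    then have "card I \<le> n" using card_mono[of "{..<n}" I] by simp
    then show ?thesis using df_definite[OF m *] True by blast
  next
    case False
    then show ?thesis using assms(2) by (simp add: tensor_space_def)
  qed
  then show False using assms(3) by (auto simp: fun_eq_iff)
qed

lemma tf_adjoint:
  assumes "i < n" "Y \<in> tensor_space n"
  shows "tf n a (cre i Y) Z = tf n a Y (ctr n (\<lambda>l. \<Sum>k<n. cnj (a k i) * a k l) Z)"
proof -
  let ?Z = "ctr n (\<lambda>l. \<Sum>k<n. cnj (a k i) * a k l) Z"
  (* There are no index sets with more than n elements, so the degrees can be shifted without a boundary term. *)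
  have "df n a (Suc n) (cre i Y) Z = 0"
  proof (rule df_vanish)
    fix I assume "I \<subseteq> {..<n}" "card I = Suc n"
    then show "cre i Y I = 0" using card_mono[of "{..<n}" I] by simp
  qed
  then have top: "df n a n Y ?Z = 0" using df_adjoint[OF assms(1), of a n Y Z] by (simp only:)
  have "tf n a (cre i Y) Z = (\<Sum>p<n. df n a (Suc p) (cre i Y) Z)"
    unfolding tensor_form_def lessThan_Suc_atMost[symmetric] sum.lessThan_Suc_shift by simp
  also have "\<dots> = (\<Sum>p<n. df n a p Y ?Z)" using df_adjoint[OF assms(1)] by simp
  also have "\<dots> = tf n a Y ?Z"
    unfolding tensor_form_def lessThan_Suc_atMost[symmetric] by (simp add: top)
  finally show ?thesis .
qed

lemma tf_comp:
  assumes A: "op_linear A" and A': "op_linear A'" and adj: "\<And>v w. h (A v) w = h v (A' w)"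
  shows "tf n a (A \<circ> Y) Z = tf n a Y (A' \<circ> Z)"
proof -
  have "df n a p (A \<circ> Y) Z = df n a p Y (A' \<circ> Z)" for p
    by (induct p arbitrary: Y Z) (auto simp: adj comp_ctr[OF A, symmetric] comp_ctr[OF A', symmetric])
  then show ?thesis by (simp add: tensor_form_def)
qed

end

section \<open>Minors\<close>

definition minor where
  "minor B u Ys I = (\<Sum>\<sigma> | \<sigma> permutes {..<length Ys}. of_int (sign \<sigma>) *
     (\<Prod>i<length Ys. B (Ys ! i) (u (sorted_list_of_set I ! \<sigma> i)) :: complex))"

definition minor_matrix where
  "minor_matrix B u Ys I = Matrix.mat (length Ys) (length Ys)
     (\<lambda>(i, j). B (Ys ! i) (u (sorted_list_of_set I ! j)) :: complex)"

lemma minor_det: "minor B u Ys I = Determinant.det (minor_matrix B u Ys I)"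
proof -
  have "(\<Prod>i<length Ys. B (Ys ! i) (u (sorted_list_of_set I ! \<sigma> i))) =
      (\<Prod>i = 0..<length Ys. minor_matrix B u Ys I $$ (i, \<sigma> i))"
    if "\<sigma> permutes {0..<length Ys}" for \<sigma>
    unfolding atLeast0LessThan[symmetric]
    using permutes_in_image[OF that] by (intro prod.cong refl) (auto simp: minor_matrix_def)
  then show ?thesis
    unfolding minor_def Determinant.det_def atLeast0LessThan[symmetric]
    by (simp add: minor_matrix_def)
qed

lemma card_less_nth_sorted_list:
  fixes I :: "nat set"
  assumes "finite I" "j < card I"
  shows "card {k \<in> I. k < sorted_list_of_set I ! j} = j"
proof -
  let ?l = "sorted_list_of_set I"
  have l: "sorted_wrt (<) ?l" "length ?l = card I" "set ?l = I" "distinct ?l"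
    using assms by (auto simp: strict_sorted_list_of_set)
  have "{k \<in> I. k < ?l ! j} = (!) ?l ` {..<j}"
  proof (intro equalityI subsetI)
    fix k assume k: "k \<in> {k \<in> I. k < ?l ! j}"
    then obtain i where i: "i < card I" "?l ! i = k" using l by (metis (mono_tags) in_set_conv_nth mem_Collect_eq)
    have "i < j"
    proof (rule ccontr)
      assume "\<not> i < j"
      then have "?l ! j \<le> ?l ! i"
        using sorted_wrt_nth_less[OF l(1), of j i] i l(2) by (cases "i = j") auto
      then show False using i k by auto
    qed
    then show "k \<in> (!) ?l ` {..<j}" using i by auto
  next
    fix k assume "k \<in> (!) ?l ` {..<j}"
    then obtain i where "i < j" "k = ?l ! i" by auto
    then show "k \<in> {k \<in> I. k < ?l ! j}"
      using sorted_wrt_nth_less[OF l(1), of i j] assms l(2,3) nth_mem[of i ?l] by auto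
  qed
  moreover have "inj_on ((!) ?l) {..<j}"
    using l(2,4) assms(2) by (intro inj_onI) (auto simp: nth_eq_iff_index_eq)
  ultimately show ?thesis by (simp add: card_image)
qed

lemma nth_sorted_list_remove:
  fixes I :: "nat set"
  assumes "finite I" "card I = Suc m" "j < Suc m" "i < m"
  shows "sorted_list_of_set (I - {sorted_list_of_set I ! j}) ! i =
    sorted_list_of_set I ! (if i < j then i else Suc i)"
proof -
  let ?l = "sorted_list_of_set I"
  have l: "length ?l = Suc m" "distinct ?l" using assms by auto
  have split: "?l = take j ?l @ ?l ! j # drop (Suc j) ?l"
    using id_take_nth_drop[of j ?l] l(1) assms(3) by simp
  have "?l ! j \<notin> set (take j ?l)"
    using l assms(3) by (auto simp: in_set_conv_nth nth_eq_iff_index_eq)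
  then have "remove1 (?l ! j) ?l = take j ?l @ drop (Suc j) ?l"
    by (subst split) (simp add: remove1_append del: append_take_drop_id)
  moreover have "sorted_list_of_set (I - {?l ! j}) = remove1 (?l ! j) ?l"
    using assms(1) sorted_list_of_set_remove by blast
  ultimately show ?thesis using l assms by (auto simp: nth_append)
qed

text \<open>Laplace expansion along the first row. In terms of index sets the cofactor signs are those of \<open>move_sign\<close>, which makes the
expansion a contraction of tensors.\<close>

lemma minor_Cons:
  assumes I: "finite I" "card I = Suc (length Ys)"
  shows "minor B u (Y # Ys) I = (\<Sum>i\<in>I. move_sign i I * B Y (u i) * minor B u Ys (I - {i}))"
proof -
  let ?m = "length Ys" and ?l = "sorted_list_of_set I"
  let ?M = "minor_matrix B u (Y # Ys) I"
  have l: "length ?l = Suc ?m" "set ?l = I" "distinct ?l" using I by auto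
  have M: "?M \<in> carrier_mat (Suc ?m) (Suc ?m)" by (simp add: minor_matrix_def)
  have del: "mat_delete ?M 0 j = minor_matrix B u Ys (I - {?l ! j})" if "j < Suc ?m" for j
    unfolding mat_delete_def
    by (rule eq_matI) (use that in \<open>auto simp: minor_matrix_def nth_sorted_list_remove[OF I]\<close>)
  have "minor B u (Y # Ys) I = (\<Sum>j<Suc ?m. ?M $$ (0, j) * cofactor ?M 0 j)"
    unfolding minor_det by (rule laplace_expansion_row[OF M]) simp
  also have "\<dots> = (\<Sum>j<Suc ?m. move_sign (?l ! j) I * B Y (u (?l ! j)) * minor B u Ys (I - {?l ! j}))"
    by (intro sum.cong refl)
      (simp add: cofactor_def del minor_det move_sign_def card_less_nth_sorted_list I,
        simp add: minor_matrix_def)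
  also have "\<dots> = (\<Sum>i\<in>I. move_sign i I * B Y (u i) * minor B u Ys (I - {i}))"
    by (rule sum.reindex_bij_betw[of "(!) ?l" "{..<Suc ?m}" I])
      (rule bij_betw_nth, use l in auto)
  finally show ?thesis .
qed

section \<open>Polarized pairs and cochains\<close>

text \<open>The algebra of a Hermitian pair: \<open>kk\<close> acts on two abelian isotropic subspaces that are dual to each other under the
invariant form \<open>B\<close>, with dual bases \<open>u\<close> and \<open>us\<close>.\<close>

locale polarized_pair = g: lie_algebra s br
  for s :: "complex \<Rightarrow> 'x::ab_group_add \<Rightarrow> 'x" and br :: "'x \<Rightarrow> 'x \<Rightarrow> 'x" +
  fixes B :: "'x \<Rightarrow> 'x \<Rightarrow> complex" and kk Pp Pm :: "'x set" and u us :: "nat \<Rightarrow> 'x" and n :: nat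
  assumes B_add_left: "B (x + y) z = B x z + B y z"
    and B_scale_left: "B (s c x) z = c * B x z"
    and B_sym: "B x y = B y x"
    and B_inv: "B (br x y) z = B x (br y z)"
    and kk: "g.subspace kk" "\<And>X Y. X \<in> kk \<Longrightarrow> Y \<in> kk \<Longrightarrow> br X Y \<in> kk"
    and Pm: "g.subspace Pm"
    and u: "inj_on u {..<n}" "g.independent (u ` {..<n})" "g.span (u ` {..<n}) = Pp"
    and us: "\<And>i. i < n \<Longrightarrow> us i \<in> Pm"
    and dual: "\<And>i j. i < n \<Longrightarrow> j < n \<Longrightarrow> B (u i) (us j) = (if i = j then 1 else 0)"
    and expand_m: "\<And>y. y \<in> Pm \<Longrightarrow> y = (\<Sum>i<n. s (B (u i) y) (us i))"
    and iso_p: "\<And>x y. x \<in> Pp \<Longrightarrow> y \<in> Pp \<Longrightarrow> B x y = 0"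
    and iso_m: "\<And>x y. x \<in> Pm \<Longrightarrow> y \<in> Pm \<Longrightarrow> B x y = 0"
    and ab_p: "\<And>x y. x \<in> Pp \<Longrightarrow> y \<in> Pp \<Longrightarrow> br x y = 0"
    and ab_m: "\<And>x y. x \<in> Pm \<Longrightarrow> y \<in> Pm \<Longrightarrow> br x y = 0"
    and k_p: "\<And>X x. X \<in> kk \<Longrightarrow> x \<in> Pp \<Longrightarrow> br X x \<in> Pp"
    and k_m: "\<And>X x. X \<in> kk \<Longrightarrow> x \<in> Pm \<Longrightarrow> br X x \<in> Pm"
begin

lemma B_add_right: "B x (y + z) = B x y + B x z"
  and B_scale_right: "B x (s c y) = c * B x y"
  by (metis B_sym B_add_left, metis B_sym B_scale_left)

lemma B_zero [simp]: "B 0 x = 0" "B x 0 = 0"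
  using B_scale_left[of 0 0 x] B_scale_right[of x 0 0] by simp_all

lemma B_minus: "B (- x) y = - B x y" "B x (- y) = - B x y"
  using B_scale_left[of "-1" x y] B_scale_right[of x "-1" y] by simp_all

lemma B_sum_left: "B (\<Sum>i\<in>A. f i) y = (\<Sum>i\<in>A. B (f i) y)"
  by (induct A rule: infinite_finite_induct) (auto simp: B_add_left)

lemma B_sum_right: "B y (\<Sum>i\<in>A. f i) = (\<Sum>i\<in>A. B y (f i))"
  by (induct A rule: infinite_finite_induct) (auto simp: B_add_right)

lemma br_antisym: "br x y = - br y x"
proof -
  have "br x y + br y x = br (x + y) (x + y)"
    unfolding g.bracket_add_left g.bracket_add_right by (simp add: g.bracket_self)
  also have "\<dots> = 0" by (rule g.bracket_self)
  finally have "br x y + br y x = 0" .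
  then show ?thesis unfolding eq_neg_iff_add_eq_0 .
qed

lemma B_skew: "B (br X x) y = - B x (br X y)"
  by (subst br_antisym) (simp only: B_minus(1) B_inv)

lemma br_zero [simp]: "br x 0 = 0" "br 0 x = 0"
  using g.bracket_scale_right[of x 0 0] g.bracket_scale_left[of 0 0 x] by simp_all

lemma br_sum_right: "br x (\<Sum>i\<in>A. f i) = (\<Sum>i\<in>A. br x (f i))"
  by (induct A rule: infinite_finite_induct) (auto simp: g.bracket_add_right)

lemma u_mem: "i < n \<Longrightarrow> u i \<in> Pp"
  using g.span_base[of "u i" "u ` {..<n}"] u(3) by auto

lemma Pp: "g.subspace Pp"
  using u(3) g.subspace_span by metis

lemma coord_eq:
  assumes "x \<in> Pp" "j < n"
  shows "coord s u n x j = B x (us j)"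
proof -
  have "x = (\<Sum>b\<in>u ` {..<n}. s (g.representation (u ` {..<n}) x b) b)"
    using g.sum_representation_eq[OF u(2), of x "u ` {..<n}"] assms(1) u(3) by simp
  also have "\<dots> = (\<Sum>i<n. s (g.representation (u ` {..<n}) x (u i)) (u i))"
    by (simp add: sum.reindex[OF u(1)])
  finally have "B x (us j) = B (\<Sum>i<n. s (g.representation (u ` {..<n}) x (u i)) (u i)) (us j)"
    by simp
  also have "\<dots> = (\<Sum>i<n. g.representation (u ` {..<n}) x (u i) * (if i = j then 1 else 0))"
    unfolding B_sum_left B_scale_left using dual assms(2) by (intro sum.cong) auto
  also have "\<dots> = coord s u n x j"
    using assms(2) by (simp add: coord_def if_distrib cong: if_cong)
  finally show ?thesis by simp
qed

lemma expand_p: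
  assumes "x \<in> Pp"
  shows "x = (\<Sum>i<n. s (B x (us i)) (u i))"
proof -
  have "x = (\<Sum>b\<in>u ` {..<n}. s (g.representation (u ` {..<n}) x b) b)"
    using g.sum_representation_eq[OF u(2), of x "u ` {..<n}"] assms(1) u(3) by simp
  also have "\<dots> = (\<Sum>i<n. s (g.representation (u ` {..<n}) x (u i)) (u i))"
    by (simp add: sum.reindex[OF u(1)])
  also have "\<dots> = (\<Sum>i<n. s (B x (us i)) (u i))"
    using coord_eq[OF assms] by (intro sum.cong refl) (simp add: coord_def)
  finally show ?thesis .
qed

lemma disjoint_pm:
  assumes "x \<in> Pp" "x \<in> Pm"
  shows "x = 0"
  using expand_p[OF assms(1)] iso_m[OF assms(2) us] by simp

end

locale polarized_module = polarized_pair s br B kk Pp Pm u us n + complex_space sV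
  for s :: "complex \<Rightarrow> 'x::ab_group_add \<Rightarrow> 'x" and br :: "'x \<Rightarrow> 'x \<Rightarrow> 'x"
    and B :: "'x \<Rightarrow> 'x \<Rightarrow> complex" and kk Pp Pm :: "'x set" and u us :: "nat \<Rightarrow> 'x" and n :: nat
    and sV :: "complex \<Rightarrow> 'v::ab_group_add \<Rightarrow> 'v" +
  fixes \<pi> :: "'x \<Rightarrow> 'v \<Rightarrow> 'v"
  assumes pi_linear: "op_linear (\<pi> X)"
    and pi_add: "\<pi> (X + Y) v = \<pi> X v + \<pi> Y v"
    and pi_scale: "\<pi> (s c X) v = sV c (\<pi> X v)"
    and pi_bracket: "\<pi> (br X Y) v = \<pi> X (\<pi> Y v) - \<pi> Y (\<pi> X v)"
begin

lemma pi_zero [simp]: "\<pi> 0 v = 0" "\<pi> X 0 = 0"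
  using pi_scale[of 0 0 v] op_linear_0[OF pi_linear] by simp_all

lemma pi_sum: "\<pi> (\<Sum>i\<in>A. f i) v = (\<Sum>i\<in>A. \<pi> (f i) v)"
  by (induct A rule: infinite_finite_induct) (auto simp: pi_add)

text \<open>The contraction with \<open>Y \<in> \<pp>\<^sup>-\<close>, the operator \<open>d\<close>, and the adjoint action of \<open>X\<close> on \<open>\<And>\<pp>\<^sup>+\<close>, all in terms of
creation and annihilation operators.\<close>

definition interior where "interior Y T = ctr n (\<lambda>i. B Y (u i)) T"

definition dd where "dd T = (\<Sum>i<n. cre i (\<pi> (us i) \<circ> T))"

definition ad_op where
  "ad_op X T = (\<Sum>i<n. \<Sum>j<n. ts (B (br X (u i)) (us j)) (cre j (ann i T)))"

lemma interior_add_left: "interior (x + y) T = interior x T + interior y T"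
  by (simp add: interior_def contraction_def B_add_left tw.scale_left_distrib sum.distrib)

lemma interior_scale_left: "interior (s c x) T = ts c (interior x T)"
  by (simp add: interior_def contraction_def B_scale_left tw.scale_sum_right)

lemma interior_comp: "interior Y (\<pi> X \<circ> T) = \<pi> X \<circ> interior Y T"
  by (simp add: interior_def comp_ctr pi_linear)

text \<open>Cartan's formula for the complex of an abelian Lie algebra: the Lie derivative along \<open>Y\<close> is the action on \<open>V\<close> alone.\<close>

lemma interior_dd:
  assumes "Y \<in> Pm"
  shows "interior Y (dd T) = (\<pi> Y \<circ> T) - dd (interior Y T)"
proof -
  have "(\<Sum>i<n. ts (B Y (u i)) (\<pi> (us i) \<circ> T)) I = (\<pi> Y \<circ> T) I" for I
  proof -
    have "(\<Sum>i<n. ts (B Y (u i)) (\<pi> (us i) \<circ> T)) I = \<pi> (\<Sum>i<n. s (B (u i) Y) (us i)) (T I)"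
      by (simp add: sum_fun_apply pi_sum pi_scale B_sym)
    then show ?thesis using expand_m[OF assms] by simp
  qed
  then have "(\<Sum>i<n. ts (B Y (u i)) (\<pi> (us i) \<circ> T)) = (\<pi> Y \<circ> T)" by blast
  moreover have "interior Y (dd T) =
      (\<Sum>i<n. ts (B Y (u i)) (\<pi> (us i) \<circ> T) - cre i (interior Y (\<pi> (us i) \<circ> T)))"
    unfolding dd_def interior_def ctr_sum by (intro sum.cong refl ctr_cre) simp
  ultimately show ?thesis
    by (simp add: sum_subtractf dd_def interior_comp)
qed

lemma interior_interior: "interior X (interior Y T) = - interior Y (interior X T)"
  unfolding interior_def by (rule ctr_ctr)

lemma interior_zero [simp]: "interior Y 0 = 0"
  unfolding interior_def by simp

lemma interior_self [simp]: "interior Y (interior Y T) = 0"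
  unfolding interior_def by simp

lemma interior_sum: "interior Y (\<Sum>i\<in>A. f i) = (\<Sum>i\<in>A. interior Y (f i))"
  unfolding interior_def by (rule ctr_sum)

lemma interior_ad_op:
  assumes X: "X \<in> kk"
  shows "interior Y (ad_op X T) = ad_op X (interior Y T) - interior (br X Y) T"
proof -
  let ?b = "\<lambda>i j. B (br X (u i)) (us j)"
  have "interior Y (ad_op X T) = (\<Sum>i<n. \<Sum>j<n. ts (?b i j) (interior Y (cre j (ann i T))))"
    by (simp add: ad_op_def interior_sum) (simp add: interior_def ctr_scale)
  also have "\<dots> = (\<Sum>i<n. \<Sum>j<n. ts (?b i j * B Y (u j)) (ann i T) + ts (?b i j) (cre j (ann i (interior Y T))))"
  proof (intro sum.cong refl)
    fix i j assume "j \<in> {..<n}"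
    then have "interior Y (cre j (ann i T)) = ts (B Y (u j)) (ann i T) + cre j (ann i (interior Y T))"
      unfolding interior_def by (simp add: ctr_cre ann_ctr cre_minus)
    then show "ts (?b i j) (interior Y (cre j (ann i T))) =
        ts (?b i j * B Y (u j)) (ann i T) + ts (?b i j) (cre j (ann i (interior Y T)))"
      by (simp add: tw.scale_right_distrib)
  qed
  also have "\<dots> = (\<Sum>i<n. ts (\<Sum>j<n. ?b i j * B Y (u j)) (ann i T)) + ad_op X (interior Y T)"
    by (simp add: sum.distrib ad_op_def tw.scale_sum_left)
  also have "(\<Sum>i<n. ts (\<Sum>j<n. ?b i j * B Y (u j)) (ann i T)) = (\<Sum>i<n. ts (- B (br X Y) (u i)) (ann i T))"
  proof (intro sum.cong refl)
    fix i assume i: "i \<in> {..<n}"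
    have "B Y (br X (u i)) = B Y (\<Sum>j<n. s (?b i j) (u j))"
      using expand_p[OF k_p[OF X u_mem]] i by simp
    also have "\<dots> = (\<Sum>j<n. ?b i j * B Y (u j))"
      by (simp add: B_sum_right B_scale_right)
    finally show "ts (\<Sum>j<n. ?b i j * B Y (u j)) (ann i T) = ts (- B (br X Y) (u i)) (ann i T)"
      by (simp add: B_skew)
  qed
  also have "\<dots> = - interior (br X Y) T"
    by (simp add: interior_def contraction_def sum_negf)
  finally show ?thesis by (simp only: uminus_add_conv_diff)
qed

primrec eval where
  "eval T [] = T {}"
| "eval T (Y # Ys) = eval (interior Y T) Ys"

lemma interior_tensor_space: "T \<in> tensor_space n \<Longrightarrow> interior Y T \<in> tensor_space n"
proof -
  assume T: "T \<in> tensor_space n"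
  have "ann i T I = 0" if "\<not> I \<subseteq> {..<n}" for i I
  proof -
    have "\<not> insert i I \<subseteq> {..<n}" using that by blast
    then show ?thesis using T by (simp add: tensor_space_def annihilation_def)
  qed
  then show ?thesis by (simp add: tensor_space_def interior_def ctr_apply)
qed

text \<open>A tensor becomes a cochain by iterated contraction, since the determinant can be expanded along its first row repeatedly. The
recursive form allows induction on the list of arguments in the lemmas that follow.\<close>

lemma to_cochain_eval:
  assumes "T \<in> tensor_space n"
  shows "to_cochain sV B Pm u n T Ys = (if Ys \<in> lists Pm then eval T Ys else 0)"
proof -
  have "(\<Sum>I\<in>{I\<in>Pow {..<n}. card I = length Ys}. sV (minor B u Ys I) (T I)) = eval T Ys"
    for Ys
    using assms
  proof (induct Ys arbitrary: T)
    case Nil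
    have "{I\<in>Pow {..<n}. card I = 0} = {{}}" by (auto intro: finite_subset[of _ "{..<n}"] simp: card_eq_0_iff)
    then show ?case by (simp add: minor_def)
  next
    case (Cons Y Ys)
    let ?m = "length Ys"
    let ?S = "{I\<in>Pow {..<n}. card I = Suc ?m}" and ?R = "{I\<in>Pow {..<n}. card I = ?m}"
    have fin: "finite I" if "I \<subseteq> {..<n}" for I using that finite_subset by blast
    let ?f = "\<lambda>I i. sV (move_sign i I * B Y (u i) * minor B u Ys (I - {i})) (T I)"
    have "(\<Sum>I\<in>?S. sV (minor B u (Y # Ys) I) (T I)) = (\<Sum>I\<in>?S. \<Sum>i\<in>I. ?f I i)"
      by (intro sum.cong refl) (simp add: minor_Cons fin scale_sum_left)
    also have "\<dots> = (\<Sum>(I, i)\<in>Sigma ?S (\<lambda>I. I). ?f I i)"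
      by (rule sum.Sigma) (auto simp: fin)
    also have "\<dots> = (\<Sum>(I, i)\<in>Sigma ?R (\<lambda>I. {..<n} - I). ?f (insert i I) i)"
      by (rule sum.reindex_bij_witness[where i = "\<lambda>(I, i). (insert i I, i)" and j = "\<lambda>(I, i). (I - {i}, i)"])
        (auto simp: insert_absorb fin)
    also have "\<dots> = (\<Sum>I\<in>?R. \<Sum>i\<in>{..<n} - I. ?f (insert i I) i)"
      by (rule sum.Sigma[symmetric]) (auto simp: fin)
    also have "\<dots> = (\<Sum>I\<in>?R. sV (minor B u Ys I) (interior Y T I))"
    proof (intro sum.cong refl)
      fix I assume "I \<in> ?R"
      have "interior Y T I = (\<Sum>i\<in>{..<n} - I. sV (B Y (u i)) (ann i T I))"
        unfolding interior_def ctr_apply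
        by (rule sum.mono_neutral_right) (auto simp: annihilation_def)
      also have "\<dots> = (\<Sum>i\<in>{..<n} - I. sV (B Y (u i) * move_sign i I) (T (insert i I)))"
        by (intro sum.cong refl) (auto simp: annihilation_def)
      finally show "(\<Sum>i\<in>{..<n} - I. ?f (insert i I) i) = sV (minor B u Ys I) (interior Y T I)"
        by (simp add: scale_sum_right) (intro sum.cong refl, auto simp: mult_ac)
    qed
    finally show ?case using Cons.hyps[OF interior_tensor_space[OF Cons.prems]] by simp
  qed
  then show ?thesis by (simp add: to_cochain_def minor_def)
qed

lemma eval_add: "eval (T + T') Ys = eval T Ys + eval T' Ys"
  by (induct Ys arbitrary: T T') (auto simp: interior_def ctr_add)

lemma eval_scale: "eval (ts c T) Ys = sV c (eval T Ys)"
  by (induct Ys arbitrary: T) (auto simp: interior_def ctr_scale)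

lemma eval_diff: "eval (T - T') Ys = eval T Ys - eval T' Ys"
  using eval_add[of "T - T'" T' Ys] by simp

lemma eval_zero [simp]: "eval 0 Ys = 0"
  using eval_scale[of 0 0 Ys] by simp

lemma eval_comp: "eval (\<pi> X \<circ> T) Ys = \<pi> X (eval T Ys)"
  by (induct Ys arbitrary: T) (auto simp: interior_comp)

lemma eval_update_add: "i < length Ys \<Longrightarrow> eval T (Ys[i := x + y]) = eval T (Ys[i := x]) + eval T (Ys[i := y])"
  by (induct Ys arbitrary: T i) (auto simp: interior_add_left eval_add split: nat.split)

lemma eval_update_scale: "i < length Ys \<Longrightarrow> eval T (Ys[i := s c x]) = sV c (eval T (Ys[i := x]))"
  by (induct Ys arbitrary: T i) (auto simp: interior_scale_left eval_scale split: nat.split)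

lemma eval_vanish: "interior Y T = 0 \<Longrightarrow> Y \<in> set Ys \<Longrightarrow> eval T Ys = 0"
proof (induct Ys arbitrary: T)
  case (Cons Z Ys)
  show ?case
  proof (cases "Y = Z")
    case False
    have "interior Y (interior Z T) = 0"
      by (simp only: interior_interior[of Y Z T] Cons.prems(1) interior_zero minus_zero)
    then show ?thesis using Cons False by simp
  next
    case True
    then show ?thesis using Cons.prems(1) by (simp only: eval.simps eval_zero)
  qed
qed simp

lemma eval_alternating: "j < length Ys \<Longrightarrow> i < j \<Longrightarrow> Ys ! i = Ys ! j \<Longrightarrow> eval T Ys = 0"
proof (induct Ys arbitrary: T i j)
  case (Cons Z Ys)
  show ?case
  proof (cases i)
    case 0
    then have "Z \<in> set Ys" using Cons.prems by (cases j) auto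
    then show ?thesis using eval_vanish[of Z "interior Z T"] by simp
  next
    case (Suc i')
    then show ?thesis using Cons.prems Cons.hyps[of "j - 1" i'] by (cases j) auto
  qed
qed simp

lemma to_cochain_cochains:
  assumes T: "T \<in> tensor_space n"
  shows "to_cochain sV B Pm u n T \<in> cochains s sV Pm"
proof -
  have upd: "Ys[i := x] \<in> lists Pm" if "Ys \<in> lists Pm" "x \<in> Pm" for Ys i x
    using that set_update_subset_insert[of Ys i x] by auto
  show ?thesis
    unfolding cochains_def to_cochain_eval[OF T]
    using upd Pm g.subspace_add[OF Pm] g.subspace_scale[OF Pm]
    by (auto simp: eval_update_add eval_update_scale eval_alternating)
qed

text \<open>Each argument is a contraction that is moved past \<open>d\<close> by Cartan's formula; this produces the alternating sum.\<close>

lemma eval_dd: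
  assumes "Ys \<in> lists Pm"
  shows "eval (dd T) Ys = (\<Sum>i<length Ys. sV ((- 1) ^ i) (\<pi> (Ys ! i) (eval T (nths Ys (- {i})))))"
  using assms
proof (induct Ys arbitrary: T)
  case Nil
  show ?case by (simp add: dd_def sum_fun_apply)
next
  case (Cons Y Ys)
  have 1: "nths (Y # Ys) (- {0}) = Ys"
  proof -
    have "{j. Suc j \<in> - {0::nat}} = UNIV" by auto
    then show ?thesis by (simp add: nths_Cons nths_all)
  qed
  have 2: "nths (Y # Ys) (- {Suc i}) = Y # nths Ys (- {i})" for i
  proof -
    have "{j. Suc j \<in> - {Suc i}} = - {i}" by auto
    then show ?thesis by (simp add: nths_Cons)
  qed
  show ?case
    using Cons
    by (simp add: interior_dd eval_diff eval_comp 1 2 sum.lessThan_Suc_shift sum_negf del: sum.lessThan_Suc)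
qed

lemma eval_ad_op:
  assumes "X \<in> kk"
  shows "eval (ad_op X T) Ys = - (\<Sum>i<length Ys. eval T (Ys[i := br X (Ys ! i)]))"
proof (induct Ys arbitrary: T)
  case Nil
  show ?case by (simp add: ad_op_def sum_fun_apply)
next
  case (Cons Y Ys)
  then show ?case
    by (simp add: interior_ad_op[OF assms] eval_diff sum.lessThan_Suc_shift del: sum.lessThan_Suc)
qed

lemma cochain_update_add:
  assumes "f \<in> cochains s sV Pm" "Ys \<in> lists Pm" "i < length Ys" "x \<in> Pm" "y \<in> Pm"
  shows "f (Ys[i := x + y]) = f (Ys[i := x]) + f (Ys[i := y])"
proof -
  have "\<forall>Ys\<in>lists Pm. \<forall>i<length Ys. \<forall>x\<in>Pm. \<forall>y\<in>Pm. f (Ys[i := x + y]) = f (Ys[i := x]) + f (Ys[i := y])"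
    using assms(1) unfolding cochains_def mem_Collect_eq by (elim conjE)
  then show ?thesis using assms(2-) by blast
qed

lemma cochain_update_scale:
  assumes "f \<in> cochains s sV Pm" "Ys \<in> lists Pm" "i < length Ys" "x \<in> Pm"
  shows "f (Ys[i := s c x]) = sV c (f (Ys[i := x]))"
proof -
  have "\<forall>Ys\<in>lists Pm. \<forall>i<length Ys. \<forall>c. \<forall>x\<in>Pm. f (Ys[i := s c x]) = sV c (f (Ys[i := x]))"
    using assms(1) unfolding cochains_def mem_Collect_eq by (elim conjE)
  then show ?thesis using assms(2-) by blast
qed

lemma cochain_alternating:
  assumes "f \<in> cochains s sV Pm" "Ys \<in> lists Pm" "j < length Ys" "i < j" "Ys ! i = Ys ! j"
  shows "f Ys = 0"
proof -
  have "\<forall>Ys\<in>lists Pm. \<forall>j<length Ys. \<forall>i<j. Ys ! i = Ys ! j \<longrightarrow> f Ys = 0"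
    using assms(1) unfolding cochains_def mem_Collect_eq by (elim conjE)
  then show ?thesis using assms(2-) by blast
qed

lemma cochain_zero: 
  assumes f: "f \<in> cochains s sV Pm" and Ys: "Ys \<in> lists Pm"
  shows "f (0 # Ys) = 0"
proof -
  have 0: "0 \<in> Pm" using g.subspace_0[OF Pm] .
  then have "f ((0 # Ys)[0 := s 0 0]) = sV 0 (f ((0 # Ys)[0 := 0]))"
    using Ys by (intro cochain_update_scale[OF f]) auto
  then show ?thesis by simp
qed

text \<open>The bracket terms of the Chevalley-Eilenberg differential vanish because \<open>\<pp>\<^sup>-\<close> is abelian.\<close>

lemma to_cochain_dd:
  assumes T: "T \<in> tensor_space n" "dd T \<in> tensor_space n"
  shows "to_cochain sV B Pm u n (dd T) = cochain_diff br sV \<pi> Pm (to_cochain sV B Pm u n T)"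
proof
  fix Ys
  have nths: "nths Ys A \<in> lists Pm" if "Ys \<in> lists Pm" for A
    using that set_nths_subset[of Ys A] by auto
  have br: "to_cochain sV B Pm u n T (br (Ys ! i) (Ys ! j) # nths Ys (- {i, j})) = 0"
    if "Ys \<in> lists Pm" "i < length Ys" "j < length Ys" for i j
  proof -
    have "br (Ys ! i) (Ys ! j) = 0"
      using that by (intro ab_m) auto
    then show ?thesis using cochain_zero[OF to_cochain_cochains[OF T(1)] nths[OF that(1)]] by simp
  qed
  show "to_cochain sV B Pm u n (dd T) Ys = cochain_diff br sV \<pi> Pm (to_cochain sV B Pm u n T) Ys"
  proof (cases "Ys \<in> lists Pm")
    case True
    have "(\<Sum>j<length Ys. \<Sum>i<j. sV ((- 1) ^ (i + j)) (to_cochain sV B Pm u n T (br (Ys ! i) (Ys ! j) # nths Ys (- {i, j})))) = 0"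
      by (intro sum.neutral ballI) (use br[OF True] in simp)
    then show ?thesis
      using True nths[OF True]
      by (simp add: cochain_diff_def to_cochain_eval[OF T(2)] eval_dd to_cochain_eval[OF T(1)])
  next
    case False
    then show ?thesis by (simp add: cochain_diff_def to_cochain_def)
  qed
qed

lemma to_cochain_act:
  assumes X: "X \<in> kk" and T: "T \<in> tensor_space n" "(\<pi> X \<circ> T) + ad_op X T \<in> tensor_space n"
  shows "to_cochain sV B Pm u n ((\<pi> X \<circ> T) + ad_op X T) = cochain_act br \<pi> Pm X (to_cochain sV B Pm u n T)"
proof
  fix Ys
  have upd: "Ys[i := br X (Ys ! i)] \<in> lists Pm" if "Ys \<in> lists Pm" "i < length Ys" for i
    using that set_update_subset_insert[of Ys i "br X (Ys ! i)"] k_m[OF X, of "Ys ! i"] by auto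
  show "to_cochain sV B Pm u n ((\<pi> X \<circ> T) + ad_op X T) Ys = cochain_act br \<pi> Pm X (to_cochain sV B Pm u n T) Ys"
    using upd
    by (simp add: cochain_act_def to_cochain_eval[OF T(2)] to_cochain_eval[OF T(1)] eval_add eval_comp
        eval_ad_op[OF X])
qed

lemma interior_us: "j < n \<Longrightarrow> interior (us j) T = ann j T"
  using dual B_sym
  by (simp add: interior_def contraction_def if_distrib[of "\<lambda>c. ts c _"] cong: if_cong)

lemma eval_sorted:
  "sorted_wrt (<) is \<Longrightarrow> set is \<subseteq> {..<n} \<Longrightarrow> eval T (map us is) = T (set is)"
proof (induct "is" arbitrary: T)
  case (Cons i js)
  have "{k \<in> set js. k < i} = {}" using Cons.prems by fastforce
  then have "move_sign i (set js) = 1" unfolding move_sign_def by (simp only: card.empty power_0)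
  moreover have "i \<notin> set js" using Cons.prems by auto
  ultimately have "eval (ann i T) (map us js) = T (set (i # js))"
    using Cons by (simp add: annihilation_def)
  then show ?case using Cons.prems by (simp add: interior_us)
qed simp

lemma to_cochain_basis:
  assumes "T \<in> tensor_space n" "I \<subseteq> {..<n}"
  shows "to_cochain sV B Pm u n T (map us (sorted_list_of_set I)) = T I"
proof -
  have fin: "finite I" using assms(2) finite_subset by blast
  then have "map us (sorted_list_of_set I) \<in> lists Pm" using us assms(2) fin by fastforce
  then have "to_cochain sV B Pm u n T (map us (sorted_list_of_set I)) = eval T (map us (sorted_list_of_set I))"
    by (simp only: to_cochain_eval[OF assms(1)] if_True)
  also have "\<dots> = T (set (sorted_list_of_set I))"
    using fin assms(2) by (intro eval_sorted) (auto simp: strict_sorted_list_of_set)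
  finally show ?thesis using fin by simp
qed

lemma cochain_swap:
  assumes f: "f \<in> cochains s sV Pm" and m: "xs \<in> lists Pm" "ys \<in> lists Pm" "a \<in> Pm" "b \<in> Pm"
  shows "f (xs @ a # b # ys) = - f (xs @ b # a # ys)"
proof -
  have add1: "f (xs @ (x + y) # z # ys) = f (xs @ x # z # ys) + f (xs @ y # z # ys)"
    if "x \<in> Pm" "y \<in> Pm" "z \<in> Pm" for x y z
  proof -
    have "xs @ x # z # ys \<in> lists Pm" "length xs < length (xs @ x # z # ys)" using m that by auto
    then have "f ((xs @ x # z # ys)[length xs := x + y]) =
        f ((xs @ x # z # ys)[length xs := x]) + f ((xs @ x # z # ys)[length xs := y])"
      using that by (intro cochain_update_add[OF f]) 
    then show ?thesis by simp
  qed
  have add2: "f (xs @ z # (x + y) # ys) = f (xs @ z # x # ys) + f (xs @ z # y # ys)"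
    if "x \<in> Pm" "y \<in> Pm" "z \<in> Pm" for x y z
  proof -
    have "xs @ z # x # ys \<in> lists Pm" "Suc (length xs) < length (xs @ z # x # ys)" using m that by auto
    then have "f ((xs @ z # x # ys)[Suc (length xs) := x + y]) =
        f ((xs @ z # x # ys)[Suc (length xs) := x]) + f ((xs @ z # x # ys)[Suc (length xs) := y])"
      using that by (intro cochain_update_add[OF f]) 
    then show ?thesis by (simp add: list_update_append)
  qed
  have alt: "f (xs @ x # x # ys) = 0" if "x \<in> Pm" for x
  proof -
    have "xs @ x # x # ys \<in> lists Pm" "Suc (length xs) < length (xs @ x # x # ys)"
      "(xs @ x # x # ys) ! length xs = (xs @ x # x # ys) ! Suc (length xs)"
      using m that by (auto simp: nth_append)
    then show ?thesis by (intro cochain_alternating[OF f, of _ "Suc (length xs)" "length xs"]) auto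
  qed
  have ab: "a + b \<in> Pm" using m g.subspace_add[OF Pm] by blast
  have "0 = f (xs @ (a + b) # (a + b) # ys)" using alt[OF ab] by simp
  also have "\<dots> = f (xs @ a # b # ys) + f (xs @ b # a # ys)"
    using m ab by (simp only: add1 add2) (simp add: add1 add2 alt)
  finally show ?thesis using minus_unique by (metis add.inverse_inverse)
qed

lemma cochain_combination:
  assumes f: "f \<in> cochains s sV Pm" and m: "xs \<in> lists Pm" "ys \<in> lists Pm"
    and "finite A" "\<And>i. i \<in> A \<Longrightarrow> b i \<in> Pm"
  shows "f (xs @ (\<Sum>i\<in>A. s (c i) (b i)) # ys) = (\<Sum>i\<in>A. sV (c i) (f (xs @ b i # ys)))"
  using assms(4,5)
proof (induct A rule: finite_induct)
  case empty
  have 0: "0 \<in> Pm" using g.subspace_0[OF Pm] .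
  then have "xs @ 0 # ys \<in> lists Pm" "length xs < length (xs @ 0 # ys)" using m by auto
  then have "f ((xs @ 0 # ys)[length xs := s 0 0]) = sV 0 (f ((xs @ 0 # ys)[length xs := 0]))"
    using 0 by (intro cochain_update_scale[OF f])
  then show ?case by simp
next
  case (insert i A)
  have sum: "(\<Sum>i\<in>A. s (c i) (b i)) \<in> Pm"
    using insert by (intro g.subspace_sum[OF Pm] g.subspace_scale[OF Pm]) auto
  have bi: "b i \<in> Pm" "s (c i) (b i) \<in> Pm" using insert g.subspace_scale[OF Pm] by auto
  have L: "xs @ b i # ys \<in> lists Pm" "length xs < length (xs @ b i # ys)" using m bi by auto
  have "f ((xs @ b i # ys)[length xs := s (c i) (b i) + (\<Sum>i\<in>A. s (c i) (b i))]) =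
      f ((xs @ b i # ys)[length xs := s (c i) (b i)]) + f ((xs @ b i # ys)[length xs := (\<Sum>i\<in>A. s (c i) (b i))])"
    using L bi sum by (intro cochain_update_add[OF f])
  moreover have "f ((xs @ b i # ys)[length xs := s (c i) (b i)]) = sV (c i) (f ((xs @ b i # ys)[length xs := b i]))"
    using L bi by (intro cochain_update_scale[OF f])
  ultimately show ?case using insert by simp
qed

text \<open>An alternating multilinear map is determined by its values on increasing lists of basis vectors: arguments are expanded in
the basis, then sorted by transpositions.\<close>

lemma cochain_unique:
  assumes h: "h \<in> cochains s sV Pm"
    and z: "\<And>I. I \<subseteq> {..<n} \<Longrightarrow> h (map us (sorted_list_of_set I)) = 0"
  shows "h = 0"
proof -
  have mem: "map us js \<in> lists Pm" if "js \<in> lists {..<n}" for js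
    using that us by (induct js) auto
  have move: "h (map us pre @ us j # map us js) = 0"
    if "pre \<in> lists {..<n}" "j < n" "js \<in> lists {..<n}" "h (map us pre @ map us (insort j js)) = 0" for pre j js
    using that
  proof (induct js arbitrary: pre)
    case (Cons k js)
    show ?case
    proof (cases "j \<le> k")
      case False
      then have "h (map us (pre @ [k]) @ us j # map us js) = 0"
        using Cons.prems by (intro Cons.hyps) auto
      moreover have "h (map us pre @ us j # us k # map us js) = - h (map us pre @ us k # us j # map us js)"
        using Cons.prems mem us by (intro cochain_swap[OF h]) auto
      ultimately show ?thesis by simp
    qed (use Cons.prems in simp)
  qed simp
  have sort: "h (map us pre @ map us js) = 0"
    if "pre \<in> lists {..<n}" "js \<in> lists {..<n}" "h (map us pre @ map us (sort js)) = 0" for pre js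
    using that
  proof (induct js arbitrary: pre)
    case (Cons j js)
    have "h (map us pre @ us j # map us (sort js)) = 0"
      using Cons.prems by (intro move) auto
    then have "h (map us (pre @ [j]) @ map us js) = 0"
      using Cons.prems by (intro Cons.hyps) auto
    then show ?case by simp
  qed simp
  have basis: "h (map us js) = 0" if js: "js \<in> lists {..<n}" for js
  proof (cases "distinct js")
    case True
    then have "sort js = sorted_list_of_set (set js)"
      by (simp add: sorted_list_of_set_sort_remdups distinct_remdups_id)
    then have "h (map us (sort js)) = 0" using z[of "set js"] js by auto
    then show ?thesis using sort[of "[]" js] js by simp
  next
    case False
    then obtain i j where "i < j" "j < length js" "js ! i = js ! j"
      by (metis distinct_conv_nth linorder_neqE_nat)
    then have "j < length (map us js)" "i < j" "map us js ! i = map us js ! j" by auto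
    then show ?thesis by (intro cochain_alternating[OF h mem[OF js]])
  qed
  have all: "h (map us js @ Ys) = 0" if "js \<in> lists {..<n}" "Ys \<in> lists Pm" for js Ys
    using that
  proof (induct Ys arbitrary: js)
    case (Cons Y Ys)
    have "h (map us js @ Y # Ys) = h (map us js @ (\<Sum>i<n. s (B (u i) Y) (us i)) # Ys)"
      using expand_m[of Y] Cons.prems by simp
    also have "\<dots> = (\<Sum>i<n. sV (B (u i) Y) (h (map us js @ us i # Ys)))"
      using Cons.prems mem us by (intro cochain_combination[OF h]) auto
    also have "\<dots> = 0"
    proof (intro sum.neutral ballI)
      fix i assume "i \<in> {..<n}"
      then have "h (map us (js @ [i]) @ Ys) = 0" using Cons.prems by (intro Cons.hyps) auto
      then show "sV (B (u i) Y) (h (map us js @ us i # Ys)) = 0" by simp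
    qed
    finally show ?case .
  qed (use basis in simp)
  show ?thesis
  proof
    fix Ys show "h Ys = 0 Ys"
      using all[of "[]" Ys] h by (cases "Ys \<in> lists Pm") (auto simp: cochains_def)
  qed
qed

lemma cochains_diff:
  assumes "f \<in> cochains s sV Pm" "g \<in> cochains s sV Pm"
  shows "f - g \<in> cochains s sV Pm"
  using assms unfolding cochains_def
  by (auto simp: scale_right_diff_distrib)

text \<open>On increasing lists of basis vectors the cochain of a tensor takes the coefficients of the tensor as values. With
\<open>cochain_unique\<close> this gives the inverse map.\<close>

lemma to_cochain_bij:
  "bij_betw (to_cochain sV B Pm u n :: (nat set \<Rightarrow> 'v) \<Rightarrow> _) (tensor_space n) (cochains s sV Pm)"
proof (rule bij_betwI')
  fix T T' :: "nat set \<Rightarrow> 'v" assume T: "T \<in> tensor_space n" "T' \<in> tensor_space n"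
  show "(to_cochain sV B Pm u n T = to_cochain sV B Pm u n T') = (T = T')"
  proof
    assume eq: "to_cochain sV B Pm u n T = to_cochain sV B Pm u n T'"
    show "T = T'"
    proof
      fix I
      show "T I = T' I"
      proof (cases "I \<subseteq> {..<n}")
        case True
        then show ?thesis using to_cochain_basis T eq by metis
      next
        case False
        then show ?thesis using T by (simp add: tensor_space_def)
      qed
    qed
  qed simp
next
  fix T :: "nat set \<Rightarrow> 'v" assume "T \<in> tensor_space n"
  then show "to_cochain sV B Pm u n T \<in> cochains s sV Pm" by (rule to_cochain_cochains)
next
  fix f assume f: "f \<in> cochains s sV Pm"
  (* The coefficients are forced by to_cochain_basis. *)
  define T where "T I = (if I \<subseteq> {..<n} then f (map us (sorted_list_of_set I)) else 0)" for I
  have T: "T \<in> tensor_space n" by (simp add: T_def tensor_space_def)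
  have "f - to_cochain sV B Pm u n T = 0"
    by (rule cochain_unique[OF cochains_diff[OF f to_cochain_cochains[OF T]]])
      (simp add: to_cochain_basis[OF T], simp add: T_def)
  then show "\<exists>T\<in>tensor_space n. f = to_cochain sV B Pm u n T" using T by auto
qed

end

section \<open>Operators on the tensor product\<close>

text \<open>Spinors are tensors with coefficients in \<open>V = \<complex>\<close>, so the relations between creation and annihilation operators apply to
them as well.\<close>

interpretation S: complex_space "(*) :: complex \<Rightarrow> complex \<Rightarrow> complex"
  by standard (auto simp: algebra_simps)

abbreviation "creS \<equiv> creation ((*) :: complex \<Rightarrow> complex \<Rightarrow> complex)"
abbreviation "annS \<equiv> annihilation ((*) :: complex \<Rightarrow> complex \<Rightarrow> complex)"
abbreviation "ctrS \<equiv> contraction ((*) :: complex \<Rightarrow> complex \<Rightarrow> complex)"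
abbreviation "tsS \<equiv> tensor_scale ((*) :: complex \<Rightarrow> complex \<Rightarrow> complex)"

lemma monomial_tensor_space: "I \<subseteq> {..<n} \<Longrightarrow> monomial I \<in> tensor_space n"
  by (auto simp: tensor_space_def monomial_def)

lemma wedge_eq:
  assumes Y: "Y \<in> tensor_space n"
  shows "wedge s u n x Y = (\<Sum>j<n. tsS (coord s u n x j) (creS j Y))"
proof
  fix J
  let ?c = "coord s u n x"
  have "wedge s u n x Y J = (\<Sum>I\<in>Pow {..<n}. \<Sum>j<n. if j \<in> I then 0 else
      Y I * (?c j * move_sign j I * monomial (insert j I) J))"
    unfolding wedge_def sum_distrib_left
    by (intro sum.cong refl sum.mono_neutral_cong_left) auto
  also have "\<dots> = (\<Sum>j<n. \<Sum>I\<in>Pow {..<n}. if j \<in> I then 0 else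
      Y I * (?c j * move_sign j I * monomial (insert j I) J))"
    by (rule sum.swap)
  also have "\<dots> = (\<Sum>j<n. tsS (?c j) (creS j Y) J)"
  proof (intro sum.cong refl)
    fix j assume "j \<in> {..<n}"
    have "(\<Sum>I\<in>Pow {..<n}. if j \<in> I then 0 else Y I * (?c j * move_sign j I * monomial (insert j I) J)) =
        (\<Sum>I\<in>Pow {..<n}. if I = J - {j} then tsS (?c j) (creS j Y) J else 0)"
      by (intro sum.cong refl) (auto simp: monomial_def creation_def)
    also have "\<dots> = tsS (?c j) (creS j Y) J"
      using Y by (auto simp: creation_def tensor_space_def sum.delta)
    finally show "(\<Sum>I\<in>Pow {..<n}. if j \<in> I then 0 else Y I * (?c j * move_sign j I * monomial (insert j I) J)) =
        tsS (?c j) (creS j Y) J" .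
  qed
  finally show "wedge s u n x Y J = (\<Sum>j<n. tsS (?c j) (creS j Y)) J"
    by (simp only: sum_fun_apply)
qed

lemma contract_eq:
  assumes Y: "Y \<in> tensor_space n"
  shows "contract u n \<phi> Y = ctrS n (\<lambda>i. \<phi> (u i)) Y"
proof
  fix J
  have "contract u n \<phi> Y J = (\<Sum>I\<in>Pow {..<n}. \<Sum>i<n. if i \<in> I then
      Y I * (move_sign i I * \<phi> (u i) * monomial (I - {i}) J) else 0)"
    unfolding contract_def sum_distrib_left
    by (intro sum.cong refl sum.mono_neutral_cong_left) auto
  also have "\<dots> = (\<Sum>i<n. \<Sum>I\<in>Pow {..<n}. if i \<in> I then
      Y I * (move_sign i I * \<phi> (u i) * monomial (I - {i}) J) else 0)"
    by (rule sum.swap)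
  also have "\<dots> = (\<Sum>i<n. \<phi> (u i) * annS i Y J)"
  proof (intro sum.cong refl)
    fix i assume "i \<in> {..<n}"
    have "(\<Sum>I\<in>Pow {..<n}. if i \<in> I then Y I * (move_sign i I * \<phi> (u i) * monomial (I - {i}) J) else 0) =
        (\<Sum>I\<in>Pow {..<n}. if I = insert i J then \<phi> (u i) * annS i Y J else 0)"
      by (intro sum.cong refl) (auto simp: monomial_def annihilation_def)
    also have "\<dots> = \<phi> (u i) * annS i Y J"
      using Y by (auto simp: annihilation_def tensor_space_def sum.delta)
    finally show "(\<Sum>I\<in>Pow {..<n}. if i \<in> I then Y I * (move_sign i I * \<phi> (u i) * monomial (I - {i}) J) else 0) =
        \<phi> (u i) * annS i Y J" .
  qed
  finally show "contract u n \<phi> Y J = ctrS n (\<lambda>i. \<phi> (u i)) Y J"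
    by (simp only: S.ctr_apply)
qed

lemma annS_monomial: "annS i (monomial I) = (if i \<in> I then tsS (move_sign i I) (monomial (I - {i})) else 0)"
  by (auto simp: fun_eq_iff annihilation_def monomial_def)

lemma creS_monomial: "creS i (monomial I) = (if i \<in> I then 0 else tsS (move_sign i I) (monomial (insert i I)))"
  by (auto simp: fun_eq_iff creation_def monomial_def)

text \<open>A derivation of the exterior algebra replaces one factor \<open>u\<^sub>i\<close> at a time by its image, that is, it annihilates \<open>u\<^sub>i\<close> and
creates \<open>u\<^sub>j\<close> with the matrix entry as coefficient.\<close>

lemma ext_derivation_monomial:
  assumes I: "I \<subseteq> {..<n}"
  shows "ext_derivation s u n A (monomial I) =
    (\<Sum>i<n. \<Sum>j<n. tsS (coord s u n (A (u i)) j) (creS j (annS i (monomial I))))"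
proof -
  have "ext_derivation s u n A (monomial I) J =
      (\<Sum>i<n. \<Sum>j<n. tsS (coord s u n (A (u i)) j) (creS j (annS i (monomial I)))) J" for J
  proof -
    let ?w = "\<lambda>i I. wedge s u n (A (u i)) (monomial (I - {i})) J"
    have "ext_derivation s u n A (monomial I) J =
        (\<Sum>I'\<in>Pow {..<n}. if I' = I then (\<Sum>i\<in>I. move_sign i I * ?w i I) else 0)"
      unfolding ext_derivation_def by (intro sum.cong refl) (auto simp: monomial_def)
    also have "\<dots> = (\<Sum>i\<in>I. move_sign i I * ?w i I)" using I by simp
    also have "\<dots> = (\<Sum>i\<in>I. (\<Sum>j<n. tsS (coord s u n (A (u i)) j) (creS j (annS i (monomial I)))) J)"
    proof (intro sum.cong refl)
      fix i assume i: "i \<in> I"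
      have "monomial (I - {i}) \<in> tensor_space n" using I by (intro monomial_tensor_space) auto
      then show "move_sign i I * ?w i I =
          (\<Sum>j<n. tsS (coord s u n (A (u i)) j) (creS j (annS i (monomial I)))) J"
        using i by (simp add: wedge_eq annS_monomial S.cre_scale sum_fun_apply sum_distrib_left mult_ac)
    qed
    also have "\<dots> = (\<Sum>i<n. (\<Sum>j<n. tsS (coord s u n (A (u i)) j) (creS j (annS i (monomial I)))) J)"
      by (rule sum.mono_neutral_left) (use I in \<open>auto simp: annS_monomial sum_fun_apply\<close>)
    finally show ?thesis by (simp only: sum_fun_apply)
  qed
  then show ?thesis by blast
qed

context complex_space
begin

lemma tensor_delta:
  assumes T: "T \<in> tensor_space n" and A: "A 0 = 0"
  shows "(\<Sum>I\<in>Pow {..<n}. scale (c * monomial I K) (A (T I))) = scale c (A (T K))"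
proof -
  have "(\<Sum>I\<in>Pow {..<n}. scale (c * monomial I K) (A (T I))) =
      (\<Sum>I\<in>Pow {..<n}. if I = K then scale c (A (T K)) else 0)"
    by (intro sum.cong refl) (auto simp: monomial_def)
  also have "\<dots> = scale c (A (T K))"
    using T A by (auto simp: tensor_space_def sum.delta)
  finally show ?thesis .
qed

lemma tensor_op_id:
  assumes "T \<in> tensor_space n" "A 0 = 0"
  shows "tensor_op scale n A id T = A \<circ> T"
  using tensor_delta[where A = A and c = 1, OF assms] by (simp add: tensor_op_def fun_eq_iff)

lemma tensor_op_cre:
  assumes T: "T \<in> tensor_space n" and A: "A 0 = 0"
  shows "tensor_op scale n A (creS i) T = cre i (A \<circ> T)"
proof
  fix J
  show "tensor_op scale n A (creS i) T J = cre i (A \<circ> T) J"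
    using tensor_delta[where A = A and c = "move_sign i J" and K = "J - {i}", OF T A] by (simp add: tensor_op_def creation_def)
qed

lemma tensor_op_ann:
  assumes T: "T \<in> tensor_space n" and A: "A 0 = 0"
  shows "tensor_op scale n A (annS i) T = ann i (A \<circ> T)"
proof
  fix J
  show "tensor_op scale n A (annS i) T J = ann i (A \<circ> T) J"
    using tensor_delta[where A = A and c = "move_sign i J" and K = "insert i J", OF T A] by (simp add: tensor_op_def annihilation_def)
qed

lemma tensor_op_cre_ann:
  assumes T: "T \<in> tensor_space n" and A: "A 0 = 0"
  shows "tensor_op scale n A (\<lambda>Y. creS j (annS i Y)) T = cre j (ann i (A \<circ> T))"
proof
  fix J
  show "tensor_op scale n A (\<lambda>Y. creS j (annS i Y)) T J = cre j (ann i (A \<circ> T)) J"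
  proof (cases "j \<in> J \<and> i \<notin> J - {j}")
    case True
    then have "creS j (annS i (monomial I)) J =
        move_sign j J * move_sign i (J - {j}) * monomial I (insert i (J - {j}))" for I
      by (simp only: creation_def annihilation_def if_True if_False mult.assoc)
    moreover have "cre j (ann i (A \<circ> T)) J =
        scale (move_sign j J * move_sign i (J - {j})) (A (T (insert i (J - {j}))))"
      using True by (simp only: creation_def annihilation_def if_True if_False scale_scale o_apply)
    ultimately show ?thesis
      unfolding tensor_op_def by (simp only: tensor_delta[where A = A, OF T A])
  next
    case False
    then have "creS j (annS i Y) J = 0" "cre j (ann i T') J = 0" for Y T'
      by (auto simp: creation_def annihilation_def)
    then show ?thesis by (simp add: tensor_op_def)
  qed
qed

lemma tensor_op_sum:
  assumes "\<And>I. I \<subseteq> {..<n} \<Longrightarrow> C (monomial I) = (\<Sum>k\<in>K. tsS (c k) (C' k (monomial I)))"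
  shows "tensor_op scale n A C T = (\<Sum>k\<in>K. ts (c k) (tensor_op scale n A (C' k) T))"
proof
  fix J
  have "tensor_op scale n A C T J = (\<Sum>I\<in>Pow {..<n}. \<Sum>k\<in>K. scale (c k * C' k (monomial I) J) (A (T I)))"
    unfolding tensor_op_def using assms
    by (intro sum.cong refl) (simp add: sum_fun_apply scale_sum_left)
  also have "\<dots> = (\<Sum>k\<in>K. \<Sum>I\<in>Pow {..<n}. scale (c k * C' k (monomial I) J) (A (T I)))"
    by (rule sum.swap)
  finally show "tensor_op scale n A C T J = (\<Sum>k\<in>K. ts (c k) (tensor_op scale n A (C' k) T)) J"
    by (simp add: sum_fun_apply tensor_op_def scale_sum_right)
qed

lemma tensor_op_cong:
  assumes "\<And>I. I \<subseteq> {..<n} \<Longrightarrow> C (monomial I) = C' (monomial I)"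
  shows "tensor_op scale n A C T = tensor_op scale n A C' T"
  unfolding tensor_op_def using assms by (intro ext sum.cong refl) simp

lemma tensor_op_add:
  "tensor_op scale n A (\<lambda>Y. C Y + C' Y) T = tensor_op scale n A C T + tensor_op scale n A C' T"
  by (auto simp: tensor_op_def fun_eq_iff scale_left_distrib sum.distrib)

lemma tensor_op_ts:
  "tensor_op scale n A (\<lambda>Y. tsS c (C Y)) T = ts c (tensor_op scale n A C T)"
  by (auto simp: tensor_op_def fun_eq_iff scale_sum_right)

lemma cre_tensor_space: "i < n \<Longrightarrow> T \<in> tensor_space n \<Longrightarrow> cre i T \<in> tensor_space n"
proof -
  assume i: "i < n" and T: "T \<in> tensor_space n"
  have "cre i T I = 0" if "\<not> I \<subseteq> {..<n}" for I
  proof -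
    have "\<not> I - {i} \<subseteq> {..<n}" using that i by auto
    then show ?thesis using T by (simp add: tensor_space_def creation_def)
  qed
  then show ?thesis by (simp add: tensor_space_def)
qed

lemma ann_tensor_space: "T \<in> tensor_space n \<Longrightarrow> ann i T \<in> tensor_space n"
proof -
  assume T: "T \<in> tensor_space n"
  have "ann i T I = 0" if "\<not> I \<subseteq> {..<n}" for I
  proof -
    have "\<not> insert i I \<subseteq> {..<n}" using that by blast
    then show ?thesis using T by (simp add: tensor_space_def annihilation_def)
  qed
  then show ?thesis by (simp add: tensor_space_def)
qed

lemma tensor_subspace: "tw.subspace (tensor_space n)"
  by (auto simp: tw.subspace_def tensor_space_def)

lemma comp_tensor_space: "A 0 = 0 \<Longrightarrow> T \<in> tensor_space n \<Longrightarrow> A \<circ> T \<in> tensor_space n"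
  by (simp add: tensor_space_def)

end

section \<open>Traces\<close>

text \<open>The trace can be computed in any finite family with linear coordinate functions, even a dependent one: when the basis
vectors and the family are expanded in terms of each other, both traces become the same double sum.\<close>

lemma trace_on_frame:
  fixes s :: "'k::field \<Rightarrow> 'x::ab_group_add \<Rightarrow> 'x"
  assumes s: "vector_space s" and W: "module.subspace s W" and I: "finite I"
    and x: "\<And>i. i \<in> I \<Longrightarrow> x i \<in> W"
    and f: "\<And>w. w \<in> W \<Longrightarrow> f w \<in> W"
      "\<And>w w'. w \<in> W \<Longrightarrow> w' \<in> W \<Longrightarrow> f (w + w') = f w + f w'"
      "\<And>c w. w \<in> W \<Longrightarrow> f (s c w) = s c (f w)"
    and p: "\<And>i w w'. i \<in> I \<Longrightarrow> w \<in> W \<Longrightarrow> w' \<in> W \<Longrightarrow> p i (w + w') = p i w + p i w'"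
      "\<And>i c w. i \<in> I \<Longrightarrow> w \<in> W \<Longrightarrow> p i (s c w) = c * p i w"
    and expand: "\<And>w. w \<in> W \<Longrightarrow> w = (\<Sum>i\<in>I. s (p i w) (x i))"
  shows "trace_on s W f = (\<Sum>i\<in>I. p i (f (x i)))"
proof -
  interpret vector_space s by (rule s)
  let ?P = "\<lambda>B. \<not> dependent B \<and> span B = W"
  have "\<exists>B. ?P B"
    using basis_exists[of W] W by (metis span_minimal subset_antisym)
  define B where "B = (SOME B. ?P B)"
  have B: "\<not> dependent B" "span B = W"
    using someI_ex[OF \<open>\<exists>B. ?P B\<close>] by (auto simp: B_def)
  have "W \<subseteq> span (x ` I)"
  proof
    fix w assume "w \<in> W"
    then have "w = (\<Sum>i\<in>I. s (p i w) (x i))" by (rule expand)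
    also have "\<dots> \<in> span (x ` I)" by (intro span_sum span_scale span_base) auto
    finally show "w \<in> span (x ` I)" .
  qed
  then have finB: "finite B"
    using independent_span_bound[of "x ` I" B] I B span_superset[of B] by auto
  have f_sum: "f (\<Sum>k\<in>K. s (c k) (y k)) = (\<Sum>k\<in>K. s (c k) (f (y k)))"
    if "finite K" "\<And>k. k \<in> K \<Longrightarrow> y k \<in> W" for K :: "'i set" and c y
    using that
  proof (induct K rule: finite_induct)
    case empty
    have "f (s 0 0) = s 0 (f 0)" by (rule f(3)) (rule subspace_0[OF W])
    then show ?case by simp
  next
    case (insert k K)
    then show ?case
      using f(2)[of "s (c k) (y k)" "\<Sum>k\<in>K. s (c k) (y k)"] subspace_scale[OF W]
      by (simp add: f(3) subspace_sum[OF W])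
  qed
  have p_sum: "p i (\<Sum>k\<in>K. s (c k) (y k)) = (\<Sum>k\<in>K. c k * p i (y k))"
    if "finite K" "\<And>k. k \<in> K \<Longrightarrow> y k \<in> W" "i \<in> I" for K :: "'x set" and c y i
    using that
  proof (induct K rule: finite_induct)
    case empty
    have "p i (s 0 0) = 0 * p i 0" using empty by (intro p(2)) (auto intro: subspace_0[OF W])
    then show ?case by simp
  next
    case (insert k K)
    then show ?case
      using p(1)[of i "s (c k) (y k)" "\<Sum>k\<in>K. s (c k) (y k)"] subspace_scale[OF W]
      by (simp add: p(2) subspace_sum[OF W])
  qed
  have B_W: "b \<in> W" if "b \<in> B" for b using B(2) span_base[OF that] by simp
  have fx: "f (x i) \<in> W" if "i \<in> I" for i using that by (intro f(1) x)
  have "trace_on s W f = (\<Sum>b\<in>B. representation B (f b) b)"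
    by (simp add: trace_on_def B_def Let_def)
  also have "\<dots> = (\<Sum>b\<in>B. \<Sum>i\<in>I. p i b * representation B (f (x i)) b)"
  proof (intro sum.cong refl)
    fix b assume b: "b \<in> B"
    have "f b = f (\<Sum>i\<in>I. s (p i b) (x i))" using expand[OF B_W[OF b]] by simp
    also have "\<dots> = (\<Sum>i\<in>I. s (p i b) (f (x i)))" by (rule f_sum[OF I x])
    finally have "f b = (\<Sum>i\<in>I. s (p i b) (f (x i)))" .
    moreover have "f (x i) \<in> span B" if "i \<in> I" for i using B(2) fx[OF that] by simp
    ultimately show "representation B (f b) b = (\<Sum>i\<in>I. p i b * representation B (f (x i)) b)"
      using B(1) by (simp add: representation_sum representation_scale span_scale)
  qed
  also have "\<dots> = (\<Sum>i\<in>I. \<Sum>b\<in>B. representation B (f (x i)) b * p i b)"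
    by (subst sum.swap) (simp add: mult.commute)
  also have "\<dots> = (\<Sum>i\<in>I. p i (f (x i)))"
  proof (intro sum.cong refl)
    fix i assume i: "i \<in> I"
    have "f (x i) = (\<Sum>b\<in>B. s (representation B (f (x i)) b) b)"
      using sum_representation_eq[OF B(1) _ finB subset_refl, of "f (x i)"] B(2) fx[OF i] by simp
    then have "p i (f (x i)) = p i (\<Sum>b\<in>B. s (representation B (f (x i)) b) b)" by simp
    also have "\<dots> = (\<Sum>b\<in>B. representation B (f (x i)) b * p i b)"
      by (rule p_sum[OF finB B_W i])
    finally show "(\<Sum>b\<in>B. representation B (f (x i)) b * p i b) = p i (f (x i))" by simp
  qed
  finally show ?thesis .
qed

section \<open>Exterior multiplication and the differentials\<close>

definition wedging ::
  "(complex \<Rightarrow> 'v::ab_group_add \<Rightarrow> 'v) \<Rightarrow> nat \<Rightarrow> (nat \<Rightarrow> complex) \<Rightarrow> (nat set \<Rightarrow> 'v) \<Rightarrow> nat set \<Rightarrow> 'v"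
  where "wedging s n \<phi> T = (\<Sum>i<n. tensor_scale s (\<phi> i) (creation s i T))"

context complex_space
begin

abbreviation crv where "crv \<equiv> wedging scale"

lemma crv_add: "crv n \<phi> (T + T') = crv n \<phi> T + crv n \<phi> T'"
  by (simp add: wedging_def cre_add tw.scale_right_distrib sum.distrib)

lemma crv_scale: "crv n \<phi> (ts c T) = ts c (crv n \<phi> T)"
  by (simp add: wedging_def cre_scale tw.scale_sum_right mult.commute)

lemma crv_zero [simp]: "crv n \<phi> 0 = 0"
  by (simp add: wedging_def)

lemma crv_minus: "crv n \<phi> (- T) = - crv n \<phi> T"
  by (simp add: wedging_def cre_minus sum_negf)

lemma crv_sum: "crv n \<phi> (\<Sum>k\<in>A. f k) = (\<Sum>k\<in>A. crv n \<phi> (f k))"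
  by (induct A rule: infinite_finite_induct)
    (simp_all only: sum.infinite sum.empty sum.insert crv_add crv_zero not_False_eq_True)

lemma cre_crv: "cre i (crv n \<phi> T) = - crv n \<phi> (cre i T)"
  by (simp add: wedging_def cre_sum cre_scale cre_cre[of i] sum_negf)

lemma crv_crv: "crv n \<phi> (crv n \<psi> T) = - crv n \<psi> (crv n \<phi> T)"
  by (subst (1 3) wedging_def) (simp add: cre_crv sum_negf crv_sum crv_scale)

lemma ctr_crv: "ctr n \<phi> (crv n \<psi> T) = ts (\<Sum>i<n. \<phi> i * \<psi> i) T - crv n \<psi> (ctr n \<phi> T)"
proof -
  have "ctr n \<phi> (crv n \<psi> T) = (\<Sum>j<n. ts (\<psi> j) (ctr n \<phi> (cre j T)))"
    by (simp add: wedging_def ctr_sum ctr_scale)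
  also have "\<dots> = (\<Sum>j<n. ts (\<phi> j * \<psi> j) T - ts (\<psi> j) (cre j (ctr n \<phi> T)))"
    by (intro sum.cong refl) (simp add: ctr_cre tw.scale_right_diff_distrib mult.commute)
  finally show ?thesis by (simp add: sum_subtractf wedging_def tw.scale_sum_left)
qed

lemma ann_crv: "i < n \<Longrightarrow> ann i (crv n \<psi> T) = ts (\<psi> i) T - crv n \<psi> (ann i T)"
proof -
  assume i: "i < n"
  have "ctr n (\<lambda>j. if j = i then 1 else 0) T' = ann i T'" for T'
    using i by (simp add: contraction_def if_distrib[of "\<lambda>c. ts c _"] cong: if_cong)
  then show ?thesis
    using ctr_crv[of n "\<lambda>j. if j = i then 1 else 0" \<psi> T] i
    by (simp add: if_distrib[of "\<lambda>c. c * _"] cong: if_cong)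
qed

lemma crv_empty [simp]: "crv n \<phi> T {} = 0"
  by (simp add: wedging_def sum_fun_apply)

lemma crv_tensor_space: "T \<in> tensor_space n \<Longrightarrow> crv n \<phi> T \<in> tensor_space n"
  unfolding wedging_def
  by (intro tw.subspace_sum[OF tensor_subspace] tw.subspace_scale[OF tensor_subspace] cre_tensor_space) auto

lemma ctr_tensor_space: "T \<in> tensor_space n \<Longrightarrow> ctr n \<phi> T \<in> tensor_space n"
  unfolding contraction_def
  by (intro tw.subspace_sum[OF tensor_subspace] tw.subspace_scale[OF tensor_subspace] ann_tensor_space) auto

lemma tensor_op_cre_ann_sum:
  assumes T: "T \<in> tensor_space n"
  shows "tensor_op scale n id (\<lambda>Y. \<Sum>i<n. \<Sum>j<n. tsS (b i j) (creS j (annS i Y))) T =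
    (\<Sum>i<n. \<Sum>j<n. ts (b i j) (cre j (ann i T)))"
proof -
  have "tensor_op scale n id (\<lambda>Y. \<Sum>i<n. \<Sum>j<n. tsS (b i j) (creS j (annS i Y))) T =
      (\<Sum>i<n. ts 1 (tensor_op scale n id (\<lambda>Y. \<Sum>j<n. tsS (b i j) (creS j (annS i Y))) T))"
    by (rule tensor_op_sum) simp
  also have "\<dots> = (\<Sum>i<n. \<Sum>j<n. ts (b i j) (tensor_op scale n id (\<lambda>Y. creS j (annS i Y)) T))"
    unfolding tw.scale_one by (intro sum.cong refl tensor_op_sum)
  also have "\<dots> = (\<Sum>i<n. \<Sum>j<n. ts (b i j) (cre j (ann i T)))"
    by (intro sum.cong refl) (simp add: tensor_op_cre_ann[OF T])
  finally show ?thesis .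
qed

end

context polarized_pair
begin

text \<open>\<open>Pp\<close> and \<open>Pm\<close> intersect in 0, so the component in \<open>Pp\<close> that the spin action selects is \<open>p\<close>.\<close>

lemma spin_gen_eq:
  assumes p: "p \<in> Pp" and m: "m \<in> Pm" and Y: "Y \<in> tensor_space n"
  shows "spin_gen s B Pp Pm u n (p + m) Y =
    wedging (*) n (\<lambda>j. B p (us j)) Y + ctrS n (\<lambda>i. 2 * B m (u i)) Y"
proof -
  have "(THE y. y \<in> Pp \<and> p + m - y \<in> Pm) = p"
  proof (rule the_equality)
    fix y assume y: "y \<in> Pp \<and> p + m - y \<in> Pm"
    have "p - y \<in> Pp" using y p g.subspace_diff[OF Pp] by blast
    moreover have "p + m - y - m \<in> Pm" using y m g.subspace_diff[OF Pm] by blast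
    then have "p - y \<in> Pm" by (simp add: algebra_simps)
    ultimately show "y = p" using disjoint_pm by fastforce
  qed (use p m in simp)
  moreover have "wedge s u n p Y = wedging (*) n (\<lambda>j. B p (us j)) Y"
    unfolding wedge_eq[OF Y] wedging_def using coord_eq[OF p] by (intro sum.cong refl) simp
  ultimately show ?thesis
    by (simp add: spin_gen_def contract_eq[OF Y])
qed

lemma spin_gen_u:
  assumes "i < n" "Y \<in> tensor_space n"
  shows "spin_gen s B Pp Pm u n (u i) Y = creS i Y"
proof -
  have "wedging (*) n (\<lambda>j. B (u i) (us j)) Y = (\<Sum>j<n. if j = i then creS j Y else 0)"
    unfolding wedging_def using dual assms(1) by (intro sum.cong refl) auto
  then show ?thesis
    using spin_gen_eq[OF u_mem[OF assms(1)] g.subspace_0[OF Pm] assms(2)] assms(1)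
    by (simp add: contraction_def)
qed

lemma spin_gen_us:
  assumes "i < n" "Y \<in> tensor_space n"
  shows "spin_gen s B Pp Pm u n (us i) Y = tsS 2 (annS i Y)"
proof -
  have "ctrS n (\<lambda>j. 2 * B (us i) (u j)) Y = (\<Sum>j<n. if j = i then tsS 2 (annS j Y) else 0)"
    unfolding contraction_def using dual assms(1) by (intro sum.cong refl) (auto simp: B_sym[of "us i"])
  then show ?thesis
    using spin_gen_eq[OF g.subspace_0[OF Pp] us[OF assms(1)] assms(2)] assms(1)
    by (simp add: wedging_def)
qed

lemma wedge_zero: "wedge s u n 0 Y = 0"
proof -
  have "coord s u n 0 j = 0" if "j < n" for j
    using coord_eq[OF g.subspace_0[OF Pp] that] by simp
  then show ?thesis by (auto simp: wedge_def fun_eq_iff intro!: sum.neutral)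
qed

lemma ext_derivation_ad:
  assumes X: "X \<in> kk" and I: "I \<subseteq> {..<n}"
  shows "ext_derivation s u n (br X) (monomial I) =
    (\<Sum>i<n. \<Sum>j<n. tsS (B (br X (u i)) (us j)) (creS j (annS i (monomial I))))"
  unfolding ext_derivation_monomial[OF I]
  by (intro sum.cong refl) (simp add: coord_eq k_p[OF X u_mem])

text \<open>Invariance of \<open>B\<close> makes the action on \<open>Pm\<close> the negative transpose of the action on \<open>Pp\<close>.\<close>

lemma half_trace:
  assumes X: "X \<in> kk"
  shows "half_trace_ad s br Pm X = - (\<Sum>i<n. B (br X (u i)) (us i)) / 2"
proof -
  have "trace_on s Pm (br X) = (\<Sum>i<n. B (u i) (br X (us i)))"
    by (rule trace_on_frame[OF g.vector_space_axioms Pm])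
      (auto simp: us k_m[OF X] g.bracket_add_right g.bracket_scale_right B_add_right B_scale_right
        expand_m[symmetric])
  then show ?thesis by (simp add: half_trace_ad_def B_skew sum_negf)
qed

end

context polarized_module
begin

lemma dirac_d_eq:
  assumes T: "T \<in> tensor_space n"
  shows "dirac_d s B Pp Pm u us n sV \<pi> T = dd T"
proof -
  have "tensor_op sV n (\<pi> (us i)) (spin_gen s B Pp Pm u n (u i)) T = cre i (\<pi> (us i) \<circ> T)"
    if "i < n" for i
  proof -
    have "tensor_op sV n (\<pi> (us i)) (spin_gen s B Pp Pm u n (u i)) T = tensor_op sV n (\<pi> (us i)) (creS i) T"
      by (rule tensor_op_cong) (simp add: spin_gen_u[OF that monomial_tensor_space])
    then show ?thesis by (simp add: tensor_op_cre[OF T])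
  qed
  then show ?thesis by (simp add: dirac_d_def dd_def)
qed

definition dl where "dl T = (\<Sum>i<n. ts 2 (ann i (\<pi> (u i) \<circ> T)))"

lemma dirac_delta_eq:
  assumes T: "T \<in> tensor_space n"
  shows "dirac_delta s B Pp Pm u us n sV \<pi> T = dl T"
proof -
  have "tensor_op sV n (\<pi> (u i)) (spin_gen s B Pp Pm u n (us i)) T = ts 2 (ann i (\<pi> (u i) \<circ> T))"
    if "i < n" for i
  proof -
    have "tensor_op sV n (\<pi> (u i)) (spin_gen s B Pp Pm u n (us i)) T =
        tensor_op sV n (\<pi> (u i)) (\<lambda>Y. tsS 2 (annS i Y)) T"
      by (rule tensor_op_cong) (simp add: spin_gen_us[OF that monomial_tensor_space])
    then show ?thesis by (simp add: tensor_op_ts tensor_op_ann[OF T])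
  qed
  then show ?thesis by (simp add: dirac_delta_def dl_def)
qed

text \<open>Only the terms of the boundary operator in which the module is acted on survive, because \<open>\<pp>\<^sup>+\<close> is abelian. The factor
reflects the 2 in the action of \<open>\<pp>\<^sup>-\<close> on spinors.\<close>

lemma chain_diff_eq:
  assumes T: "T \<in> tensor_space n"
  shows "chain_diff s br sV \<pi> u n T = ts (- 1 / 2) (dl T)"
proof
  fix J
  have br: "(\<Sum>j\<in>I. \<Sum>i\<in>{i\<in>I. i < j}.
      sV (move_sign i I * move_sign j I * wedge s u n (br (u i) (u j)) (monomial (I - {i, j})) J) (T I)) = 0"
    if "I \<in> Pow {..<n}" for I
  proof (intro sum.neutral ballI)
    fix j i assume "j \<in> I" "i \<in> {i \<in> I. i < j}"
    then have "br (u i) (u j) = 0" using that by (intro ab_p u_mem) auto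
    then show "sV (move_sign i I * move_sign j I * wedge s u n (br (u i) (u j)) (monomial (I - {i, j})) J) (T I) = 0"
      by (simp add: wedge_zero)
  qed
  have "chain_diff s br sV \<pi> u n T J =
      (\<Sum>I\<in>Pow {..<n}. \<Sum>i\<in>I. sV (- move_sign i I * monomial (I - {i}) J) (\<pi> (u i) (T I)))"
    unfolding chain_diff_def using br by (intro sum.cong refl) simp
  also have "\<dots> = (\<Sum>I\<in>Pow {..<n}. \<Sum>i<n. if i \<in> I then
      sV (- move_sign i I * monomial (I - {i}) J) (\<pi> (u i) (T I)) else 0)"
    by (intro sum.cong refl sum.mono_neutral_cong_left) auto
  also have "\<dots> = (\<Sum>i<n. \<Sum>I\<in>Pow {..<n}. if i \<in> I then
      sV (- move_sign i I * monomial (I - {i}) J) (\<pi> (u i) (T I)) else 0)"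
    by (rule sum.swap)
  also have "\<dots> = (\<Sum>i<n. - ann i (\<pi> (u i) \<circ> T) J)"
  proof (intro sum.cong refl)
    fix i assume "i \<in> {..<n}"
    have "(\<Sum>I\<in>Pow {..<n}. if i \<in> I then
        sV (- move_sign i I * monomial (I - {i}) J) (\<pi> (u i) (T I)) else 0) =
        (\<Sum>I\<in>Pow {..<n}. if I = insert i J then - ann i (\<pi> (u i) \<circ> T) J else 0)"
      by (intro sum.cong refl) (auto simp: monomial_def annihilation_def)
    also have "\<dots> = - ann i (\<pi> (u i) \<circ> T) J"
      using T by (auto simp: annihilation_def tensor_space_def sum.delta)
    finally show "(\<Sum>I\<in>Pow {..<n}. if i \<in> I then
        sV (- move_sign i I * monomial (I - {i}) J) (\<pi> (u i) (T I)) else 0) = - ann i (\<pi> (u i) \<circ> T) J" .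
  qed
  finally show "chain_diff s br sV \<pi> u n T J = ts (- 1 / 2) (dl T) J"
    by (simp add: dl_def sum_fun_apply scale_sum_right sum_negf)
qed

lemma chain_act_eq:
  assumes X: "X \<in> kk" and T: "T \<in> tensor_space n"
  shows "chain_act s br sV \<pi> u n X T = (\<pi> X \<circ> T) + ad_op X T"
proof -
  have "tensor_op sV n id (ext_derivation s u n (br X)) T = tensor_op sV n id
      (\<lambda>Y. \<Sum>i<n. \<Sum>j<n. tsS (B (br X (u i)) (us j)) (creS j (annS i Y))) T"
    by (rule tensor_op_cong) (rule ext_derivation_ad[OF X])
  then show ?thesis
    by (simp add: chain_act_def tensor_op_id[OF T] tensor_op_cre_ann_sum[OF T] ad_op_def)
qed

abbreviation wedge_op where "wedge_op p \<equiv> crv n (\<lambda>j. B p (us j))"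

lemma ad_op_wedge_ann: "ad_op X T = (\<Sum>i<n. wedge_op (br X (u i)) (ann i T))"
  by (simp add: ad_op_def wedging_def)

lemma wedge_op_sum: "wedge_op (\<Sum>i\<in>A. s (c i) (x i)) T = (\<Sum>i\<in>A. ts (c i) (wedge_op (x i) T))"
proof -
  have "wedge_op (\<Sum>i\<in>A. s (c i) (x i)) T = (\<Sum>j<n. \<Sum>i\<in>A. ts (c i * B (x i) (us j)) (cre j T))"
    by (simp add: wedging_def B_sum_left B_scale_left tw.scale_sum_left)
  also have "\<dots> = (\<Sum>i\<in>A. \<Sum>j<n. ts (c i * B (x i) (us j)) (cre j T))" by (rule sum.swap)
  finally show ?thesis by (simp add: wedging_def tw.scale_sum_right)
qed

text \<open>The adjoint action is a derivation of the exterior algebra.\<close>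

lemma ad_op_wedge_op:
  assumes "p \<in> Pp"
  shows "ad_op X (wedge_op p T) = wedge_op p (ad_op X T) + wedge_op (br X p) T"
proof -
  have "br X p = (\<Sum>i<n. s (B p (us i)) (br X (u i)))"
    using arg_cong[OF expand_p[OF assms], of "br X"] by (simp add: br_sum_right g.bracket_scale_right)
  then have *: "(\<Sum>i<n. ts (B p (us i)) (wedge_op (br X (u i)) T)) = wedge_op (br X p) T"
    by (simp add: wedge_op_sum)
  have "ad_op X (wedge_op p T) =
      (\<Sum>i<n. ts (B p (us i)) (wedge_op (br X (u i)) T) - wedge_op (br X (u i)) (wedge_op p (ann i T)))"
    unfolding ad_op_wedge_ann
    by (intro sum.cong refl) (simp add: ann_crv crv_add crv_scale crv_minus flip: add_uminus_conv_diff)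
  also have "\<dots> = wedge_op (br X p) T - (\<Sum>i<n. wedge_op (br X (u i)) (wedge_op p (ann i T)))"
    by (simp add: sum_subtractf *)
  also have "(\<Sum>i<n. wedge_op (br X (u i)) (wedge_op p (ann i T))) = - wedge_op p (ad_op X T)"
    unfolding ad_op_wedge_ann crv_sum
    by (subst crv_crv) (simp add: sum_negf)
  finally show ?thesis by (simp only: diff_minus_eq_add add.commute)
qed

lemma ad_op_add: "ad_op X (T + T') = ad_op X T + ad_op X T'"
  and ad_op_scale: "ad_op X (ts c T) = ts c (ad_op X T)"
  by (simp_all add: ad_op_wedge_ann ann_add crv_add sum.distrib ann_scale crv_scale tw.scale_sum_right)

lemma ad_op_tensor_space: "T \<in> tensor_space n \<Longrightarrow> ad_op X T \<in> tensor_space n"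
  unfolding ad_op_wedge_ann
  by (intro tw.subspace_sum[OF tensor_subspace] crv_tensor_space ann_tensor_space)

lemma dd_tensor_space: "T \<in> tensor_space n \<Longrightarrow> dd T \<in> tensor_space n"
  unfolding dd_def
  by (intro tw.subspace_sum[OF tensor_subspace] cre_tensor_space comp_tensor_space) auto

lemma dl_tensor_space: "T \<in> tensor_space n \<Longrightarrow> dl T \<in> tensor_space n"
  unfolding dl_def
  by (intro tw.subspace_sum[OF tensor_subspace] tw.subspace_scale[OF tensor_subspace]
      ann_tensor_space comp_tensor_space) auto

end

section \<open>The Clifford algebra acting on spinors\<close>

lemma monomial_self [simp]: "monomial I I = 1"
  by (simp add: monomial_def)

lemma free_algebra_induct [case_names zero single add]:
  fixes a :: "'x list \<Rightarrow>\<^sub>0 complex"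
  assumes "P 0" "\<And>w c. P (Poly_Mapping.single w c)" "\<And>a b. P a \<Longrightarrow> P b \<Longrightarrow> P (a + b)"
  shows "P a"
proof (induct a rule: Poly_Mapping.update_induct)
  case (update f a b)
  have "Poly_Mapping.update a b f = f + Poly_Mapping.single a b"
    by (rule poly_mapping_eqI)
      (use update(1) in \<open>auto simp: lookup_update lookup_add lookup_single when_def in_keys_iff\<close>)
  then show ?case using assms update by simp
qed (rule assms(1))

lemma const_mult_commute: "const c * a = a * const c"
  by (induct a rule: free_algebra_induct)
    (auto simp: const_def mult_single plus_list_def distrib_left distrib_right mult.commute)

lemma const_add: "const (c + d) = const c + const d"
  and const_mult: "const (c * d) = const c * const d"
  and const_zero: "const 0 = 0"
  and const_minus: "const (- c) = - const c"
  by (simp_all add: const_def single_add mult_single plus_list_def single_uminus)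

lemma const_one: "const 1 = 1"
  by (simp add: const_def flip: zero_list_def)

lemma const_vector_space: "vector_space (\<lambda>c r. const c * r :: 'x list \<Rightarrow>\<^sub>0 complex)"
  by standard (simp_all add: const_add const_mult const_one distrib_left distrib_right mult.assoc)

lemma free_algebra_mult: "a \<in> free_algebra P \<Longrightarrow> b \<in> free_algebra P \<Longrightarrow> a * b \<in> free_algebra P"
  using keys_mult[of a b] by (force simp: free_algebra_def plus_list_def)

lemma free_algebra_const: "const c \<in> free_algebra P"
  by (simp add: const_def free_algebra_def)

lemma free_algebra_one: "1 \<in> free_algebra P"
  using free_algebra_const[of 1] by (simp add: const_one)

lemma free_algebra_gen: "x \<in> P \<Longrightarrow> gen x \<in> free_algebra P"
  by (simp add: gen_def free_algebra_def)

lemma relator_in_ideal: "r \<in> clifford_relators s B P \<Longrightarrow> r \<in> clifford_ideal s B P"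
  using clifford_ideal.sandwich[OF _ free_algebra_one free_algebra_one, of r s B P] by simp

lemma additive_relator:
  "x \<in> P \<Longrightarrow> y \<in> P \<Longrightarrow> gen (x + y) - gen x - gen y \<in> clifford_ideal s B P"
  by (rule relator_in_ideal) (unfold clifford_relators_def, blast)

lemma scaling_relator: "x \<in> P \<Longrightarrow> gen (s c x) - const c * gen x \<in> clifford_ideal s B P"
  by (rule relator_in_ideal) (unfold clifford_relators_def, blast)

lemma product_relator:
  "x \<in> P \<Longrightarrow> y \<in> P \<Longrightarrow> gen x * gen y + gen y * gen x - const (2 * B x y) \<in> clifford_ideal s B P"
  by (rule relator_in_ideal) (unfold clifford_relators_def, blast)

text \<open>The ideal is generated by products with a relator in the middle; that it absorbs further factors follows by induction on
its construction.\<close>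

lemma clifford_ideal_left:
  assumes "r \<in> clifford_ideal s B P" "a \<in> free_algebra P"
  shows "a * r \<in> clifford_ideal s B P"
  using assms
proof (induct rule: clifford_ideal.induct)
  case (sandwich r c b)
  have "(a * c) * r * b \<in> clifford_ideal s B P"
    by (intro clifford_ideal.sandwich free_algebra_mult sandwich)
  then show ?case by (simp only: mult.assoc)
qed (simp_all add: distrib_left clifford_ideal.zero clifford_ideal.add)

lemma clifford_ideal_right:
  assumes "r \<in> clifford_ideal s B P" "a \<in> free_algebra P"
  shows "r * a \<in> clifford_ideal s B P"
  using assms
proof (induct rule: clifford_ideal.induct)
  case (sandwich r c b)
  have "c * r * (b * a) \<in> clifford_ideal s B P"
    by (intro clifford_ideal.sandwich free_algebra_mult sandwich)
  then show ?case by (simp only: mult.assoc)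
qed (simp_all add: distrib_right clifford_ideal.zero clifford_ideal.add)

lemma clifford_ideal_minus: "r \<in> clifford_ideal s B P \<Longrightarrow> - r \<in> clifford_ideal s B P"
  using clifford_ideal_left[OF _ free_algebra_const[of "-1"]] by (fastforce simp: const_minus const_one)

lemma clifford_ideal_diff:
  "a \<in> clifford_ideal s B P \<Longrightarrow> b \<in> clifford_ideal s B P \<Longrightarrow> a - b \<in> clifford_ideal s B P"
  using clifford_ideal.add[OF _ clifford_ideal_minus] by fastforce

lemma clifford_ideal_sum:
  "(\<And>i. i \<in> A \<Longrightarrow> f i \<in> clifford_ideal s B P) \<Longrightarrow> (\<Sum>i\<in>A. f i) \<in> clifford_ideal s B P"
  by (induct A rule: infinite_finite_induct) (auto intro: clifford_ideal.zero clifford_ideal.add)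

lemma wedge_add: "wedge s u n x (Y + Y') = wedge s u n x Y + wedge s u n x Y'"
  and wedge_scale: "wedge s u n x (tsS c Y) = tsS c (wedge s u n x Y)"
  by (auto simp: fun_eq_iff wedge_def distrib_right sum.distrib sum_distrib_left mult.assoc)

lemma contract_add: "contract u n \<phi> (Y + Y') = contract u n \<phi> Y + contract u n \<phi> Y'"
  and contract_scale: "contract u n \<phi> (tsS c Y) = tsS c (contract u n \<phi> Y)"
  by (auto simp: fun_eq_iff contract_def distrib_right sum.distrib sum_distrib_left mult.assoc)

lemma wedge_tensor_space: "wedge s u n x Y \<in> tensor_space n"
proof -
  have "monomial (insert j I) J = 0" if "\<not> J \<subseteq> {..<n}" "I \<in> Pow {..<n}" "j \<in> {..<n} - I" for I j J
    using that by (auto simp: monomial_def)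
  then show ?thesis by (simp add: tensor_space_def wedge_def)
qed

lemma contract_tensor_space: "contract u n \<phi> Y \<in> tensor_space n"
proof -
  have "monomial (I - {i}) J = 0" if "\<not> J \<subseteq> {..<n}" "I \<in> Pow {..<n}" for I i J
    using that by (auto simp: monomial_def)
  then show ?thesis by (simp add: tensor_space_def contract_def)
qed

lemma spin_gen_add:
  "spin_gen s B Pp Pm u n x (Y + Y') = spin_gen s B Pp Pm u n x Y + spin_gen s B Pp Pm u n x Y'"
  by (simp add: spin_gen_def wedge_add contract_add Let_def)

lemma spin_gen_scale: "spin_gen s B Pp Pm u n x (tsS c Y) = tsS c (spin_gen s B Pp Pm u n x Y)"
  by (simp add: spin_gen_def wedge_scale contract_scale Let_def S.tw.scale_right_distrib)

lemma spin_gen_tensor_space: "spin_gen s B Pp Pm u n x Y \<in> tensor_space n"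
  unfolding spin_gen_def Let_def
  by (intro S.tw.subspace_add[OF S.tensor_subspace] wedge_tensor_space contract_tensor_space)

locale spin_module =
  fixes s :: "complex \<Rightarrow> 'x::ab_group_add \<Rightarrow> 'x" and B :: "'x \<Rightarrow> 'x \<Rightarrow> complex"
    and Pp Pm :: "'x set" and u :: "nat \<Rightarrow> 'x" and n :: nat
begin

abbreviation "\<gamma> \<equiv> spin_gen s B Pp Pm u n"
abbreviation "sp \<equiv> spin_action s B Pp Pm u n"

lemma foldr_add: "foldr \<gamma> w (Y + Y') = foldr \<gamma> w Y + foldr \<gamma> w Y'"
  by (induct w) (simp_all only: foldr.simps id_apply o_apply spin_gen_add)

lemma foldr_scale: "foldr \<gamma> w (tsS c Y) = tsS c (foldr \<gamma> w Y)"
  by (induct w) (simp_all only: foldr.simps id_apply o_apply spin_gen_scale)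

lemma foldr_tensor_space: "Y \<in> tensor_space n \<Longrightarrow> foldr \<gamma> w Y \<in> tensor_space n"
  by (induct w) (auto simp: spin_gen_tensor_space)

lemma sp_superset:
  assumes "finite K" "Poly_Mapping.keys a \<subseteq> K"
  shows "sp a Y = (\<Sum>w\<in>K. tsS (Poly_Mapping.lookup a w) (foldr \<gamma> w Y))"
proof
  fix J
  show "sp a Y J = (\<Sum>w\<in>K. tsS (Poly_Mapping.lookup a w) (foldr \<gamma> w Y)) J"
    unfolding spin_action_def sum_fun_apply
    by (rule sum.mono_neutral_cong_left) (use assms in \<open>auto simp: in_keys_iff\<close>)
qed

lemma sp_add: "sp (a + b) Y = sp a Y + sp b Y"
proof -
  let ?K = "Poly_Mapping.keys a \<union> Poly_Mapping.keys b"
  have "Poly_Mapping.keys (a + b) \<subseteq> ?K" by (rule Poly_Mapping.keys_add)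
  then show ?thesis
    by (simp add: sp_superset[of ?K] lookup_add S.tw.scale_left_distrib sum.distrib)
qed

lemma sp_single: "sp (Poly_Mapping.single w c) Y = tsS c (foldr \<gamma> w Y)"
  using sp_superset[of "{w}" "Poly_Mapping.single w c" Y] by simp

lemma sp_zero [simp]: "sp 0 Y = 0"
  by (auto simp: fun_eq_iff spin_action_def)

lemma sp_arg_add: "sp a (Y + Y') = sp a Y + sp a Y'"
  by (induct a rule: free_algebra_induct) (simp_all only: sp_add sp_single foldr_add S.tw.scale_right_distrib sp_zero add_0 ac_simps)

lemma sp_arg_scale: "sp a (tsS c Y) = tsS c (sp a Y)"
  by (induct a rule: free_algebra_induct)
    (simp_all only: sp_add sp_single foldr_scale S.tw.scale_right_distrib sp_zero S.tw.scale_scale mult.commute S.tw.scale_zero_right)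

lemma sp_arg_zero [simp]: "sp a 0 = 0"
  using sp_arg_scale[of a 0 0] by simp

text \<open>Concatenation of words is composition of the operators, so spinors are a module over the free algebra.\<close>

lemma sp_mult: "sp (a * b) Y = sp a (sp b Y)"
proof (induct a rule: free_algebra_induct)
  case (single w c)
  show ?case
    by (induct b rule: free_algebra_induct)
      (simp_all only: mult_zero_right sp_zero sp_arg_zero mult_single sp_single plus_list_def foldr_append o_apply
        foldr_scale S.tw.scale_scale distrib_left sp_add sp_arg_add foldr_add S.tw.scale_right_distrib)
next
  case (add a b)
  then show ?case by (simp only: distrib_right sp_add)
qed simp

lemma sp_gen: "sp (gen x) Y = \<gamma> x Y"
  by (simp add: gen_def sp_single)

lemma sp_const: "sp (const c) Y = tsS c Y"
  by (simp add: const_def sp_single)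

lemma sp_minus: "sp (- a) Y = - sp a Y"
proof -
  have "- a = const (- 1) * a" by (simp add: const_minus const_one)
  then show ?thesis by (simp add: sp_mult sp_const)
qed

lemma sp_diff: "sp (a - b) Y = sp a Y - sp b Y"
  using sp_add[of a "- b" Y] by (simp add: sp_minus)

lemma sp_tensor_space: "Y \<in> tensor_space n \<Longrightarrow> sp a Y \<in> tensor_space n"
  by (subst sp_superset[OF finite_keys subset_refl])
    (intro S.tw.subspace_sum[OF S.tensor_subspace] S.tw.subspace_scale[OF S.tensor_subspace] foldr_tensor_space)

end

section \<open>The spin action of \<open>\<kk>\<close>\<close>

context polarized_pair
begin

interpretation SP: spin_module s B Pp Pm u n .

text \<open>The module \<open>\<complex>\<close> with zero action, for which \<open>ad_op\<close> is the adjoint action on spinors.\<close>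

interpretation SS: polarized_module s br B kk Pp Pm u us n "(*)" "\<lambda>X v. 0"
  by unfold_locales (simp_all add: S.op_linear_def)

declare SS.pi_zero [simp del]

definition PP where "PP = {p + m |p m. p \<in> Pp \<and> m \<in> Pm}"

lemma PP_p: "p \<in> Pp \<Longrightarrow> p \<in> PP" and PP_m: "m \<in> Pm \<Longrightarrow> m \<in> PP"
  using g.subspace_0[OF Pp] g.subspace_0[OF Pm] by (force simp: PP_def)+

lemma PP_subspace: "g.subspace PP"
  unfolding PP_def by (rule g.subspace_sums[OF Pp Pm])

abbreviation (input) "wS p \<equiv> wedging ((*) :: complex \<Rightarrow> complex \<Rightarrow> complex) n (\<lambda>j. B p (us j))"
abbreviation (input) "iS m \<equiv> ctrS n (\<lambda>i. 2 * B m (u i))"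

lemma spin_gen_linear:
  assumes "x \<in> PP" "y \<in> PP" "Y \<in> tensor_space n"
  shows "SP.\<gamma> (x + y) Y = SP.\<gamma> x Y + SP.\<gamma> y Y" "SP.\<gamma> (s c x) Y = tsS c (SP.\<gamma> x Y)"
proof -
  obtain p m p' m' where xy: "x = p + m" "y = p' + m'" and m: "p \<in> Pp" "m \<in> Pm" "p' \<in> Pp" "m' \<in> Pm"
    using assms(1,2) by (auto simp: PP_def)
  have w: "wS (p + p') Y = wS p Y + wS p' Y"
    by (simp add: wedging_def B_add_left S.tw.scale_left_distrib sum.distrib)
  have i: "iS (m + m') Y = iS m Y + iS m' Y"
    by (simp add: contraction_def B_add_left S.tw.scale_left_distrib sum.distrib distrib_left)
  have "SP.\<gamma> ((p + p') + (m + m')) Y = wS (p + p') Y + iS (m + m') Y"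
    by (intro spin_gen_eq g.subspace_add[OF Pp] g.subspace_add[OF Pm] m assms(3))
  moreover have "SP.\<gamma> x Y = wS p Y + iS m Y" "SP.\<gamma> y Y = wS p' Y + iS m' Y"
    unfolding xy using m assms(3) by (simp_all only: spin_gen_eq)
  moreover have "SP.\<gamma> (x + y) Y = SP.\<gamma> ((p + p') + (m + m')) Y" unfolding xy by (simp only: ac_simps)
  ultimately show "SP.\<gamma> (x + y) Y = SP.\<gamma> x Y + SP.\<gamma> y Y"
    by (simp only: w i) (simp only: ac_simps)
  have w: "wS (s c p) Y = tsS c (wS p Y)"
    by (simp add: wedging_def B_scale_left S.tw.scale_sum_right)
  have i: "iS (s c m) Y = tsS c (iS m Y)"
    by (simp add: contraction_def B_scale_left S.tw.scale_sum_right mult_ac)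
  have "SP.\<gamma> (s c p + s c m) Y = wS (s c p) Y + iS (s c m) Y"
    by (intro spin_gen_eq g.subspace_scale[OF Pp] g.subspace_scale[OF Pm] m assms(3))
  then show "SP.\<gamma> (s c x) Y = tsS c (SP.\<gamma> x Y)"
    unfolding xy g.scale_right_distrib w i using m assms(3)
    by (simp add: spin_gen_eq S.tw.scale_right_distrib)
qed

lemma pairing_expand:
  assumes "p \<in> Pp"
  shows "(\<Sum>i<n. B m (u i) * B p (us i)) = B m p"
  using arg_cong[OF expand_p[OF assms], of "B m"] by (simp add: B_sum_right B_scale_right mult.commute)

text \<open>The wedge parts anticommute, so do the contraction parts, and the mixed terms give the two pairings of \<open>Pp\<close> with \<open>Pm\<close>, whose
sum is \<open>B\<close> since both subspaces are isotropic.\<close>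

lemma spin_gen_clifford:
  assumes "x \<in> PP" "y \<in> PP" "Y \<in> tensor_space n"
  shows "SP.\<gamma> x (SP.\<gamma> y Y) + SP.\<gamma> y (SP.\<gamma> x Y) = tsS (2 * B x y) Y"
proof -
  obtain p m p' m' where xy: "x = p + m" "y = p' + m'" and m: "p \<in> Pp" "m \<in> Pm" "p' \<in> Pp" "m' \<in> Pm"
    using assms(1,2) by (auto simp: PP_def)
  have g: "SP.\<gamma> x Z = wS p Z + iS m Z" "SP.\<gamma> y Z = wS p' Z + iS m' Z" if "Z \<in> tensor_space n" for Z
    unfolding xy using that m by (simp_all add: spin_gen_eq)
  have iw: "iS a (wS b Z) = tsS (2 * B a b) Z - wS b (iS a Z)" if "b \<in> Pp" for a b Z
    unfolding S.ctr_crv using pairing_expand[OF that, of a]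
    by (simp add: mult.assoc flip: sum_distrib_left)
  have in_S: "wS a Y + iS b Y \<in> tensor_space n" for a b
    using assms(3) by (intro S.tw.subspace_add[OF S.tensor_subspace] S.crv_tensor_space S.ctr_tensor_space)
  have B: "B x y = B m p' + B m' p"
  proof -
    have "B x y = (B p p' + B m p') + (B p m' + B m m')" by (simp only: xy B_add_left B_add_right)
    also have "B p p' = 0" by (rule iso_p[OF m(1,3)])
    also have "B m m' = 0" by (rule iso_m[OF m(2,4)])
    also have "B p m' = B m' p" by (rule B_sym)
    finally show ?thesis by (simp only: add_0 add_0_right)
  qed
  have e1: "wS p (wS p' Y) + wS p' (wS p Y) = 0" by (subst S.crv_crv) simp
  have e2: "iS m (iS m' Y) + iS m' (iS m Y) = 0" by (subst S.ctr_ctr) simp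
  have e3: "wS p (iS m' Y) + iS m' (wS p Y) = tsS (2 * B m' p) Y" unfolding iw[OF m(1)] by simp
  have e4: "wS p' (iS m Y) + iS m (wS p' Y) = tsS (2 * B m p') Y" unfolding iw[OF m(3)] by simp
  have rearrange: "(a + b) + (c + d) + ((e + f) + (g + h)) = (a + e) + (d + h) + (b + g) + (f + c)"
    for a b c d e f g h :: "nat set \<Rightarrow> complex"
    by (simp add: algebra_simps)
  have "SP.\<gamma> x (SP.\<gamma> y Y) + SP.\<gamma> y (SP.\<gamma> x Y) =
      (wS p (wS p' Y + iS m' Y) + iS m (wS p' Y + iS m' Y)) +
      (wS p' (wS p Y + iS m Y) + iS m' (wS p Y + iS m Y))"
    by (simp only: g[OF assms(3)] g[OF in_S])
  also have "\<dots> = (wS p (wS p' Y) + wS p' (wS p Y)) + (iS m (iS m' Y) + iS m' (iS m Y))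
      + (wS p (iS m' Y) + iS m' (wS p Y)) + (wS p' (iS m Y) + iS m (wS p' Y))"
    unfolding S.crv_add S.ctr_add by (rule rearrange)
  also have "\<dots> = tsS (2 * B x y) Y"
    unfolding e1 e2 e3 e4 B distrib_left S.tw.scale_left_distrib add_0 by (rule add.commute)
  finally show ?thesis .
qed

text \<open>The action of the free algebra descends to the Clifford algebra.\<close>

lemma spin_ideal:
  assumes "r \<in> clifford_ideal s B PP" "Y \<in> tensor_space n"
  shows "SP.sp r Y = 0"
  using assms
proof (induct arbitrary: Y rule: clifford_ideal.induct)
  case (sandwich r a b)
  have "SP.sp r Z = 0" if Z: "Z \<in> tensor_space n" for Z
  proof -
    consider (add) x y where "x \<in> PP" "y \<in> PP" "r = gen (x + y) - gen x - gen y"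
      | (scale) c x where "x \<in> PP" "r = gen (s c x) - const c * gen x"
      | (clifford) x y where "x \<in> PP" "y \<in> PP" "r = gen x * gen y + gen y * gen x - const (2 * B x y)"
      using sandwich(1) unfolding clifford_relators_def by blast
    then show ?thesis
    proof cases
      case add
      then show ?thesis
        using spin_gen_linear(1)[OF add(1,2) Z] by (simp only: SP.sp_diff SP.sp_gen) simp
    next
      case scale
      then show ?thesis
        using spin_gen_linear(2)[OF scale(1) scale(1) Z]
        by (simp only: SP.sp_diff SP.sp_mult SP.sp_gen SP.sp_const) simp
    next
      case clifford
      then show ?thesis
        using spin_gen_clifford[OF clifford(1,2) Z]
        by (simp only: SP.sp_diff SP.sp_add SP.sp_mult SP.sp_gen SP.sp_const) simp
    qed
  qed
  then show ?case using SP.sp_tensor_space[OF sandwich(4)] by (simp add: SP.sp_mult)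
qed (simp_all add: SP.sp_add)

lemma gen_sum_ideal:
  assumes "finite A" "\<And>i. i \<in> A \<Longrightarrow> x i \<in> PP"
  shows "gen (\<Sum>i\<in>A. s (c i) (x i)) - (\<Sum>i\<in>A. const (c i) * gen (x i)) \<in> clifford_ideal s B PP"
  using assms
proof (induct A rule: finite_induct)
  case empty
  have "gen (s 0 0) - const 0 * gen 0 \<in> clifford_ideal s B PP"
    by (rule scaling_relator[OF g.subspace_0[OF PP_subspace]])
  then show ?case by (simp add: const_zero)
next
  case (insert j A)
  let ?S = "\<Sum>i\<in>A. s (c i) (x i)"
  have S: "?S \<in> PP" "s (c j) (x j) \<in> PP"
    using insert by (auto intro: g.subspace_sum[OF PP_subspace] g.subspace_scale[OF PP_subspace])
  have "gen (s (c j) (x j) + ?S) - gen (s (c j) (x j)) - gen ?S \<in> clifford_ideal s B PP"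
    by (rule additive_relator[OF S(2,1)])
  moreover have "gen (s (c j) (x j)) - const (c j) * gen (x j) \<in> clifford_ideal s B PP"
    using insert by (intro scaling_relator) auto
  ultimately have "(gen (s (c j) (x j) + ?S) - gen (s (c j) (x j)) - gen ?S)
      + (gen (s (c j) (x j)) - const (c j) * gen (x j))
      + (gen ?S - (\<Sum>i\<in>A. const (c i) * gen (x i))) \<in> clifford_ideal s B PP"
    using insert by (intro clifford_ideal.add) auto
  moreover have "(X - A - S) + (A - C) + (S - T) = X - (C + T)" for X A S C T :: "'x list \<Rightarrow>\<^sub>0 complex"
    by (simp add: algebra_simps)
  ultimately show ?case by (simp only: sum.insert[OF insert(1,2)])
qed

text \<open>In the Clifford algebra \<open>[p q - q p, v] = 4 B(q, v) p - 4 B(p, v) q\<close>. Since the Clifford algebra is represented by the free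
algebra, identities in it are memberships in the ideal; here the difference is a combination of products with relators.\<close>

lemma commutator_ideal:
  assumes "p \<in> PP" "q \<in> PP" "v \<in> PP"
  shows "(gen p * gen q - gen q * gen p) * gen v - gen v * (gen p * gen q - gen q * gen p)
    - (const (4 * B q v) * gen p - const (4 * B p v) * gen q) \<in> clifford_ideal s B PP"
proof -
  define r where "r x y = gen x * gen y + gen y * gen x - const (2 * B x y)" for x y
  have r: "r x y \<in> clifford_ideal s B PP" if "x \<in> PP" "y \<in> PP" for x y
    unfolding r_def using that by (rule product_relator)
  have four: "const (4 * c) = const (2 * c) + const (2 * c)" for c
    by (simp flip: const_add)
  have "gen p * r q v - r p v * gen q - gen q * r p v + r q v * gen p \<in> clifford_ideal s B PP"
    using assms r free_algebra_gen
    by (intro clifford_ideal.add clifford_ideal_diff clifford_ideal_left clifford_ideal_right) auto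
  also have "gen p * r q v - r p v * gen q - gen q * r p v + r q v * gen p =
      (gen p * gen q - gen q * gen p) * gen v - gen v * (gen p * gen q - gen q * gen p)
      - (const (4 * B q v) * gen p - const (4 * B p v) * gen q)"
    unfolding r_def four
    by (simp add: distrib_left distrib_right left_diff_distrib right_diff_distrib mult.assoc
        const_mult_commute[of _ "gen p"] const_mult_commute[of _ "gen q"])
  finally show ?thesis .
qed

lemma bracket_expand:
  assumes X: "X \<in> kk" and v: "v \<in> PP"
  shows "br X v = (\<Sum>i<n. s (B (us i) v) (br X (u i))) + (\<Sum>i<n. s (- B (br X (u i)) v) (us i))"
proof -
  obtain p m where v: "v = p + m" "p \<in> Pp" "m \<in> Pm" using v by (auto simp: PP_def)
  have "br X p = (\<Sum>i<n. s (B p (us i)) (br X (u i)))"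
    using arg_cong[OF expand_p[OF v(2)], of "br X"] by (simp add: br_sum_right g.bracket_scale_right)
  also have "\<dots> = (\<Sum>i<n. s (B (us i) v) (br X (u i)))"
    using iso_m[OF us v(3)] by (intro sum.cong refl) (simp add: v(1) B_add_right B_sym[of p])
  finally have 1: "br X p = (\<Sum>i<n. s (B (us i) v) (br X (u i)))" .
  have "br X m = (\<Sum>i<n. s (B (u i) (br X m)) (us i))" by (rule expand_m[OF k_m[OF X v(3)]])
  also have "\<dots> = (\<Sum>i<n. s (- B (br X (u i)) v) (us i))"
    using iso_p[OF k_p[OF X u_mem] v(2)] by (intro sum.cong refl) (simp add: v(1) B_add_right B_skew)
  finally show ?thesis using 1 by (simp add: v(1) g.bracket_add_right)
qed

text \<open>The element is \<open>\<alpha>(X) = 1/4 \<Sum>\<^sub>i [[X, u\<^sub>i], u\<^sub>i\<^sup>*]\<close> with the outer bracket taken in the Clifford algebra. Its commutator with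
\<open>v\<close> is the expansion of \<open>[X, v]\<close> in \<open>bracket_expand\<close>.\<close>

lemma alpha_exists:
  assumes X: "X \<in> kk"
  shows "\<exists>a. a \<in> module.span (\<lambda>c r. const c * r) {gen v * gen w - gen w * gen v |v w. v \<in> PP \<and> w \<in> PP} \<and>
      (\<forall>v\<in>PP. (a * gen v - gen v * a) - gen (br X v) \<in> clifford_ideal s B PP)"
proof -
  interpret A: vector_space "\<lambda>c r. const c * r :: 'x list \<Rightarrow>\<^sub>0 complex" by (rule const_vector_space)
  define C where "C i = gen (br X (u i)) * gen (us i) - gen (us i) * gen (br X (u i))" for i
  define a where "a = (\<Sum>i<n. const (1 / 4) * C i)"
  have mem: "br X (u i) \<in> PP" "us i \<in> PP" if "i < n" for i
    using that PP_p[OF k_p[OF X u_mem]] PP_m[OF us] by auto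
  have "a \<in> A.span {gen v * gen w - gen w * gen v |v w. v \<in> PP \<and> w \<in> PP}"
    unfolding a_def C_def by (intro A.span_sum A.span_scale A.span_base) (use mem in blast)
  moreover have "(a * gen v - gen v * a) - gen (br X v) \<in> clifford_ideal s B PP" if v: "v \<in> PP" for v
  proof -
    let ?E = "\<lambda>i. C i * gen v - gen v * C i - (const (4 * B (us i) v) * gen (br X (u i)) -
        const (4 * B (br X (u i)) v) * gen (us i))"
    let ?s1 = "\<Sum>i<n. s (B (us i) v) (br X (u i))" and ?s2 = "\<Sum>i<n. s (- B (br X (u i)) v) (us i)"
    let ?g1 = "\<Sum>i<n. const (B (us i) v) * gen (br X (u i))"
    let ?g2 = "\<Sum>i<n. const (- B (br X (u i)) v) * gen (us i)"
    have E: "(\<Sum>i<n. const (1 / 4) * ?E i) \<in> clifford_ideal s B PP"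
      unfolding C_def
      by (intro clifford_ideal_sum clifford_ideal_left commutator_ideal free_algebra_const) (use mem v in auto)
    have quarter: "const (1 / 4) * (const (4 * c) * y) = const c * y" for c :: complex and y :: "'x list \<Rightarrow>\<^sub>0 complex"
      by (simp flip: mult.assoc const_mult)
    have c14: "gen v * (const (1 / 4) * y) = const (1 / 4) * (gen v * y)" for y :: "'x list \<Rightarrow>\<^sub>0 complex"
      by (metis const_mult_commute mult.assoc)
    have arith: "X - Y - (Z - T) = X - Y - (Z + - T)" for X Y Z T :: "'x list \<Rightarrow>\<^sub>0 complex"
      by simp
    have "(\<Sum>i<n. const (1 / 4) * ?E i) = (a * gen v - gen v * a) - (?g1 + ?g2)"
      unfolding a_def sum_distrib_left sum_distrib_right sum.distrib[symmetric] sum_subtractf[symmetric]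
    proof (intro sum.cong refl)
      fix i
      show "const (1 / 4) * ?E i = const (1 / 4) * C i * gen v - gen v * (const (1 / 4) * C i)
          - (const (B (us i) v) * gen (br X (u i)) + const (- B (br X (u i)) v) * gen (us i))"
        unfolding right_diff_distrib quarter c14 const_minus mult.assoc minus_mult_left[symmetric]
        by (rule arith)
    qed
    then have E': "(a * gen v - gen v * a) - (?g1 + ?g2) \<in> clifford_ideal s B PP" using E by simp
    have s12: "?s1 \<in> PP" "?s2 \<in> PP"
      by (intro g.subspace_sum[OF PP_subspace] g.subspace_scale[OF PP_subspace]; use mem in simp)+
    have "gen (?s1 + ?s2) - gen ?s1 - gen ?s2 \<in> clifford_ideal s B PP"
      by (rule additive_relator[OF s12])
    note h1 = this
    have h2: "gen ?s1 - ?g1 \<in> clifford_ideal s B PP" and h3: "gen ?s2 - ?g2 \<in> clifford_ideal s B PP"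
      by (intro gen_sum_ideal; use mem in simp)+
    have mem3: "((a * gen v - gen v * a) - (?g1 + ?g2)) -
        ((gen (?s1 + ?s2) - gen ?s1 - gen ?s2) + (gen ?s1 - ?g1) + (gen ?s2 - ?g2)) \<in> clifford_ideal s B PP"
      by (rule clifford_ideal_diff[OF E' clifford_ideal.add[OF clifford_ideal.add[OF h1 h2] h3]])
    have arith2: "(P - (G1 + G2)) - ((T - S1 - S2) + (S1 - G1) + (S2 - G2)) = P - T"
      for P T G1 G2 S1 S2 :: "'x list \<Rightarrow>\<^sub>0 complex"
      by (simp add: algebra_simps)
    note mem3
    also have "((a * gen v - gen v * a) - (?g1 + ?g2)) -
        ((gen (?s1 + ?s2) - gen ?s1 - gen ?s2) + (gen ?s1 - ?g1) + (gen ?s2 - ?g2)) =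
        (a * gen v - gen v * a) - gen (br X v)"
      unfolding bracket_expand[OF X v, symmetric] by (rule arith2)
    finally show ?thesis .
  qed
  ultimately show ?thesis by blast
qed

text \<open>For \<open>v = p + m\<close> and \<open>w = p' + m'\<close> the product \<open>v w\<close> has diagonal coefficient \<open>2 B(m, p')\<close> in lowest and \<open>2 B(m', p)\<close> in highest
degree. Exchanging \<open>v\<close> and \<open>w\<close> exchanges the two values, so commutators have opposite coefficients in these degrees.\<close>

lemma spin_commutator_trace:
  assumes "a \<in> module.span (\<lambda>c r. const c * r) {gen v * gen w - gen w * gen v |v w. v \<in> PP \<and> w \<in> PP}"
  shows "SP.sp a (monomial {}) {} + SP.sp a (monomial {..<n}) {..<n} = 0"
proof -
  interpret A: vector_space "\<lambda>c r. const c * r :: 'x list \<Rightarrow>\<^sub>0 complex" by (rule const_vector_space)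
  let ?F = "\<lambda>a. SP.sp a (monomial {}) {} + SP.sp a (monomial {..<n}) {..<n}"
  have S: "monomial {} \<in> tensor_space n" "monomial {..<n} \<in> tensor_space n"
    by (rule monomial_tensor_space, simp)+
  have vals: "SP.\<gamma> (p + m) (SP.\<gamma> (p' + m') (monomial {})) {} = 2 * B m p'"
    "SP.\<gamma> (p + m) (SP.\<gamma> (p' + m') (monomial {..<n})) {..<n} = 2 * B m' p"
    if m: "p \<in> Pp" "m \<in> Pm" "p' \<in> Pp" "m' \<in> Pm" for p m p' m'
  proof -
    have iw: "iS a (wS b Z) = tsS (2 * B a b) Z - wS b (iS a Z)" if "b \<in> Pp" for a b Z
      unfolding S.ctr_crv using pairing_expand[OF that, of a]
      by (simp add: mult.assoc flip: sum_distrib_left)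
    have "iS m' (monomial {}) = 0" by (simp add: contraction_def annS_monomial)
    then have 1: "SP.\<gamma> (p' + m') (monomial {}) = wS p' (monomial {})"
      using spin_gen_eq[OF m(3,4) S(1)] by simp
    show "SP.\<gamma> (p + m) (SP.\<gamma> (p' + m') (monomial {})) {} = 2 * B m p'"
      unfolding 1 using spin_gen_eq[OF m(1,2) S.crv_tensor_space[OF S(1)]] m(3)
      by (simp add: iw)
    have w0: "wS q (monomial {..<n}) = 0" for q
      by (simp add: wedging_def creS_monomial)
    then have 2: "SP.\<gamma> (p' + m') (monomial {..<n}) = iS m' (monomial {..<n})"
      using spin_gen_eq[OF m(3,4) S(2)] by simp
    have "iS m (iS m' (monomial {..<n})) {..<n} = 0"
      by (simp add: S.ctr_apply annihilation_def)
    moreover have "wS p (iS m' (monomial {..<n})) = tsS (2 * B m' p) (monomial {..<n})"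
      using iw[OF m(1), of m' "monomial {..<n}"] unfolding w0 S.ctr_zero by (metis right_minus_eq)
    ultimately show "SP.\<gamma> (p + m) (SP.\<gamma> (p' + m') (monomial {..<n})) {..<n} = 2 * B m' p"
      unfolding 2 using spin_gen_eq[OF m(1,2) S.ctr_tensor_space[OF S(2)]]
      by simp
  qed
  show ?thesis
    using assms
  proof (induct rule: A.span_induct)
    case (step b)
    then obtain v w where vw: "b = gen v * gen w - gen w * gen v" "v \<in> PP" "w \<in> PP" by auto
    obtain p m p' m' where vw': "v = p + m" "w = p' + m'" and m: "p \<in> Pp" "m \<in> Pm" "p' \<in> Pp" "m' \<in> Pm"
      using vw(2,3) by (auto simp: PP_def)
    show ?case
      by (simp add: vw(1) SP.sp_diff SP.sp_mult SP.sp_gen vw' vals m)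
  next
    case base
    show ?case
    proof (rule A.subspaceI)
      show "0 \<in> {x. SP.sp x (monomial {}) {} + SP.sp x (monomial {..<n}) {..<n} = 0}" by simp
      fix x y c
      assume x: "x \<in> {x. SP.sp x (monomial {}) {} + SP.sp x (monomial {..<n}) {..<n} = 0}"
      have "SP.sp (const c * x) (monomial {}) {} + SP.sp (const c * x) (monomial {..<n}) {..<n} =
          c * (SP.sp x (monomial {}) {} + SP.sp x (monomial {..<n}) {..<n})"
        by (simp add: SP.sp_mult SP.sp_const distrib_left)
      then show "const c * x \<in> {x. SP.sp x (monomial {}) {} + SP.sp x (monomial {..<n}) {..<n} = 0}"
        using x by simp
      assume "y \<in> {x. SP.sp x (monomial {}) {} + SP.sp x (monomial {..<n}) {..<n} = 0}"
      then show "x + y \<in> {x. SP.sp x (monomial {}) {} + SP.sp x (monomial {..<n}) {..<n} = 0}"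
        using x by (simp add: SP.sp_add) (simp add: algebra_simps)
    qed
  qed
qed

text \<open>Irreducibility of the spin module: the vacuum \<open>1\<close> spans the common kernel of the annihilation operators, so a commuting
operator multiplies it by a scalar, and the creation operators generate all monomials from it.\<close>

lemma spin_commutant_scalar:
  fixes Q :: "(nat set \<Rightarrow> complex) \<Rightarrow> nat set \<Rightarrow> complex"
  assumes Q: "Q (monomial {}) \<in> tensor_space n" "\<And>c Y. Q (tsS c Y) = tsS c (Q Y)"
    and cre: "\<And>i Y. i < n \<Longrightarrow> Y \<in> tensor_space n \<Longrightarrow> Q (creS i Y) = creS i (Q Y)"
    and ann: "\<And>i Y. i < n \<Longrightarrow> Y \<in> tensor_space n \<Longrightarrow> Q (annS i Y) = annS i (Q Y)"
    and I: "I \<subseteq> {..<n}"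
  shows "Q (monomial I) = tsS (Q (monomial {}) {}) (monomial I)"
proof -
  have fin: "finite I" using I finite_subset by blast
  show ?thesis
    using fin I
  proof (induct I rule: finite_induct)
    case empty
    have "Q (monomial {}) J = 0" if J: "J \<noteq> {}" for J
    proof (cases "J \<subseteq> {..<n}")
      case True
      obtain i where i: "i \<in> J" using J by blast
      have "Q (tsS 0 0) = tsS 0 (Q 0)" by (rule Q(2))
      then have Q0: "Q 0 = 0" by simp
      have "annS i (Q (monomial {})) = Q (annS i (monomial {}))"
        using i True by (intro ann[symmetric] monomial_tensor_space) auto
      then have "annS i (Q (monomial {})) = 0" by (simp only: annS_monomial empty_iff if_False Q0)
      then have "annS i (Q (monomial {})) (J - {i}) = 0" by (simp only: zero_fun_apply)
      then show ?thesis using i by (simp add: annihilation_def insert_absorb)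
    qed (use Q(1) in \<open>simp add: tensor_space_def\<close>)
    then show ?case by (auto simp: fun_eq_iff monomial_def)
  next
    case (insert i I)
    let ?m = "move_sign i I"
    have eq: "monomial (insert i I) = tsS ?m (creS i (monomial I))"
      using insert by (simp add: creS_monomial)
    have "Q (monomial (insert i I)) = tsS ?m (creS i (Q (monomial I)))"
      unfolding eq Q(2) using insert by (simp add: cre monomial_tensor_space)
    also have "\<dots> = tsS ?m (creS i (tsS (Q (monomial {}) {}) (monomial I)))"
      using insert by (simp only: insert_subset)
    also have "\<dots> = tsS (Q (monomial {}) {}) (monomial (insert i I))"
      unfolding eq by (simp add: S.cre_scale mult.commute)
    finally show ?case .
  qed
qed

text \<open>The operator \<open>\<alpha>(X)\<close> and the adjoint action have the same commutators with the Clifford generators, so their difference is a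
scalar \<open>q\<close>. In lowest degree \<open>\<alpha>(X)\<close> has the coefficient \<open>q\<close>, in highest degree \<open>q\<close> plus the trace of \<open>ad X\<close> on \<open>\<pp>\<^sup>+\<close>. Their
sum is 0 by \<open>spin_commutator_trace\<close>, so \<open>q\<close> is half of the trace on \<open>\<pp>\<^sup>-\<close>.\<close>

lemma spin_alpha:
  assumes X: "X \<in> kk" and I: "I \<subseteq> {..<n}"
  shows "SP.sp (alpha s br B PP X) (monomial I) =
    (\<Sum>i<n. \<Sum>j<n. tsS (B (br X (u i)) (us j)) (creS j (annS i (monomial I)))) +
    tsS (half_trace_ad s br Pm X) (monomial I)"
proof -
  define a where "a = alpha s br B PP X"
  have a: "a \<in> module.span (\<lambda>c r. const c * r) {gen v * gen w - gen w * gen v |v w. v \<in> PP \<and> w \<in> PP}"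
    "\<And>v. v \<in> PP \<Longrightarrow> (a * gen v - gen v * a) - gen (br X v) \<in> clifford_ideal s B PP"
    using someI_ex[OF alpha_exists[OF X]] unfolding a_def alpha_def by blast+
  define Q where "Q Y = SP.sp a Y - SS.ad_op X Y" for Y
  have comm: "SP.sp a (SP.\<gamma> v Y) = SP.\<gamma> v (SP.sp a Y) + SP.\<gamma> (br X v) Y"
    if "v \<in> PP" "Y \<in> tensor_space n" for v Y
  proof -
    have "SP.sp ((a * gen v - gen v * a) - gen (br X v)) Y = 0"
      by (rule spin_ideal[OF a(2)]) (use that in auto)
    then have "SP.sp a (SP.\<gamma> v Y) - SP.\<gamma> v (SP.sp a Y) - SP.\<gamma> (br X v) Y = 0"
      by (simp only: SP.sp_diff SP.sp_mult SP.sp_gen)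
    then show ?thesis unfolding diff_diff_eq right_minus_eq .
  qed
  have Q_S: "Q Y \<in> tensor_space n" if "Y \<in> tensor_space n" for Y
    unfolding Q_def
    by (intro S.tw.subspace_diff[OF S.tensor_subspace] SP.sp_tensor_space SS.ad_op_tensor_space that)
  have Q_scale: "Q (tsS c Y) = tsS c (Q Y)" for c Y
    by (simp add: Q_def SP.sp_arg_scale SS.ad_op_scale S.tw.scale_right_diff_distrib)
  have Q_cre: "Q (creS i Y) = creS i (Q Y)" if i: "i < n" and Y: "Y \<in> tensor_space n" for i Y
  proof -
    have w: "creS i Z = wS (u i) Z" for Z
    proof -
      have "wS (u i) Z = (\<Sum>j<n. if j = i then creS j Z else 0)"
        unfolding wedging_def using dual i by (intro sum.cong refl) auto
      then show ?thesis using i by simp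
    qed
    have g: "SP.\<gamma> (br X (u i)) Y = wS (br X (u i)) Y"
      using spin_gen_eq[OF k_p[OF X u_mem[OF i]] g.subspace_0[OF Pm] Y] by (simp add: contraction_def)
    have "SP.sp a (creS i Y) = creS i (SP.sp a Y) + wS (br X (u i)) Y"
      using comm[OF PP_p[OF u_mem[OF i]] Y]
      by (simp only: g spin_gen_u[OF i Y] spin_gen_u[OF i SP.sp_tensor_space[OF Y]])
    moreover have "SS.ad_op X (creS i Y) = creS i (SS.ad_op X Y) + wS (br X (u i)) Y"
      unfolding w by (rule SS.ad_op_wedge_op[OF u_mem[OF i]])
    moreover have "creS i (Z - Z') = creS i Z - creS i Z'" for Z Z'
      using S.cre_add[of i Z "- Z'"] by (simp add: S.cre_minus)
    ultimately show ?thesis by (simp add: Q_def)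
  qed
  have two: "(2::complex) \<noteq> 0" by simp
  have Q_ann: "Q (annS i Y) = annS i (Q Y)" if i: "i < n" and Y: "Y \<in> tensor_space n" for i Y
  proof -
    have g: "SP.\<gamma> (br X (us i)) Y = tsS 2 (SS.interior (br X (us i)) Y)"
      using spin_gen_eq[OF g.subspace_0[OF Pp] k_m[OF X us[OF i]] Y]
      by (simp add: wedging_def contraction_def SS.interior_def S.tw.scale_sum_right mult.assoc)
    have "tsS 2 (SP.sp a (annS i Y)) = tsS 2 (annS i (SP.sp a Y)) + tsS 2 (SS.interior (br X (us i)) Y)"
      using comm[OF PP_m[OF us[OF i]] Y]
      by (simp only: g spin_gen_us[OF i Y] spin_gen_us[OF i SP.sp_tensor_space[OF Y]] SP.sp_arg_scale)
    then have "tsS 2 (SP.sp a (annS i Y)) = tsS 2 (annS i (SP.sp a Y) + SS.interior (br X (us i)) Y)"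
      by (simp only: S.tw.scale_right_distrib)
    then have m1: "SP.sp a (annS i Y) = annS i (SP.sp a Y) + SS.interior (br X (us i)) Y"
      by (rule S.tw.scale_left_imp_eq[OF two])
    have m2: "annS i (SS.ad_op X Y) = SS.ad_op X (annS i Y) - SS.interior (br X (us i)) Y"
      using SS.interior_ad_op[OF X, of "us i" Y] by (simp only: SS.interior_us[OF i])
    have m3: "annS i (Z - Z') = annS i Z - annS i Z'" for Z Z'
      using S.ann_add[of i Z "- Z'"] by (simp add: S.ann_minus)
    show ?thesis unfolding Q_def m1 m3 m2 by (simp add: algebra_simps)
  qed
  define q where "q = Q (monomial {}) {}"
  have Q: "Q (monomial I) = tsS q (monomial I)" if "I \<subseteq> {..<n}" for I
    unfolding q_def
    by (rule spin_commutant_scalar[OF Q_S Q_scale Q_cre Q_ann that]) (rule monomial_tensor_space, simp)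
  have ad: "SS.ad_op X Y = (\<Sum>i<n. \<Sum>j<n. tsS (B (br X (u i)) (us j)) (creS j (annS i Y)))" for Y
    by (rule SS.ad_op_def)
  have ad0: "SS.ad_op X (monomial {}) = 0" by (simp add: ad annS_monomial)
  have "SS.ad_op X (monomial {..<n}) {..<n} = (\<Sum>i<n. B (br X (u i)) (us i))"
  proof -
    have ca: "creS j (annS i (monomial {..<n})) {..<n} = (if i = j then 1 else 0)" if "i < n" "j < n" for i j
    proof -
      have "annS i (creS j (monomial {..<n})) = 0" using that by (simp add: creS_monomial)
      then have "(if i = j then monomial {..<n} else 0) - creS j (annS i (monomial {..<n})) = 0"
        by (rule trans[OF sym[OF S.ann_cre]])
      then have "creS j (annS i (monomial {..<n})) = (if i = j then monomial {..<n} else 0)"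
        unfolding right_minus_eq by (rule sym)
      then show ?thesis by (simp add: monomial_def)
    qed
    have "SS.ad_op X (monomial {..<n}) {..<n} =
        (\<Sum>i<n. \<Sum>j<n. B (br X (u i)) (us j) * (if i = j then 1 else 0))"
      unfolding ad sum_fun_apply by (intro sum.cong refl) (simp add: ca)
    then show ?thesis by (simp add: if_distrib cong: if_cong)
  qed
  moreover have "SP.sp a (monomial {}) {} = q"
    using fun_cong[OF Q[of "{}"], of "{}"] by (simp add: Q_def ad0 monomial_self)
  moreover have "SP.sp a (monomial {..<n}) {..<n} = q + SS.ad_op X (monomial {..<n}) {..<n}"
    using fun_cong[OF Q[of "{..<n}"], of "{..<n}"] by (simp add: Q_def monomial_self algebra_simps)
  ultimately have "2 * q = - (\<Sum>i<n. B (br X (u i)) (us i))"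
    using spin_commutator_trace[OF a(1)] by (simp add: eq_neg_iff_add_eq_0)
  then have "q = half_trace_ad s br Pm X"
    unfolding half_trace[OF X] by (metis nonzero_mult_div_cancel_left zero_neq_numeral)
  then show ?thesis
    using Q[OF I] unfolding Q_def ad a_def unfolding diff_eq_eq by (simp only: add.commute)
qed

end

context polarized_module
begin

lemma spin_diag_act_eq:
  assumes X: "X \<in> kk" and T: "T \<in> tensor_space n"
  shows "spin_diag_act s br B PP Pp Pm u n sV \<pi> X T =
    (\<pi> X \<circ> T) + ad_op X T + ts (half_trace_ad s br Pm X) T"
proof -
  have "tensor_op sV n id (spin_action s B Pp Pm u n (alpha s br B PP X)) T =
      tensor_op sV n id (\<lambda>Y. (\<Sum>i<n. \<Sum>j<n. tsS (B (br X (u i)) (us j)) (creS j (annS i Y)))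
        + tsS (half_trace_ad s br Pm X) (id Y)) T"
    by (rule tensor_op_cong) (simp add: spin_alpha[OF X])
  moreover have "tensor_op sV n id (\<lambda>Y. Y) T = T"
    using tensor_op_id[OF T, of id] by (simp add: id_def comp_def)
  ultimately show ?thesis
    by (simp add: spin_diag_act_def tensor_op_id[OF T] tensor_op_add tensor_op_ts
        tensor_op_cre_ann_sum[OF T] ad_op_def add.assoc)
qed

end

section \<open>Internal direct sums\<close>

lemma direct_sum_pair:
  assumes s: "vector_space s" and A: "module.subspace s A" "module.subspace s A'"
    and sum: "\<And>a b. a \<in> A \<Longrightarrow> b \<in> A' \<Longrightarrow> a + b \<in> W" "\<And>w. w \<in> W \<Longrightarrow> \<exists>a\<in>A. \<exists>b\<in>A'. w = a + b"
    and ind: "\<And>a. a \<in> A \<Longrightarrow> a \<in> A' \<Longrightarrow> a = 0"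
  shows "direct_sum s W [A, A']"
proof -
  interpret vector_space s by (rule s)
  have inj: "a = a' \<and> b = b'" if "a \<in> A" "a' \<in> A" "b \<in> A'" "b' \<in> A'" "a + b = a' + b'" for a a' b b'
  proof -
    have eq: "a - a' = b' - b" using that(5) by (simp add: algebra_simps)
    have "a - a' \<in> A" using that subspace_diff[OF A(1)] by blast
    moreover have "a - a' \<in> A'" unfolding eq using that subspace_diff[OF A(2)] by blast
    ultimately have "a - a' = 0" by (rule ind)
    then show ?thesis using eq by simp
  qed
  have "bij_betw sum_list (listset [A, A']) W"
  proof (rule bij_betwI')
    fix x y assume "x \<in> listset [A, A']" "y \<in> listset [A, A']"
    then show "(sum_list x = sum_list y) = (x = y)" using inj by (auto simp: set_Cons_def)
  next
    fix x assume "x \<in> listset [A, A']"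
    then show "sum_list x \<in> W" using sum(1) by (auto simp: set_Cons_def)
  next
    fix w assume "w \<in> W"
    then obtain a b where ab: "a \<in> A" "b \<in> A'" "w = a + b" using sum(2) by blast
    then have "[a, b] \<in> listset [A, A']" by (auto simp: set_Cons_def)
    moreover have "w = sum_list [a, b]" using ab(3) by simp
    ultimately show "\<exists>x\<in>listset [A, A']. w = sum_list x" by (rule bexI[rotated])
  qed
  then show ?thesis using A by (simp add: direct_sum_def)
qed

lemma direct_sum_triple:
  assumes s: "vector_space s" and A: "module.subspace s A" "module.subspace s A'" "module.subspace s A''"
    and sum: "\<And>a b c. a \<in> A \<Longrightarrow> b \<in> A' \<Longrightarrow> c \<in> A'' \<Longrightarrow> a + b + c \<in> W"
      "\<And>w. w \<in> W \<Longrightarrow> \<exists>a\<in>A. \<exists>b\<in>A'. \<exists>c\<in>A''. w = a + b + c"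
    and ind: "\<And>a b c. a \<in> A \<Longrightarrow> b \<in> A' \<Longrightarrow> c \<in> A'' \<Longrightarrow> a + b + c = 0 \<Longrightarrow> a = 0 \<and> b = 0 \<and> c = 0"
  shows "direct_sum s W [A, A', A'']"
proof -
  interpret vector_space s by (rule s)
  have inj: "a = a' \<and> b = b' \<and> c = c'"
    if "a \<in> A" "a' \<in> A" "b \<in> A'" "b' \<in> A'" "c \<in> A''" "c' \<in> A''" "a + (b + c) = a' + (b' + c')" for a a' b b' c c'
  proof -
    have "(a - a') + (b - b') + (c - c') = (a + (b + c)) - (a' + (b' + c'))" by (simp add: algebra_simps)
    then have "(a - a') + (b - b') + (c - c') = 0" using that(7) by simp
    then have "a - a' = 0 \<and> b - b' = 0 \<and> c - c' = 0"
      using that by (intro ind subspace_diff A)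
    then show ?thesis by simp
  qed
  have "bij_betw sum_list (listset [A, A', A'']) W"
  proof (rule bij_betwI')
    fix x y assume "x \<in> listset [A, A', A'']" "y \<in> listset [A, A', A'']"
    then obtain a b c a' b' c' where x: "x = [a, b, c]" "a \<in> A" "b \<in> A'" "c \<in> A''"
      and y: "y = [a', b', c']" "a' \<in> A" "b' \<in> A'" "c' \<in> A''"
      by (auto simp: set_Cons_def)
    show "(sum_list x = sum_list y) = (x = y)" using inj[of a a' b b' c c'] x y by auto
  next
    fix x assume "x \<in> listset [A, A', A'']"
    then show "sum_list x \<in> W" using sum(1) by (auto simp: set_Cons_def add.assoc)
  next
    fix w assume "w \<in> W"
    then obtain a b c where ab: "a \<in> A" "b \<in> A'" "c \<in> A''" "w = a + b + c" using sum(2) by blast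
    then have "[a, b, c] \<in> listset [A, A', A'']" by (auto simp: set_Cons_def)
    moreover have "w = sum_list [a, b, c]" using ab(4) by (simp add: add.assoc)
    ultimately show "\<exists>x\<in>listset [A, A', A'']. w = sum_list x" by (rule bexI[rotated])
  qed
  then show ?thesis using A by (simp add: direct_sum_def)
qed

lemma direct_sum_pairD:
  assumes "direct_sum s W [A, A']"
  shows "module.subspace s A" "module.subspace s A'" "W = {a + b |a b. a \<in> A \<and> b \<in> A'}"
proof -
  show "module.subspace s A" "module.subspace s A'" using assms by (auto simp: direct_sum_def)
  have "sum_list ` listset [A, A'] = W" using assms by (auto simp: direct_sum_def bij_betw_def)
  moreover have "sum_list ` listset [A, A'] = {a + b |a b. a \<in> A \<and> b \<in> A'}"
  proof (intro equalityI subsetI)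
    fix w assume "w \<in> sum_list ` listset [A, A']"
    then obtain a b where "w = sum_list [a, b]" "a \<in> A" "b \<in> A'" by (auto simp: set_Cons_def)
    then show "w \<in> {a + b |a b. a \<in> A \<and> b \<in> A'}" by auto
  next
    fix w assume "w \<in> {a + b |a b. a \<in> A \<and> b \<in> A'}"
    then obtain a b where ab: "a \<in> A" "b \<in> A'" "w = a + b" by blast
    then have "[a, b] \<in> listset [A, A']" by (auto simp: set_Cons_def)
    moreover have "w = sum_list [a, b]" using ab(3) by simp
    ultimately show "w \<in> sum_list ` listset [A, A']" by (rule image_eqI[rotated])
  qed
  ultimately show "W = {a + b |a b. a \<in> A \<and> b \<in> A'}" by simp
qed

section \<open>Orthonormal families\<close>

locale sesquilinear_space = vector_space s
  for s :: "complex \<Rightarrow> 'm::ab_group_add \<Rightarrow> 'm" +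
  fixes F :: "'m \<Rightarrow> 'm \<Rightarrow> complex"
  assumes F_add_left: "F (x + y) z = F x z + F y z"
    and F_scale_left: "F (s c x) z = c * F x z"
    and F_sym: "F y x = cnj (F x y)"
begin

lemma F_add_right: "F x (y + z) = F x y + F x z"
  by (metis F_add_left F_sym complex_cnj_add)

lemma F_scale_right: "F x (s c y) = cnj c * F x y"
  by (metis F_scale_left F_sym complex_cnj_mult)

lemma F_zero [simp]: "F 0 x = 0" "F x 0 = 0"
  using F_scale_left[of 0 0 x] F_scale_right[of x 0 0] by simp_all

lemma F_diff_left: "F (x - y) z = F x z - F y z"
  using F_add_left[of "x - y" y z] by simp

lemma F_sum_left: "F (\<Sum>i\<in>A. f i) z = (\<Sum>i\<in>A. F (f i) z)"
  by (induct A rule: infinite_finite_induct) (auto simp: F_add_left)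

lemma F_sum_right: "F z (\<Sum>i\<in>A. f i) = (\<Sum>i\<in>A. F z (f i))"
  by (induct A rule: infinite_finite_induct) (auto simp: F_add_right)

lemma F_self_real: "F x x = of_real (Re (F x x))"
  using F_sym[of x x] by (simp add: complex_eq_iff)

text \<open>The family may be dependent. Where it is, the orthonormal family has the entry 0, which keeps the index set and makes the
expansion valid for all members.\<close>

lemma gram_schmidt:
  fixes v :: "nat \<Rightarrow> 'm"
  assumes "\<And>x. x \<in> span (v ` {..<m}) \<Longrightarrow> x \<noteq> 0 \<Longrightarrow> 0 < Re (F x x)"
  shows "\<exists>e. (\<forall>k<m. e k \<in> span (v ` {..<m})) \<and>
    (\<forall>j<m. \<forall>k<m. F (e j) (e k) = (if j = k \<and> e j \<noteq> 0 then 1 else 0)) \<and>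
    (\<forall>i<m. v i = (\<Sum>k<m. s (F (v i) (e k)) (e k)))"
  using assms
proof (induct m)
  case (Suc m)
  have mono: "span (v ` {..<m}) \<subseteq> span (v ` {..<Suc m})" by (intro span_mono) auto
  have "\<exists>e. (\<forall>k<m. e k \<in> span (v ` {..<m})) \<and>
    (\<forall>j<m. \<forall>k<m. F (e j) (e k) = (if j = k \<and> e j \<noteq> 0 then 1 else 0)) \<and>
    (\<forall>i<m. v i = (\<Sum>k<m. s (F (v i) (e k)) (e k)))"
    by (rule Suc.hyps) (use Suc.prems mono in blast)
  then obtain e where e: "\<And>k. k < m \<Longrightarrow> e k \<in> span (v ` {..<m})"
    "\<And>j k. j < m \<Longrightarrow> k < m \<Longrightarrow> F (e j) (e k) = (if j = k \<and> e j \<noteq> 0 then 1 else 0)"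
    "\<And>i. i < m \<Longrightarrow> v i = (\<Sum>k<m. s (F (v i) (e k)) (e k))"
    by blast
  define p where "p = (\<Sum>k<m. s (F (v m) (e k)) (e k))"
  define r where "r = v m - p"
  have p: "p \<in> span (v ` {..<Suc m})"
    unfolding p_def using e(1) mono by (intro span_sum span_scale) auto
  have r: "r \<in> span (v ` {..<Suc m})"
    unfolding r_def by (intro span_diff p span_base) auto
  have r_orth: "F r (e j) = 0" if "j < m" for j
  proof -
    have "F p (e j) = (\<Sum>k<m. F (v m) (e k) * (if k = j \<and> e k \<noteq> 0 then 1 else 0))"
      unfolding p_def F_sum_left F_scale_left using e(2) that by (intro sum.cong refl) simp
    also have "\<dots> = (\<Sum>k<m. if k = j then F (v m) (e j) else 0)"
      by (intro sum.cong refl) auto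
    also have "\<dots> = F (v m) (e j)" using that by simp
    finally show ?thesis by (simp add: r_def F_diff_left)
  qed
  define c where "c = 1 / sqrt (Re (F r r))"
  (* If r = 0 the new entry is 0 whatever the value of c. *)
  define e' where "e' k = (if k = m then s (of_real c) r else e k)" for k
  have e'_m: "e' m = s (of_real c) r" and e'_less: "\<And>k. k < m \<Longrightarrow> e' k = e k" by (auto simp: e'_def)
  have cc: "of_real c * of_real c * F r r = 1" "c \<noteq> 0" if "r \<noteq> 0"
  proof -
    have pos: "0 < Re (F r r)" using Suc.prems[OF r that] .
    then show "c \<noteq> 0" by (simp add: c_def)
    have "c * c * Re (F r r) = 1" using pos by (simp add: c_def)
    then show "of_real c * of_real c * F r r = 1"
      by (subst F_self_real) (simp flip: of_real_mult)
  qed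
  have orth1: "F (e' m) (e' k) = 0" if "k < m" for k
    using that by (simp add: e'_m e'_less F_scale_left r_orth)
  have orth2: "F (e' k) (e' m) = 0" if "k < m" for k
    using orth1[OF that] F_sym[of "e' k" "e' m"] by simp
  have norm: "F (e' m) (e' m) = (if e' m \<noteq> 0 then 1 else 0)"
    using cc by (auto simp: e'_m F_scale_left F_scale_right mult.assoc)
  have "F p (e' m) = 0"
    unfolding p_def F_sum_left F_scale_left using orth2 e'_less by (intro sum.neutral ballI) simp
  then have "F (v m) (e' m) = F r (e' m)" by (simp add: r_def F_diff_left)
  then have "s (F (v m) (e' m)) (e' m) = r"
    using cc by (cases "r = 0") (auto simp: e'_m F_scale_right mult_ac)
  then have vm: "v m = (\<Sum>k<Suc m. s (F (v m) (e' k)) (e' k))"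
    by (simp add: e'_less r_def p_def)
  have vi: "v i = (\<Sum>k<Suc m. s (F (v i) (e' k)) (e' k))" if i: "i < m" for i
  proof -
    have "F (v i) (e' m) = (\<Sum>k<m. F (v i) (e k) * F (e k) (e' m))"
      by (subst e(3)[OF i]) (simp add: F_sum_left F_scale_left)
    also have "\<dots> = 0" using orth2 e'_less by (intro sum.neutral ballI) simp
    finally show ?thesis using e(3)[OF i] by (simp add: e'_less)
  qed
  show ?case
  proof (intro exI[of _ e'] conjI allI impI)
    fix k assume "k < Suc m"
    then show "e' k \<in> span (v ` {..<Suc m})"
      using e(1) mono r span_scale by (auto simp: e'_def less_Suc_eq)
  next
    fix j k assume "j < Suc m" "k < Suc m"
    then show "F (e' j) (e' k) = (if j = k \<and> e' j \<noteq> 0 then 1 else 0)"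
      using orth1 orth2 norm e(2) e'_less by (auto simp: less_Suc_eq)
  next
    fix i assume "i < Suc m"
    then show "v i = (\<Sum>k<Suc m. s (F (v i) (e' k)) (e' k))"
      using vi vm by (auto simp only: less_Suc_eq)
  qed
qed simp

lemma orthonormal_expand:
  fixes v :: "nat \<Rightarrow> 'm"
  assumes "\<And>i. i < m \<Longrightarrow> v i = (\<Sum>k<m. s (F (v i) (e k)) (e k))" "x \<in> span (v ` {..<m})"
  shows "x = (\<Sum>k<m. s (F x (e k)) (e k))"
  using assms(2)
proof (induct rule: span_induct)
  case step
  then show ?case using assms(1) by blast
next
  case base
  show ?case
  proof (rule subspaceI)
    fix x y c assume x: "x \<in> {a. a = (\<Sum>k<m. s (F a (e k)) (e k))}"
    then have "s c x = s c (\<Sum>k<m. s (F x (e k)) (e k))" by simp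
    also have "\<dots> = (\<Sum>k<m. s (F (s c x) (e k)) (e k))"
      by (simp only: F_scale_left scale_sum_right scale_scale)
    finally show "s c x \<in> {a. a = (\<Sum>k<m. s (F a (e k)) (e k))}" by (rule CollectI)
    assume "y \<in> {a. a = (\<Sum>k<m. s (F a (e k)) (e k))}"
    then show "x + y \<in> {a. a = (\<Sum>k<m. s (F a (e k)) (e k))}"
      using x by (simp add: F_add_left scale_left_distrib sum.distrib)
  qed simp
qed

lemma orthogonal_projection:
  assumes fin: "finite A" and pos: "\<And>x. x \<in> span A \<Longrightarrow> x \<noteq> 0 \<Longrightarrow> 0 < Re (F x x)"
  shows "\<exists>p\<in>span A. \<forall>b\<in>span A. F (x - p) b = 0"
proof -
  obtain v m where A: "A = v ` {..<m::nat}"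
    using fin by (metis finite_imp_nat_seg_image_inj_on lessThan_def)
  have "\<exists>e. (\<forall>k<m. e k \<in> span (v ` {..<m})) \<and>
    (\<forall>j<m. \<forall>k<m. F (e j) (e k) = (if j = k \<and> e j \<noteq> 0 then 1 else 0)) \<and>
    (\<forall>i<m. v i = (\<Sum>k<m. s (F (v i) (e k)) (e k)))"
    by (rule gram_schmidt) (use pos A in blast)
  then obtain e where e: "\<And>k. k < m \<Longrightarrow> e k \<in> span A"
    "\<And>j k. j < m \<Longrightarrow> k < m \<Longrightarrow> F (e j) (e k) = (if j = k \<and> e j \<noteq> 0 then 1 else 0)"
    "\<And>i. i < m \<Longrightarrow> v i = (\<Sum>k<m. s (F (v i) (e k)) (e k))"
    unfolding A by blast
  define p where "p = (\<Sum>k<m. s (F x (e k)) (e k))"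
  have orth: "F (x - p) (e j) = 0" if "j < m" for j
  proof -
    have "F p (e j) = (\<Sum>k<m. F x (e k) * (if k = j \<and> e k \<noteq> 0 then 1 else 0))"
      unfolding p_def F_sum_left F_scale_left using e(2) that by (intro sum.cong refl) simp
    also have "\<dots> = (\<Sum>k<m. if k = j then F x (e j) else 0)"
      by (intro sum.cong refl) auto
    also have "\<dots> = F x (e j)" using that by simp
    finally show ?thesis by (simp add: F_diff_left)
  qed
  have "F (x - p) b = 0" if "b \<in> span A" for b
  proof -
    have "b = (\<Sum>k<m. s (F b (e k)) (e k))"
      using that unfolding A by (intro orthonormal_expand[OF e(3)])
    then have "F (x - p) b = F (x - p) (\<Sum>k<m. s (F b (e k)) (e k))" by (rule arg_cong)
    then show ?thesis using orth by (simp add: F_sum_right F_scale_right)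
  qed
  moreover have "p \<in> span A" unfolding p_def using e(1) by (intro span_sum span_scale) auto
  ultimately show ?thesis by blast
qed

end

section \<open>Algebraic Hodge decomposition\<close>

text \<open>The last assumption stands for the analysis in Hodge theory: the Laplacian acts within a finite-dimensional subspace around
each vector. The factor in the adjointness relation is the one that the normalization of \<open>\<delta>\<close> produces.\<close>

locale hodge_complex = sesquilinear_space s F
  for s :: "complex \<Rightarrow> 'm::ab_group_add \<Rightarrow> 'm" and F +
  fixes W :: "'m set" and d dl :: "'m \<Rightarrow> 'm"
  assumes W: "subspace W"
    and F_pos: "x \<in> W \<Longrightarrow> x \<noteq> 0 \<Longrightarrow> 0 < Re (F x x)"
    and d_W: "x \<in> W \<Longrightarrow> d x \<in> W" and dl_W: "x \<in> W \<Longrightarrow> dl x \<in> W"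
    and d_add: "x \<in> W \<Longrightarrow> y \<in> W \<Longrightarrow> d (x + y) = d x + d y"
    and dl_add: "x \<in> W \<Longrightarrow> y \<in> W \<Longrightarrow> dl (x + y) = dl x + dl y"
    and d_scale: "x \<in> W \<Longrightarrow> d (s c x) = s c (d x)"
    and dl_scale: "x \<in> W \<Longrightarrow> dl (s c x) = s c (dl x)"
    and d_d: "x \<in> W \<Longrightarrow> d (d x) = 0" and dl_dl: "x \<in> W \<Longrightarrow> dl (dl x) = 0"
    and adjoint: "x \<in> W \<Longrightarrow> y \<in> W \<Longrightarrow> F (d x) y = - F x (dl y) / 2"
    and locally_finite: "x \<in> W \<Longrightarrow> \<exists>A. finite A \<and> A \<subseteq> W \<and> x \<in> span A \<and>
      (\<forall>y\<in>span A. d (dl y) + dl (d y) \<in> span A)"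
begin

definition "dirac x = d x + dl x"
definition "lap x = d (dl x) + dl (d x)"

lemma adjoint': "x \<in> W \<Longrightarrow> y \<in> W \<Longrightarrow> F (dl x) y = - 2 * F x (d y)"
proof -
  assume "x \<in> W" "y \<in> W"
  then have "cnj (F x (d y)) = - cnj (F (dl x) y) / 2"
    using adjoint[of y x] F_sym[of "d y" x] F_sym[of y "dl x"] by simp
  then have "cnj (F (dl x) y) = cnj (- 2 * F x (d y))" by simp
  then show ?thesis by (simp only: complex_cnj_cancel_iff)
qed

lemma F_eq_0: "x \<in> W \<Longrightarrow> F x x = 0 \<Longrightarrow> x = 0"
  using F_pos by force

lemma zero_W: "0 \<in> W" by (rule subspace_0[OF W])

lemma d_zero [simp]: "d 0 = 0" and dl_zero [simp]: "dl 0 = 0"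
  using d_scale[OF zero_W, of 0] dl_scale[OF zero_W, of 0] by simp_all

lemma lap_W: "x \<in> W \<Longrightarrow> lap x \<in> W"
  unfolding lap_def by (intro subspace_add[OF W] d_W dl_W)

lemma lap_add: "x \<in> W \<Longrightarrow> y \<in> W \<Longrightarrow> lap (x + y) = lap x + lap y"
  by (simp add: lap_def d_add dl_add d_W dl_W)

lemma lap_scale: "x \<in> W \<Longrightarrow> lap (s c x) = s c (lap x)"
  by (simp add: lap_def d_scale dl_scale d_W dl_W scale_right_distrib)

lemma lap_symmetric: "x \<in> W \<Longrightarrow> y \<in> W \<Longrightarrow> F (lap x) y = F x (lap y)"
  by (simp add: lap_def F_add_left F_add_right adjoint adjoint' d_W dl_W add.commute)

lemma orth_images: "x \<in> W \<Longrightarrow> y \<in> W \<Longrightarrow> F (d x) (dl y) = 0"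
  by (simp add: adjoint dl_W dl_dl)

text \<open>\<open>F (lap x) x\<close> is minus a sum of positive multiples of the squared norms of \<open>d x\<close> and \<open>dl x\<close>.\<close>

lemma lap_kernel:
  assumes x: "x \<in> W" and "lap x = 0"
  shows "d x = 0 \<and> dl x = 0"
proof -
  have "F (lap x) x = - (F (dl x) (dl x) / 2 + 2 * F (d x) (d x))"
    using x by (simp add: lap_def F_add_left adjoint adjoint' d_W dl_W)
  then have "Re (F (dl x) (dl x)) / 2 + 2 * Re (F (d x) (d x)) = 0"
    using assms(2) by (simp add: complex_eq_iff)
  moreover have "0 \<le> Re (F (dl x) (dl x))" "0 \<le> Re (F (d x) (d x))"
    using F_pos d_W[OF x] dl_W[OF x] by (metis F_zero(1) less_eq_real_def zero_complex.simps(1))+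
  ultimately show ?thesis using F_pos[OF d_W[OF x]] F_pos[OF dl_W[OF x]] by linarith
qed

lemma dirac_dirac: "x \<in> W \<Longrightarrow> dirac (dirac x) = lap x"
  by (simp add: dirac_def lap_def d_add dl_add d_W dl_W d_d dl_dl)

lemma dirac_kernel: "x \<in> W \<Longrightarrow> dirac x = 0 \<longleftrightarrow> d x = 0 \<and> dl x = 0"
  using dirac_dirac[of x] lap_kernel[of x] by (auto simp: dirac_def)

text \<open>Within an invariant finite-dimensional subspace, \<open>x\<close> is projected to the image of the Laplacian. What remains is orthogonal
to that image, so the symmetric Laplacian maps it to a vector of norm 0.\<close>

lemma lap_decomposition:
  assumes x: "x \<in> W"
  shows "\<exists>h\<in>W. \<exists>y\<in>W. lap h = 0 \<and> x = h + lap y"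
proof -
  obtain A where A: "finite A" "A \<subseteq> W" "x \<in> span A" "\<And>y. y \<in> span A \<Longrightarrow> lap y \<in> span A"
    using locally_finite[OF x] unfolding lap_def by blast
  have AW: "span A \<subseteq> W" using A(2) W by (rule span_minimal)
  (* The image of span A is spanned by the finite family lap ` A, so x can be projected onto it. *)
  have lap_span: "\<exists>y\<in>span A. z = lap y" if "z \<in> span (lap ` A)" for z
    using that
  proof (induct rule: span_induct)
    case step
    then show ?case using span_base by blast
  next
    case base
    show ?case
    proof (rule subspaceI)
      show "0 \<in> {z. \<exists>y\<in>span A. z = lap y}" using span_zero by (auto simp: lap_def intro!: bexI[of _ 0])
      fix z z' c assume "z \<in> {z. \<exists>y\<in>span A. z = lap y}"
      then obtain y where y: "y \<in> span A" "z = lap y" by blast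
      then show "s c z \<in> {z. \<exists>y\<in>span A. z = lap y}"
        using lap_scale[of y c] AW span_scale[of y A c] by (auto intro!: bexI[of _ "s c y"])
      assume "z' \<in> {z. \<exists>y\<in>span A. z = lap y}"
      then obtain y' where "y' \<in> span A" "z' = lap y'" by blast
      moreover from this have "lap (y + y') = lap y + lap y'" using y AW by (intro lap_add) blast+
      ultimately show "z + z' \<in> {z. \<exists>y\<in>span A. z = lap y}"
        using y span_add[of y A y'] by (intro CollectI bexI[of _ "y + y'"]) simp_all
    qed
  qed
  have span_lap: "lap y \<in> span (lap ` A)" if "y \<in> span A" for y
  proof -
    have "y \<in> W \<and> lap y \<in> span (lap ` A)"
      using that
    proof (induct rule: span_induct)
      case step
      then show ?case using A(2) span_base by blast
    next
      case base
      show ?case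
        by (rule subspaceI)
          (auto simp: zero_W lap_add lap_scale subspace_add[OF W] subspace_scale[OF W] span_add span_scale,
            simp add: lap_def span_zero)
    qed
    then show ?thesis by simp
  qed
  have sub: "span (lap ` A) \<subseteq> span A" using A(4) lap_span by blast
  obtain p where p: "p \<in> span (lap ` A)" "\<And>b. b \<in> span (lap ` A) \<Longrightarrow> F (x - p) b = 0"
    using orthogonal_projection[of "lap ` A" x] A(1) F_pos sub AW by blast
  obtain y where y: "y \<in> span A" "p = lap y" using lap_span p(1) by blast
  have q: "x - p \<in> span A" using A(3) p(1) sub by (intro span_diff) auto
  then have qW: "x - p \<in> W" using AW by blast
  (* Symmetry moves one Laplacian to the left, which leaves the norm of lap (x - p). *)
  have "F (x - p) (lap (lap (x - p))) = 0" by (intro p(2) span_lap A(4) q)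
  then have "F (lap (x - p)) (lap (x - p)) = 0"
    using lap_symmetric[OF qW lap_W[OF qW]] by simp
  then have "lap (x - p) = 0" by (intro F_eq_0 lap_W qW)
  then show ?thesis
    using qW y AW by (intro bexI[of _ "x - p"] bexI[of _ y]) auto
qed

lemma decomposition:
  assumes x: "x \<in> W"
  shows "\<exists>h\<in>ker_on W dirac. \<exists>a\<in>W. \<exists>b\<in>W. x = h + d a + dl b"
proof -
  obtain h y where h: "h \<in> W" "y \<in> W" "lap h = 0" "x = h + lap y"
    using lap_decomposition[OF x] by blast
  have "h \<in> ker_on W dirac" using h lap_kernel dirac_kernel by (auto simp: ker_on_def)
  then show ?thesis
    using h by (intro bexI[of _ h] bexI[of _ "dl y"] bexI[of _ "d y"]) (auto simp: lap_def add.assoc d_W dl_W)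
qed

lemma ker_subspace: "subspace (ker_on W dirac)"
  by (rule subspaceI)
    (auto simp: ker_on_def zero_W dirac_def d_add dl_add d_scale dl_scale subspace_add[OF W] subspace_scale[OF W]
      add.assoc add.left_commute scale_right_distrib[symmetric], metis add.left_commute add_0 add.commute add.assoc)

lemma image_subspaces: "subspace (d ` W)" "subspace (dl ` W)"
proof -
  show "subspace (d ` W)"
    by (rule subspaceI)
      (use zero_W d_zero subspace_add[OF W] subspace_scale[OF W] in \<open>force simp flip: d_add d_scale\<close>)+
  show "subspace (dl ` W)"
    by (rule subspaceI)
      (use zero_W dl_zero subspace_add[OF W] subspace_scale[OF W] in \<open>force simp flip: dl_add dl_scale\<close>)+
qed

lemma ker_orth:
  assumes "h \<in> ker_on W dirac" "a \<in> W"
  shows "F h (d a) = 0" "F h (dl a) = 0"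
proof -
  have h: "h \<in> W" "d h = 0" "dl h = 0" using assms(1) dirac_kernel by (auto simp: ker_on_def)
  show "F h (d a) = 0" using adjoint'[OF h(1) assms(2)] h by simp
  show "F h (dl a) = 0" using adjoint[OF h(1) assms(2)] h by simp
qed

lemma independent_parts:
  assumes h: "h \<in> ker_on W dirac" and ab: "a \<in> W" "b \<in> W" and z: "h + d a + dl b = 0"
  shows "h = 0 \<and> d a = 0 \<and> dl b = 0"
proof -
  have hW: "h \<in> W" using h by (simp add: ker_on_def)
  have "F h (h + d a + dl b) = F h h" using ker_orth[OF h] ab by (simp add: F_add_right)
  then have h0: "h = 0" using z F_eq_0[OF hW] by simp
  have "F (d a) (h + d a + dl b) = F (d a) (d a)" using orth_images ab h0 by (simp add: F_add_right)
  then have a0: "d a = 0" using z F_eq_0[OF d_W[OF ab(1)]] by simp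
  then show ?thesis using z h0 by simp
qed

theorem hodge_direct_sum: "direct_sum s W [ker_on W dirac, d ` W, dl ` W]"
proof (rule direct_sum_triple[OF vector_space_axioms ker_subspace image_subspaces])
  fix a b c assume "a \<in> ker_on W dirac" "b \<in> d ` W" "c \<in> dl ` W"
  then show "a + b + c \<in> W" by (auto simp: ker_on_def intro!: subspace_add[OF W] d_W dl_W)
next
  fix w assume "w \<in> W"
  then show "\<exists>a\<in>ker_on W dirac. \<exists>b\<in>d ` W. \<exists>c\<in>dl ` W. w = a + b + c"
    using decomposition[of w] by blast
next
  fix a b c assume "a \<in> ker_on W dirac" "b \<in> d ` W" "c \<in> dl ` W" "a + b + c = 0"
  then show "a = 0 \<and> b = 0 \<and> c = 0" using independent_parts by blast
qed

lemma ker_d_decomposition: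
  assumes x: "x \<in> W" "d x = 0"
  shows "\<exists>h\<in>ker_on W dirac. \<exists>a\<in>W. x = h + d a"
proof -
  obtain h a b where h: "h \<in> ker_on W dirac" "a \<in> W" "b \<in> W" "x = h + d a + dl b"
    using decomposition[OF x(1)] by blast
  have hW: "h \<in> W" "d h = 0" using h(1) dirac_kernel by (auto simp: ker_on_def)
  have "d x = d (dl b)"
    using h hW by (simp add: d_add d_W dl_W d_d subspace_add[OF W])
  then have "d (dl b) = 0" using x(2) by simp
  then have "F (dl b) (dl b) = 0" using adjoint'[OF h(3) dl_W[OF h(3)]] by simp
  then have "dl b = 0" by (intro F_eq_0 dl_W h)
  then show ?thesis using h by auto
qed

lemma ker_dl_decomposition:
  assumes x: "x \<in> W" "dl x = 0"
  shows "\<exists>h\<in>ker_on W dirac. \<exists>a\<in>W. x = h + dl a"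
proof -
  obtain h a b where h: "h \<in> ker_on W dirac" "a \<in> W" "b \<in> W" "x = h + d a + dl b"
    using decomposition[OF x(1)] by blast
  have hW: "h \<in> W" "dl h = 0" using h(1) dirac_kernel by (auto simp: ker_on_def)
  have "dl x = dl (d a)"
    using h hW by (simp add: dl_add d_W dl_W dl_dl subspace_add[OF W])
  then have "dl (d a) = 0" using x(2) by simp
  then have "F (d a) (d a) = 0" using adjoint[OF h(2) d_W[OF h(2)]] by simp
  then have "d a = 0" by (intro F_eq_0 d_W h)
  then show ?thesis using h by auto
qed

theorem ker_d_direct_sum: "direct_sum s (ker_on W d) [ker_on W dirac, d ` W]"
proof (rule direct_sum_pair[OF vector_space_axioms ker_subspace image_subspaces(1)])
  fix a b assume "a \<in> ker_on W dirac" "b \<in> d ` W"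
  then show "a + b \<in> ker_on W d"
    using dirac_kernel by (auto simp: ker_on_def d_add d_W d_d subspace_add[OF W])
next
  fix w assume "w \<in> ker_on W d"
  then show "\<exists>a\<in>ker_on W dirac. \<exists>b\<in>d ` W. w = a + b"
    using ker_d_decomposition[of w] by (auto simp: ker_on_def)
next
  fix a assume a: "a \<in> ker_on W dirac" "a \<in> d ` W"
  then obtain b where b: "b \<in> W" "a = d b" by blast
  then show "a = 0" using ker_orth(1)[OF a(1) b(1)] a F_eq_0[of a] by (simp add: ker_on_def)
qed

theorem ker_dl_direct_sum: "direct_sum s (ker_on W dl) [ker_on W dirac, dl ` W]"
proof (rule direct_sum_pair[OF vector_space_axioms ker_subspace image_subspaces(2)])
  fix a b assume "a \<in> ker_on W dirac" "b \<in> dl ` W"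
  then show "a + b \<in> ker_on W dl"
    using dirac_kernel by (auto simp: ker_on_def dl_add dl_W dl_dl subspace_add[OF W])
next
  fix w assume "w \<in> ker_on W dl"
  then show "\<exists>a\<in>ker_on W dirac. \<exists>b\<in>dl ` W. w = a + b"
    using ker_dl_decomposition[of w] by (auto simp: ker_on_def)
next
  fix a assume a: "a \<in> ker_on W dirac" "a \<in> dl ` W"
  then obtain b where b: "b \<in> W" "a = dl b" by blast
  then show "a = 0" using ker_orth(2)[OF a(1) b(1)] a F_eq_0[of a] by (simp add: ker_on_def)
qed

theorem image_dirac_inter_kernel: "dirac ` W \<inter> ker_on W dirac = {0}"
proof -
  have "x = 0" if "y \<in> W" "x = dirac y" "dirac x = 0" for x y
    using that dirac_dirac[of y] lap_kernel[of y] dirac_kernel[of y] by auto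
  then show ?thesis using zero_W by (auto simp: ker_on_def dirac_def image_iff intro!: bexI[of _ 0])
qed

end

section \<open>Isomorphisms of modules\<close>

lemma is_lie_rep_closed:
  assumes M: "is_lie_rep s br \<kk> M"
  shows "m \<in> space M \<Longrightarrow> m' \<in> space M \<Longrightarrow> lie_rep.add M m m' \<in> space M"
    and "m \<in> space M \<Longrightarrow> smul M c m \<in> space M"
    and "X \<in> \<kk> \<Longrightarrow> m \<in> space M \<Longrightarrow> act M X m \<in> space M"
  using M unfolding is_lie_rep_def by simp_all

text \<open>An isomorphism requires both sides to be modules. The axioms need to be checked on one side only.\<close>

lemma is_lie_rep_transport:
  assumes M: "is_lie_rep s br \<kk> M" and N: "space N = \<phi> ` space M"
    and hom: "\<And>m m'. m \<in> space M \<Longrightarrow> m' \<in> space M \<Longrightarrow> lie_rep.add N (\<phi> m) (\<phi> m') = \<phi> (lie_rep.add M m m')"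
      "\<And>c m. m \<in> space M \<Longrightarrow> smul N c (\<phi> m) = \<phi> (smul M c m)"
      "\<And>X m. X \<in> \<kk> \<Longrightarrow> m \<in> space M \<Longrightarrow> act N X (\<phi> m) = \<phi> (act M X m)"
    and kk: "\<And>X Y. X \<in> \<kk> \<Longrightarrow> Y \<in> \<kk> \<Longrightarrow> X + Y \<in> \<kk>" "\<And>c X. X \<in> \<kk> \<Longrightarrow> s c X \<in> \<kk>"
      "\<And>X Y. X \<in> \<kk> \<Longrightarrow> Y \<in> \<kk> \<Longrightarrow> br X Y \<in> \<kk>"
  shows "is_lie_rep s br \<kk> N"
proof -
  note c = is_lie_rep_closed[OF M]
  have e1: "act M X (lie_rep.add M m m') = lie_rep.add M (act M X m) (act M X m')"
    if "X \<in> \<kk>" "m \<in> space M" "m' \<in> space M" for X m m'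
    using M that unfolding is_lie_rep_def by (elim conjE) blast
  have e2: "act M X (smul M c m) = smul M c (act M X m)"
    if "X \<in> \<kk>" "m \<in> space M" for X c m
    using M that unfolding is_lie_rep_def by (elim conjE) blast
  have e3: "act M (X + Y) m = lie_rep.add M (act M X m) (act M Y m)"
    if "X \<in> \<kk>" "Y \<in> \<kk>" "m \<in> space M" for X Y m
    using M that unfolding is_lie_rep_def by (elim conjE) blast
  have e4: "act M (s c X) m = smul M c (act M X m)"
    if "X \<in> \<kk>" "m \<in> space M" for X c m
    using M that unfolding is_lie_rep_def by (elim conjE) blast
  have e5: "lie_rep.add M (act M (br X Y) m) (act M Y (act M X m)) = act M X (act M Y m)"
    if "X \<in> \<kk>" "Y \<in> \<kk>" "m \<in> space M" for X Y m
  proof -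
    have "\<forall>X\<in>\<kk>. \<forall>Y\<in>\<kk>. \<forall>m\<in>space M.
        lie_rep.add M (act M (br X Y) m) (act M Y (act M X m)) = act M X (act M Y m)"
      using M unfolding is_lie_rep_def by (elim conjE) assumption
    then show ?thesis using that by blast
  qed
  have ne: "space M \<noteq> {}" using M by (simp add: is_lie_rep_def)
  show ?thesis
    unfolding is_lie_rep_def N
    by (intro conjI ballI allI; (elim imageE)?; (use ne in blast)?;
        simp add: hom kk c e1 e2 e3 e4 e5)
qed

lemma lie_rep_iso_transport:
  assumes M: "is_lie_rep s br \<kk> M" and bij: "bij_betw \<phi> (space M) (space N)"
    and hom: "\<And>m m'. m \<in> space M \<Longrightarrow> m' \<in> space M \<Longrightarrow> lie_rep.add N (\<phi> m) (\<phi> m') = \<phi> (lie_rep.add M m m')"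
      "\<And>c m. m \<in> space M \<Longrightarrow> smul N c (\<phi> m) = \<phi> (smul M c m)"
      "\<And>X m. X \<in> \<kk> \<Longrightarrow> m \<in> space M \<Longrightarrow> act N X (\<phi> m) = \<phi> (act M X m)"
    and kk: "\<And>X Y. X \<in> \<kk> \<Longrightarrow> Y \<in> \<kk> \<Longrightarrow> X + Y \<in> \<kk>" "\<And>c X. X \<in> \<kk> \<Longrightarrow> s c X \<in> \<kk>"
      "\<And>X Y. X \<in> \<kk> \<Longrightarrow> Y \<in> \<kk> \<Longrightarrow> br X Y \<in> \<kk>"
  shows "lie_rep_iso s br \<kk> M N \<phi>"
  using is_lie_rep_transport[OF M bij_betw_imp_surj_on[OF bij, symmetric] hom kk] M bij hom
  by (simp add: lie_rep_iso_def)

lemma lie_rep_iso_common_source: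
  assumes C: "lie_rep_iso s br \<kk> K C \<phi>" and D: "lie_rep_iso s br \<kk> K D \<psi>"
  shows "\<exists>\<zeta>. lie_rep_iso s br \<kk> C D \<zeta>"
proof -
  let ?i = "inv_into (space K) \<phi>"
  have bij: "bij_betw \<phi> (space K) (space C)" "bij_betw \<psi> (space K) (space D)"
    using C D by (simp_all add: lie_rep_iso_def)
  have K: "is_lie_rep s br \<kk> K" using C by (simp add: lie_rep_iso_def)
  have i: "?i (\<phi> m) = m" if "m \<in> space K" for m
    using that bij(1) by (simp add: bij_betw_inv_into_left)
  have img: "\<exists>k\<in>space K. m = \<phi> k" if "m \<in> space C" for m
    using that bij_betw_imp_surj_on[OF bij(1)] by blast
  note closed = is_lie_rep_closed[OF K]
  have hC: "lie_rep.add C (\<phi> m) (\<phi> m') = \<phi> (lie_rep.add K m m')" "smul C c (\<phi> m) = \<phi> (smul K c m)"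
    "X \<in> \<kk> \<Longrightarrow> act C X (\<phi> m) = \<phi> (act K X m)"
    if "m \<in> space K" "m' \<in> space K" for m m' c X
    using C that by (simp_all add: lie_rep_iso_def)
  have hD: "\<psi> (lie_rep.add K m m') = lie_rep.add D (\<psi> m) (\<psi> m')" "\<psi> (smul K c m) = smul D c (\<psi> m)"
    "X \<in> \<kk> \<Longrightarrow> \<psi> (act K X m) = act D X (\<psi> m)"
    if "m \<in> space K" "m' \<in> space K" for m m' c X
    using D that by (simp_all add: lie_rep_iso_def)
  have "lie_rep_iso s br \<kk> C D (\<psi> \<circ> ?i)"
    unfolding lie_rep_iso_def
  proof (intro conjI ballI allI)
    show "is_lie_rep s br \<kk> C" "is_lie_rep s br \<kk> D" using C D by (simp_all add: lie_rep_iso_def)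
    show "bij_betw (\<psi> \<circ> ?i) (space C) (space D)"
      using bij_betw_trans[OF bij_betw_inv_into[OF bij(1)] bij(2)] .
    fix m c X assume "m \<in> space C"
    then obtain k where k: "k \<in> space K" "m = \<phi> k" using img by blast
    show "(\<psi> \<circ> ?i) (smul C c m) = smul D c ((\<psi> \<circ> ?i) m)"
      using k by (simp add: hC i closed hD)
    show "(\<psi> \<circ> ?i) (act C X m) = act D X ((\<psi> \<circ> ?i) m)" if "X \<in> \<kk>"
      using k that by (simp add: hC i closed hD)
    fix m' assume "m' \<in> space C"
    then obtain k' where k': "k' \<in> space K" "m' = \<phi> k'" using img by blast
    show "(\<psi> \<circ> ?i) (lie_rep.add C m m') = lie_rep.add D ((\<psi> \<circ> ?i) m) ((\<psi> \<circ> ?i) m')"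
      using k k' by (simp add: hC i closed hD)
  qed
  then show ?thesis by blast
qed

section \<open>Quotients\<close>

context vector_space
begin

lemma coset_eq_iff:
  assumes "subspace N"
  shows "coset N x = coset N y \<longleftrightarrow> x - y \<in> N"
proof
  assume "coset N x = coset N y"
  then have "x \<in> coset N y" using subspace_0[OF assms] by (force simp: coset_def)
  then show "x - y \<in> N" by (auto simp: coset_def)
next
  assume xy: "x - y \<in> N"
  have "coset N a \<subseteq> coset N b" if ab: "a - b \<in> N" for a b
  proof
    fix z assume "z \<in> coset N a"
    then obtain c where c: "c \<in> N" "z = a + c" by (auto simp: coset_def)
    then have "z = b + ((a - b) + c)" by simp
    then show "z \<in> coset N b" using subspace_add[OF assms ab c(1)] unfolding coset_def by blast
  qed
  moreover have "y - x \<in> N" using subspace_neg[OF assms xy] by simp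
  ultimately show "coset N x = coset N y" using xy by blast
qed

lemma coset_add:
  assumes N: "subspace N"
  shows "{a + b |a b. a \<in> coset N x \<and> b \<in> coset N y} = coset N (x + y)"
proof (intro equalityI subsetI)
  fix z assume "z \<in> {a + b |a b. a \<in> coset N x \<and> b \<in> coset N y}"
  then obtain c e where "c \<in> N" "e \<in> N" "z = (x + c) + (y + e)" by (auto simp: coset_def)
  then have "z = (x + y) + (c + e)" "c + e \<in> N" using subspace_add[OF N] by (auto simp: algebra_simps)
  then show "z \<in> coset N (x + y)" by (auto simp: coset_def)
next
  fix z assume "z \<in> coset N (x + y)"
  then obtain c where "c \<in> N" "z = (x + 0) + (y + c)" by (auto simp: coset_def algebra_simps)
  then show "z \<in> {a + b |a b. a \<in> coset N x \<and> b \<in> coset N y}"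
    using subspace_0[OF N] by (fastforce simp: coset_def)
qed

lemma coset_image:
  assumes N: "subspace N" and f: "\<And>b. b \<in> N \<Longrightarrow> \<exists>b'\<in>N. f (x + b) = f x + b'"
  shows "{f z + b |z b. z \<in> coset N x \<and> b \<in> N} = coset N (f x)"
proof (intro equalityI subsetI)
  fix w assume "w \<in> {f z + b |z b. z \<in> coset N x \<and> b \<in> N}"
  then obtain c b where c: "c \<in> N" "b \<in> N" "w = f (x + c) + b" by (auto simp: coset_def)
  then obtain c' where "c' \<in> N" "w = f x + (c' + b)" using f[OF c(1)] by (auto simp: add.assoc)
  then show "w \<in> coset N (f x)" using subspace_add[OF N _ c(2)] by (auto simp: coset_def)
next
  fix w assume "w \<in> coset N (f x)"
  then obtain b where "b \<in> N" "w = f (x + 0) + b" by (auto simp: coset_def)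
  then show "w \<in> {f z + b |z b. z \<in> coset N x \<and> b \<in> N}"
    using subspace_0[OF N] by (fastforce simp: coset_def)
qed

end

text \<open>The comparison used for all three isomorphisms: if every class of \<open>M\<close> modulo \<open>N\<close> has exactly one representative \<open>\<phi> h\<close> with \<open>h\<close> in \<open>H\<close>,
then \<open>H\<close> is the quotient as a vector space. The two actions may differ by the scalar \<open>\<rho>\<close>, which is then the twist.\<close>

lemma coset_iso:
  fixes sM :: "complex \<Rightarrow> 'm::ab_group_add \<Rightarrow> 'm" and sN :: "complex \<Rightarrow> 'n::ab_group_add \<Rightarrow> 'n"
    and \<rho> :: "'x::ab_group_add \<Rightarrow> complex"
  assumes sN: "vector_space sN"
    and H: "is_lie_rep s br \<kk> (sub_rep sM aM H)"
    and N: "module.subspace sN N"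
    and phi: "\<And>x. x \<in> H \<Longrightarrow> \<phi> x \<in> M" "\<And>x y. x \<in> H \<Longrightarrow> y \<in> H \<Longrightarrow> \<phi> (x + y) = \<phi> x + \<phi> y"
      "\<And>c x. x \<in> H \<Longrightarrow> \<phi> (sM c x) = sN c (\<phi> x)"
    and surj: "\<And>x. x \<in> M \<Longrightarrow> \<exists>h\<in>H. \<exists>b\<in>N. x = \<phi> h + b"
    and inj: "\<And>x y. x \<in> H \<Longrightarrow> y \<in> H \<Longrightarrow> \<phi> x - \<phi> y \<in> N \<Longrightarrow> x = y"
    and act: "\<And>X x. X \<in> \<kk> \<Longrightarrow> x \<in> H \<Longrightarrow> \<phi> (aM X x) = aN X (\<phi> x) + sN (\<rho> X) (\<phi> x)"
    and stable: "\<And>X x b. X \<in> \<kk> \<Longrightarrow> x \<in> H \<Longrightarrow> b \<in> N \<Longrightarrow> \<exists>b'\<in>N. aN X (\<phi> x + b) = aN X (\<phi> x) + b'"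
    and kk: "\<And>X Y. X \<in> \<kk> \<Longrightarrow> Y \<in> \<kk> \<Longrightarrow> X + Y \<in> \<kk>" "\<And>c X. X \<in> \<kk> \<Longrightarrow> s c X \<in> \<kk>"
      "\<And>X Y. X \<in> \<kk> \<Longrightarrow> Y \<in> \<kk> \<Longrightarrow> br X Y \<in> \<kk>"
  shows "lie_rep_iso s br \<kk> (sub_rep sM aM H) (twist \<rho> (quotient_rep sN aN M N)) (\<lambda>h. coset N (\<phi> h))"
    and "(\<And>X. X \<in> \<kk> \<Longrightarrow> \<rho> X = 0) \<Longrightarrow>
      lie_rep_iso s br \<kk> (sub_rep sM aM H) (quotient_rep sN aN M N) (\<lambda>h. coset N (\<phi> h))"
proof -
  interpret N: vector_space sN by (rule sN)
  have closed: "sM c x \<in> H" if "x \<in> H" for c x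
    using H that unfolding is_lie_rep_def sub_rep_def by simp
  have bij: "bij_betw (\<lambda>h. coset N (\<phi> h)) H (coset N ` M)"
    unfolding bij_betw_def
  proof
    show "inj_on (\<lambda>h. coset N (\<phi> h)) H"
      by (rule inj_onI) (use inj N.coset_eq_iff[OF N] in blast)
    show "(\<lambda>h. coset N (\<phi> h)) ` H = coset N ` M"
    proof (intro equalityI subsetI)
      fix C assume "C \<in> coset N ` M"
      then obtain x where x: "x \<in> M" "C = coset N x" by blast
      then obtain h b where h: "h \<in> H" "b \<in> N" "x = \<phi> h + b" using surj by blast
      then have "C = coset N (\<phi> h)" using x N.coset_eq_iff[OF N, of x "\<phi> h"] by simp
      then show "C \<in> (\<lambda>h. coset N (\<phi> h)) ` H" using h by blast
    qed (use phi(1) in blast)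
  qed
  have q_add: "lie_rep.add (quotient_rep sN aN M N) (coset N x) (coset N y) = coset N (x + y)" for x y
    by (simp add: quotient_rep_def N.coset_add[OF N])
  have q_smul: "smul (quotient_rep sN aN M N) c (coset N x) = coset N (sN c x)" for c x
    unfolding quotient_rep_def lie_rep.simps
    by (rule N.coset_image[OF N]) (use N.subspace_scale[OF N] in \<open>auto simp: N.scale_right_distrib\<close>)
  have q_act: "lie_rep.act (quotient_rep sN aN M N) X (coset N (\<phi> x)) = coset N (aN X (\<phi> x))"
    if "X \<in> \<kk>" "x \<in> H" for X x
    unfolding quotient_rep_def lie_rep.simps
    by (rule N.coset_image[OF N]) (use stable[OF that] in blast)
  have q_space: "space (quotient_rep sN aN M N) = coset N ` M" by (simp add: quotient_rep_def)
  have t: "space (twist \<rho> Q) = space Q" "lie_rep.add (twist \<rho> Q) = lie_rep.add Q" "smul (twist \<rho> Q) = smul Q"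
    "lie_rep.act (twist \<rho> Q) X m = lie_rep.add Q (lie_rep.act Q X m) (smul Q (\<rho> X) m)" for Q :: "('x, 'q) lie_rep" and X m
    by (simp_all add: twist_def)
  have H': "space (sub_rep sM aM H) = H" "lie_rep.add (sub_rep sM aM H) = (+)" "smul (sub_rep sM aM H) = sM"
    "lie_rep.act (sub_rep sM aM H) = aM" by (simp_all add: sub_rep_def)
  show "lie_rep_iso s br \<kk> (sub_rep sM aM H) (twist \<rho> (quotient_rep sN aN M N)) (\<lambda>h. coset N (\<phi> h))"
    by (rule lie_rep_iso_transport[OF H])
      (simp_all add: t H' q_space bij q_add q_smul q_act phi(2,3) act kk)
  assume "\<And>X. X \<in> \<kk> \<Longrightarrow> \<rho> X = 0"
  then show "lie_rep_iso s br \<kk> (sub_rep sM aM H) (quotient_rep sN aN M N) (\<lambda>h. coset N (\<phi> h))"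
    by (intro lie_rep_iso_transport[OF H])
      (simp_all add: t H' q_space bij q_add q_smul q_act phi(2,3) act kk)
qed

section \<open>Equivariance and the Laplacian\<close>

context polarized_module
begin

text \<open>The action of \<open>\<kk>\<close> on \<open>V \<otimes> \<And>\<pp>\<^sup>+\<close> through \<open>V\<close> and the adjoint action. The spin action exceeds it by the scalar \<open>\<rho>\<close>.\<close>

definition k_act where "k_act X T = (\<pi> X \<circ> T) + ad_op X T"

lemma pi_comp_add: "\<pi> (X + Y) \<circ> T = (\<pi> X \<circ> T) + (\<pi> Y \<circ> T)"
  by (simp add: fun_eq_iff pi_add)

lemma pi_comp_scale: "\<pi> (s c X) \<circ> T = ts c (\<pi> X \<circ> T)"
  by (simp add: fun_eq_iff pi_scale)

lemma pi_comp_sum: "\<pi> (\<Sum>i\<in>A. f i) \<circ> T = (\<Sum>i\<in>A. \<pi> (f i) \<circ> T)"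
  by (simp add: fun_eq_iff pi_sum sum_fun_apply)

lemma pi_comp_bracket: "\<pi> X \<circ> (\<pi> Y \<circ> T) = (\<pi> Y \<circ> (\<pi> X \<circ> T)) + (\<pi> (br X Y) \<circ> T)"
  by (simp add: fun_eq_iff pi_bracket)

lemma ad_op_zero [simp]: "ad_op X 0 = 0"
  using ad_op_scale[of X 0 0] by simp

lemma ad_op_sum: "ad_op X (\<Sum>i\<in>A. f i) = (\<Sum>i\<in>A. ad_op X (f i))"
  by (induct A rule: infinite_finite_induct)
    (simp_all only: sum.infinite sum.empty sum.insert ad_op_add ad_op_zero not_False_eq_True)

lemma ad_op_comp: "\<pi> Y \<circ> ad_op X T = ad_op X (\<pi> Y \<circ> T)"
  unfolding ad_op_def
  by (simp only: comp_sum[OF pi_linear] comp_ts[OF pi_linear] comp_cre[OF pi_linear] comp_ann[OF pi_linear])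

lemma cre_wedge_op: "i < n \<Longrightarrow> cre i T = wedge_op (u i) T"
proof -
  assume i: "i < n"
  have "wedge_op (u i) T = (\<Sum>j<n. if j = i then cre j T else 0)"
    unfolding wedging_def using dual i by (intro sum.cong refl) auto
  then show ?thesis using i by simp
qed

lemma ad_op_cre: "i < n \<Longrightarrow> ad_op X (cre i T) = cre i (ad_op X T) + wedge_op (br X (u i)) T"
  unfolding cre_wedge_op by (rule ad_op_wedge_op[OF u_mem])

lemma ad_op_ann: "X \<in> kk \<Longrightarrow> i < n \<Longrightarrow> ad_op X (ann i T) = ann i (ad_op X T) + interior (br X (us i)) T"
proof -
  assume X: "X \<in> kk" and i: "i < n"
  have "ann i (ad_op X T) = ad_op X (ann i T) - interior (br X (us i)) T"
    using interior_ad_op[OF X, of "us i" T] by (simp only: interior_us[OF i])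
  then show ?thesis by (simp only: diff_add_cancel)
qed

lemma bracket_dual_m:
  assumes "X \<in> kk" "j < n"
  shows "(\<Sum>i<n. s (B (br X (u i)) (us j)) (us i)) = - br X (us j)"
proof -
  have "br X (us j) = (\<Sum>i<n. s (B (u i) (br X (us j))) (us i))"
    by (rule expand_m[OF k_m[OF assms(1) us[OF assms(2)]]])
  also have "\<dots> = - (\<Sum>i<n. s (B (br X (u i)) (us j)) (us i))"
    by (simp add: B_skew sum_negf)
  finally show ?thesis by (metis minus_minus)
qed

lemma bracket_dual_p:
  assumes "X \<in> kk" "j < n"
  shows "(\<Sum>i<n. s (B (br X (us i)) (u j)) (u i)) = - br X (u j)"
proof -
  have "br X (u j) = (\<Sum>i<n. s (B (br X (u j)) (us i)) (u i))"
    by (rule expand_p[OF k_p[OF assms(1) u_mem[OF assms(2)]]])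
  also have "\<dots> = - (\<Sum>i<n. s (B (br X (us i)) (u j)) (u i))"
    using B_sym[of "u j"] by (simp add: B_skew sum_negf)
  finally show ?thesis by (metis minus_minus)
qed

text \<open>The element \<open>\<Sum>\<^sub>i u\<^sub>i\<^sup>* \<otimes> u\<^sub>i\<close> is invariant under \<open>\<kk>\<close>, since the two bases are dual under an invariant form. The same holds for
\<open>\<delta>\<close> below.\<close>

lemma dd_k_act:
  assumes X: "X \<in> kk"
  shows "k_act X (dd T) = dd (k_act X T)"
proof -
  have cancel: "(\<Sum>i<n. wedge_op (br X (u i)) (\<pi> (us i) \<circ> T)) = - (\<Sum>j<n. cre j (\<pi> (br X (us j)) \<circ> T))"
  proof -
    have "(\<Sum>i<n. wedge_op (br X (u i)) (\<pi> (us i) \<circ> T)) =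
        (\<Sum>j<n. \<Sum>i<n. ts (B (br X (u i)) (us j)) (cre j (\<pi> (us i) \<circ> T)))"
      unfolding wedging_def by (rule sum.swap)
    also have "\<dots> = (\<Sum>j<n. cre j (\<pi> (- br X (us j)) \<circ> T))"
    proof (intro sum.cong refl)
      fix j assume "j \<in> {..<n}"
      then show "(\<Sum>i<n. ts (B (br X (u i)) (us j)) (cre j (\<pi> (us i) \<circ> T))) = cre j (\<pi> (- br X (us j)) \<circ> T)"
        using bracket_dual_m[OF X, of j]
        by (simp only: cre_scale[symmetric] cre_sum[symmetric] pi_comp_scale[symmetric] pi_comp_sum[symmetric] lessThan_iff)
    qed
    also have "\<dots> = - (\<Sum>j<n. cre j (\<pi> (br X (us j)) \<circ> T))"
    proof -
      have "\<pi> (- Y) \<circ> T = - (\<pi> Y \<circ> T)" for Y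
        using pi_comp_scale[of "-1" Y T] by simp
      then show ?thesis by (simp only: cre_minus sum_negf)
    qed
    finally show ?thesis .
  qed
  have "k_act X (dd T) = (\<Sum>i<n. cre i (\<pi> X \<circ> (\<pi> (us i) \<circ> T)) +
      (cre i (ad_op X (\<pi> (us i) \<circ> T)) + wedge_op (br X (u i)) (\<pi> (us i) \<circ> T)))"
    unfolding k_act_def dd_def comp_sum[OF pi_linear] ad_op_sum sum.distrib[symmetric]
    by (intro sum.cong refl) (simp add: comp_cre[OF pi_linear] ad_op_cre)
  also have "\<dots> = (\<Sum>i<n. cre i (\<pi> (us i) \<circ> (\<pi> X \<circ> T)) + cre i (\<pi> (br X (us i)) \<circ> T) +
      (cre i (\<pi> (us i) \<circ> ad_op X T) + wedge_op (br X (u i)) (\<pi> (us i) \<circ> T)))"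
    by (simp only: pi_comp_bracket[of X] cre_add ad_op_comp)
  also have "\<dots> = (\<Sum>i<n. cre i (\<pi> (us i) \<circ> (\<pi> X \<circ> T)) + cre i (\<pi> (us i) \<circ> ad_op X T))"
    by (simp only: sum.distrib cancel) (simp add: algebra_simps)
  also have "\<dots> = dd (k_act X T)"
    unfolding dd_def k_act_def by (simp only: comp_add[OF pi_linear] cre_add)
  finally show ?thesis .
qed

lemma dl_k_act:
  assumes X: "X \<in> kk"
  shows "k_act X (dl T) = dl (k_act X T)"
proof -
  have cancel: "(\<Sum>i<n. ts 2 (interior (br X (us i)) (\<pi> (u i) \<circ> T))) = - (\<Sum>j<n. ts 2 (ann j (\<pi> (br X (u j)) \<circ> T)))"
  proof -
    have "(\<Sum>i<n. ts 2 (interior (br X (us i)) (\<pi> (u i) \<circ> T))) =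
        (\<Sum>i<n. \<Sum>j<n. ts 2 (ts (B (br X (us i)) (u j)) (ann j (\<pi> (u i) \<circ> T))))"
      unfolding interior_def contraction_def tw.scale_sum_right ..
    also have "\<dots> = (\<Sum>j<n. \<Sum>i<n. ts 2 (ts (B (br X (us i)) (u j)) (ann j (\<pi> (u i) \<circ> T))))"
      by (rule sum.swap)
    also have "\<dots> = (\<Sum>j<n. ts 2 (ann j (\<pi> (- br X (u j)) \<circ> T)))"
    proof (intro sum.cong refl)
      fix j assume "j \<in> {..<n}"
      then have "(\<Sum>i<n. ts (B (br X (us i)) (u j)) (ann j (\<pi> (u i) \<circ> T))) = ann j (\<pi> (- br X (u j)) \<circ> T)"
        using bracket_dual_p[OF X, of j]
        by (simp only: ann_scale[symmetric] ann_sum[symmetric] pi_comp_scale[symmetric] pi_comp_sum[symmetric] lessThan_iff)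
      then show "(\<Sum>i<n. ts 2 (ts (B (br X (us i)) (u j)) (ann j (\<pi> (u i) \<circ> T)))) = ts 2 (ann j (\<pi> (- br X (u j)) \<circ> T))"
        by (simp only: tw.scale_sum_right[symmetric])
    qed
    also have "\<dots> = - (\<Sum>j<n. ts 2 (ann j (\<pi> (br X (u j)) \<circ> T)))"
    proof -
      have "\<pi> (- Y) \<circ> T = - (\<pi> Y \<circ> T)" for Y
        using pi_comp_scale[of "-1" Y T] by simp
      then show ?thesis by (simp only: ann_minus tw.scale_minus_right sum_negf)
    qed
    finally show ?thesis .
  qed
  have "k_act X (dl T) = (\<Sum>i<n. ts 2 (ann i (\<pi> X \<circ> (\<pi> (u i) \<circ> T))) +
      (ts 2 (ann i (ad_op X (\<pi> (u i) \<circ> T))) + ts 2 (interior (br X (us i)) (\<pi> (u i) \<circ> T))))"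
    unfolding k_act_def dl_def comp_sum[OF pi_linear] ad_op_sum sum.distrib[symmetric]
    by (intro sum.cong refl)
      (simp add: comp_ts[OF pi_linear] comp_ann[OF pi_linear] ad_op_scale ad_op_ann[OF X] tw.scale_right_distrib)
  also have "\<dots> = (\<Sum>i<n. ts 2 (ann i (\<pi> (u i) \<circ> (\<pi> X \<circ> T))) + ts 2 (ann i (\<pi> (br X (u i)) \<circ> T)) +
      (ts 2 (ann i (\<pi> (u i) \<circ> ad_op X T)) + ts 2 (interior (br X (us i)) (\<pi> (u i) \<circ> T))))"
    by (simp only: pi_comp_bracket[of X] ann_add ad_op_comp tw.scale_right_distrib)
  also have "\<dots> = (\<Sum>i<n. ts 2 (ann i (\<pi> (u i) \<circ> (\<pi> X \<circ> T))) + ts 2 (ann i (\<pi> (u i) \<circ> ad_op X T)))"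
    by (simp only: sum.distrib cancel) (simp add: algebra_simps)
  also have "\<dots> = dl (k_act X T)"
    unfolding dl_def k_act_def by (simp only: comp_add[OF pi_linear] ann_add tw.scale_right_distrib)
  finally show ?thesis .
qed

lemma k_act_add: "k_act X (T + T') = k_act X T + k_act X T'"
  by (simp add: k_act_def comp_add[OF pi_linear] ad_op_add algebra_simps)

lemma k_act_scale: "k_act X (ts c T) = ts c (k_act X T)"
  by (simp add: k_act_def comp_ts[OF pi_linear] ad_op_scale tw.scale_right_distrib)

lemma ad_op_add_left: "ad_op (X + Y) T = ad_op X T + ad_op Y T"
  by (simp add: ad_op_def g.bracket_add_left B_add_left tw.scale_left_distrib sum.distrib)

lemma ad_op_scale_left: "ad_op (s c X) T = ts c (ad_op X T)"
  by (simp add: ad_op_def g.bracket_scale_left B_scale_left tw.scale_sum_right)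

lemma k_act_add_left: "k_act (X + Y) T = k_act X T + k_act Y T"
  by (simp add: k_act_def pi_comp_add ad_op_add_left algebra_simps)

lemma k_act_scale_left: "k_act (s c X) T = ts c (k_act X T)"
  by (simp add: k_act_def pi_comp_scale ad_op_scale_left tw.scale_right_distrib)

lemma wedge_op_add_left: "wedge_op (p + q) T = wedge_op p T + wedge_op q T"
  by (simp add: wedging_def B_add_left tw.scale_left_distrib sum.distrib)

lemma wedge_op_minus_left: "wedge_op (- p) T = - wedge_op p T"
  by (simp add: wedging_def B_minus sum_negf)

text \<open>Computed on generators: commuting \<open>X\<close> past the creation and annihilation operators in the action of \<open>Y\<close> leaves the action of
\<open>[X, Y]\<close> and terms that cancel by duality of the bases.\<close>

lemma ad_op_bracket:
  assumes X: "X \<in> kk" and Y: "Y \<in> kk"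
  shows "ad_op X (ad_op Y T) = ad_op Y (ad_op X T) + ad_op (br X Y) T"
proof -
  have swap: "(\<Sum>i<n. wedge_op (br Y (u i)) (interior (br X (us i)) T)) = - (\<Sum>j<n. wedge_op (br Y (br X (u j))) (ann j T))"
  proof -
    have "(\<Sum>i<n. wedge_op (br Y (u i)) (interior (br X (us i)) T)) =
        (\<Sum>i<n. \<Sum>j<n. ts (B (br X (us i)) (u j)) (wedge_op (br Y (u i)) (ann j T)))"
      unfolding interior_def contraction_def crv_sum crv_scale ..
    also have "\<dots> = (\<Sum>j<n. \<Sum>i<n. ts (B (br X (us i)) (u j)) (wedge_op (br Y (u i)) (ann j T)))"
      by (rule sum.swap)
    also have "\<dots> = (\<Sum>j<n. - wedge_op (br Y (br X (u j))) (ann j T))"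
    proof (intro sum.cong refl)
      fix j assume j: "j \<in> {..<n}"
      have "(\<Sum>i<n. s (B (br X (us i)) (u j)) (br Y (u i))) = br Y (\<Sum>i<n. s (B (br X (us i)) (u j)) (u i))"
        by (simp add: br_sum_right g.bracket_scale_right)
      also have "\<dots> = br Y (- br X (u j))" using bracket_dual_p[OF X, of j] j by simp
      also have "\<dots> = - br Y (br X (u j))"
        using g.bracket_scale_right[of Y "-1" "br X (u j)"] by simp
      finally show "(\<Sum>i<n. ts (B (br X (us i)) (u j)) (wedge_op (br Y (u i)) (ann j T))) =
          - wedge_op (br Y (br X (u j))) (ann j T)"
        by (simp only: wedge_op_sum[symmetric] wedge_op_minus_left)
    qed
    finally show ?thesis by (simp only: sum_negf)
  qed
  have jac: "br X (br Y z) = br Y (br X z) + br (br X Y) z" for z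
  proof -
    have "br X (br Y z) + br Y (br z X) + br z (br X Y) = 0" by (rule g.jacobi)
    moreover have "br Y (br z X) = - br Y (br X z)"
      using br_antisym[of z X] g.bracket_scale_right[of Y "-1" "br X z"] by simp
    moreover have "br z (br X Y) = - br (br X Y) z" by (rule br_antisym)
    ultimately show ?thesis by (simp add: algebra_simps)
  qed
  have "ad_op X (ad_op Y T) = (\<Sum>i<n. wedge_op (br Y (u i)) (ad_op X (ann i T)) + wedge_op (br X (br Y (u i))) (ann i T))"
    unfolding ad_op_wedge_ann[of Y] ad_op_sum
    by (intro sum.cong refl) (simp add: ad_op_wedge_op[OF k_p[OF Y u_mem]])
  also have "\<dots> = (\<Sum>i<n. (wedge_op (br Y (u i)) (ann i (ad_op X T)) + wedge_op (br Y (u i)) (interior (br X (us i)) T))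
      + (wedge_op (br Y (br X (u i))) (ann i T) + wedge_op (br (br X Y) (u i)) (ann i T)))"
    by (intro sum.cong refl) (simp only: lessThan_iff ad_op_ann[OF X] crv_add jac[of "u _"] wedge_op_add_left)
  also have "\<dots> = ad_op Y (ad_op X T) + ad_op (br X Y) T"
    by (simp only: sum.distrib swap ad_op_wedge_ann) (simp add: algebra_simps)
  finally show ?thesis .
qed

lemma k_act_bracket:
  assumes X: "X \<in> kk" and Y: "Y \<in> kk"
  shows "k_act (br X Y) T + k_act Y (k_act X T) = k_act X (k_act Y T)"
proof -
  have expand: "k_act X (k_act Y T) =
      ((\<pi> X \<circ> (\<pi> Y \<circ> T)) + ad_op Y (\<pi> X \<circ> T)) + (ad_op X (\<pi> Y \<circ> T) + ad_op X (ad_op Y T))" for X Y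
    by (simp only: k_act_def comp_add[OF pi_linear] ad_op_add ad_op_comp)
  have rearrange: "(p + q) + ((a + b) + (c + d)) = ((a + p) + c) + (b + (d + q))"
    for a b c d p q :: "nat set \<Rightarrow> 'v"
    by (simp add: algebra_simps)
  show ?thesis
    unfolding expand[of X Y] expand[of Y X] pi_comp_bracket[of X Y] ad_op_bracket[OF X Y] k_act_def[of "br X Y"]
    by (rule rearrange)
qed

lemma half_trace_linear:
  assumes "X \<in> kk" "Y \<in> kk"
  shows "half_trace_ad s br Pm (X + Y) = half_trace_ad s br Pm X + half_trace_ad s br Pm Y"
    and "half_trace_ad s br Pm (s c X) = c * half_trace_ad s br Pm X"
  using assms g.subspace_add[OF kk(1)] g.subspace_scale[OF kk(1)]
  by (simp_all add: half_trace g.bracket_add_left g.bracket_scale_left B_add_left B_scale_left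
      sum.distrib add_divide_distrib sum_distrib_left)

lemma half_trace_bracket:
  assumes X: "X \<in> kk" and Y: "Y \<in> kk"
  shows "half_trace_ad s br Pm (br X Y) = 0"
proof -
  have prod: "(\<Sum>i<n. B (br X (br Y (u i))) (us i)) = (\<Sum>i<n. \<Sum>j<n. B (br Y (u i)) (us j) * B (br X (u j)) (us i))"
    if X: "X \<in> kk" and Y: "Y \<in> kk" for X Y
  proof (intro sum.cong refl)
    fix i assume "i \<in> {..<n}"
    then have "br Y (u i) = (\<Sum>j<n. s (B (br Y (u i)) (us j)) (u j))"
      by (intro expand_p k_p[OF Y] u_mem) simp
    then have "br X (br Y (u i)) = br X (\<Sum>j<n. s (B (br Y (u i)) (us j)) (u j))" by (rule arg_cong)
    then show "B (br X (br Y (u i))) (us i) = (\<Sum>j<n. B (br Y (u i)) (us j) * B (br X (u j)) (us i))"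
      by (simp only: br_sum_right g.bracket_scale_right B_sum_left B_scale_left)
  qed
  have sym: "(\<Sum>i<n. B (br X (br Y (u i))) (us i)) = (\<Sum>i<n. B (br Y (br X (u i))) (us i))"
    unfolding prod[OF X Y] prod[OF Y X] by (subst sum.swap) (simp add: mult.commute)
  have jac: "br (br X Y) z = br X (br Y z) + - br Y (br X z)" for z
  proof -
    have "br X (br Y z) + br Y (br z X) + br z (br X Y) = 0" by (rule g.jacobi)
    moreover have "br Y (br z X) = - br Y (br X z)"
      using br_antisym[of z X] g.bracket_scale_right[of Y "-1" "br X z"] by simp
    moreover have "br z (br X Y) = - br (br X Y) z" by (rule br_antisym)
    ultimately show ?thesis by (simp add: algebra_simps)
  qed
  show ?thesis
    unfolding half_trace[OF kk(2)[OF X Y]] jac B_add_left B_minus sum.distrib sum_negf sym by simp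
qed

lemma antisymmetric_sum_zero:
  assumes "\<And>i j. i < n \<Longrightarrow> j < n \<Longrightarrow> f i j = - (f j i :: nat set \<Rightarrow> 'v)"
  shows "(\<Sum>i<n. \<Sum>j<n. f i j) = 0"
proof -
  have "(\<Sum>i<n. \<Sum>j<n. f i j) = (\<Sum>j<n. \<Sum>i<n. f i j)" by (rule sum.swap)
  also have "\<dots> = (\<Sum>j<n. \<Sum>i<n. - f j i)"
    by (intro sum.cong refl) (rule assms, simp_all)
  also have "\<dots> = - (\<Sum>j<n. \<Sum>i<n. f j i)"
    by (simp only: sum_negf)
  finally have "(\<Sum>i<n. \<Sum>j<n. f i j) + (\<Sum>i<n. \<Sum>j<n. f i j) = 0" by (simp only: eq_neg_iff_add_eq_0)
  then have "ts 2 (\<Sum>i<n. \<Sum>j<n. f i j) = 0"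
    by (metis one_add_one tw.scale_left_distrib tw.scale_one)
  then show ?thesis by (metis tw.scale_eq_0_iff zero_neq_numeral)
qed

lemma dd_dd: "dd (dd T) = 0"
proof -
  have "dd (dd T) = (\<Sum>i<n. \<Sum>j<n. cre i (cre j (\<pi> (us i) \<circ> (\<pi> (us j) \<circ> T))))"
    unfolding dd_def by (simp only: comp_sum[OF pi_linear] cre_sum comp_cre[OF pi_linear])
  also have "\<dots> = 0"
  proof (rule antisymmetric_sum_zero)
    fix i j assume "i < n" "j < n"
    then have "br (us i) (us j) = 0" by (intro ab_m us)
    then have "\<pi> (us i) \<circ> (\<pi> (us j) \<circ> T) = \<pi> (us j) \<circ> (\<pi> (us i) \<circ> T)"
      using pi_bracket[of "us i" "us j"] by (simp add: fun_eq_iff)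
    then show "cre i (cre j (\<pi> (us i) \<circ> (\<pi> (us j) \<circ> T))) = - cre j (cre i (\<pi> (us j) \<circ> (\<pi> (us i) \<circ> T)))"
      by (simp only: cre_cre[of i])
  qed
  finally show ?thesis .
qed

lemma dl_dl: "dl (dl T) = 0"
proof -
  have "dl (dl T) = (\<Sum>i<n. \<Sum>j<n. ts 2 (ts 2 (ann i (ann j (\<pi> (u i) \<circ> (\<pi> (u j) \<circ> T))))))"
    unfolding dl_def
    by (simp only: comp_sum[OF pi_linear] ann_sum comp_ann[OF pi_linear] comp_ts[OF pi_linear] ann_scale tw.scale_sum_right)
  also have "\<dots> = 0"
  proof (rule antisymmetric_sum_zero)
    fix i j assume "i < n" "j < n"
    then have "br (u i) (u j) = 0" by (intro ab_p u_mem)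
    then have "\<pi> (u i) \<circ> (\<pi> (u j) \<circ> T) = \<pi> (u j) \<circ> (\<pi> (u i) \<circ> T)"
      using pi_bracket[of "u i" "u j"] by (simp add: fun_eq_iff)
    then show "ts 2 (ts 2 (ann i (ann j (\<pi> (u i) \<circ> (\<pi> (u j) \<circ> T))))) = - ts 2 (ts 2 (ann j (ann i (\<pi> (u j) \<circ> (\<pi> (u i) \<circ> T)))))"
      by (simp only: ann_ann[of i] tw.scale_minus_right)
  qed
  finally show ?thesis .
qed

text \<open>The anticommutation relations leave two kinds of terms: commutators \<open>[u\<^sub>i\<^sup>*, u\<^sub>j] \<in> \<kk>\<close> acting on \<open>V\<close>, and the terms with
\<open>i = j\<close> from the contraction of \<open>u\<^sub>i\<close> with \<open>u\<^sub>i\<^sup>*\<close>.\<close>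

lemma laplacian:
  "dd (dl T) + dl (dd T) = (\<Sum>i<n. \<Sum>j<n. ts 2 (cre i (ann j (\<pi> (br (us i) (u j)) \<circ> T))))
    + ts 2 (\<Sum>i<n. \<pi> (u i) \<circ> (\<pi> (us i) \<circ> T))"
proof -
  have 1: "dd (dl T) = (\<Sum>i<n. \<Sum>j<n. ts 2 (cre i (ann j (\<pi> (us i) \<circ> (\<pi> (u j) \<circ> T)))))"
    unfolding dl_def dd_def
    by (simp only: comp_sum[OF pi_linear] cre_sum comp_ann[OF pi_linear] comp_ts[OF pi_linear] cre_scale)
  have "dl (dd T) = (\<Sum>j<n. \<Sum>i<n. ts 2 (ann j (cre i (\<pi> (u j) \<circ> (\<pi> (us i) \<circ> T)))))"
    unfolding dl_def dd_def
    by (simp only: comp_sum[OF pi_linear] ann_sum comp_cre[OF pi_linear] tw.scale_sum_right)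
  also have "\<dots> = (\<Sum>i<n. \<Sum>j<n. ts 2 (ann j (cre i (\<pi> (u j) \<circ> (\<pi> (us i) \<circ> T)))))"
    by (rule sum.swap)
  also have "\<dots> = (\<Sum>i<n. \<Sum>j<n. (if j = i then ts 2 (\<pi> (u j) \<circ> (\<pi> (us i) \<circ> T)) else 0) -
      ts 2 (cre i (ann j (\<pi> (u j) \<circ> (\<pi> (us i) \<circ> T)))))"
    by (intro sum.cong refl) (simp add: ann_cre tw.scale_right_diff_distrib)
  also have "\<dots> = (\<Sum>i<n. ts 2 (\<pi> (u i) \<circ> (\<pi> (us i) \<circ> T))) -
      (\<Sum>i<n. \<Sum>j<n. ts 2 (cre i (ann j (\<pi> (u j) \<circ> (\<pi> (us i) \<circ> T)))))"
    by (simp add: sum_subtractf)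
  finally have 2: "dl (dd T) = (\<Sum>i<n. ts 2 (\<pi> (u i) \<circ> (\<pi> (us i) \<circ> T))) -
      (\<Sum>i<n. \<Sum>j<n. ts 2 (cre i (ann j (\<pi> (u j) \<circ> (\<pi> (us i) \<circ> T)))))" .
  have 3: "ts 2 (cre i (ann j (\<pi> (us i) \<circ> (\<pi> (u j) \<circ> T)))) = ts 2 (cre i (ann j (\<pi> (u j) \<circ> (\<pi> (us i) \<circ> T)))) +
      ts 2 (cre i (ann j (\<pi> (br (us i) (u j)) \<circ> T)))" for i j
    by (simp only: pi_comp_bracket[of "us i"] ann_add cre_add tw.scale_right_distrib)
  show ?thesis
    unfolding 1 2 3 sum.distrib tw.scale_sum_right by (simp add: algebra_simps)
qed

lemma dd_add: "dd (T + T') = dd T + dd T'"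
  by (simp add: dd_def comp_add[OF pi_linear] cre_add sum.distrib)

lemma dd_scale: "dd (ts c T) = ts c (dd T)"
  by (simp add: dd_def comp_ts[OF pi_linear] cre_scale tw.scale_sum_right)

lemma dl_add: "dl (T + T') = dl T + dl T'"
  by (simp add: dl_def comp_add[OF pi_linear] ann_add sum.distrib tw.scale_right_distrib)

lemma dl_scale: "dl (ts c T) = ts c (dl T)"
  by (simp add: dl_def comp_ts[OF pi_linear] ann_scale tw.scale_sum_right mult.commute)

end

section \<open>Adjointness on unitary modules\<close>

text \<open>\<open>\<sigma>\<close> is the conjugation of \<open>\<gg>\<close> with respect to \<open>\<gg>\<^sub>0\<close>; \<open>skew\<close> is the complex-linear extension of the condition that \<open>\<gg>\<^sub>0\<close> acts by
skew-Hermitian operators. The finiteness property \<open>finite_stable\<close> is proved below for irreducible modules.\<close>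

locale unitary_polarized_module = polarized_module s br B kk Pp Pm u us n sV \<pi> + hermitian_space sV h
  for s :: "complex \<Rightarrow> 'x::ab_group_add \<Rightarrow> 'x" and br :: "'x \<Rightarrow> 'x \<Rightarrow> 'x"
    and B :: "'x \<Rightarrow> 'x \<Rightarrow> complex" and kk Pp Pm :: "'x set" and u us :: "nat \<Rightarrow> 'x" and n :: nat
    and sV :: "complex \<Rightarrow> 'v::ab_group_add \<Rightarrow> 'v" and \<pi> :: "'x \<Rightarrow> 'v \<Rightarrow> 'v" and h +
  fixes \<sigma> :: "'x \<Rightarrow> 'x"
  assumes sigma_add: "\<sigma> (x + y) = \<sigma> x + \<sigma> y" and sigma_scale: "\<sigma> (s c x) = s (cnj c) (\<sigma> x)"
    and sigma_sigma: "\<sigma> (\<sigma> x) = x" and B_sigma: "B (\<sigma> x) (\<sigma> y) = cnj (B x y)"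
    and sigma_p: "x \<in> Pp \<Longrightarrow> \<sigma> x \<in> Pm" and sigma_m: "x \<in> Pm \<Longrightarrow> \<sigma> x \<in> Pp"
    and B_pos: "x \<in> Pp \<Longrightarrow> x \<noteq> 0 \<Longrightarrow> 0 < Re (B x (\<sigma> x))"
    and skew: "h (\<pi> X v) w = - h v (\<pi> (\<sigma> X) w)"
    and br_pm: "x \<in> Pm \<Longrightarrow> y \<in> Pp \<Longrightarrow> br x y \<in> kk"
    and finite_stable: "finite A \<Longrightarrow> \<exists>C. finite C \<and> A \<subseteq> span C \<and>
      (\<forall>X\<in>kk. \<forall>v\<in>span C. \<pi> X v \<in> span C) \<and> (\<forall>v\<in>span C. (\<Sum>i<n. \<pi> (u i) (\<pi> (us i) v)) \<in> span C)"
begin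

text \<open>The Hermitian form on \<open>\<pp>\<^sup>+\<close> that the form on \<open>V \<otimes> \<And>\<pp>\<^sup>+\<close> is built from.\<close>

definition "hb x y = B x (\<sigma> y)"

lemma sesquilinear_hb: "sesquilinear_space s hb"
proof unfold_locales
  show "hb (x + y) z = hb x z + hb y z" for x y z by (simp add: hb_def B_add_left)
  show "hb (s c x) z = c * hb x z" for c x z by (simp add: hb_def B_scale_left)
  show "hb y x = cnj (hb x y)" for x y
    using B_sigma[of x "\<sigma> y"] by (simp add: hb_def sigma_sigma B_sym)
qed

lemma expand_sigma:
  assumes "x \<in> Pp"
  shows "x = (\<Sum>i<n. s (hb x (u i)) (\<sigma> (us i)))"
proof -
  have sum: "\<sigma> (\<Sum>i\<in>A. f i) = (\<Sum>i\<in>A. \<sigma> (f i))" for A and f :: "nat \<Rightarrow> 'x"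
  proof -
    have "\<sigma> 0 = 0" using sigma_scale[of 0 0] by simp
    then show ?thesis by (induct A rule: infinite_finite_induct) (simp_all add: sigma_add)
  qed
  have "\<sigma> x = (\<Sum>i<n. s (B (u i) (\<sigma> x)) (us i))" by (rule expand_m[OF sigma_p[OF assms]])
  then have "\<sigma> (\<sigma> x) = \<sigma> (\<Sum>i<n. s (B (u i) (\<sigma> x)) (us i))" by (rule arg_cong)
  then have "x = (\<Sum>i<n. s (cnj (B (u i) (\<sigma> x))) (\<sigma> (us i)))"
    by (simp only: sigma_sigma sum sigma_scale)
  moreover have "cnj (B (u i) (\<sigma> x)) = hb x (u i)" for i
    using B_sigma[of "u i" "\<sigma> x"] by (simp add: hb_def sigma_sigma B_sym)
  ultimately show ?thesis by simp
qed

text \<open>Gram-Schmidt for the Hermitian form on \<open>\<pp>\<^sup>+\<close> writes the Gram matrix of \<open>u\<close> as needed by the form on tensors: \<open>a k i\<close> is the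
\<open>k\<close>-th coordinate of \<open>u\<^sub>i\<close> in an orthonormal basis.\<close>

lemma cholesky:
  obtains a m where "\<And>i l. i < n \<Longrightarrow> l < n \<Longrightarrow> hb (u l) (u i) = (\<Sum>k<n. a k l * cnj (a k i))"
    and "\<And>i j. i < n \<Longrightarrow> j < n \<Longrightarrow> (\<Sum>k<n. m i k * a k j) = (if i = j then 1 else 0)"
proof -
  interpret H: sesquilinear_space s hb by (rule sesquilinear_hb)
  have "\<exists>e. (\<forall>k<n. e k \<in> g.span (u ` {..<n})) \<and>
    (\<forall>j<n. \<forall>k<n. hb (e j) (e k) = (if j = k \<and> e j \<noteq> 0 then 1 else 0)) \<and>
    (\<forall>i<n. u i = (\<Sum>k<n. s (hb (u i) (e k)) (e k)))"
    by (rule H.gram_schmidt) (use B_pos u(3) in \<open>simp add: hb_def\<close>)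
  then obtain e where e: "\<And>i. i < n \<Longrightarrow> u i = (\<Sum>k<n. s (hb (u i) (e k)) (e k))" by blast
  define a where "a k i = hb (u i) (e k)" for k i
  have H: "hb (u l) (u i) = (\<Sum>k<n. a k l * cnj (a k i))" if "i < n" "l < n" for i l
  proof -
    have "hb (u l) (u i) = hb (\<Sum>k<n. s (hb (u l) (e k)) (e k)) (u i)" using e[OF that(2)] by simp
    also have "\<dots> = (\<Sum>k<n. a k l * hb (e k) (u i))"
      by (simp only: H.F_sum_left H.F_scale_left a_def)
    also have "\<dots> = (\<Sum>k<n. a k l * cnj (a k i))"
      unfolding a_def by (intro sum.cong refl) (simp only: H.F_sym[of "e _"])
    finally show ?thesis .
  qed
  (* The Gram matrix of the dual basis is inverse to that of u; composing it with the adjoint of a inverts a. *)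
  define N where "N j i = B (\<sigma> (us j)) (us i)" for i j
  define m where "m i k = (\<Sum>j<n. cnj (a k j) * N j i)" for i k
  have "(\<Sum>k<n. m i k * a k l) = (if i = l then 1 else 0)" if il: "i < n" "l < n" for i l
  proof -
    have "(\<Sum>k<n. m i k * a k l) = (\<Sum>k<n. \<Sum>j<n. a k l * cnj (a k j) * N j i)"
      by (simp add: m_def sum_distrib_left sum_distrib_right mult_ac)
    also have "\<dots> = (\<Sum>j<n. \<Sum>k<n. a k l * cnj (a k j) * N j i)" by (rule sum.swap)
    also have "\<dots> = (\<Sum>j<n. hb (u l) (u j) * N j i)"
      using il by (intro sum.cong refl) (simp add: H sum_distrib_right)
    also have "\<dots> = B (\<Sum>j<n. s (hb (u l) (u j)) (\<sigma> (us j))) (us i)"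
      by (simp add: B_sum_left B_scale_left N_def)
    also have "\<dots> = B (u l) (us i)" using expand_sigma[OF u_mem[OF il(2)]] by simp
    finally show ?thesis using dual[OF il(2,1)] by auto
  qed
  then show ?thesis using H that by blast
qed

lemma h_minus_right: "h v (- w) = - h v w"
proof -
  have "h (- w) v = - h w v" using h_scale_left[of "- 1" w v] by simp
  then show ?thesis using h_sym[of v "- w"] h_sym[of v w] by simp
qed

text \<open>The adjoint of \<open>u\<^sub>i\<^sup>* \<otimes> u\<^sub>i\<close> is \<open>- \<sigma>(u\<^sub>i\<^sup>*)\<close> on \<open>V\<close> together with the contraction with the functional \<open>hb _ u\<^sub>i\<close>. In the sum over \<open>i\<close>
the vectors \<open>\<sigma>(u\<^sub>i\<^sup>*)\<close> recombine to the basis \<open>u\<close> by \<open>expand_sigma\<close>, which gives \<open>- \<delta> / 2\<close>.\<close>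

lemma dd_adjoint:
  assumes H: "\<And>i l. i < n \<Longrightarrow> l < n \<Longrightarrow> hb (u l) (u i) = (\<Sum>k<n. a k l * cnj (a k i))"
    and Y: "Y \<in> tensor_space n"
  shows "tf n a (dd Y) Z = - tf n a Y (dl Z) / 2"
proof -
  interpret F: sesquilinear_space ts "tf n a"
    by unfold_locales (rule tf_add_left, rule tf_scale_left, rule tf_sym)
  have minus: "op_linear (\<lambda>v. - \<pi> (\<sigma> (us i)) v)" for i
    using pi_linear[of "\<sigma> (us i)"] by (simp add: op_linear_def)
  have "tf n a (dd Y) Z = (\<Sum>i<n. tf n a (cre i (\<pi> (us i) \<circ> Y)) Z)"
    unfolding dd_def by (rule F.F_sum_left)
  also have "\<dots> = (\<Sum>i<n. tf n a Y (\<Sum>l<n. ts (- hb (u l) (u i)) (ann l (\<pi> (\<sigma> (us i)) \<circ> Z))))"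
  proof (intro sum.cong refl)
    fix i assume i: "i \<in> {..<n}"
    let ?c = "\<lambda>l. \<Sum>k<n. cnj (a k i) * a k l"
    have "tf n a (cre i (\<pi> (us i) \<circ> Y)) Z = tf n a (\<pi> (us i) \<circ> Y) (ctr n ?c Z)"
      using i by (intro tf_adjoint comp_tensor_space Y) auto
    also have "\<dots> = tf n a Y ((\<lambda>v. - \<pi> (\<sigma> (us i)) v) \<circ> ctr n ?c Z)"
      by (rule tf_comp[OF pi_linear minus])
        (simp only: skew h_minus_right)
    also have "(\<lambda>v. - \<pi> (\<sigma> (us i)) v) \<circ> ctr n ?c Z = (\<Sum>l<n. ts (- hb (u l) (u i)) (ann l (\<pi> (\<sigma> (us i)) \<circ> Z)))"
    proof -
      have "(\<lambda>v. - \<pi> (\<sigma> (us i)) v) \<circ> ctr n ?c Z = - (\<pi> (\<sigma> (us i)) \<circ> ctr n ?c Z)"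
        by (simp add: fun_eq_iff)
      also have "\<dots> = - ctr n ?c (\<pi> (\<sigma> (us i)) \<circ> Z)" by (simp only: comp_ctr[OF pi_linear])
      also have "\<dots> = (\<Sum>l<n. ts (- ?c l) (ann l (\<pi> (\<sigma> (us i)) \<circ> Z)))"
        by (simp only: contraction_def sum_negf tw.scale_minus_left)
      also have "\<dots> = (\<Sum>l<n. ts (- hb (u l) (u i)) (ann l (\<pi> (\<sigma> (us i)) \<circ> Z)))"
        using i by (intro sum.cong refl) (simp add: H mult.commute)
      finally show ?thesis .
    qed
    finally show "tf n a (cre i (\<pi> (us i) \<circ> Y)) Z =
        tf n a Y (\<Sum>l<n. ts (- hb (u l) (u i)) (ann l (\<pi> (\<sigma> (us i)) \<circ> Z)))" .
  qed
  also have "\<dots> = tf n a Y (\<Sum>i<n. \<Sum>l<n. ts (- hb (u l) (u i)) (ann l (\<pi> (\<sigma> (us i)) \<circ> Z)))"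
    by (simp only: F.F_sum_right)
  also have "(\<Sum>i<n. \<Sum>l<n. ts (- hb (u l) (u i)) (ann l (\<pi> (\<sigma> (us i)) \<circ> Z))) =
      (\<Sum>l<n. \<Sum>i<n. ts (- hb (u l) (u i)) (ann l (\<pi> (\<sigma> (us i)) \<circ> Z)))"
    by (rule sum.swap)
  also have "\<dots> = (\<Sum>l<n. - ann l (\<pi> (u l) \<circ> Z))"
  proof (intro sum.cong refl)
    fix l assume "l \<in> {..<n}"
    then have "u l = (\<Sum>i<n. s (hb (u l) (u i)) (\<sigma> (us i)))" by (intro expand_sigma u_mem) simp
    then have "\<pi> (u l) \<circ> Z = \<pi> (\<Sum>i<n. s (hb (u l) (u i)) (\<sigma> (us i))) \<circ> Z"
      by (rule arg_cong[where f = "\<lambda>x. \<pi> x \<circ> Z"])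
    then have "\<pi> (u l) \<circ> Z = (\<Sum>i<n. ts (hb (u l) (u i)) (\<pi> (\<sigma> (us i)) \<circ> Z))"
      by (simp only: pi_comp_scale pi_comp_sum)
    then show "(\<Sum>i<n. ts (- hb (u l) (u i)) (ann l (\<pi> (\<sigma> (us i)) \<circ> Z))) = - ann l (\<pi> (u l) \<circ> Z)"
      by (simp only: ann_sum ann_scale tw.scale_minus_left sum_negf)
  qed
  also have "\<dots> = ts (- 1 / 2) (dl Z)"
    unfolding dl_def tw.scale_sum_right by (intro sum.cong refl) simp
  also have "tf n a Y (ts (- 1 / 2) (dl Z)) = - tf n a Y (dl Z) / 2"
    by (simp only: F.F_scale_right) simp
  finally show ?thesis .
qed

text \<open>The coefficients of a tensor are finitely many vectors of \<open>V\<close>. The tensors with coefficients in a suitable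
finite-dimensional subspace around them form a finite-dimensional space that all terms of the Laplacian preserve.\<close>

lemma laplacian_locally_finite:
  assumes T: "T \<in> tensor_space n"
  shows "\<exists>A. finite A \<and> A \<subseteq> tensor_space n \<and> T \<in> tw.span A \<and>
    (\<forall>Y\<in>tw.span A. dd (dl Y) + dl (dd Y) \<in> tw.span A)"
proof -
  have "finite (T ` Pow {..<n})" by simp
  from finite_stable[OF this] obtain C where C: "finite C" "T ` Pow {..<n} \<subseteq> span C"
    and stable: "\<forall>X\<in>kk. \<forall>v\<in>span C. \<pi> X v \<in> span C"
      "\<forall>v\<in>span C. (\<Sum>i<n. \<pi> (u i) (\<pi> (us i) v)) \<in> span C"
    by (elim exE conjE)
  define E where "E = {Y \<in> tensor_space n. \<forall>I. Y I \<in> span C}"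
  (* E is finite-dimensional: it is spanned by tensors with one coefficient, taken from C. *)
  define single where "single I v J = (if J = I then v else 0)" for I J :: "nat set" and v :: 'v
  define A where "A = (\<lambda>(I, v). single I v) ` (Pow {..<n} \<times> C)"
  have E_sub: "tw.subspace E"
    by (rule tw.subspaceI) (simp_all add: E_def tensor_space_def span_zero span_add span_scale)
  have A_E: "A \<subseteq> E"
    unfolding A_def E_def tensor_space_def single_def
    by (auto intro: span_zero span_base split: if_splits)
  have single_span: "single I v \<in> tw.span A" if "v \<in> span C" "I \<subseteq> {..<n}" for I v
    using that(1)
  proof (induct rule: span_induct)
    case (step v)
    then show ?case using that(2) by (intro tw.span_base) (auto simp: A_def)
  next
    case base
    show ?case
    proof (rule subspaceI)
      have "single I 0 = 0" by (auto simp: single_def fun_eq_iff)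
      then show "0 \<in> {v. single I v \<in> tw.span A}" using tw.span_zero by simp
      fix v w c assume v: "v \<in> {v. single I v \<in> tw.span A}"
      have "single I (sV c v) = ts c (single I v)" by (auto simp: single_def fun_eq_iff)
      then show "sV c v \<in> {v. single I v \<in> tw.span A}" using v tw.span_scale by simp
      assume w: "w \<in> {v. single I v \<in> tw.span A}"
      have "single I (v + w) = single I v + single I w" by (auto simp: single_def fun_eq_iff)
      then show "v + w \<in> {v. single I v \<in> tw.span A}" using v w tw.span_add by simp
    qed
  qed
  have E_span: "E = tw.span A"
  proof
    show "E \<subseteq> tw.span A"
    proof
      fix Y assume Y: "Y \<in> E"
      have "Y J = (\<Sum>I\<in>Pow {..<n}. single I (Y I)) J" for J
        using Y by (auto simp: sum_fun_apply single_def E_def tensor_space_def)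
      then have "Y = (\<Sum>I\<in>Pow {..<n}. single I (Y I))" by blast
      also have "\<dots> \<in> tw.span A"
        using Y by (intro tw.span_sum single_span) (auto simp: E_def)
      finally show "Y \<in> tw.span A" .
    qed
    show "tw.span A \<subseteq> E" using A_E E_sub by (rule tw.span_minimal)
  qed
  have E_cre: "cre i Y \<in> E" if "Y \<in> E" "i < n" for i Y
    using that cre_tensor_space by (auto simp: E_def creation_def intro!: span_zero span_scale)
  have E_ann: "ann i Y \<in> E" if "Y \<in> E" for i Y
    using that ann_tensor_space by (auto simp: E_def annihilation_def intro!: span_zero span_scale)
  have E_pi: "\<pi> X \<circ> Y \<in> E" if "Y \<in> E" "X \<in> kk" for X Y
    using that stable(1) comp_tensor_space[of "\<pi> X" Y n] by (auto simp: E_def)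
  have E_q: "(\<Sum>i<n. \<pi> (u i) \<circ> (\<pi> (us i) \<circ> Y)) \<in> E" if "Y \<in> E" for Y
  proof -
    have "(\<Sum>i<n. \<pi> (u i) \<circ> (\<pi> (us i) \<circ> Y)) \<in> tensor_space n"
      using that by (intro tw.subspace_sum[OF tensor_subspace] comp_tensor_space) (auto simp: E_def)
    moreover have "(\<Sum>i<n. \<pi> (u i) \<circ> (\<pi> (us i) \<circ> Y)) I \<in> span C" for I
      using that stable(2) by (simp add: sum_fun_apply E_def)
    ultimately show ?thesis by (simp add: E_def)
  qed
  have "dd (dl Y) + dl (dd Y) \<in> E" if Y: "Y \<in> E" for Y
    unfolding laplacian
    using Y by (intro tw.subspace_add[OF E_sub] tw.subspace_sum[OF E_sub] tw.subspace_scale[OF E_sub]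
        E_cre E_ann E_pi E_q br_pm us u_mem) auto
  moreover have "T \<in> E"
  proof -
    have "T I \<in> span C" for I
      using T C(2) span_zero by (cases "I \<subseteq> {..<n}") (auto simp: tensor_space_def)
    then show ?thesis using T by (simp add: E_def)
  qed
  moreover have "finite A" using C(1) by (simp add: A_def)
  moreover have "A \<subseteq> tensor_space n" using A_E by (auto simp: E_def)
  ultimately show ?thesis unfolding E_span by blast
qed

lemma hodge: "\<exists>F. hodge_complex ts F (tensor_space n) dd dl"
proof -
  obtain a m where H: "\<And>i l. i < n \<Longrightarrow> l < n \<Longrightarrow> hb (u l) (u i) = (\<Sum>k<n. a k l * cnj (a k i))"
    and m: "\<And>i j. i < n \<Longrightarrow> j < n \<Longrightarrow> (\<Sum>k<n. m i k * a k j) = (if i = j then 1 else 0)"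
    using cholesky by blast
  have "hodge_complex ts (tf n a) (tensor_space n) dd dl"
  proof unfold_locales
    show "tw.subspace (tensor_space n)" by (rule tensor_subspace)
  qed (simp_all add: tf_add_left tf_scale_left tf_positive[OF m] dd_tensor_space dl_tensor_space dd_add dl_add
      dd_scale dl_scale dd_dd dl_dl dd_adjoint[OF H] laplacian_locally_finite tf_sym[symmetric])
  then show ?thesis by blast
qed

end

section \<open>The complexified Killing form\<close>

lemma cscale_vector_space: "vector_space cscale"
  by standard (auto simp: cscale_def prod_eq_iff algebra_simps)

lemma cconj_add: "cconj (x + y) = cconj x + cconj y"
  and cconj_scale: "cconj (cscale c x) = cscale (cnj c) (cconj x)"
  and cconj_cconj: "cconj (cconj x) = x"
  by (auto simp: cconj_def cscale_def prod_eq_iff algebra_simps)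

lemma pair_decompose: "z = (fst z, 0) + cscale \<i> (snd z, 0)"
  by (auto simp: cscale_def prod_eq_iff)

locale real_lie_algebra =
  fixes br :: "'a::real_vector \<Rightarrow> 'a \<Rightarrow> 'a"
  assumes lie: "lie_algebra (scaleR :: real \<Rightarrow> 'a \<Rightarrow> 'a) br"
    and fin_dim: "finite_dimensional (scaleR :: real \<Rightarrow> 'a \<Rightarrow> 'a)"
begin

abbreviation (input) "rdependent \<equiv> module.dependent (scaleR :: real \<Rightarrow> 'a \<Rightarrow> 'a)"
abbreviation (input) "rspan \<equiv> module.span (scaleR :: real \<Rightarrow> 'a \<Rightarrow> 'a)"

interpretation r: lie_algebra "scaleR :: real \<Rightarrow> 'a \<Rightarrow> 'a" br by (rule lie)

abbreviation "cbr \<equiv> cbracket br"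

lemma real_vs: "vector_space (scaleR :: real \<Rightarrow> 'a \<Rightarrow> 'a)"
  by (rule lie_algebra.axioms(1)[OF lie])

lemmas real_module = real_vs[folded module_iff_vector_space]

lemma br_zero [simp]: "br x 0 = 0" "br 0 x = 0"
  using r.bracket_scale_right[of x 0 0] r.bracket_scale_left[of 0 0 x] by simp_all

lemma br_minus: "br (- x) y = - br x y" "br x (- y) = - br x y"
  using r.bracket_scale_left[of "-1" x y] r.bracket_scale_right[of x "-1" y] by simp_all

lemma br_diff: "br (x - x') y = br x y - br x' y" "br x (y - y') = br x y - br x y'"
proof -
  show "br (x - x') y = br x y - br x' y" using r.bracket_add_left[of "x - x'" x' y] by simp
  show "br x (y - y') = br x y - br x y'" using r.bracket_add_right[of x "y - y'" y'] by simp
qed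

lemma br_antisym: "br x y = - br y x"
proof -
  have "br x y + br y x = br (x + y) (x + y)"
    unfolding r.bracket_add_left r.bracket_add_right by (simp add: r.bracket_self)
  also have "\<dots> = 0" by (rule r.bracket_self)
  finally show ?thesis by (simp only: eq_neg_iff_add_eq_0)
qed

lemmas br_simps = r.bracket_add_left r.bracket_add_right r.bracket_scale_left r.bracket_scale_right
  br_diff br_minus

lemma complex_lie_algebra: "lie_algebra cscale cbr"
proof -
  interpret vector_space "cscale :: complex \<Rightarrow> 'a \<times> 'a \<Rightarrow> 'a \<times> 'a" by (rule cscale_vector_space)
  show ?thesis
  proof unfold_locales
    fix x y z :: "'a \<times> 'a" and c
    show "cbr (x + y) z = cbr x z + cbr y z" "cbr x (y + z) = cbr x y + cbr x z"
      by (simp_all add: cbracket_def br_simps)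
    show "cbr (cscale c x) y = cscale c (cbr x y)" "cbr x (cscale c y) = cscale c (cbr x y)"
      by (simp_all add: cbracket_def cscale_def br_simps scaleR_diff_right scaleR_add_right)
    show "cbr x x = 0"
      using br_antisym[of "snd x" "fst x"] by (simp add: cbracket_def r.bracket_self zero_prod_def)
    have "fst (cbr x (cbr y z) + cbr y (cbr z x) + cbr z (cbr x y)) =
        (br (fst x) (br (fst y) (fst z)) + br (fst y) (br (fst z) (fst x)) + br (fst z) (br (fst x) (fst y)))
        - (br (fst x) (br (snd y) (snd z)) + br (snd y) (br (snd z) (fst x)) + br (snd z) (br (fst x) (snd y)))
        - (br (snd x) (br (fst y) (snd z)) + br (fst y) (br (snd z) (snd x)) + br (snd z) (br (snd x) (fst y)))
        - (br (snd x) (br (snd y) (fst z)) + br (snd y) (br (fst z) (snd x)) + br (fst z) (br (snd x) (snd y)))"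
      by (simp add: cbracket_def br_simps)
    moreover have "snd (cbr x (cbr y z) + cbr y (cbr z x) + cbr z (cbr x y)) =
        (br (fst x) (br (fst y) (snd z)) + br (fst y) (br (snd z) (fst x)) + br (snd z) (br (fst x) (fst y)))
        + (br (fst x) (br (snd y) (fst z)) + br (snd y) (br (fst z) (fst x)) + br (fst z) (br (fst x) (snd y)))
        + (br (snd x) (br (fst y) (fst z)) + br (fst y) (br (fst z) (snd x)) + br (fst z) (br (snd x) (fst y)))
        - (br (snd x) (br (snd y) (snd z)) + br (snd y) (br (snd z) (snd x)) + br (snd z) (br (snd x) (snd y)))"
      by (simp add: cbracket_def br_simps)
    ultimately show "cbr x (cbr y z) + cbr y (cbr z x) + cbr z (cbr x y) = 0"
      by (simp add: r.jacobi prod_eq_iff)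
  qed
qed

sublocale c: lie_algebra cscale cbr by (rule complex_lie_algebra)

lemma cbr_antisym: "cbr x y = - cbr y x"
proof -
  have "cbr x y + cbr y x = cbr (x + y) (x + y)"
    unfolding c.bracket_add_left c.bracket_add_right by (simp add: c.bracket_self)
  also have "\<dots> = 0" by (rule c.bracket_self)
  finally show ?thesis by (simp only: eq_neg_iff_add_eq_0)
qed

lemma cbr_zero [simp]: "cbr x 0 = 0" "cbr 0 x = 0"
  using c.bracket_scale_right[of x 0 0] c.bracket_scale_left[of 0 0 x] by simp_all

lemma cbr_minus: "cbr (- x) y = - cbr x y" "cbr x (- y) = - cbr x y"
  using c.bracket_scale_left[of "-1" x y] c.bracket_scale_right[of x "-1" y] by simp_all

lemma cbr_jacobi: "cbr (cbr x y) z = cbr x (cbr y z) - cbr y (cbr x z)"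
proof -
  have "cbr x (cbr y z) + cbr y (cbr z x) + cbr z (cbr x y) = 0" by (rule c.jacobi)
  moreover have "cbr y (cbr z x) = - cbr y (cbr x z)" using cbr_antisym[of z x] by (simp add: cbr_minus)
  moreover have "cbr z (cbr x y) = - cbr (cbr x y) z" by (rule cbr_antisym)
  ultimately show ?thesis by (simp add: algebra_simps)
qed

definition basis :: "'a set" where
  "basis = (SOME E. finite E \<and> \<not> rdependent E \<and> rspan E = UNIV)"

lemma basis: "finite basis" "\<not> rdependent basis" "rspan basis = UNIV"
proof -
  obtain S :: "'a set" where S: "finite S" "rspan S = UNIV"
    using fin_dim unfolding finite_dimensional_def by blast
  obtain E where E: "\<not> rdependent E" "rspan E = UNIV"
    using vector_space.basis_exists[OF real_vs, of UNIV] by (metis UNIV_eq_I subsetD UNIV_I)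
  have "finite E" using vector_space.independent_span_bound[OF real_vs S(1) E(1)] S(2) by simp
  then have "\<exists>E. finite E \<and> \<not> rdependent E \<and> rspan E = UNIV" using E by blast
  from someI_ex[OF this] show "finite basis" "\<not> rdependent basis" "rspan basis = UNIV"
    by (auto simp: basis_def)
qed

abbreviation "rep \<equiv> module.representation (scaleR :: real \<Rightarrow> 'a \<Rightarrow> 'a) basis"

lemma rep_expand: "x = (\<Sum>b\<in>basis. rep x b *\<^sub>R b)"
  using module.sum_representation_eq[OF real_module basis(2) _ basis(1) subset_refl, of x] basis(3) by simp

lemma rep_add: "rep (x + y) b = rep x b + rep y b" and rep_scale: "rep (c *\<^sub>R x) b = c * rep x b"
  using module.representation_add[OF real_module basis(2)]
    module.representation_scale[OF real_module basis(2)] basis(3) by simp_all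

lemma rep_diff: "rep (x - y) b = rep x b - rep y b"
  using rep_add[of "x - y" y b] by simp

text \<open>The complex coordinate with respect to the basis of \<open>\<gg>\<close> that comes from a real basis of \<open>\<gg>\<^sub>0\<close>.\<close>

definition crep where "crep b z = Complex (rep (fst z) b) (rep (snd z) b)"

lemma crep_add: "crep b (z + w) = crep b z + crep b w"
  by (simp add: crep_def rep_add complex_eq_iff)

lemma crep_scale: "crep b (cscale c z) = c * crep b z"
  by (simp add: crep_def cscale_def rep_add rep_diff rep_scale complex_eq_iff)

lemma crep_sum: "crep b (\<Sum>i\<in>A. f i) = (\<Sum>i\<in>A. crep b (f i))"
proof -
  have "crep b 0 = 0" using crep_scale[of b 0 0] by simp
  then show ?thesis by (induct A rule: infinite_finite_induct) (simp_all add: crep_add)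
qed

lemma crep_expand: "z = (\<Sum>b\<in>basis. cscale (crep b z) (b, 0))"
proof -
  have "cscale (crep b z) (b, 0) = (rep (fst z) b *\<^sub>R b, rep (snd z) b *\<^sub>R b)" for b
    by (simp add: cscale_def crep_def)
  then have "(\<Sum>b\<in>basis. cscale (crep b z) (b, 0)) =
      ((\<Sum>b\<in>basis. rep (fst z) b *\<^sub>R b), (\<Sum>b\<in>basis. rep (snd z) b *\<^sub>R b))"
    by (simp add: prod_eq_iff fst_sum snd_sum)
  then show ?thesis using rep_expand[of "fst z"] rep_expand[of "snd z"] by simp
qed

definition clinear :: "('a \<times> 'a \<Rightarrow> 'a \<times> 'a) \<Rightarrow> bool" where
  "clinear f \<longleftrightarrow> (\<forall>x y. f (x + y) = f x + f y) \<and> (\<forall>c x. f (cscale c x) = cscale c (f x))"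

lemma clinearD:
  assumes "clinear f"
  shows "f (x + y) = f x + f y" "f (cscale c x) = cscale c (f x)"
  using assms unfolding clinear_def by blast+

lemma clinearI:
  assumes "\<And>x y. f (x + y) = f x + f y" "\<And>c x. f (cscale c x) = cscale c (f x)"
  shows "clinear f"
  using assms unfolding clinear_def by blast

lemma clinear_sum: "clinear f \<Longrightarrow> f (\<Sum>i\<in>A. g i) = (\<Sum>i\<in>A. f (g i))"
proof -
  assume f: "clinear f"
  have "f (cscale 0 0) = cscale 0 (f 0)" using f unfolding clinear_def by blast
  then have "f 0 = 0" by simp
  then show ?thesis by (induct A rule: infinite_finite_induct) (simp_all add: clinearD[OF f])
qed

lemma clinear_comp: "clinear f \<Longrightarrow> clinear g \<Longrightarrow> clinear (\<lambda>z. f (g z))"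
  by (rule clinearI) (simp_all add: clinearD)

lemma clinear_ad: "clinear (cbr x)"
  by (rule clinearI) (rule c.bracket_add_right, rule c.bracket_scale_right)

abbreviation "tr \<equiv> trace_on (cscale :: complex \<Rightarrow> 'a \<times> 'a \<Rightarrow> 'a \<times> 'a) UNIV"

lemma tr_eq: "clinear f \<Longrightarrow> tr f = (\<Sum>b\<in>basis. crep b (f (b, 0)))"
  by (rule trace_on_frame[OF cscale_vector_space c.subspace_UNIV basis(1)])
    (auto simp: clinear_def crep_add crep_scale crep_expand[symmetric])

lemma tr_comm:
  assumes f: "clinear f" and g: "clinear g"
  shows "tr (\<lambda>z. f (g z)) = tr (\<lambda>z. g (f z))"
proof -
  have *: "tr (\<lambda>z. f (g z)) = (\<Sum>b\<in>basis. \<Sum>b'\<in>basis. crep b' (g (b, 0)) * crep b (f (b', 0)))"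
    if f: "clinear f" and g: "clinear g" for f g
  proof -
    have "crep b (f (g (b, 0))) = (\<Sum>b'\<in>basis. crep b' (g (b, 0)) * crep b (f (b', 0)))" for b
    proof -
      have "f (g (b, 0)) = f (\<Sum>b'\<in>basis. cscale (crep b' (g (b, 0))) (b', 0))"
        by (rule arg_cong[where f = f]) (rule crep_expand)
      also have "\<dots> = (\<Sum>b'\<in>basis. cscale (crep b' (g (b, 0))) (f (b', 0)))"
        by (simp add: clinear_sum[OF f] clinearD[OF f])
      finally show ?thesis by (simp add: crep_sum crep_scale)
    qed
    then show ?thesis by (simp add: tr_eq[OF clinear_comp[OF f g]])
  qed
  show ?thesis
    unfolding *[OF f g] *[OF g f] by (subst sum.swap) (simp add: mult.commute)
qed

definition kf where "kf = killing cscale cbr"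

lemma kf_def': "kf x y = tr (\<lambda>z. cbr x (cbr y z))"
  by (simp add: kf_def killing_def)

lemma kf_eq: "kf x y = (\<Sum>b\<in>basis. crep b (cbr x (cbr y (b, 0))))"
  unfolding kf_def' by (rule tr_eq[OF clinear_comp[OF clinear_ad clinear_ad]])

lemma kf_add_left: "kf (x + y) z = kf x z + kf y z"
  by (simp add: kf_eq c.bracket_add_left crep_add sum.distrib)

lemma kf_scale_left: "kf (cscale c x) y = c * kf x y"
  by (simp add: kf_eq c.bracket_scale_left crep_scale sum_distrib_left)

lemma kf_sym: "kf x y = kf y x"
  unfolding kf_def' by (rule tr_comm[OF clinear_ad clinear_ad])

text \<open>Cyclicity of the trace, applied after \<open>ad [x, y]\<close> and \<open>ad [y, z]\<close> are written as commutators.\<close>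

lemma kf_inv: "kf (cbr x y) z = kf x (cbr y z)"
proof -
  have sub: "tr (\<lambda>v. f v - g v) = tr f - tr g" if "clinear f" "clinear g" for f g
  proof -
    have "clinear (\<lambda>v. f v - g v)"
      by (rule clinearI) (simp_all add: clinearD[OF that(1)] clinearD[OF that(2)] c.scale_right_diff_distrib)
    moreover have "crep b (x - y) = crep b x - crep b y" for b x y
      using crep_add[of b "x - y" y] by simp
    ultimately show ?thesis using that by (simp add: tr_eq sum_subtractf)
  qed
  have lin: "clinear (\<lambda>v. cbr a (cbr b (cbr d v)))" for a b d
    by (rule clinear_comp[OF clinear_ad clinear_comp[OF clinear_ad clinear_ad]])
  have "kf (cbr x y) z = tr (\<lambda>v. cbr x (cbr y (cbr z v)) - cbr y (cbr x (cbr z v)))"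
    unfolding kf_def' by (simp add: cbr_jacobi)
  also have "\<dots> = tr (\<lambda>v. cbr x (cbr y (cbr z v))) - tr (\<lambda>v. cbr y (cbr x (cbr z v)))"
    by (rule sub[OF lin lin])
  also have "tr (\<lambda>v. cbr y (cbr x (cbr z v))) = tr (\<lambda>v. cbr x (cbr z (cbr y v)))"
    by (rule tr_comm[OF clinear_ad clinear_comp[OF clinear_ad clinear_ad]])
  also have "tr (\<lambda>v. cbr x (cbr y (cbr z v))) - tr (\<lambda>v. cbr x (cbr z (cbr y v))) =
      tr (\<lambda>v. cbr x (cbr y (cbr z v)) - cbr x (cbr z (cbr y v)))"
    by (rule sub[OF lin lin, symmetric])
  also have "\<dots> = kf x (cbr y z)"
  proof -
    have "cbr x (cbr y (cbr z v)) - cbr x (cbr z (cbr y v)) = cbr x (cbr (cbr y z) v)" for v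
      using c.bracket_add_right[of x "cbr y (cbr z v) - cbr z (cbr y v)" "cbr z (cbr y v)"]
      by (simp add: cbr_jacobi)
    then show ?thesis by (simp add: kf_def')
  qed
  finally show ?thesis .
qed

lemma kf_automorphism:
  assumes A: "clinear A" "clinear A'" and inv: "\<And>x. A' (A x) = x" "\<And>x. A (A' x) = x"
    and hom: "\<And>x y. A (cbr x y) = cbr (A x) (A y)"
  shows "kf (A x) (A y) = kf x y"
proof -
  have "cbr (A x) (cbr (A y) z) = A (cbr x (cbr y (A' z)))" for z
    by (simp add: hom inv)
  then have "kf (A x) (A y) = tr (\<lambda>z. A (cbr x (cbr y (A' z))))" by (simp add: kf_def')
  also have "\<dots> = tr (\<lambda>z. cbr x (cbr y (A' (A z))))"
    by (rule tr_comm[OF A(1) clinear_comp[OF clinear_ad clinear_comp[OF clinear_ad A(2)]]])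
  finally show ?thesis by (simp add: inv kf_def')
qed

lemma kf_real: "kf (x, 0) (y, 0) = of_real (killing scaleR br x y)"
proof -
  have "killing scaleR br x y = (\<Sum>b\<in>basis. rep (br x (br y b)) b)"
    unfolding killing_def
    by (rule trace_on_frame[OF real_vs module.subspace_UNIV[OF real_module] basis(1)])
      (auto simp: br_simps rep_add rep_scale rep_expand[symmetric])
  moreover have "crep b (cbr (x, 0) (cbr (y, 0) (b, 0))) = of_real (rep (br x (br y b)) b)" for b
  proof -
    have "rep 0 b = 0" using rep_scale[of 0 0 b] by simp
    then show ?thesis by (simp add: cbracket_def crep_def complex_eq_iff)
  qed
  ultimately show ?thesis by (simp add: kf_eq)
qed

lemma kf_add_right: "kf x (y + z) = kf x y + kf x z" and kf_scale_right: "kf x (cscale c y) = c * kf x y"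
  by (metis kf_sym kf_add_left, metis kf_sym kf_scale_left)

lemma kf_minus: "kf (- x) y = - kf x y" "kf x (- y) = - kf x y"
  using kf_scale_left[of "-1" x y] kf_scale_right[of x "-1" y] by simp_all

abbreviation "\<kappa> \<equiv> killing scaleR br"

lemma kf_pair: "kf (a, b) (c, d) = Complex (\<kappa> a c - \<kappa> b d) (\<kappa> a d + \<kappa> b c)"
proof -
  have "kf (a, b) (c, d) = kf ((a, 0) + cscale \<i> (b, 0)) ((c, 0) + cscale \<i> (d, 0))"
    using pair_decompose[of "(a, b)"] pair_decompose[of "(c, d)"] by simp
  also have "\<dots> = Complex (\<kappa> a c - \<kappa> b d) (\<kappa> a d + \<kappa> b c)"
    by (simp only: kf_add_left kf_add_right kf_scale_left kf_scale_right kf_real)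
      (simp add: complex_eq_iff)
  finally show ?thesis .
qed

lemma killing_sym: "\<kappa> x y = \<kappa> y x"
proof -
  have "complex_of_real (\<kappa> x y) = of_real (\<kappa> y x)" using kf_sym[of "(x, 0)" "(y, 0)"] by (simp add: kf_real)
  then show ?thesis by (simp only: of_real_eq_iff)
qed

lemma kf_cconj: "kf (cconj x) (cconj y) = cnj (kf x y)"
proof -
  have minus: "\<kappa> (- a) b = - \<kappa> a b" "\<kappa> b (- a) = - \<kappa> b a" for a b
  proof -
    have "kf (- (a, 0)) (b, 0) = - kf (a, 0) (b, 0)" by (rule kf_minus)
    moreover have "- (a, 0::'a) = (- a, 0)" by (simp add: prod_eq_iff)
    ultimately have "complex_of_real (\<kappa> (- a) b) = of_real (- \<kappa> a b)" by (simp add: kf_real)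
    then show "\<kappa> (- a) b = - \<kappa> a b" by (simp only: of_real_eq_iff)
    then show "\<kappa> b (- a) = - \<kappa> b a" by (simp add: killing_sym[of b])
  qed
  show ?thesis by (cases x; cases y) (simp add: cconj_def kf_pair minus complex_eq_iff)
qed

lemma cconj_cbr: "cconj (cbr x y) = cbr (cconj x) (cconj y)"
  by (simp add: cconj_def cbracket_def br_simps)

end

section \<open>Cartan involutions and Hermitian pairs\<close>

locale cartan = real_lie_algebra br for br :: "'a::real_vector \<Rightarrow> 'a \<Rightarrow> 'a" +
  fixes \<theta> :: "'a \<Rightarrow> 'a"
  assumes cartan: "cartan_involution br \<theta>"
begin

lemma theta_linear: "linear \<theta>" and theta_theta: "\<theta> (\<theta> x) = x"
  and theta_br: "\<theta> (br x y) = br (\<theta> x) (\<theta> y)" and theta_neg: "x \<noteq> 0 \<Longrightarrow> - \<kappa> x (\<theta> x) > 0"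
  using cartan by (simp_all add: cartan_involution_def)

definition ct where "ct = map_prod \<theta> \<theta>"

lemmas theta_simps = linear_add[OF theta_linear] linear_diff[OF theta_linear] linear_scale[OF theta_linear]
  linear_neg[OF theta_linear] linear_0[OF theta_linear]

lemma ct_clinear: "clinear ct"
  by (simp add: clinear_def ct_def cscale_def prod_eq_iff theta_simps)

lemma ct_ct: "ct (ct x) = x" by (simp add: ct_def prod_eq_iff theta_theta)

lemma ct_cbr: "ct (cbr x y) = cbr (ct x) (ct y)"
  by (simp add: ct_def cbracket_def theta_simps theta_br)

lemma kf_ct: "kf (ct x) (ct y) = kf x y"
  by (rule kf_automorphism[OF ct_clinear ct_clinear ct_ct ct_ct ct_cbr])

text \<open>The conjugation with respect to the compact real form \<open>\<kk>\<^sub>0 + i \<pp>\<^sub>0\<close>. It makes the Killing form a positive definite Hermitian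
form \<open>hf\<close> on \<open>\<gg>\<close>, so that orthogonal complements exist for all subspaces.\<close>

definition tau where "tau x = cconj (ct x)"

lemma tau_tau: "tau (tau x) = x"
  by (simp add: tau_def ct_def cconj_def prod_eq_iff theta_simps theta_theta)

lemma tau_cbr: "tau (cbr x y) = cbr (tau x) (tau y)"
  by (simp add: tau_def ct_cbr cconj_cbr)

lemma kf_tau: "kf (tau x) (tau y) = cnj (kf x y)"
  by (simp add: tau_def kf_cconj kf_ct)

definition hf where "hf x y = - kf x (tau y)"

lemma hf_sesquilinear: "sesquilinear_space cscale hf"
proof unfold_locales
  show "hf (x + y) z = hf x z + hf y z" "hf (cscale c x) z = c * hf x z" for x y z c
    by (simp_all add: hf_def kf_add_left kf_scale_left)
  show "hf y x = cnj (hf x y)" for x y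
    using kf_tau[of x "tau y"] kf_sym[of "tau x" y] by (simp add: hf_def tau_tau)
qed

sublocale hf: sesquilinear_space cscale hf by (rule hf_sesquilinear)

lemma hf_pos: "x \<noteq> 0 \<Longrightarrow> 0 < Re (hf x x)"
proof -
  assume x: "x \<noteq> 0"
  have "- \<kappa> a (\<theta> a) \<ge> 0" for a
    using theta_neg[of a] kf_real[of 0 "\<theta> 0"] kf_scale_left[of 0 0 "(\<theta> 0, 0)"]
    by (cases "a = 0") (auto simp: zero_prod_def)
  moreover have "\<kappa> a (- b) = - \<kappa> a b" for a b
  proof -
    have "kf (a, 0) (- (b, 0)) = - kf (a, 0) (b, 0)" by (rule kf_minus)
    moreover have "- (b, 0::'a) = (- b, 0)" by (simp add: prod_eq_iff)
    ultimately have "complex_of_real (\<kappa> a (- b)) = of_real (- \<kappa> a b)" by (simp add: kf_real)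
    then show ?thesis by (simp only: of_real_eq_iff)
  qed
  ultimately have "Re (hf x x) = - \<kappa> (fst x) (\<theta> (fst x)) + - \<kappa> (snd x) (\<theta> (snd x))"
    by (cases x) (simp add: hf_def tau_def ct_def cconj_def kf_pair)
  moreover have "fst x \<noteq> 0 \<or> snd x \<noteq> 0" using x by (simp add: prod_eq_iff)
  ultimately show ?thesis
    using theta_neg \<open>\<And>a. - \<kappa> a (\<theta> a) \<ge> 0\<close> by (metis add_nonneg_pos add_pos_nonneg)
qed

lemma kf_nondegenerate: "(\<And>y. kf x y = 0) \<Longrightarrow> x = 0"
proof (rule ccontr)
  assume "\<And>y. kf x y = 0" "x \<noteq> 0"
  then show False using hf_pos[of x] by (simp add: hf_def)
qed

lemma finite_span:
  fixes Q :: "('a \<times> 'a) set"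
  assumes "c.subspace Q"
  shows "\<exists>v m. Q = c.span (v ` {..<m::nat})"
proof -
  obtain E where E: "E \<subseteq> Q" "c.independent E" "Q \<subseteq> c.span E"
    using c.basis_exists[of Q] by metis
  have "z \<in> c.span ((\<lambda>b. (b, 0)) ` basis)" for z
    by (subst crep_expand) (intro c.span_sum c.span_scale c.span_base, auto)
  then have "E \<subseteq> c.span ((\<lambda>b. (b, 0)) ` basis)" by blast
  then have "finite E"
    using c.independent_span_bound[of "(\<lambda>b. (b, 0)) ` basis" E] basis(1) E(2) by simp
  then obtain v m where "E = v ` {..<m::nat}"
    by (metis finite_imp_nat_seg_image_inj_on lessThan_def)
  moreover have "Q = c.span E" using E assms by (metis c.span_minimal subset_antisym)
  ultimately show ?thesis by blast
qed

lemma orthonormal_frame: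
  fixes Q :: "('a \<times> 'a) set"
  assumes Q: "c.subspace Q"
  shows "\<exists>e m. (\<forall>k<m::nat. e k \<in> Q) \<and> (\<forall>x\<in>Q. x = (\<Sum>k<m. cscale (hf x (e k)) (e k))) \<and>
    (\<forall>x. \<forall>q\<in>Q. hf (x - (\<Sum>k<m. cscale (hf x (e k)) (e k))) q = 0)"
proof -
  obtain v m where v: "Q = c.span (v ` {..<m::nat})" using finite_span[OF Q] by blast
  have "\<exists>e. (\<forall>k<m. e k \<in> c.span (v ` {..<m})) \<and>
    (\<forall>j<m. \<forall>k<m. hf (e j) (e k) = (if j = k \<and> e j \<noteq> 0 then 1 else 0)) \<and>
    (\<forall>i<m. v i = (\<Sum>k<m. cscale (hf (v i) (e k)) (e k)))"
    by (rule hf.gram_schmidt) (rule hf_pos)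
  then obtain e where e: "\<forall>k<m. e k \<in> Q"
    "\<And>j k. j < m \<Longrightarrow> k < m \<Longrightarrow> hf (e j) (e k) = (if j = k \<and> e j \<noteq> 0 then 1 else 0)"
    "\<And>i. i < m \<Longrightarrow> v i = (\<Sum>k<m. cscale (hf (v i) (e k)) (e k))"
    unfolding v by blast
  have expand: "x = (\<Sum>k<m. cscale (hf x (e k)) (e k))" if "x \<in> Q" for x
  proof (rule hf.orthonormal_expand[where v = v and m = m and e = e])
    show "v i = (\<Sum>k<m. cscale (hf (v i) (e k)) (e k))" if "i < m" for i using that by (rule e(3))
    show "x \<in> c.span (v ` {..<m})" using that v by simp
  qed
  have orth: "hf (x - (\<Sum>k<m. cscale (hf x (e k)) (e k))) (e j) = 0" if j: "j < m" for x j
  proof -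
    have "hf (\<Sum>k<m. cscale (hf x (e k)) (e k)) (e j) = (\<Sum>k<m. if k = j then hf x (e j) else 0)"
      unfolding hf.F_sum_left hf.F_scale_left using e(2) j by (intro sum.cong refl) auto
    also have "\<dots> = hf x (e j)" using j by simp
    finally show ?thesis by (simp add: hf.F_diff_left)
  qed
  have "hf (x - (\<Sum>k<m. cscale (hf x (e k)) (e k))) q = 0" if "q \<in> Q" for x q
  proof -
    have "hf y q = (\<Sum>k<m. cnj (hf q (e k)) * hf y (e k))" for y
    proof -
      have "hf y q = hf y (\<Sum>k<m. cscale (hf q (e k)) (e k))"
        by (rule arg_cong[where f = "hf y"]) (rule expand[OF that])
      then show ?thesis by (simp only: hf.F_sum_right hf.F_scale_right)
    qed
    then show ?thesis using orth by simp
  qed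
  then show ?thesis using e(1) expand by blast
qed

text \<open>With the orthogonal projection \<open>P\<close> onto \<open>Q\<close>, the trace of \<open>N = P N\<close> is the trace of \<open>N P = 0\<close>.\<close>

lemma tr_square_zero:
  assumes N: "clinear N" and Q: "c.subspace Q" and "\<And>x. N x \<in> Q" "\<And>x. x \<in> Q \<Longrightarrow> N x = 0"
  shows "tr N = 0"
proof -
  obtain e m where e: "\<forall>k<m::nat. e k \<in> Q" "\<forall>x\<in>Q. x = (\<Sum>k<m. cscale (hf x (e k)) (e k))"
    using orthonormal_frame[OF Q] by blast
  define P where "P x = (\<Sum>k<m. cscale (hf x (e k)) (e k))" for x
  have P: "clinear P"
    by (simp add: clinear_def P_def hf.F_add_left hf.F_scale_left c.scale_left_distrib sum.distrib c.scale_sum_right)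
  have P_Q: "P x \<in> Q" for x
    unfolding P_def using e(1) by (intro c.subspace_sum[OF Q] c.subspace_scale[OF Q]) auto
  have "tr N = tr (\<lambda>x. P (N x))" using e(2) assms(3) by (simp add: P_def[symmetric])
  also have "\<dots> = tr (\<lambda>x. N (P x))" by (rule tr_comm[OF P N])
  also have "\<dots> = tr (\<lambda>x. 0)" using assms(4) P_Q by simp
  also have "\<dots> = 0"
  proof -
    have "crep b 0 = 0" for b using crep_scale[of b 0 0] by simp
    then show ?thesis using tr_eq[of "\<lambda>x. 0"] by (simp add: clinear_def)
  qed
  finally show ?thesis .
qed

abbreviation "kk \<equiv> kpart \<theta>"
abbreviation "pp \<equiv> ppart \<theta>"

lemma kk_iff: "x \<in> kk \<longleftrightarrow> ct x = x" and pp_iff: "x \<in> pp \<longleftrightarrow> ct x = - x"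
  by (simp_all add: kpart_def ppart_def ct_def)

lemma kk_subspace: "c.subspace kk"
proof (rule c.subspaceI)
  show "0 \<in> kk" by (simp add: kk_iff ct_def zero_prod_def theta_simps)
qed (simp_all add: kk_iff clinearD[OF ct_clinear])

lemma kk_bracket: "x \<in> kk \<Longrightarrow> y \<in> kk \<Longrightarrow> cbr x y \<in> kk"
  by (simp add: kk_iff ct_cbr)

lemma pp_bracket: "x \<in> pp \<Longrightarrow> y \<in> pp \<Longrightarrow> cbr x y \<in> kk"
  by (simp add: kk_iff pp_iff ct_cbr cbr_minus)

lemma kk_pp_orth: "x \<in> kk \<Longrightarrow> y \<in> pp \<Longrightarrow> kf x y = 0"
  using kf_ct[of x y] by (simp add: kk_iff pp_iff kf_minus)

lemma kk_pp_decompose: "\<exists>x\<in>kk. \<exists>y\<in>pp. z = x + y"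
proof -
  have half: "cscale (1/2) z + cscale (1/2) z = z"
    by (simp flip: c.scale_left_distrib)
  have lin: "ct (cscale c x + cscale d y) = cscale c (ct x) + cscale d (ct y)" for c d x y
    by (simp add: clinearD[OF ct_clinear])
  let ?x = "cscale (1/2) z + cscale (1/2) (ct z)" and ?y = "cscale (1/2) z + cscale (-1/2) (ct z)"
  have "?x \<in> kk" unfolding kk_iff lin ct_ct by (simp add: add.commute)
  moreover have "?y \<in> pp" unfolding pp_iff lin ct_ct by (simp add: add.commute)
  moreover have "z = ?x + ?y" using half by (simp add: algebra_simps)
  ultimately show ?thesis by blast
qed

lemma tau_kk: "x \<in> kk \<Longrightarrow> tau x \<in> kk"
  by (simp add: kk_iff tau_def cconj_def ct_def prod_eq_iff theta_simps theta_theta)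

lemma pp_pos: "x \<in> pp \<Longrightarrow> x \<noteq> 0 \<Longrightarrow> 0 < Re (kf x (cconj x))"
proof -
  assume x: "x \<in> pp" "x \<noteq> 0"
  have "cconj (- x) = - cconj x" by (simp add: cconj_def)
  then have "hf x x = kf x (cconj x)" using x(1) by (simp add: hf_def tau_def pp_iff kf_minus)
  then show ?thesis using hf_pos[OF x(2)] by simp
qed

end

locale hermitian_pair = cartan br \<theta> for br :: "'a::real_vector \<Rightarrow> 'a \<Rightarrow> 'a" and \<theta> +
  fixes Pp Pm :: "('a \<times> 'a) set" and u us :: "nat \<Rightarrow> 'a \<times> 'a" and n :: nat
  assumes sum: "direct_sum cscale (ppart \<theta>) [Pp, Pm]"
    and ab: "\<And>x y. x \<in> Pp \<Longrightarrow> y \<in> Pp \<Longrightarrow> cbracket br x y = 0"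
      "\<And>x y. x \<in> Pm \<Longrightarrow> y \<in> Pm \<Longrightarrow> cbracket br x y = 0"
    and conj: "Pm = cconj ` Pp"
    and levi: "parabolic_with_levi cscale (cbracket br) (kpart \<theta>) Pp"
      "parabolic_with_levi cscale (cbracket br) (kpart \<theta>) Pm"
    and u: "inj_on u {..<n}" "\<not> module.dependent cscale (u ` {..<n})"
      "module.span cscale (u ` {..<n}) = Pp"
    and us: "\<And>i. i < n \<Longrightarrow> us i \<in> Pm"
      "\<And>i j. i < n \<Longrightarrow> j < n \<Longrightarrow> killing cscale (cbracket br) (u i) (us j) = (if i = j then 1 else 0)"
begin

lemma Pp: "c.subspace Pp" and Pm: "c.subspace Pm" and pp_eq: "pp = {a + b |a b. a \<in> Pp \<and> b \<in> Pm}"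
  using direct_sum_pairD[OF sum] by auto

lemma Pp_pp: "x \<in> Pp \<Longrightarrow> x \<in> pp" and Pm_pp: "x \<in> Pm \<Longrightarrow> x \<in> pp"
proof -
  show "x \<in> pp" if "x \<in> Pp"
    unfolding pp_eq using that c.subspace_0[OF Pm] by (intro CollectI exI[of _ x] exI[of _ 0]) simp
  show "x \<in> pp" if "x \<in> Pm"
    unfolding pp_eq using that c.subspace_0[OF Pp] by (intro CollectI exI[of _ 0] exI[of _ x]) simp
qed

text \<open>The nilradical is an ideal of the parabolic subalgebra.\<close>

lemma levi_stable:
  assumes "parabolic_with_levi cscale cbr kk U" "c.subspace U" "X \<in> kk" "x \<in> U"
  shows "cbr X x \<in> U"
proof -
  have "lie_ideal cscale cbr {x + y |x y. x \<in> kk \<and> y \<in> U} U"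
    using assms(1) by (simp add: parabolic_with_levi_def is_nilradical_def Let_def)
  moreover have "X \<in> {x + y |x y. x \<in> kk \<and> y \<in> U}"
    using assms(3) c.subspace_0[OF assms(2)] by (intro CollectI exI[of _ X] exI[of _ 0]) simp
  ultimately show ?thesis using assms(4) unfolding lie_ideal_def by blast
qed

lemma decompose: "\<exists>X\<in>kk. \<exists>p\<in>Pp. \<exists>m\<in>Pm. z = X + (p + m)"
  using kk_pp_decompose[of z] unfolding pp_eq by blast

text \<open>For \<open>x, y \<in> Q\<close> the operator \<open>ad x ad y\<close> maps \<open>\<gg>\<close> into \<open>Q\<close> and vanishes on \<open>Q\<close>: \<open>ad y\<close> lowers \<open>Q'\<close> to \<open>\<kk>\<close> and \<open>\<kk>\<close> to \<open>Q\<close>, and \<open>Q\<close> is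
abelian. Hence it has trace 0.\<close>

lemma isotropic:
  assumes Q: "c.subspace Q" "\<And>x. x \<in> Q \<Longrightarrow> x \<in> pp" "\<And>x y. x \<in> Q \<Longrightarrow> y \<in> Q \<Longrightarrow> cbr x y = 0"
    and Q': "\<And>z. z \<in> Q' \<Longrightarrow> z \<in> pp"
    and stable: "\<And>X x. X \<in> kk \<Longrightarrow> x \<in> Q \<Longrightarrow> cbr X x \<in> Q"
    and dec: "\<And>z. \<exists>X\<in>kk. \<exists>p\<in>Q. \<exists>m\<in>Q'. z = X + (p + m)"
    and xy: "x \<in> Q" "y \<in> Q"
  shows "kf x y = 0"
  unfolding kf_def'
proof (rule tr_square_zero[OF clinear_comp[OF clinear_ad clinear_ad] Q(1)])
  have k: "cbr x X \<in> Q" if "X \<in> kk" "x \<in> Q" for X x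
    using stable[OF that] cbr_antisym[of x X] c.subspace_neg[OF Q(1)] by simp
  fix z
  obtain X p m where z: "X \<in> kk" "p \<in> Q" "m \<in> Q'" "z = X + (p + m)" using dec by blast
  have "cbr x (cbr y z) = cbr x (cbr y X) + cbr x (cbr y p) + cbr x (cbr y m)"
    by (simp add: z(4) c.bracket_add_right)
  also have "cbr y p = 0" by (rule Q(3)[OF xy(2) z(2)])
  also have "cbr x (cbr y X) = 0" by (rule Q(3)[OF xy(1) k[OF z(1) xy(2)]])
  finally have "cbr x (cbr y z) = cbr x (cbr y m)" by simp
  also have "\<dots> \<in> Q" by (rule k[OF pp_bracket[OF Q(2)[OF xy(2)] Q'[OF z(3)]] xy(1)])
  finally show "cbr x (cbr y z) \<in> Q" .
next
  fix z assume "z \<in> Q"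
  then show "cbr x (cbr y z) = 0" using Q(3)[OF xy(2)] by simp
qed

lemma isotropic_p: "x \<in> Pp \<Longrightarrow> y \<in> Pp \<Longrightarrow> kf x y = 0"
  by (rule isotropic[where Q' = Pm, OF Pp Pp_pp ab(1) Pm_pp levi_stable[OF levi(1) Pp] decompose])

lemma isotropic_m: "x \<in> Pm \<Longrightarrow> y \<in> Pm \<Longrightarrow> kf x y = 0"
proof (rule isotropic[where Q' = Pp, OF Pm Pm_pp ab(2) Pp_pp levi_stable[OF levi(2) Pm]])
  fix z
  obtain X p m where "X \<in> kk" "p \<in> Pp" "m \<in> Pm" "z = X + (p + m)" using decompose by blast
  then show "\<exists>X\<in>kk. \<exists>p\<in>Pm. \<exists>m\<in>Pp. z = X + (p + m)" by (metis add.commute)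
qed

lemma cconj_Pm: "x \<in> Pm \<Longrightarrow> cconj x \<in> Pp" and cconj_Pp: "x \<in> Pp \<Longrightarrow> cconj x \<in> Pm"
  using conj by (auto simp: cconj_cconj)

lemma dual: "i < n \<Longrightarrow> j < n \<Longrightarrow> kf (u i) (us j) = (if i = j then 1 else 0)"
  using us(2) by (simp add: kf_def)

text \<open>The difference of the two sides is orthogonal to \<open>Pp\<close>, which contains its conjugate, so positivity on \<open>\<pp>\<close> makes it 0. This is
where the vectors \<open>us\<close>, given only as dual to \<open>u\<close>, are seen to span \<open>Pm\<close>.\<close>

lemma expand_Pm:
  assumes y: "y \<in> Pm"
  shows "y = (\<Sum>i<n. cscale (kf (u i) y) (us i))"
proof -
  define z where "z = y - (\<Sum>i<n. cscale (kf (u i) y) (us i))"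
  have z: "z \<in> Pm"
    unfolding z_def using y us(1)
    by (intro c.subspace_diff[OF Pm] c.subspace_sum[OF Pm] c.subspace_scale[OF Pm]) auto
  have kf_sum: "kf x (\<Sum>i\<in>A. f i) = (\<Sum>i\<in>A. kf x (f i))" for x A and f :: "nat \<Rightarrow> 'a \<times> 'a"
  proof -
    have "kf x 0 = 0" using kf_scale_right[of x 0 0] by simp
    then show ?thesis by (induct A rule: infinite_finite_induct) (simp_all add: kf_add_right)
  qed
  have uz: "kf (u j) z = 0" if j: "j < n" for j
  proof -
    have "kf (u j) (\<Sum>i<n. cscale (kf (u i) y) (us i)) = (\<Sum>i<n. if i = j then kf (u j) y else 0)"
      unfolding kf_sum kf_scale_right using dual j by (intro sum.cong refl) auto
    then show ?thesis
      using kf_add_right[of "u j" z "\<Sum>i<n. cscale (kf (u i) y) (us i)"] j by (simp add: z_def)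
  qed
  have "kf 0 z = 0" using kf_scale_left[of 0 0 z] by simp
  then have sub: "c.subspace {p. kf p z = 0}"
    by (intro c.subspaceI) (simp_all add: kf_add_left kf_scale_left)
  have "kf p z = 0" if "p \<in> c.span (u ` {..<n})" for p
    using that sub by (rule c.span_induct) (use uz in auto)
  then have "kf p z = 0" if "p \<in> Pp" for p using that u(3) by simp
  then have "kf z (cconj z) = 0" using cconj_Pm[OF z] kf_sym by metis
  then have "z = 0" using pp_pos[OF Pm_pp[OF z]] by force
  then show ?thesis by (simp add: z_def)
qed

sublocale pair: polarized_pair cscale cbr kf kk Pp Pm u us n
  by unfold_locales
    (fact kf_add_left kf_scale_left kf_sym kf_inv kk_subspace kk_bracket Pm u us(1) dual expand_Pm
      isotropic_p isotropic_m ab levi_stable[OF levi(1) Pp] levi_stable[OF levi(2) Pm])+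

lemma pair_PP: "pair.PP = pp"
  by (simp add: pair.PP_def pp_eq)

end

section \<open>Eigenvalues in countable dimension\<close>

lemma (in vector_space) countable_independent:
  assumes S: "countable S" and T: "independent T" "T \<subseteq> span S"
  shows "countable T"
proof -
  have "T \<subseteq> (\<Union>F\<in>{F. finite F \<and> F \<subseteq> S}. T \<inter> span F)"
  proof
    fix x assume x: "x \<in> T"
    then have "x \<in> span S" using T(2) by blast
    then obtain F r where F: "finite F" "F \<subseteq> S" "x = (\<Sum>a\<in>F. scale (r a) a)"
      unfolding span_explicit by blast
    have "x \<in> span F" unfolding F(3) by (intro span_sum span_scale span_base)
    then show "x \<in> (\<Union>F\<in>{F. finite F \<and> F \<subseteq> S}. T \<inter> span F)" using F x by blast
  qed
  moreover have "countable (\<Union>F\<in>{F. finite F \<and> F \<subseteq> S}. T \<inter> span F)"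
  proof (rule countable_UN)
    show "countable {F. finite F \<and> F \<subseteq> S}" using S by (rule countable_Collect_finite_subset)
    fix F assume "F \<in> {F. finite F \<and> F \<subseteq> S}"
    then have "finite (T \<inter> span F)"
      using independent_span_bound[of F "T \<inter> span F"] independent_mono[OF T(1)] by blast
    then show "countable (T \<inter> span F)" by (rule countable_finite)
  qed
  ultimately show ?thesis by (rule countable_subset)
qed

context complex_space
begin

text \<open>The value \<open>p(C) v\<close> of the polynomial \<open>p\<close> at the operator \<open>C\<close>.\<close>

definition poly_op :: "('v \<Rightarrow> 'v) \<Rightarrow> complex poly \<Rightarrow> 'v \<Rightarrow> 'v" where
  "poly_op C p v = (\<Sum>i\<le>degree p. scale (poly.coeff p i) ((C ^^ i) v))"

lemma poly_op_bound:
  assumes "degree p \<le> N"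
  shows "poly_op C p v = (\<Sum>i\<le>N. scale (poly.coeff p i) ((C ^^ i) v))"
  unfolding poly_op_def
  by (rule sum.mono_neutral_left) (use assms in \<open>auto simp: coeff_eq_0\<close>)

lemma poly_op_add: "poly_op C (p + q) v = poly_op C p v + poly_op C q v"
proof -
  let ?N = "max (degree p) (degree q)"
  have "degree (p + q) \<le> ?N" by (rule degree_add_le_max)
  then show ?thesis
    using poly_op_bound[of "p + q" ?N C v] poly_op_bound[of p ?N C v] poly_op_bound[of q ?N C v]
    by (simp add: scale_left_distrib sum.distrib)
qed

lemma poly_op_smult: "poly_op C (Polynomial.smult c p) v = scale c (poly_op C p v)"
  using poly_op_bound[OF degree_smult_le[of c p], of C v]
  by (simp add: poly_op_def scale_sum_right)

lemma poly_op_0 [simp]: "poly_op C 0 v = 0"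
  by (simp add: poly_op_def)

lemma poly_op_sum: "poly_op C (\<Sum>i\<in>A. f i) v = (\<Sum>i\<in>A. poly_op C (f i) v)"
  by (induct A rule: infinite_finite_induct) (simp_all add: poly_op_add)

lemma poly_op_pCons:
  assumes C: "op_linear C"
  shows "poly_op C (pCons a p) v = scale a v + C (poly_op C p v)"
proof -
  have "poly_op C (pCons a p) v = (\<Sum>i\<le>Suc (degree p). scale (poly.coeff (pCons a p) i) ((C ^^ i) v))"
    by (rule poly_op_bound) (rule degree_pCons_le)
  also have "\<dots> = scale a v + (\<Sum>i\<le>degree p. scale (poly.coeff p i) (C ((C ^^ i) v)))"
    by (simp add: sum.atMost_Suc_shift del: sum.atMost_Suc)
  also have "(\<Sum>i\<le>degree p. scale (poly.coeff p i) (C ((C ^^ i) v))) = C (poly_op C p v)"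
    using C unfolding poly_op_def op_linear_sum[OF C] by (simp add: op_linear_def)
  finally show ?thesis .
qed

lemma poly_op_linear_factor:
  assumes C: "op_linear C"
  shows "poly_op C ([:- l, 1:] * q) v = C (poly_op C q v) - scale l (poly_op C q v)"
proof -
  have "[:- l, 1:] * q = Polynomial.smult (- l) q + pCons 0 q"
    by (simp only: mult_pCons_left mult_zero_left pCons_0_0 add_0_right smult_1_left)
  then have "poly_op C ([:- l, 1:] * q) v = scale (- l) (poly_op C q v) + (scale 0 v + C (poly_op C q v))"
    by (simp only: poly_op_add poly_op_smult poly_op_pCons[OF C])
  then show ?thesis by simp
qed

lemma poly_op_linear: "op_linear C \<Longrightarrow> op_linear (poly_op C q)"
proof -
  assume C: "op_linear C"
  have "(C ^^ i) (v + w) = (C ^^ i) v + (C ^^ i) w \<and> (C ^^ i) (scale c v) = scale c ((C ^^ i) v)" for i v w c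
    by (induct i) (use C in \<open>auto simp: op_linear_def\<close>)
  then show ?thesis
    by (simp add: op_linear_def poly_op_def scale_right_distrib sum.distrib scale_sum_right mult.commute)
qed

text \<open>Over the complex numbers a polynomial splits into linear factors, and \<open>C - l\<close> is injective if \<open>C\<close> has no eigenvalue.\<close>

lemma poly_op_injective:
  assumes C: "op_linear C" and no_eigen: "\<And>l v. C v = scale l v \<Longrightarrow> v = 0"
    and "q \<noteq> 0" "poly_op C q v = 0"
  shows "v = 0"
  using assms(3,4)
proof (induct "degree q" arbitrary: q rule: less_induct)
  case less
  show ?case
  proof (cases "degree q = 0")
    case True
    then obtain c where "q = [:c:]" by (rule degree_eq_zeroE)
    then show ?thesis using less.prems op_linear_0[OF C] by (simp add: poly_op_pCons[OF C])
  next
    case False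
    then obtain z where "poly q z = 0"
      using fundamental_theorem_of_algebra[of q] constant_degree[of q] by auto
    then obtain r where r: "q = [:- z, 1:] * r" using poly_eq_0_iff_dvd by (metis dvdE)
    then have r0: "r \<noteq> 0" using less.prems by auto
    then have "degree q = Suc (degree r)" unfolding r by (subst degree_mult_eq) auto
    moreover have "poly_op C r v = 0"
      using less.prems(2) unfolding r poly_op_linear_factor[OF C] by (intro no_eigen[of _ z]) simp
    ultimately show ?thesis using less.hyps[of r] r0 by simp
  qed
qed

text \<open>Dixmier's argument. Without eigenvalue, each \<open>C - l\<close> has a preimage \<open>w l\<close> of \<open>v0\<close>. A linear relation between finitely many of
these vectors, multiplied by the product of the factors \<open>C - l\<close>, becomes \<open>q(C) v0 = 0\<close> for a polynomial \<open>q\<close>. As \<open>q(C)\<close> is injective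
for \<open>q \<noteq> 0\<close>, the polynomial is 0, and so are the coefficients by Lagrange interpolation. Already the real numbers \<open>l\<close> then
give an uncountable independent set.\<close>

lemma countable_dimension_eigenvalue:
  fixes C :: "'v \<Rightarrow> 'v" and v0 :: 'v
  assumes C: "op_linear C" and S: "countable S" "span S = UNIV" and v0: "v0 \<noteq> 0"
    and surj: "\<And>l v. (\<And>w. C w = scale l w \<Longrightarrow> w = 0) \<Longrightarrow> \<exists>w. C w - scale l w = v"
  shows "\<exists>l v. v \<noteq> 0 \<and> C v = scale l v"
proof (rule ccontr)
  assume "\<not> ?thesis"
  then have no_eigen: "\<And>l v. C v = scale l v \<Longrightarrow> v = 0" by blast
  have "\<exists>w. C w - scale (of_real l) w = v0" for l :: real
    by (rule surj) (rule no_eigen)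
  then obtain w where w: "\<And>l :: real. C (w l) - scale (of_real l) (w l) = v0" by metis
  define P :: "real set \<Rightarrow> complex poly" where "P \<Lambda> = (\<Prod>l\<in>\<Lambda>. [:- of_real l, 1:])" for \<Lambda>
  (* The factor C - l of the product turns w l into v0, so only the remaining factors are left. *)
  have Pw: "poly_op C (P \<Lambda>) (w l) = poly_op C (P (\<Lambda> - {l})) v0" if "finite \<Lambda>" "l \<in> \<Lambda>" for \<Lambda> l
  proof -
    have "P \<Lambda> = [:- of_real l, 1:] * P (\<Lambda> - {l})"
      unfolding P_def using that by (rule prod.remove)
    then have "poly_op C (P \<Lambda>) (w l) = C (poly_op C (P (\<Lambda> - {l})) (w l)) - scale (of_real l) (poly_op C (P (\<Lambda> - {l})) (w l))"
      by (simp only: poly_op_linear_factor[OF C])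
    also have "\<dots> = poly_op C (P (\<Lambda> - {l})) (C (w l) - scale (of_real l) (w l))"
    proof -
      have lin: "op_linear (poly_op C q)" for q by (rule poly_op_linear[OF C])
      have sub: "f (a - b) = f a - f b" if "op_linear f" for f a b
        using that unfolding op_linear_def by (metis add_diff_cancel diff_add_cancel)
      have comm: "C (poly_op C q x) = poly_op C q (C x)" for q x
      proof -
        have "(C ^^ i) (C x) = C ((C ^^ i) x)" for i by (simp add: funpow_swap1)
        then show ?thesis
          using C unfolding poly_op_def op_linear_sum[OF C] by (simp add: op_linear_def)
      qed
      show ?thesis using lin by (simp add: sub[OF lin] comm op_linear_def)
    qed
    finally show ?thesis by (simp only: w)
  qed
  have coeffs: "c l = 0" if fin: "finite \<Lambda>" and l: "l \<in> \<Lambda>" and z: "(\<Sum>l\<in>\<Lambda>. scale (c l) (w l)) = 0" for \<Lambda> c l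
  proof -
    define q where "q = (\<Sum>l\<in>\<Lambda>. Polynomial.smult (c l) (P (\<Lambda> - {l})))"
    have lin: "op_linear (poly_op C (P \<Lambda>))" by (rule poly_op_linear[OF C])
    have "poly_op C q v0 = (\<Sum>l\<in>\<Lambda>. scale (c l) (poly_op C (P \<Lambda>) (w l)))"
      unfolding q_def poly_op_sum poly_op_smult by (intro sum.cong refl) (simp add: Pw fin)
    also have "\<dots> = poly_op C (P \<Lambda>) (\<Sum>l\<in>\<Lambda>. scale (c l) (w l))"
      using lin by (simp add: op_linear_sum[OF lin]) (simp add: op_linear_def)
    also have "\<dots> = 0" unfolding z by (rule op_linear_0[OF lin])
    finally have "q = 0" using poly_op_injective[OF C, of q v0] no_eigen v0 by blast
    then have "0 = poly q (of_real l)" by simp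
    also have "\<dots> = (\<Sum>k\<in>\<Lambda>. c k * (\<Prod>j\<in>\<Lambda> - {k}. of_real l - of_real j))"
      by (simp add: q_def P_def poly_sum poly_prod)
    also have "\<dots> = (\<Sum>k\<in>\<Lambda>. if k = l then c l * (\<Prod>j\<in>\<Lambda> - {l}. of_real l - of_real j) else 0)"
    proof (intro sum.cong refl)
      fix k assume "k \<in> \<Lambda>"
      have "(\<Prod>j\<in>\<Lambda> - {k}. complex_of_real l - of_real j) = 0" if "k \<noteq> l"
        using fin l that by (intro prod_zero) auto
      then show "c k * (\<Prod>j\<in>\<Lambda> - {k}. of_real l - of_real j) =
          (if k = l then c l * (\<Prod>j\<in>\<Lambda> - {l}. of_real l - of_real j) else 0)" by simp
    qed
    also have "\<dots> = c l * (\<Prod>j\<in>\<Lambda> - {l}. of_real l - of_real j)" using fin l by simp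
    finally show "c l = 0" using fin by auto
  qed
  have inj: "inj w"
  proof (rule injI, rule ccontr)
    fix l l' assume eq: "w l = w l'" and ne: "l \<noteq> l'"
    have "(\<Sum>k\<in>{l, l'}. scale (if k = l then 1 else - 1) (w k)) = 0"
      using eq ne by simp
    then have "(if l = l then 1 else - 1 :: complex) = 0"
      by (intro coeffs[of "{l, l'}" l "\<lambda>k. if k = l then 1 else - 1"]) auto
    then show False by simp
  qed
  have "independent (range w)"
    unfolding dependent_explicit
  proof clarify
    fix T r v assume T: "finite T" "T \<subseteq> range w" "(\<Sum>v\<in>T. scale (r v) v) = 0" "v \<in> T" "r v \<noteq> 0"
    obtain \<Lambda> where L: "finite \<Lambda>" "T = w ` \<Lambda>" using T(1,2) by (metis finite_subset_image)
    obtain l where l: "l \<in> \<Lambda>" "v = w l" using T(4) L(2) by blast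
    have "(\<Sum>l\<in>\<Lambda>. scale (r (w l)) (w l)) = 0"
      using T(3) unfolding L(2) by (simp add: sum.reindex inj_on_subset[OF inj])
    then have "r (w l) = 0" by (rule coeffs[OF L(1) l(1), of "\<lambda>l. r (w l)"])
    then show False using T(5) l(2) by simp
  qed
  then have "countable (range w)" using countable_independent[OF S(1)] S(2) by simp
  then have "countable (UNIV :: real set)" using inj by (rule countable_image_inj_on)
  then show False using uncountable_UNIV_real by simp
qed

end

section \<open>The Casimir operator\<close>

text \<open>An irreducible \<open>(\<gg>, K)\<close>-module, with the group entering through the algebraic properties of \<open>K\<close>, its action \<open>\<kappa>\<close> and \<open>Ad\<close>.
The relation between \<open>\<kappa>\<close> and the action of \<open>\<kk>\<close> takes the form \<open>K_stable\<close>.\<close>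

locale harish_chandra_module =
  hermitian_pair br \<theta> Pp Pm u us n + V: complex_space sV
  for br :: "'a::real_vector \<Rightarrow> 'a \<Rightarrow> 'a" and \<theta> Pp Pm u us n
    and sV :: "complex \<Rightarrow> 'v::ab_group_add \<Rightarrow> 'v" +
  fixes \<pi> :: "'a \<times> 'a \<Rightarrow> 'v \<Rightarrow> 'v" and K :: "'g set" and \<kappa> :: "'g \<Rightarrow> 'v \<Rightarrow> 'v"
    and Ad :: "'g \<Rightarrow> 'a \<times> 'a \<Rightarrow> 'a \<times> 'a" and gone :: 'g and gmult :: "'g \<Rightarrow> 'g \<Rightarrow> 'g" and ginv :: "'g \<Rightarrow> 'g"
  assumes pi_linear: "V.op_linear (\<pi> X)"
    and pi_add: "\<pi> (X + Y) v = \<pi> X v + \<pi> Y v"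
    and pi_scale: "\<pi> (cscale c X) v = sV c (\<pi> X v)"
    and pi_bracket: "\<pi> (cbracket br X Y) v = \<pi> X (\<pi> Y v) - \<pi> Y (\<pi> X v)"
    and kappa_linear: "k \<in> K \<Longrightarrow> V.op_linear (\<kappa> k)"
    and K_one: "gone \<in> K" "\<kappa> gone v = v"
    and K_mult: "k \<in> K \<Longrightarrow> k' \<in> K \<Longrightarrow> gmult k k' \<in> K"
      "k \<in> K \<Longrightarrow> k' \<in> K \<Longrightarrow> \<kappa> (gmult k k') v = \<kappa> k (\<kappa> k' v)"
    and K_inv: "k \<in> K \<Longrightarrow> ginv k \<in> K" "k \<in> K \<Longrightarrow> gmult k (ginv k) = gone" "k \<in> K \<Longrightarrow> gmult (ginv k) k = gone"
    and K_finite: "\<exists>A. finite A \<and> (\<lambda>k. \<kappa> k v) ` K \<subseteq> V.span A"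
    and intertwine: "k \<in> K \<Longrightarrow> \<kappa> k (\<pi> X v) = \<pi> (Ad k X) (\<kappa> k v)"
    and K_stable: "V.subspace U \<Longrightarrow> (\<And>k v. k \<in> K \<Longrightarrow> v \<in> U \<Longrightarrow> \<kappa> k v \<in> U) \<Longrightarrow> X \<in> kpart \<theta> \<Longrightarrow> v \<in> U \<Longrightarrow> \<pi> X v \<in> U"
    and nontrivial: "\<exists>v::'v. v \<noteq> 0"
    and irreducible: "V.subspace U \<Longrightarrow> (\<And>X v. v \<in> U \<Longrightarrow> \<pi> X v \<in> U) \<Longrightarrow>
      (\<And>k v. k \<in> K \<Longrightarrow> v \<in> U \<Longrightarrow> \<kappa> k v \<in> U) \<Longrightarrow> U = {0} \<or> U = UNIV"
begin

sublocale polarized_module cscale cbr kf kk Pp Pm u us n sV \<pi>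
  by unfold_locales (fact pi_linear pi_add pi_scale pi_bracket)+

lemma kappa_inv: "k \<in> K \<Longrightarrow> \<kappa> k (\<kappa> (ginv k) v) = v" "k \<in> K \<Longrightarrow> \<kappa> (ginv k) (\<kappa> k v) = v"
  by (simp_all flip: K_mult(2) add: K_inv K_one)

text \<open>\<open>J\<close> is the kernel of the representation and \<open>M\<close> its orthogonal complement. Both are ideals and \<open>\<pi>\<close> is faithful on \<open>M\<close>.\<close>

definition J where "J = {X. \<forall>v. \<pi> X v = 0}"
definition M where "M = {x. \<forall>j\<in>J. hf x j = 0}"

lemma J_subspace: "c.subspace J"
  by (rule c.subspaceI) (simp_all add: J_def pi_add pi_scale)

lemma J_ideal: "j \<in> J \<Longrightarrow> cbr z j \<in> J"
  by (simp add: J_def pi_bracket)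

lemma M_subspace: "c.subspace M"
  by (rule c.subspaceI) (simp_all add: M_def hf.F_add_left hf.F_scale_left)

lemma M_ideal: "x \<in> M \<Longrightarrow> cbr z x \<in> M"
proof -
  assume x: "x \<in> M"
  have "hf (cbr z x) j = 0" if j: "j \<in> J" for j
  proof -
    have "kf (cbr z x) (tau j) = - kf x (cbr z (tau j))"
      using kf_inv[of x z "tau j"] cbr_antisym[of z x] by (simp add: kf_minus)
    also have "cbr z (tau j) = tau (cbr (tau z) j)" by (simp add: tau_cbr tau_tau)
    finally have "hf (cbr z x) j = - hf x (cbr (tau z) j)" by (simp add: hf_def)
    then show ?thesis using x J_ideal[OF j] by (simp add: M_def)
  qed
  then show ?thesis by (simp add: M_def)
qed

lemma J_M_disjoint: "x \<in> J \<Longrightarrow> x \<in> M \<Longrightarrow> x = 0"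
  using hf_pos[of x] by (force simp: M_def)

lemma M_faithful: "x \<in> M \<Longrightarrow> y \<in> M \<Longrightarrow> (\<And>w. \<pi> x w = \<pi> y w) \<Longrightarrow> x = y"
proof -
  assume xy: "x \<in> M" "y \<in> M" and eq: "\<And>w. \<pi> x w = \<pi> y w"
  have "\<pi> (x - y) w = 0" for w using pi_add[of "x - y" y w] eq by simp
  then have "x - y = 0"
    using xy by (intro J_M_disjoint c.subspace_diff[OF M_subspace]) (simp_all add: J_def)
  then show ?thesis by simp
qed

lemma projection: "\<exists>P. clinear P \<and> (\<forall>x. P x \<in> J) \<and> (\<forall>x\<in>J. P x = x) \<and> (\<forall>x. x - P x \<in> M) \<and> (\<forall>x\<in>M. P x = 0)"
proof -
  obtain e m where e: "\<forall>k<m::nat. e k \<in> J" "\<forall>x\<in>J. x = (\<Sum>k<m. cscale (hf x (e k)) (e k))"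
    "\<forall>x. \<forall>q\<in>J. hf (x - (\<Sum>k<m. cscale (hf x (e k)) (e k))) q = 0"
    using orthonormal_frame[OF J_subspace] by blast
  define P where "P x = (\<Sum>k<m. cscale (hf x (e k)) (e k))" for x
  have "clinear P"
    by (simp add: clinear_def P_def hf.F_add_left hf.F_scale_left c.scale_left_distrib sum.distrib c.scale_sum_right)
  moreover have "P x \<in> J" for x
    unfolding P_def using e(1) by (intro c.subspace_sum[OF J_subspace] c.subspace_scale[OF J_subspace]) auto
  moreover have "\<forall>x\<in>J. P x = x" using e(2) by (simp add: P_def[symmetric])
  moreover have "x - P x \<in> M" for x using e(3) unfolding M_def P_def by blast
  moreover have "P x = 0" if "x \<in> M" for x
    unfolding P_def using that e(1) by (intro sum.neutral) (simp add: M_def)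
  ultimately show ?thesis by blast
qed

text \<open>The module itself yields an automorphism of \<open>\<gg>\<close> through which \<open>k\<close> acts. Conjugation by \<open>\<kappa> k\<close> maps the operators \<open>\<pi> x\<close> among
themselves, hence defines an automorphism of \<open>\<gg> / J\<close>, that is, of the ideal \<open>M\<close>; it is extended by the identity on \<open>J\<close>. All
identities for it are checked on operators, where \<open>M_faithful\<close> applies.\<close>

lemma intertwining_automorphism:
  assumes k: "k \<in> K"
  shows "\<exists>A A'. clinear A \<and> clinear A' \<and> (\<forall>x. A' (A x) = x) \<and> (\<forall>x. A (A' x) = x) \<and>
    (\<forall>x y. A (cbr x y) = cbr (A x) (A y)) \<and> (\<forall>x v. \<kappa> k (\<pi> x v) = \<pi> (A x) (\<kappa> k v))"
proof -
  obtain P where P: "clinear P" "\<And>x. P x \<in> J" "\<And>x. x \<in> J \<Longrightarrow> P x = x" "\<And>x. x - P x \<in> M" "\<And>x. x \<in> M \<Longrightarrow> P x = 0"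
    using projection by blast
  define R where "R x = x - P x" for x
  have R: "R x \<in> M" "\<pi> (R x) v = \<pi> x v" for x v
  proof -
    show "R x \<in> M" using P(4) by (simp add: R_def)
    have "\<pi> (P x) v = 0" using P(2) by (simp add: J_def)
    then show "\<pi> (R x) v = \<pi> x v" using pi_add[of "x - P x" "P x" v] by (simp add: R_def)
  qed
  have PR: "P x + R x = x" for x by (simp add: R_def)
  have P_diff: "P (x - y) = P x - P y" for x y
    using clinearD(1)[OF P(1), of "x - y" y] by simp
  have R_M: "R x = x" if "x \<in> M" for x using P(5)[OF that] by (simp add: R_def)
  (* T is conjugation by k on the ideal M, written with values in M. *)
  define T where "T k x = R (Ad k (R x))" for k x
  define A where "A k x = P x + T k x" for k x
  have T_M: "T k x \<in> M" for k x by (simp add: T_def R)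
  have T_pi: "\<pi> (T k x) (\<kappa> k v) = \<kappa> k (\<pi> x v)" if "k \<in> K" for k x v
    using intertwine[OF that, of "R x" v] by (simp add: T_def R)
  have T_pi': "\<pi> (T k x) w = \<kappa> k (\<pi> x (\<kappa> (ginv k) w))" if "k \<in> K" for k x w
    using T_pi[OF that, of x "\<kappa> (ginv k) w"] by (simp add: kappa_inv[OF that])
  have A_pi: "\<pi> (A k x) w = \<pi> (T k x) w" for k x w
    using P(2)[of x] by (simp add: A_def pi_add J_def)
  have kl: "\<kappa> k (v + w) = \<kappa> k v + \<kappa> k w" "\<kappa> k (sV c v) = sV c (\<kappa> k v)" if "k \<in> K" for k v w c
    using kappa_linear[OF that] by (simp_all add: V.op_linear_def)
  have kd: "\<kappa> k (v - w) = \<kappa> k v - \<kappa> k w" if "k \<in> K" for k v w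
    using kl(1)[OF that, of "v - w" w] by simp
  have T_add: "T k (x + y) = T k x + T k y" if "k \<in> K" for k x y
    by (rule M_faithful[OF T_M c.subspace_add[OF M_subspace T_M T_M]])
      (simp add: T_pi'[OF that] pi_add kl[OF that])
  have T_scale: "T k (cscale c x) = cscale c (T k x)" if "k \<in> K" for k c x
    by (rule M_faithful[OF T_M c.subspace_scale[OF M_subspace T_M]])
      (simp add: T_pi'[OF that] pi_scale kl[OF that])
  have A_lin: "clinear (A k)" if "k \<in> K" for k
    by (rule clinearI)
      (simp_all add: A_def clinearD[OF P(1)] T_add[OF that] T_scale[OF that] c.scale_right_distrib)
  have P_A: "P (A k x) = P x" for k x
    by (simp add: A_def clinearD(1)[OF P(1)] P(3)[OF P(2)] P(5)[OF T_M])
  have A_A: "A k (A k' x) = x" if k: "k \<in> K" "k' \<in> K" "\<And>v. \<kappa> k (\<kappa> k' v) = v" for k k' x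
  proof -
    have "T k (A k' x) = R x"
    proof (rule M_faithful[OF T_M R(1)])
      fix w
      have "\<kappa> (ginv k) w = \<kappa> (ginv k) (\<kappa> k (\<kappa> k' w))" by (simp add: k(3))
      also have "\<dots> = \<kappa> k' w" by (rule kappa_inv(2)[OF k(1)])
      finally have "\<pi> (T k (A k' x)) w = \<kappa> k (\<pi> (T k' x) (\<kappa> k' w))"
        by (simp add: T_pi'[OF k(1)] A_pi)
      then show "\<pi> (T k (A k' x)) w = \<pi> (R x) w"
        by (simp add: T_pi[OF k(2)] k(3) R)
    qed
    then show ?thesis using PR by (simp add: A_def[of k] P_A)
  qed
  have split: "P (cbr x y) = cbr (P x) (P y)" "R (cbr x y) = cbr (R x) (R y)" for x y
  proof -
    have 1: "cbr (P x) (R y) = 0"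
    proof (rule J_M_disjoint[OF _ M_ideal[OF R(1)]])
      have "cbr (R y) (P x) \<in> J" by (rule J_ideal[OF P(2)])
      then show "cbr (P x) (R y) \<in> J"
        using cbr_antisym[of "P x" "R y"] c.subspace_neg[OF J_subspace] by simp
    qed
    have 2: "cbr (R x) (P y) = 0"
    proof (rule J_M_disjoint[OF J_ideal[OF P(2)]])
      have "cbr (P y) (R x) \<in> M" by (rule M_ideal[OF R(1)])
      then show "cbr (R x) (P y) \<in> M"
        using cbr_antisym[of "R x" "P y"] c.subspace_neg[OF M_subspace] by simp
    qed
    have "cbr x y = cbr (P x + R x) (P y + R y)" by (simp add: PR)
    also have "\<dots> = cbr (P x) (P y) + cbr (R x) (R y)"
      by (simp only: c.bracket_add_left c.bracket_add_right 1 2 add_0 add_0_right)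
    finally have xy: "cbr x y = cbr (P x) (P y) + cbr (R x) (R y)" .
    show *: "P (cbr x y) = cbr (P x) (P y)"
      unfolding xy clinearD(1)[OF P(1)] P(3)[OF J_ideal[OF P(2)]] P(5)[OF M_ideal[OF R(1)]] by simp
    show "R (cbr x y) = cbr (R x) (R y)" unfolding R_def[of "cbr x y"] * by (simp add: xy)
  qed
  have R_A: "R (A k x) = T k x" for k x by (simp add: R_def P_A) (simp add: A_def)
  have A_hom: "A k (cbr x y) = cbr (A k x) (A k y)" if "k \<in> K" for k x y
  proof -
    have "T k (cbr x y) = cbr (T k x) (T k y)"
    proof (rule M_faithful[OF T_M M_ideal[OF T_M]])
      fix w
      show "\<pi> (T k (cbr x y)) w = \<pi> (cbr (T k x) (T k y)) w"
        by (simp add: T_pi'[OF that] pi_bracket kd[OF that] kappa_inv[OF that])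
    qed
    moreover have "cbr (A k x) (A k y) = P (cbr (A k x) (A k y)) + R (cbr (A k x) (A k y))" by (simp add: PR)
    ultimately show ?thesis by (simp add: A_def[of k "cbr x y"] split P_A R_A)
  qed
  have "\<kappa> k (\<pi> x v) = \<pi> (A k x) (\<kappa> k v)" for x v
    by (simp add: A_pi T_pi[OF k])
  moreover have "A (ginv k) (A k x) = x" "A k (A (ginv k) x) = x" for x
    using A_A[of "ginv k" k] A_A[of k "ginv k"] k K_inv(1)[OF k] kappa_inv[OF k] by auto
  ultimately show ?thesis
    using A_lin[OF k] A_lin[OF K_inv(1)[OF k]] A_hom[OF k] by blast
qed

lemma kf_sum_left: "kf (\<Sum>i\<in>A. f i) y = (\<Sum>i\<in>A. kf (f i) y)"
  by (rule pair.B_sum_left)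

text \<open>The tensor \<open>\<Sum>\<^sub>i x\<^sub>i \<otimes> y\<^sub>i\<close> of dual families represents the identity, so an operator on the left factor is the same as its
transpose on the right factor.\<close>

lemma dual_frame_swap:
  assumes I: "finite I" and expand: "\<And>X. X = (\<Sum>i\<in>I. cscale (kf X (y i)) (x i))"
    and Phi: "\<And>X X' Y. \<Phi> (X + X') Y = \<Phi> X Y + \<Phi> X' Y" "\<And>c X Y. \<Phi> (cscale c X) Y = sV c (\<Phi> X Y)"
      "\<And>X Y Y'. \<Phi> X (Y + Y') = \<Phi> X Y + \<Phi> X Y'" "\<And>c X Y. \<Phi> X (cscale c Y) = sV c (\<Phi> X Y)"
    and adj: "\<And>X Y. kf (T X) Y = kf X (T' Y)"
  shows "(\<Sum>i\<in>I. \<Phi> (T (x i)) (y i)) = (\<Sum>i\<in>I. \<Phi> (x i) (T' (y i)))"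
proof -
  have expand': "(\<Sum>i\<in>I. cscale (kf X (x i)) (y i)) = X" for X
  proof -
    have "kf (X - (\<Sum>i\<in>I. cscale (kf X (x i)) (y i))) Y = 0" for Y
    proof -
      have "kf (\<Sum>i\<in>I. cscale (kf X (x i)) (y i)) Y = (\<Sum>i\<in>I. kf X (x i) * kf Y (y i))"
        unfolding kf_sum_left kf_scale_left by (simp only: kf_sym[of Y])
      also have "\<dots> = kf X (\<Sum>i\<in>I. cscale (kf Y (y i)) (x i))"
        unfolding pair.B_sum_right kf_scale_right by (simp add: mult.commute)
      also have "\<dots> = kf X Y" using expand[of Y] by simp
      finally show ?thesis using kf_add_left[of "X - (\<Sum>i\<in>I. cscale (kf X (x i)) (y i))" "\<Sum>i\<in>I. cscale (kf X (x i)) (y i)" Y] by simp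
    qed
    then have "X - (\<Sum>i\<in>I. cscale (kf X (x i)) (y i)) = 0" by (rule kf_nondegenerate)
    then show ?thesis by simp
  qed
  have z: "\<Phi> 0 Y = 0" "\<Phi> X 0 = 0" for X Y
    using Phi(2)[of 0 0 Y] Phi(4)[of X 0 0] by simp_all
  have sum_left: "\<Phi> (\<Sum>j\<in>I. cscale (f j) (g j)) Y = (\<Sum>j\<in>I. sV (f j) (\<Phi> (g j) Y))" for f g Y
    using I by (induct I rule: finite_induct) (simp_all add: z Phi)
  have sum_right: "\<Phi> X (\<Sum>j\<in>I. cscale (f j) (g j)) = (\<Sum>j\<in>I. sV (f j) (\<Phi> X (g j)))" for f g X
    using I by (induct I rule: finite_induct) (simp_all add: z Phi)
  have "(\<Sum>i\<in>I. \<Phi> (T (x i)) (y i)) = (\<Sum>i\<in>I. \<Sum>j\<in>I. sV (kf (x i) (T' (y j))) (\<Phi> (x j) (y i)))"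
  proof (intro sum.cong refl)
    fix i
    have "\<Phi> (T (x i)) (y i) = \<Phi> (\<Sum>j\<in>I. cscale (kf (T (x i)) (y j)) (x j)) (y i)"
      by (rule arg_cong[where f = "\<lambda>X. \<Phi> X (y i)"]) (rule expand)
    then show "\<Phi> (T (x i)) (y i) = (\<Sum>j\<in>I. sV (kf (x i) (T' (y j))) (\<Phi> (x j) (y i)))"
      by (simp only: sum_left adj)
  qed
  also have "\<dots> = (\<Sum>j\<in>I. \<Sum>i\<in>I. sV (kf (T' (y j)) (x i)) (\<Phi> (x j) (y i)))"
    by (subst sum.swap) (simp only: kf_sym)
  also have "\<dots> = (\<Sum>j\<in>I. \<Phi> (x j) (T' (y j)))"
    by (simp only: sum_right[symmetric] expand')
  finally show ?thesis .
qed

definition casimir where "casimir I x y v = (\<Sum>i\<in>I. \<pi> (x i) (\<pi> (y i) v))"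

lemma pi_op: "\<pi> X (v + w) = \<pi> X v + \<pi> X w" "\<pi> X (sV c v) = sV c (\<pi> X v)"
  using pi_linear by (simp_all add: V.op_linear_def)

text \<open>Swap with \<open>ad Z\<close>, whose transpose is \<open>- ad Z\<close>: the two sums from the product rule cancel.\<close>

lemma casimir_pi:
  assumes I: "finite I" and expand: "\<And>X. X = (\<Sum>i\<in>I. cscale (kf X (y i)) (x i))"
  shows "\<pi> Z (casimir I x y v) = casimir I x y (\<pi> Z v)"
proof -
  have "(\<Sum>i\<in>I. \<pi> (cbr Z (x i)) (\<pi> (y i) v)) = (\<Sum>i\<in>I. \<pi> (x i) (\<pi> (- cbr Z (y i)) v))"
  proof (rule dual_frame_swap[OF I expand, where \<Phi> = "\<lambda>X Y. \<pi> X (\<pi> Y v)" and T = "cbr Z" and T' = "\<lambda>Y. - cbr Z Y"])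
    show "kf (cbr Z X) Y = kf X (- cbr Z Y)" for X Y
      using kf_inv[of X Z Y] cbr_antisym[of Z X] by (simp add: kf_minus)
  qed (simp_all add: pi_add pi_scale pi_op)
  moreover have "\<pi> (- Y) v = - \<pi> Y v" for Y v using pi_scale[of "-1" Y v] by simp
  moreover have "\<pi> X (- w) = - \<pi> X w" for X w using pi_op(2)[of X "-1" w] by simp
  ultimately have zero: "(\<Sum>i\<in>I. \<pi> (cbr Z (x i)) (\<pi> (y i) v)) + (\<Sum>i\<in>I. \<pi> (x i) (\<pi> (cbr Z (y i)) v)) = 0"
    by (simp add: sum_negf)
  have "\<pi> Z (casimir I x y v) = (\<Sum>i\<in>I. \<pi> Z (\<pi> (x i) (\<pi> (y i) v)))"
    unfolding casimir_def by (rule V.op_linear_sum[OF pi_linear])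
  also have "\<dots> = (\<Sum>i\<in>I. \<pi> (cbr Z (x i)) (\<pi> (y i) v) + \<pi> (x i) (\<pi> (cbr Z (y i)) v) + \<pi> (x i) (\<pi> (y i) (\<pi> Z v)))"
  proof (intro sum.cong refl)
    fix i
    have "\<pi> Z (\<pi> (y i) v) = \<pi> (cbr Z (y i)) v + \<pi> (y i) (\<pi> Z v)" by (simp add: pi_bracket)
    then have "\<pi> (x i) (\<pi> Z (\<pi> (y i) v)) = \<pi> (x i) (\<pi> (cbr Z (y i)) v) + \<pi> (x i) (\<pi> (y i) (\<pi> Z v))"
      by (simp only: pi_op)
    moreover have "\<pi> Z (\<pi> (x i) (\<pi> (y i) v)) = \<pi> (cbr Z (x i)) (\<pi> (y i) v) + \<pi> (x i) (\<pi> Z (\<pi> (y i) v))"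
      by (simp add: pi_bracket)
    ultimately show "\<pi> Z (\<pi> (x i) (\<pi> (y i) v)) =
        \<pi> (cbr Z (x i)) (\<pi> (y i) v) + \<pi> (x i) (\<pi> (cbr Z (y i)) v) + \<pi> (x i) (\<pi> (y i) (\<pi> Z v))"
      by (simp add: add.assoc)
  qed
  also have "\<dots> = casimir I x y (\<pi> Z v)" by (simp add: sum.distrib zero casimir_def)
  finally show ?thesis .
qed

text \<open>Swap with an automorphism, whose transpose under the Killing form is its inverse.\<close>

lemma casimir_kappa:
  assumes I: "finite I" and expand: "\<And>X. X = (\<Sum>i\<in>I. cscale (kf X (y i)) (x i))" and k: "k \<in> K"
  shows "\<kappa> k (casimir I x y v) = casimir I x y (\<kappa> k v)"
proof -
  obtain A A' where A: "clinear A" "clinear A'" "\<And>x. A' (A x) = x" "\<And>x. A (A' x) = x"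
    "\<And>x y. A (cbr x y) = cbr (A x) (A y)" "\<And>x v. \<kappa> k (\<pi> x v) = \<pi> (A x) (\<kappa> k v)"
    using intertwining_automorphism[OF k] by blast
  have adj: "kf (A X) Y = kf X (A' Y)" for X Y
    using kf_automorphism[OF A(1-5), of X "A' Y"] by (simp add: A(4))
  have "\<kappa> k (casimir I x y v) = (\<Sum>i\<in>I. \<pi> (A (x i)) (\<pi> (A (y i)) (\<kappa> k v)))"
    unfolding casimir_def V.op_linear_sum[OF kappa_linear[OF k]] by (simp add: A(6))
  also have "\<dots> = (\<Sum>i\<in>I. \<pi> (x i) (\<pi> (A (A' (y i))) (\<kappa> k v)))"
    by (rule dual_frame_swap[OF I expand, where \<Phi> = "\<lambda>X Y. \<pi> X (\<pi> (A Y) (\<kappa> k v))" and T = A and T' = A'])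
      (simp_all add: pi_add pi_scale pi_op clinearD[OF A(1)] adj)
  finally show ?thesis by (simp add: A(4) casimir_def)
qed

text \<open>\<open>V\<close> is generated by one vector, whose translates under \<open>K\<close> span a finite-dimensional space. Words in a finite basis of \<open>\<gg>\<close>
applied to a finite spanning set of it are countably many.\<close>

lemma countable_span: "\<exists>S. countable S \<and> V.span S = UNIV"
proof -
  obtain v0 :: 'v where v0: "v0 \<noteq> 0" using nontrivial by blast
  obtain A where A: "finite A" "(\<lambda>k. \<kappa> k v0) ` K \<subseteq> V.span A" using K_finite by blast
  define act where "act w v = foldr \<pi> w v" for w v
  (* A real basis of the real form is a complex basis of the complexification. *)
  define E where "E = (\<lambda>b. (b, 0::'a)) ` basis"
  define S where "S = (\<lambda>(w, a). act w a) ` (lists E \<times> A)"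
  define U where "U = V.span {act w (\<kappa> k v0) |w k. k \<in> K}"
  have act_lin: "V.op_linear (act w)" for w
    unfolding act_def by (induct w) (use pi_op in \<open>auto simp: V.op_linear_def\<close>)
  have span_stable: "f v \<in> V.span Y" if f: "V.op_linear f" and X: "\<And>x. x \<in> X \<Longrightarrow> f x \<in> V.span Y" and v: "v \<in> V.span X" for f X Y v
    using v
  proof (rule V.span_induct)
    show "V.subspace {v. f v \<in> V.span Y}"
      using f V.op_linear_0[OF f]
      by (intro V.subspaceI) (auto simp: V.op_linear_def V.span_zero V.span_add V.span_scale)
  qed (rule X)
  have "U = {0} \<or> U = UNIV"
  proof (rule irreducible)
    show "V.subspace U" by (simp add: U_def)
    show "\<pi> X v \<in> U" if "v \<in> U" for X v
      using that unfolding U_def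
    proof (rule span_stable[OF pi_linear, rotated])
      fix x assume "x \<in> {act w (\<kappa> k v0) |w k. k \<in> K}"
      then obtain w k where "x = act w (\<kappa> k v0)" "k \<in> K" by blast
      then have "\<pi> X x = act (X # w) (\<kappa> k v0)" "k \<in> K" by (simp_all add: act_def)
      then show "\<pi> X x \<in> V.span {act w (\<kappa> k v0) |w k. k \<in> K}" by (intro V.span_base) blast
    qed
    show "\<kappa> k v \<in> U" if k: "k \<in> K" and v: "v \<in> U" for k v
      using v unfolding U_def
    proof (rule span_stable[OF kappa_linear[OF k], rotated])
      fix x assume "x \<in> {act w (\<kappa> k v0) |w k. k \<in> K}"
      then obtain w k' where x: "x = act w (\<kappa> k' v0)" "k' \<in> K" by blast
      have "\<kappa> k (act w z) = act (map (Ad k) w) (\<kappa> k z)" for w z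
        by (induct w) (simp_all add: act_def intertwine[OF k])
      then have "\<kappa> k x = act (map (Ad k) w) (\<kappa> (gmult k k') v0)" using x k by (simp add: K_mult)
      then show "\<kappa> k x \<in> V.span {act w (\<kappa> k v0) |w k. k \<in> K}"
        using K_mult(1)[OF k x(2)] by (intro V.span_base) blast
    qed
  qed
  moreover have "v0 \<in> U"
  proof -
    have "v0 = act [] (\<kappa> gone v0)" by (simp add: act_def K_one)
    then show ?thesis unfolding U_def using K_one(1) by (intro V.span_base) blast
  qed
  ultimately have U: "U = UNIV" using v0 by blast
  have act_S: "act w z \<in> V.span S" if "z \<in> V.span A" for w z
  proof (induct w)
    case Nil
    have "A \<subseteq> V.span S"
    proof
      fix a assume "a \<in> A"
      then have "act [] a \<in> S" unfolding S_def by force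
      then show "a \<in> V.span S" by (simp add: act_def V.span_base)
    qed
    then show ?case using that V.span_mono[of A "V.span S"] by (auto simp: act_def V.span_span)
  next
    case (Cons X w)
    have "\<pi> X z \<in> V.span S" if "z \<in> V.span S" for z
    proof -
      have "\<pi> e z \<in> V.span S" if "e \<in> E" for e
        using \<open>z \<in> V.span S\<close>
      proof (rule span_stable[OF pi_linear, rotated])
        fix x assume "x \<in> S"
        then obtain w a where "x = act w a" "w \<in> lists E" "a \<in> A" by (auto simp: S_def)
        then have "\<pi> e x = act (e # w) a" "e # w \<in> lists E" "a \<in> A" using that by (simp_all add: act_def)
        then have "\<pi> e x \<in> S" unfolding S_def by force
        then show "\<pi> e x \<in> V.span S" by (rule V.span_base)
      qed
      then have "(\<Sum>b\<in>basis. sV (crep b X) (\<pi> (b, 0) z)) \<in> V.span S"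
        by (intro V.span_sum V.span_scale) (simp add: E_def)
      moreover have "\<pi> X z = \<pi> (\<Sum>b\<in>basis. cscale (crep b X) (b, 0)) z"
        by (rule arg_cong[where f = "\<lambda>X. \<pi> X z"]) (rule crep_expand)
      ultimately show ?thesis by (simp add: pi_sum pi_scale)
    qed
    then show ?case using Cons by (simp add: act_def)
  qed
  have "{act w (\<kappa> k v0) |w k. k \<in> K} \<subseteq> V.span S" using act_S A(2) by blast
  then have "U \<subseteq> V.span S" unfolding U_def by (rule V.span_minimal) simp
  then have "V.span S = UNIV" using U by blast
  moreover have "countable S"
    unfolding S_def E_def using A(1) basis(1)
    by (intro countable_image countable_SIGMA countable_lists countable_finite) auto
  ultimately show ?thesis by blast
qed

text \<open>Schur's lemma: the image of \<open>C - l\<close> and the eigenspaces of \<open>C\<close> are submodules.\<close>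

lemma casimir_scalar:
  assumes I: "finite I" and expand: "\<And>X. X = (\<Sum>i\<in>I. cscale (kf X (y i)) (x i))"
  shows "\<exists>l. \<forall>v. casimir I x y v = sV l v"
proof -
  let ?C = "casimir I x y"
  have C: "V.op_linear ?C"
    unfolding V.op_linear_def casimir_def by (simp add: pi_op sum.distrib V.scale_sum_right)
  obtain v0 :: 'v where v0: "v0 \<noteq> 0" using nontrivial by blast
  obtain S where S: "countable S" "V.span S = UNIV" using countable_span by blast
  have Cadd: "?C (v + w) = ?C v + ?C w" and Cscale: "?C (sV c v) = sV c (?C v)" for v w c
    using C by (simp_all add: V.op_linear_def)
  have kl: "\<kappa> k (v + w) = \<kappa> k v + \<kappa> k w" "\<kappa> k (sV c v) = sV c (\<kappa> k v)" if "k \<in> K" for k v w c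
    using kappa_linear[OF that] by (simp_all add: V.op_linear_def)
  have kd: "\<kappa> k (v - w) = \<kappa> k v - \<kappa> k w" if "k \<in> K" for k v w
    using kl(1)[OF that, of "v - w" w] by simp
  have pd: "\<pi> X (v - w) = \<pi> X v - \<pi> X w" for X v w
    using pi_op(1)[of X "v - w" w] by simp
  have comm: "\<pi> Z (?C v) = ?C (\<pi> Z v)" "k \<in> K \<Longrightarrow> \<kappa> k (?C v) = ?C (\<kappa> k v)" for Z v k
    by (rule casimir_pi[OF I expand], rule casimir_kappa[OF I expand])
  have surj: "\<exists>w. ?C w - sV l w = v" if inj: "\<And>w. ?C w = sV l w \<Longrightarrow> w = 0" for l v
  proof -
    let ?U = "range (\<lambda>w. ?C w - sV l w)"
    have C0: "?C 0 = 0" by (rule V.op_linear_0[OF C])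
    have "?U = {0} \<or> ?U = UNIV"
    proof (rule irreducible)
      show "V.subspace ?U"
      proof (rule V.subspaceI)
        show "0 \<in> ?U" by (rule range_eqI[of _ _ 0]) (simp add: C0)
        fix a b c assume "a \<in> ?U"
        then obtain w where w: "a = ?C w - sV l w" by blast
        show "sV c a \<in> ?U"
          by (rule range_eqI[of _ _ "sV c w"]) (simp add: w Cscale V.scale_right_diff_distrib mult.commute)
        assume "b \<in> ?U"
        then obtain w' where w': "b = ?C w' - sV l w'" by blast
        show "a + b \<in> ?U"
          by (rule range_eqI[of _ _ "w + w'"]) (simp add: w w' Cadd V.scale_right_distrib)
      qed
      show "\<pi> X a \<in> ?U" if "a \<in> ?U" for X a
      proof -
        obtain w where w: "a = ?C w - sV l w" using \<open>a \<in> ?U\<close> by blast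
        show ?thesis by (rule range_eqI[of _ _ "\<pi> X w"]) (simp add: w pd comm pi_op)
      qed
      show "\<kappa> k a \<in> ?U" if k: "k \<in> K" and a: "a \<in> ?U" for k a
      proof -
        obtain w where w: "a = ?C w - sV l w" using a by blast
        show ?thesis by (rule range_eqI[of _ _ "\<kappa> k w"]) (simp add: w kd[OF k] kl[OF k] comm(2)[OF k])
      qed
    qed
    moreover have "?C v0 - sV l v0 \<noteq> 0" using inj[of v0] v0 by auto
    ultimately have "?U = UNIV" by blast
    then have "v \<in> ?U" by (rule ssubst) (rule UNIV_I)
    then show ?thesis by blast
  qed
  obtain l v where lv: "v \<noteq> 0" "?C v = sV l v"
    using V.countable_dimension_eigenvalue[OF C S v0 surj] by blast
  let ?E = "{v. ?C v = sV l v}"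
  have "?E = {0} \<or> ?E = UNIV"
  proof (rule irreducible)
    show "V.subspace ?E"
      by (rule V.subspaceI)
        (simp_all add: V.op_linear_0[OF C] Cadd Cscale V.scale_right_distrib mult.commute)
    show "\<pi> X a \<in> ?E" if "a \<in> ?E" for X a
      using that by (simp flip: comm(1) add: pi_op)
    show "\<kappa> k a \<in> ?E" if "k \<in> K" "a \<in> ?E" for k a
      using that by (simp flip: comm(2) add: kl)
  qed
  then have "?E = UNIV" using lv by blast
  then show ?thesis by blast
qed

text \<open>The span of the \<open>K\<close>-orbits of finitely many vectors is finite-dimensional and stable under \<open>\<kk>\<close>. It is also stable under
\<open>\<Sum>\<^sub>i u\<^sub>i u\<^sub>i\<^sup>*\<close>: in the family dual to \<open>(u, us, \<dots>)\<close> the Casimir element is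
\<open>\<Sum>\<^sub>i (u\<^sub>i u\<^sub>i\<^sup>* + u\<^sub>i\<^sup>* u\<^sub>i)\<close> plus a part from \<open>\<kk>\<close>, the order of the second product can be changed at the cost of \<open>[u\<^sub>i\<^sup>*, u\<^sub>i] \<in> \<kk>\<close>,
and the Casimir element itself is a scalar.\<close>

lemma finite_stable:
  assumes A: "finite A"
  shows "\<exists>C. finite C \<and> A \<subseteq> V.span C \<and> (\<forall>X\<in>kk. \<forall>v\<in>V.span C. \<pi> X v \<in> V.span C) \<and>
    (\<forall>v\<in>V.span C. (\<Sum>i<n. \<pi> (u i) (\<pi> (us i) v)) \<in> V.span C)"
proof -
  let ?orb = "\<Union>a\<in>A. (\<lambda>k. \<kappa> k a) ` K"
  have "\<forall>a. \<exists>F. finite F \<and> (\<lambda>k. \<kappa> k a) ` K \<subseteq> V.span F" using K_finite by blast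
  then obtain F where F: "\<And>a. finite (F a)" "\<And>a. (\<lambda>k. \<kappa> k a) ` K \<subseteq> V.span (F a)" by metis
  have "?orb \<subseteq> V.span (\<Union>a\<in>A. F a)"
  proof
    fix x assume "x \<in> ?orb"
    then obtain a where a: "a \<in> A" "x \<in> V.span (F a)" using F(2) by blast
    then show "x \<in> V.span (\<Union>a\<in>A. F a)" using V.span_mono[of "F a" "\<Union>a\<in>A. F a"] by blast
  qed
  then have orb: "V.span ?orb \<subseteq> V.span (\<Union>a\<in>A. F a)" by (rule V.span_minimal) simp
  obtain C where C: "C \<subseteq> V.span ?orb" "V.independent C" "V.span ?orb \<subseteq> V.span C"
    using V.basis_exists[of "V.span ?orb"] by metis
  have "finite C"
    using V.independent_span_bound[of "\<Union>a\<in>A. F a" C] A F(1) C(1,2) orb by auto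
  have span_C: "V.span C = V.span ?orb"
    using C V.span_minimal[of C "V.span ?orb"] by auto
  have kappa_C: "\<kappa> k v \<in> V.span C" if k: "k \<in> K" and v: "v \<in> V.span C" for k v
    using v unfolding span_C
  proof (rule V.span_induct)
    show "V.subspace {v. \<kappa> k v \<in> V.span ?orb}"
      using kappa_linear[OF k] V.op_linear_0[OF kappa_linear[OF k]]
      by (intro V.subspaceI) (auto simp: V.op_linear_def V.span_zero V.span_add V.span_scale)
    fix x assume "x \<in> ?orb"
    then obtain a k' where a: "a \<in> A" "k' \<in> K" "x = \<kappa> k' a" by blast
    then have "\<kappa> k x = \<kappa> (gmult k k') a" using k by (simp add: K_mult)
    then have "\<kappa> k x \<in> ?orb" using a K_mult(1)[OF k a(2)] by blast
    then show "\<kappa> k x \<in> V.span ?orb" by (rule V.span_base)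
  qed
  have pi_C: "\<pi> X v \<in> V.span C" if "X \<in> kk" "v \<in> V.span C" for X v
    by (rule K_stable[OF V.subspace_span kappa_C that])
  have A_C: "A \<subseteq> V.span C"
  proof
    fix a assume "a \<in> A"
    then have "\<kappa> gone a \<in> ?orb" using K_one(1) by blast
    then show "a \<in> V.span C" unfolding span_C by (simp add: K_one V.span_base)
  qed
  obtain e m where e: "\<forall>k<m::nat. e k \<in> kk" "\<forall>x\<in>kk. x = (\<Sum>k<m. cscale (hf x (e k)) (e k))"
    using orthonormal_frame[OF kk_subspace] by blast
  (* The Hermitian form is - kf x (tau y), so - tau (e k) is dual to e k under the Killing form. *)
  define f where "f k = - tau (e k)" for k
  have f: "f k \<in> kk" if "k < m" for k
    unfolding f_def using e(1) that by (intro c.subspace_neg[OF kk_subspace] tau_kk) auto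
  define I where "I = {..<n} <+> ({..<n} <+> {..<m})"
  define x where "x = case_sum u (case_sum us e)"
  define y where "y = case_sum us (case_sum u f)"
  have I: "finite I" by (simp add: I_def)
  have sum_I: "(\<Sum>i\<in>I. g i) = (\<Sum>i<n. g (Inl i)) + ((\<Sum>i<n. g (Inr (Inl i))) + (\<Sum>k<m. g (Inr (Inr k))))"
    for g :: "_ \<Rightarrow> 'z::comm_monoid_add"
    unfolding I_def by (simp add: sum.Plus comp_def)
  have expand: "X = (\<Sum>i\<in>I. cscale (kf X (y i)) (x i))" for X
  proof -
    obtain X0 p q where X: "X0 \<in> kk" "p \<in> Pp" "q \<in> Pm" "X = X0 + (p + q)" using decompose by blast
    have "(\<Sum>i<n. cscale (kf X (us i)) (u i)) = (\<Sum>i<n. cscale (kf p (us i)) (u i))"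
      using kk_pp_orth[OF X(1) Pm_pp[OF us(1)]] isotropic_m[OF X(3) us(1)]
      by (intro sum.cong refl) (simp add: X(4) kf_add_left)
    then have 1: "(\<Sum>i<n. cscale (kf X (us i)) (u i)) = p" using pair.expand_p[OF X(2)] by simp
    have "(\<Sum>i<n. cscale (kf X (u i)) (us i)) = (\<Sum>i<n. cscale (kf (u i) q) (us i))"
      using kk_pp_orth[OF X(1) Pp_pp[OF pair.u_mem]] isotropic_p[OF X(2) pair.u_mem]
      by (intro sum.cong refl) (simp add: X(4) kf_add_left kf_sym[of q])
    then have 2: "(\<Sum>i<n. cscale (kf X (u i)) (us i)) = q" using pair.expand_m[OF X(3)] by simp
    have "p + q \<in> pp" unfolding pp_eq using X(2,3) by blast
    then have "kf X (f k) = kf X0 (f k)" if "k < m" for k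
      using kk_pp_orth[OF f[OF that]] kf_sym[of "p + q" "f k"] by (simp add: X(4) kf_add_left[of X0])
    then have "kf X (f k) = hf X0 (e k)" if "k < m" for k
      using that by (simp add: f_def hf_def kf_minus)
    then have "(\<Sum>k<m. cscale (kf X (f k)) (e k)) = (\<Sum>k<m. cscale (hf X0 (e k)) (e k))"
      by (intro sum.cong refl) simp
    then have 3: "(\<Sum>k<m. cscale (kf X (f k)) (e k)) = X0" using e(2) X(1) by simp
    show ?thesis
      unfolding sum_I x_def y_def sum.case 1 2 3 unfolding X(4) by (simp only: ac_simps)
  qed
  obtain l where l: "\<And>v. casimir I x y v = sV l v" using casimir_scalar[OF I expand] by blast
  have "(\<Sum>i<n. \<pi> (u i) (\<pi> (us i) v)) \<in> V.span C" if v: "v \<in> V.span C" for v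
  proof -
    (* ?q occurs twice in the Casimir operator, up to the commutators ?b and the part ?c from the frame of kk. *)
    let ?q = "\<Sum>i<n. \<pi> (u i) (\<pi> (us i) v)"
    let ?b = "\<Sum>i<n. \<pi> (cbr (us i) (u i)) v" and ?c = "\<Sum>k<m. \<pi> (e k) (\<pi> (f k) v)"
    have "(\<Sum>i<n. \<pi> (us i) (\<pi> (u i) v)) = ?q + ?b"
      unfolding sum.distrib[symmetric] by (intro sum.cong refl) (simp add: pi_bracket)
    then have "casimir I x y v = ?q + ((?q + ?b) + ?c)"
      unfolding casimir_def sum_I x_def y_def sum.case by simp
    then have "?q + ?q = sV l v - ?b - ?c" unfolding l by (simp add: algebra_simps)
    moreover have "?b \<in> V.span C"
      using v us(1) pair.u_mem by (intro V.span_sum pi_C pp_bracket Pm_pp Pp_pp) auto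
    moreover have "?c \<in> V.span C"
      using v f e(1) by (intro V.span_sum pi_C) auto
    ultimately have "?q + ?q \<in> V.span C" using v by (simp add: V.span_diff V.span_scale)
    then have "sV (1/2) (?q + ?q) \<in> V.span C" by (rule V.span_scale)
    moreover have "sV (1/2) (?q + ?q) = ?q"
      unfolding V.scale_right_distrib V.scale_left_distrib[symmetric] by simp
    ultimately show ?thesis by simp
  qed
  then show ?thesis using \<open>finite C\<close> A_C pi_C by (intro exI[of _ C]) simp
qed

end

section \<open>Harmonic representatives\<close>

context unitary_polarized_module
begin

lemma to_cochain_add: "to_cochain sV B Pm u n (S + T) = to_cochain sV B Pm u n S + to_cochain sV B Pm u n T"
  by (auto simp: fun_eq_iff to_cochain_def scale_right_distrib sum.distrib)

lemma to_cochain_scale: "to_cochain sV B Pm u n (ts c T) = tensor_scale sV c (to_cochain sV B Pm u n T)"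
  by (auto simp: fun_eq_iff to_cochain_def tensor_scale_def scale_sum_right mult.commute)

lemma spin_diag_act_k_act:
  "X \<in> kk \<Longrightarrow> T \<in> tensor_space n \<Longrightarrow>
    spin_diag_act s br B PP Pp Pm u n sV \<pi> X T = k_act X T + ts (half_trace_ad s br Pm X) T"
  by (simp only: spin_diag_act_eq k_act_def)

lemma k_act_tensor_space: "T \<in> tensor_space n \<Longrightarrow> k_act X T \<in> tensor_space n"
  unfolding k_act_def
  by (intro tw.subspace_add[OF tensor_subspace] comp_tensor_space[of "\<pi> X", OF op_linear_0[OF pi_linear]] ad_op_tensor_space)

text \<open>A scalar can be added to an action when it is a character, which the half trace is by \<open>half_trace_bracket\<close>.\<close>

lemma is_lie_rep_twisted:
  assumes H: "tw.subspace H" "H \<subseteq> tensor_space n" "\<And>X T. X \<in> kk \<Longrightarrow> T \<in> H \<Longrightarrow> k_act X T \<in> H"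
  shows "is_lie_rep s br kk (sub_rep ts (spin_diag_act s br B PP Pp Pm u n sV \<pi>) H)"
proof -
  let ?act = "spin_diag_act s br B PP Pp Pm u n sV \<pi>" and ?\<rho> = "half_trace_ad s br Pm"
  have act: "?act X T = k_act X T + ts (?\<rho> X) T" if "X \<in> kk" "T \<in> H" for X T
    using that H(2) by (intro spin_diag_act_k_act) auto
  have stable: "?act X T \<in> H" if "X \<in> kk" "T \<in> H" for X T
    unfolding act[OF that] using that by (intro tw.subspace_add[OF H(1)] tw.subspace_scale[OF H(1)] H(3))
  note sub = tw.subspace_add[OF H(1)] tw.subspace_scale[OF H(1)]
  note kk_sub = g.subspace_add[OF kk(1)] g.subspace_scale[OF kk(1)] kk(2)
  have 1: "?act X (T + T') = ?act X T + ?act X T'" if "X \<in> kk" "T \<in> H" "T' \<in> H" for X T T'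
    using that by (simp only: act sub k_act_add tw.scale_right_distrib ac_simps)
  have 2: "?act X (ts c T) = ts c (?act X T)" if "X \<in> kk" "T \<in> H" for X c T
    using that by (simp only: act sub k_act_scale tw.scale_right_distrib tw.scale_scale mult.commute)
  have 3: "?act (X + Y) T = ?act X T + ?act Y T" if "X \<in> kk" "Y \<in> kk" "T \<in> H" for X Y T
    using that by (simp only: act kk_sub half_trace_linear k_act_add_left tw.scale_left_distrib ac_simps)
  have 4: "?act (s c X) T = ts c (?act X T)" if "X \<in> kk" "T \<in> H" for X c T
    using that by (simp only: act kk_sub half_trace_linear k_act_scale_left tw.scale_right_distrib tw.scale_scale)
  have 5: "?act (br X Y) T + ?act Y (?act X T) = ?act X (?act Y T)" if XY: "X \<in> kk" "Y \<in> kk" and T: "T \<in> H" for X Y T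
  proof -
    have e: "?act X (?act Y T) = k_act X (k_act Y T) + (ts (?\<rho> Y) (k_act X T) + ts (?\<rho> X) (k_act Y T) + ts (?\<rho> X * ?\<rho> Y) T)"
      if "X \<in> kk" "Y \<in> kk" for X Y
      unfolding act[OF that(1) stable[OF that(2) T]] unfolding act[OF that(2) T]
      by (simp only: k_act_add k_act_scale tw.scale_right_distrib tw.scale_scale ac_simps)
    have "?act (br X Y) T = k_act (br X Y) T"
      using act[OF kk(2)[OF XY] T] half_trace_bracket[OF XY] by simp
    then show ?thesis
      unfolding e[OF XY] e[OF XY(2) XY(1)] k_act_bracket[OF XY, symmetric] by (simp only: ac_simps)
  qed
  have "H \<noteq> {}" using tw.subspace_0[OF H(1)] by blast
  then show ?thesis
    unfolding is_lie_rep_def sub_rep_def lie_rep.simps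
    using sub stable 1 2 3 4 5 by (intro conjI ballI allI) assumption+
qed

text \<open>The statement about Dirac cohomology in terms of the algebraic data alone. The decompositions are those of Hodge theory;
each isomorphism is an instance of \<open>coset_iso\<close>, with \<open>Ker D\<close> as the set of unique representatives.\<close>

theorem harmonic_representatives:
  fixes W :: "(nat set \<Rightarrow> 'v) set"
  assumes W: "W = tensor_space n"
    and d: "d = dirac_d s B Pp Pm u us n sV \<pi>"
    and delta: "\<delta> = dirac_delta s B Pp Pm u us n sV \<pi>"
    and D: "D = (\<lambda>T. d T + \<delta> T)"
    and bd: "bd = chain_diff s br sV \<pi> u n"
    and rho: "\<rho> = half_trace_ad s br Pm"
    and KerD: "KerD = sub_rep ts (spin_diag_act s br B PP Pp Pm u n sV \<pi>) (ker_on W D)"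
    and H_D: "H_D = quotient_rep ts (spin_diag_act s br B PP Pp Pm u n sV \<pi>) (ker_on W D) (D ` W \<inter> ker_on W D)"
  shows "direct_sum ts W [ker_on W D, d ` W, \<delta> ` W]"
    and "direct_sum ts (ker_on W d) [ker_on W D, d ` W]"
    and "direct_sum ts (ker_on W \<delta>) [ker_on W D, \<delta> ` W]"
    and "D ` W \<inter> ker_on W D = {0}"
    and "lie_rep_iso s br kk KerD H_D (coset (D ` W \<inter> ker_on W D))"
    and "lie_rep_iso s br kk KerD (twist \<rho> (cohomology_rep s br sV \<pi> Pm))
      (\<lambda>h. coset (cochain_diff br sV \<pi> Pm ` cochains s sV Pm) (to_cochain sV B Pm u n h))"
    and "lie_rep_iso s br kk KerD (twist \<rho> (homology_rep s br sV \<pi> u n)) (coset (bd ` W))"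
    and "\<forall>C \<in> coset (d ` W) ` ker_on W d. \<exists>!h. h \<in> C \<and> h \<in> ker_on W D"
    and "\<forall>C \<in> coset (\<delta> ` W) ` ker_on W \<delta>. \<exists>!h. h \<in> C \<and> h \<in> ker_on W D"
proof -
  obtain F where F: "hodge_complex ts F (tensor_space n) dd dl" using hodge by blast
  interpret HC: hodge_complex ts F W dd dl unfolding W by (rule F)
  have d_eq: "d T = dd T" and dl_eq: "\<delta> T = dl T" if "T \<in> W" for T
    using that by (simp_all add: d delta W dirac_d_eq dirac_delta_eq)
  have D_eq: "D T = HC.dirac T" if "T \<in> W" for T
    using that by (simp only: D HC.dirac_def d_eq dl_eq)
  have bd_eq: "bd T = ts (- 1 / 2) (dl T)" if "T \<in> W" for T
    using that unfolding bd W by (rule chain_diff_eq)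
  have images: "d ` W = dd ` W" "\<delta> ` W = dl ` W" "D ` W = HC.dirac ` W"
    by (intro image_cong refl d_eq dl_eq D_eq; assumption)+
  have kernels: "ker_on W d = ker_on W dd" "ker_on W \<delta> = ker_on W dl" "ker_on W D = ker_on W HC.dirac"
    unfolding ker_on_def using d_eq dl_eq D_eq by (metis (mono_tags))+
  have bd_ker: "ker_on W bd = ker_on W dl"
    unfolding ker_on_def using bd_eq by (intro Collect_cong) (auto simp: tw.scale_eq_0_iff)
  have bd_image: "bd ` W = dl ` W"
  proof (intro equalityI subsetI)
    fix y assume "y \<in> bd ` W"
    then obtain T where T: "T \<in> W" "y = dl (ts (- 1 / 2) T)" by (auto simp only: bd_eq dl_scale)
    then show "y \<in> dl ` W" using tw.subspace_scale[OF HC.W] by blast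
  next
    fix y assume "y \<in> dl ` W"
    then obtain T where T: "T \<in> W" "y = dl T" by blast
    have "bd (ts (- 2) T) = ts (- 1 / 2) (ts (- 2) (dl T))"
      using bd_eq[OF tw.subspace_scale[OF HC.W T(1)]] by (simp only: dl_scale)
    also have "\<dots> = dl T" by (simp add: tw.scale_scale)
    finally have "y = bd (ts (- 2) T)" using T(2) by simp
    then show "y \<in> bd ` W" using tw.subspace_scale[OF HC.W T(1)] by blast
  qed
  define H where "H = ker_on W HC.dirac"
  have HD: "H = {T \<in> W. dd T = 0 \<and> dl T = 0}"
    unfolding H_def ker_on_def using HC.dirac_kernel by blast
  have H_sub: "tw.subspace H" unfolding H_def by (rule HC.ker_subspace)
  have HW: "T \<in> W" if "T \<in> H" for T using that by (simp add: HD)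
  have k_W: "k_act X T \<in> W" if "T \<in> W" for X T using that unfolding W by (rule k_act_tensor_space)
  have H_stable: "k_act X T \<in> H" if "X \<in> kk" "T \<in> H" for X T
    using that k_W[of T X] dd_k_act[OF that(1), of T] dl_k_act[OF that(1), of T]
    by (simp add: HD k_act_scale[of X 0, simplified])
  have orth_d: "h = 0" if "h \<in> H" "a \<in> W" "h = dd a" for h a
    using HC.ker_orth(1)[of h a] HC.F_eq_0[OF HW] that by (simp add: H_def)
  have orth_dl: "h = 0" if "h \<in> H" "a \<in> W" "h = dl a" for h a
    using HC.ker_orth(2)[of h a] HC.F_eq_0[OF HW] that by (simp add: H_def)
  have dec_d: "\<exists>h\<in>H. \<exists>a\<in>W. x = h + dd a" if "x \<in> ker_on W dd" for x
    using that HC.ker_d_decomposition by (simp add: ker_on_def H_def)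
  have dec_dl: "\<exists>h\<in>H. \<exists>a\<in>W. x = h + dl a" if "x \<in> ker_on W dl" for x
    using that HC.ker_dl_decomposition by (simp add: ker_on_def H_def)
  show "direct_sum ts W [ker_on W D, d ` W, \<delta> ` W]"
    unfolding kernels images by (rule HC.hodge_direct_sum)
  show "direct_sum ts (ker_on W d) [ker_on W D, d ` W]"
    unfolding kernels images by (rule HC.ker_d_direct_sum)
  show "direct_sum ts (ker_on W \<delta>) [ker_on W D, \<delta> ` W]"
    unfolding kernels images by (rule HC.ker_dl_direct_sum)
  show zero: "D ` W \<inter> ker_on W D = {0}"
    unfolding kernels images by (rule HC.image_dirac_inter_kernel)
  let ?act = "spin_diag_act s br B PP Pp Pm u n sV \<pi>"
  have act: "?act X T = k_act X T + ts (\<rho> X) T" if "X \<in> kk" "T \<in> W" for X T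
    using that unfolding W rho by (rule spin_diag_act_k_act)
  have rep: "is_lie_rep s br kk (sub_rep ts ?act H)"
    by (rule is_lie_rep_twisted[OF H_sub _ H_stable]) (use HW in \<open>auto simp: W\<close>)
  note kk_sub = g.subspace_add[OF kk(1)] g.subspace_scale[OF kk(1)] kk(2)
  show "lie_rep_iso s br kk KerD H_D (coset (D ` W \<inter> ker_on W D))"
    unfolding KerD H_D zero unfolding kernels(3) H_def[symmetric]
  proof (rule coset_iso(2)[OF ts_vector_space rep, where \<phi> = "\<lambda>x. x" and \<rho> = "\<lambda>_. 0"])
    show "tw.subspace {0}" by (rule tw.subspace_single_0)
  qed (auto intro: kk_sub)
  define Z where "Z = to_cochain sV B Pm u n"
  have Z_add: "Z (S + T) = Z S + Z T" and Z_scale: "Z (ts c T) = tensor_scale sV c (Z T)" for S T c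
    by (simp_all only: Z_def to_cochain_add to_cochain_scale)
  have Z_bij: "bij_betw Z W (cochains s sV Pm)" unfolding Z_def W by (rule to_cochain_bij)
  have Z_inj: "S = T" if "Z S = Z T" "S \<in> W" "T \<in> W" for S T
    using Z_bij that unfolding bij_betw_def inj_on_def by blast
  have Z_zero: "Z 0 = 0" using Z_add[of 0 0] by simp
  have Z_d: "cochain_diff br sV \<pi> Pm (Z T) = Z (dd T)" if "T \<in> W" for T
    using that HC.d_W[OF that] unfolding Z_def W by (rule to_cochain_dd[symmetric])
  have Z_act: "cochain_act br \<pi> Pm X (Z T) = Z (k_act X T)" if "X \<in> kk" "T \<in> W" for X T
    using to_cochain_act[of X T] that k_W[of T X] unfolding Z_def W k_act_def by simp
  have cochains_eq: "cochains s sV Pm = Z ` W" using Z_bij by (simp add: bij_betw_def)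
  define N where "N = cochain_diff br sV \<pi> Pm ` cochains s sV Pm"
  have N_eq: "N = Z ` dd ` W"
    unfolding N_def cochains_eq image_image by (intro image_cong refl Z_d)
  have dd_sub: "tw.subspace (dd ` W)" by (rule HC.image_subspaces(1))
  have N_sub: "tw.subspace N"
  proof (rule tw.subspaceI)
    show "0 \<in> N" unfolding N_eq using Z_zero tw.subspace_0[OF dd_sub] by force
    fix x y c assume "x \<in> N"
    then obtain S where S: "S \<in> dd ` W" "x = Z S" unfolding N_eq by blast
    show "tensor_scale sV c x \<in> N"
      unfolding S(2) Z_scale[symmetric] N_eq by (intro imageI tw.subspace_scale[OF dd_sub] S(1))
    assume "y \<in> N"
    then obtain T where T: "T \<in> dd ` W" "y = Z T" unfolding N_eq by blast
    show "x + y \<in> N"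
      unfolding S(2) T(2) Z_add[symmetric] N_eq by (intro imageI tw.subspace_add[OF dd_sub] S(1) T(1))
  qed
  show "lie_rep_iso s br kk KerD (twist \<rho> (cohomology_rep s br sV \<pi> Pm))
      (\<lambda>h. coset (cochain_diff br sV \<pi> Pm ` cochains s sV Pm) (to_cochain sV B Pm u n h))"
    unfolding KerD cohomology_rep_def kernels(3) H_def[symmetric] N_def[symmetric] Z_def[symmetric]
  proof (rule coset_iso(1)[OF ts_vector_space rep N_sub, where \<phi> = Z])
    fix x y X c assume x: "x \<in> H"
    have x0: "dd x = 0" using x by (simp add: HD)
    show "Z x \<in> ker_on (cochains s sV Pm) (cochain_diff br sV \<pi> Pm)"
      using HW[OF x] by (simp add: ker_on_def cochains_eq Z_d x0 Z_zero)
    show "Z (ts c x) = tensor_scale sV c (Z x)" by (rule Z_scale)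
    show "Z (x + y) = Z x + Z y" by (rule Z_add)
    show "x = y" if y: "y \<in> H" and xy: "Z x - Z y \<in> N"
    proof -
      obtain a where a: "a \<in> W" "Z x - Z y = Z (dd a)" using xy unfolding N_eq by blast
      have "Z x = Z (dd a + y)" using a(2) by (simp add: Z_add algebra_simps)
      then have "x = dd a + y"
        by (rule Z_inj) (intro HW x y tw.subspace_add[OF HC.W] HC.d_W a)+
      then have "x - y = dd a" by simp
      then have "x - y = 0" by (intro orth_d[OF tw.subspace_diff[OF H_sub x y] a(1)])
      then show "x = y" by simp
    qed
    assume X: "X \<in> kk"
    show "Z (?act X x) = cochain_act br \<pi> Pm X (Z x) + tensor_scale sV (\<rho> X) (Z x)"
      by (simp only: act[OF X HW[OF x]] Z_add Z_scale Z_act[OF X HW[OF x]])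
    fix b assume "b \<in> N"
    then obtain a where a: "a \<in> W" "b = Z (dd a)" unfolding N_eq by blast
    have "cochain_act br \<pi> Pm X (Z x + b) = Z (k_act X (x + dd a))"
      unfolding a(2) Z_add[symmetric] by (intro Z_act X tw.subspace_add[OF HC.W] HW x HC.d_W a)
    also have "\<dots> = cochain_act br \<pi> Pm X (Z x) + Z (dd (k_act X a))"
      by (simp only: k_act_add dd_k_act[OF X] Z_add Z_act[OF X HW[OF x]])
    finally show "\<exists>b'\<in>N. cochain_act br \<pi> Pm X (Z x + b) = cochain_act br \<pi> Pm X (Z x) + b'"
      using k_W[OF a(1), of X] unfolding N_eq by blast
  next
    fix f assume "f \<in> ker_on (cochains s sV Pm) (cochain_diff br sV \<pi> Pm)"
    then obtain T where T: "T \<in> W" "f = Z T" "Z (dd T) = 0"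
      unfolding ker_on_def cochains_eq using Z_d by auto
    have "dd T = 0" using T(3) by (intro Z_inj[OF _ HC.d_W[OF T(1)] HC.zero_W]) (simp only: Z_zero)
    then obtain h a where h: "h \<in> H" "a \<in> W" "T = h + dd a"
      using dec_d[of T] T(1) by (auto simp: ker_on_def)
    have "f = Z h + Z (dd a)" by (simp only: T(2) h(3) Z_add)
    then show "\<exists>h\<in>H. \<exists>b\<in>N. f = Z h + b" using h(1,2) unfolding N_eq by blast
  qed (rule kk_sub; assumption)+
  show "lie_rep_iso s br kk KerD (twist \<rho> (homology_rep s br sV \<pi> u n)) (coset (bd ` W))"
    unfolding KerD homology_rep_def kernels(3) H_def[symmetric] bd[symmetric] W[symmetric] bd_ker bd_image
  proof (rule coset_iso(1)[OF ts_vector_space rep HC.image_subspaces(2), where \<phi> = "\<lambda>x. x"])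
    have c_act: "chain_act s br sV \<pi> u n X T = k_act X T" if "X \<in> kk" "T \<in> W" for X T
      using that unfolding W k_act_def by (rule chain_act_eq)
    fix x y X assume x: "x \<in> H"
    show "x \<in> ker_on W dl" using x by (simp add: HD ker_on_def)
    show "x = y" if y: "y \<in> H" and xy: "x - y \<in> dl ` W"
    proof -
      obtain a where "a \<in> W" "x - y = dl a" using xy by blast
      then have "x - y = 0" by (rule orth_dl[OF tw.subspace_diff[OF H_sub x y]])
      then show "x = y" by simp
    qed
    assume X: "X \<in> kk"
    show "?act X x = chain_act s br sV \<pi> u n X x + ts (\<rho> X) x"
      by (simp only: act[OF X HW[OF x]] c_act[OF X HW[OF x]])
    fix b assume "b \<in> dl ` W"
    then obtain a where a: "a \<in> W" "b = dl a" by blast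
    have "chain_act s br sV \<pi> u n X (x + b) = k_act X (x + dl a)"
      unfolding a(2) by (intro c_act X tw.subspace_add[OF HC.W] HW x HC.dl_W a)
    also have "\<dots> = chain_act s br sV \<pi> u n X x + dl (k_act X a)"
      by (simp only: k_act_add dl_k_act[OF X] c_act[OF X HW[OF x]])
    finally show "\<exists>b'\<in>dl ` W. chain_act s br sV \<pi> u n X (x + b) = chain_act s br sV \<pi> u n X x + b'"
      using k_W[OF a(1), of X] by blast
  next
    fix x assume "x \<in> ker_on W dl"
    then show "\<exists>h\<in>H. \<exists>b\<in>dl ` W. x = h + b" using dec_dl by blast
  qed (rule refl kk_sub; assumption?)+
  have unique: "\<exists>!h. h \<in> C \<and> h \<in> H"
    if N: "tw.subspace N" and orth: "\<And>h. h \<in> H \<Longrightarrow> h \<in> N \<Longrightarrow> h = 0"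
      and x: "\<exists>h\<in>H. \<exists>b\<in>N. x = h + b" and C: "C = coset N x" for N C x
  proof -
    obtain h b where h: "h \<in> H" "b \<in> N" "x = h + b" using x by blast
    have "h = x + - b" using h(3) by simp
    then have "h \<in> C" unfolding C coset_def using tw.subspace_neg[OF N h(2)] by blast
    moreover have "h' = h" if h': "h' \<in> C" "h' \<in> H" for h'
    proof -
      obtain b' where b': "b' \<in> N" "h' = x + b'" using h'(1) by (auto simp: C coset_def)
      have "h' - h = b + b'" by (simp add: b'(2) h(3))
      then have "h' - h \<in> N" using tw.subspace_add[OF N h(2) b'(1)] by simp
      then have "h' - h = 0" by (rule orth[OF tw.subspace_diff[OF H_sub h'(2) h(1)]])
      then show "h' = h" by simp
    qed
    ultimately show ?thesis using h(1) by blast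
  qed
  show "\<forall>C \<in> coset (d ` W) ` ker_on W d. \<exists>!h. h \<in> C \<and> h \<in> ker_on W D"
    unfolding kernels images H_def[symmetric]
  proof (rule ballI, erule imageE)
    fix C x assume x: "C = coset (dd ` W) x" "x \<in> ker_on W dd"
    show "\<exists>!h. h \<in> C \<and> h \<in> H"
      by (rule unique[OF HC.image_subspaces(1) _ _ x(1)]) (use orth_d dec_d[OF x(2)] in blast)+
  qed
  show "\<forall>C \<in> coset (\<delta> ` W) ` ker_on W \<delta>. \<exists>!h. h \<in> C \<and> h \<in> ker_on W D"
    unfolding kernels images H_def[symmetric]
  proof (rule ballI, erule imageE)
    fix C x assume x: "C = coset (dl ` W) x" "x \<in> ker_on W dl"
    show "\<exists>!h. h \<in> C \<and> h \<in> H"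
      by (rule unique[OF HC.image_subspaces(2) _ _ x(1)]) (use orth_dl dec_dl[OF x(2)] in blast)+
  qed
qed

end

section \<open>From the group to the Lie algebra\<close>

lemma Ck_on_const: "Ck_on k S (\<lambda>_. c)"
  by (induct k arbitrary: c) (simp_all add: frechet_derivative_const)

lemma zero_smooth: "(\<lambda>_. 0) \<in> smooth_functions A"
  by (auto simp: smooth_functions_def smooth_on_def comp_def Ck_on_const)

lemma left_invariant_field_zero:
  assumes "X \<in> left_invariant_fields G A"
  shows "X (\<lambda>_. 0) = (\<lambda>_. 0)"
proof -
  have "\<forall>c. \<forall>f\<in>smooth_functions A. X (\<lambda>g. c * f g) = (\<lambda>g. c * X f g)"
    using assms by (simp add: left_invariant_fields_def)
  from bspec[OF spec[OF this, of 0] zero_smooth] show ?thesis by simp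
qed

text \<open>A basis of \<open>U\<close> together with \<open>v\<close> is independent, so a functional can be prescribed on it.\<close>

lemma (in complex_space) separating_functional:
  assumes U: "subspace U" and v: "v \<notin> U"
  shows "\<exists>\<xi>. Vector_Spaces.linear scale (*) \<xi> \<and> (\<forall>x\<in>U. \<xi> x = 0) \<and> \<xi> v = (1 :: complex)"
proof -
  interpret pair: vector_space_pair scale "(*) :: complex \<Rightarrow> complex \<Rightarrow> complex"
    by unfold_locales (simp_all add: algebra_simps)
  obtain A where A: "A \<subseteq> U" "independent A" "U \<subseteq> span A" using basis_exists[of U] by metis
  have span_A: "span A \<subseteq> U" using A(1) U by (rule span_minimal)
  have "independent (insert v A)" using A(2) v span_A by (intro independent_insertI) auto
  then obtain \<xi> where xi: "Vector_Spaces.linear scale (*) \<xi>" "\<And>x. x \<in> insert v A \<Longrightarrow> \<xi> x = (if x = v then 1 else 0)"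
    using pair.linear_independent_extend[of "insert v A" "\<lambda>x. if x = v then 1 else 0"] by blast
  have lin: "\<xi> (x + y) = \<xi> x + \<xi> y" "\<xi> (scale c x) = c * \<xi> x" for x y c
    using xi(1) by (simp_all add: Vector_Spaces.linear_iff)
  have "\<xi> 0 = 0" using lin(2)[of 0 0] by simp
  then have sub: "subspace {x. \<xi> x = 0}" by (intro subspaceI) (simp_all add: lin)
  have "A \<subseteq> {x. \<xi> x = 0}" using xi(2) A(1) v by auto
  then have "span A \<subseteq> {x. \<xi> x = 0}" using sub by (rule span_minimal)
  then show ?thesis using xi A(3) by (intro exI[of _ \<xi>]) auto
qed

lemma gK_moduleD:
  assumes V: "gK_module G A br L K \<theta> sV \<pi> \<kappa>"
  shows "vector_space sV" "Vector_Spaces.linear sV sV (\<pi> X)"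
    "\<pi> (X + Y) v = \<pi> X v + \<pi> Y v" "\<pi> (cscale c X) v = sV c (\<pi> X v)"
    "\<pi> (cbracket br X Y) v = \<pi> X (\<pi> Y v) - \<pi> Y (\<pi> X v)"
    "k \<in> K \<Longrightarrow> Vector_Spaces.linear sV sV (\<kappa> k)" "\<kappa> \<one>\<^bsub>G\<^esub> v = v"
    "k \<in> K \<Longrightarrow> k' \<in> K \<Longrightarrow> \<kappa> (k \<otimes>\<^bsub>G\<^esub> k') v = \<kappa> k (\<kappa> k' v)"
    "\<exists>A. finite A \<and> (\<lambda>k. \<kappa> k v) ` K \<subseteq> module.span sV A"
    "k \<in> K \<Longrightarrow> \<kappa> k (\<pi> X v) = \<pi> (cAd G A L k X) (\<kappa> k v)"
  using V by (simp_all add: gK_module_def del: split_paired_All)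

text \<open>Suppose \<open>\<pi> (x, 0) v \<notin> U\<close> and take a functional that vanishes on \<open>U\<close> and not there. Its matrix coefficient with \<open>v\<close> vanishes on
\<open>K\<close>, so the zero function is a smooth function that restricts to it, and its derivative in the direction \<open>x\<close> is 0. But that
derivative is the value of the functional at \<open>\<pi> (x, 0) v\<close>. Complex \<open>X \<in> \<kk>\<close> follow by linearity.\<close>

lemma K_stable_subspace:
  assumes L: "lie_algebra_of G A br L" and V: "gK_module G A br L K \<theta> sV \<pi> \<kappa>"
    and U: "module.subspace sV U" "\<And>k v. k \<in> K \<Longrightarrow> v \<in> U \<Longrightarrow> \<kappa> k v \<in> U"
    and X: "X \<in> kpart \<theta>" and v: "v \<in> U"
  shows "\<pi> X v \<in> U"
proof -
  interpret V: complex_space sV using gK_moduleD(1)[OF V] by (rule complex_space.intro)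
  have real: "\<pi> (x, 0) v \<in> U" if x: "\<theta> x = x" for x
  proof (rule ccontr)
    assume "\<pi> (x, 0) v \<notin> U"
    then obtain \<xi> where xi: "Vector_Spaces.linear sV (*) \<xi>" "\<And>w. w \<in> U \<Longrightarrow> \<xi> w = 0" "\<xi> (\<pi> (x, 0) v) = (1 :: complex)"
      using V.separating_functional[OF U(1)] by blast
    have "\<forall>v \<xi>. Vector_Spaces.linear sV (*) \<xi> \<longrightarrow>
      (\<exists>f\<in>smooth_functions A. \<forall>k\<in>K. f k = Re (\<xi> (\<kappa> k v))) \<and>
      (\<forall>f\<in>smooth_functions A. (\<forall>k\<in>K. f k = Re (\<xi> (\<kappa> k v))) \<longrightarrow>
        (\<forall>x. \<theta> x = x \<longrightarrow> L x f \<one>\<^bsub>G\<^esub> = Re (\<xi> (\<pi> (x, 0) v))))"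
      using V unfolding gK_module_def by (elim conjE) assumption
    then have deriv: "\<forall>f\<in>smooth_functions A. (\<forall>k\<in>K. f k = Re (\<xi> (\<kappa> k v))) \<longrightarrow>
        (\<forall>x. \<theta> x = x \<longrightarrow> L x f \<one>\<^bsub>G\<^esub> = Re (\<xi> (\<pi> (x, 0) v)))"
      using xi(1) by blast
    have "\<forall>k\<in>K. 0 = Re (\<xi> (\<kappa> k v))" using xi(2) U(2) v by simp
    with bspec[OF deriv zero_smooth] have "L x (\<lambda>_. 0) \<one>\<^bsub>G\<^esub> = Re (\<xi> (\<pi> (x, 0) v))"
      using x by blast
    moreover have "L x \<in> left_invariant_fields G A"
      using L unfolding lie_algebra_of_def bij_betw_def by blast
    ultimately show False using left_invariant_field_zero[of "L x" G A] xi(3) by simp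
  qed
  obtain x y where xy: "X = (x, y)" "\<theta> x = x" "\<theta> y = y" using X by (cases X) (simp add: kpart_def)
  have "X = (x, 0) + cscale \<i> (y, 0)" by (simp add: xy(1) cscale_def)
  then have "\<pi> X v = \<pi> (x, 0) v + sV \<i> (\<pi> (y, 0) v)"
    by (simp only: gK_moduleD(3,4)[OF V])
  then show ?thesis using real xy U(1) V.subspace_add V.subspace_scale by simp
qed

lemma (in complex_space) op_linearI: "Vector_Spaces.linear scale scale f \<Longrightarrow> op_linear f"
  by (simp add: Vector_Spaces.linear_iff op_linear_def)

lemma fixed_subgroup:
  fixes G (structure)
  assumes G: "group G" "carrier G = UNIV" and hom: "\<Theta> \<in> hom G G" and K: "K = {g. \<Theta> g = g}"
  shows "\<one> \<in> K" "k \<in> K \<Longrightarrow> k' \<in> K \<Longrightarrow> k \<otimes> k' \<in> K"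
    "k \<in> K \<Longrightarrow> m_inv G k \<in> K" "k \<in> K \<Longrightarrow> k \<otimes> m_inv G k = \<one>" "k \<in> K \<Longrightarrow> m_inv G k \<otimes> k = \<one>"
proof -
  interpret group_hom G G \<Theta> using G(1) hom by (simp add: group_hom_def group_hom_axioms_def)
  show "\<one> \<in> K" "k \<in> K \<Longrightarrow> k' \<in> K \<Longrightarrow> k \<otimes> k' \<in> K"
    "k \<in> K \<Longrightarrow> m_inv G k \<in> K" "k \<in> K \<Longrightarrow> k \<otimes> m_inv G k = \<one>" "k \<in> K \<Longrightarrow> m_inv G k \<otimes> k = \<one>"
    by (simp_all add: K G(2))
qed

lemma skew_complex:
  assumes h: "positive_hermitian_form sV h"
    and pi: "\<And>X Y v. \<pi> (X + Y) v = \<pi> X v + \<pi> Y v" "\<And>c X v. \<pi> (cscale c X) v = sV c (\<pi> X v)"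
    and skew: "\<And>x v w. h (\<pi> (x, 0) v) w = - h v (\<pi> (x, 0) w)"
  shows "h (\<pi> X v) w = - h v (\<pi> (cconj X) w)"
proof -
  have h1: "h (v + v') w = h v w + h v' w" "h (sV c v) w = c * h v w" "h w v = cnj (h v w)" for v v' w c
    using h unfolding positive_hermitian_form_def by blast+
  have h2: "h w (v + v') = h w v + h w v'" "h w (sV c v) = cnj c * h w v" for v v' w c
    unfolding h1(3)[of w] h1(1,2) by simp_all
  obtain x y where X: "X = (x, y)" by fastforce
  have "X = (x, 0) + cscale \<i> (y, 0)" "cconj X = (x, 0) + cscale (- \<i>) (y, 0)"
    by (simp_all add: X cscale_def cconj_def)
  then show ?thesis by (simp add: pi h1(1,2) h2 skew)
qed

theorem theorem4p7:
  fixes G :: "'g::{t2_space, second_countable_topology} monoid"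
    and atlas :: "('g set \<times> ('g \<Rightarrow> 'e::real_normed_vector)) set"
    and br :: "'a::real_vector \<Rightarrow> 'a \<Rightarrow> 'a"
    and L :: "'a \<Rightarrow> ('g \<Rightarrow> real) \<Rightarrow> 'g \<Rightarrow> real"
    and \<Theta> :: "'g \<Rightarrow> 'g" and \<theta> :: "'a \<Rightarrow> 'a" and K :: "'g set"
    and Pp Pm \<kk> \<pp> :: "('a \<times> 'a) set"
    and B :: "'a \<times> 'a \<Rightarrow> 'a \<times> 'a \<Rightarrow> complex"
    and sV :: "complex \<Rightarrow> 'v::ab_group_add \<Rightarrow> 'v"
    and \<pi> :: "'a \<times> 'a \<Rightarrow> 'v \<Rightarrow> 'v" and \<kappa> :: "'g \<Rightarrow> 'v \<Rightarrow> 'v"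
    and u us :: "nat \<Rightarrow> 'a \<times> 'a" and n :: nat
    and W :: "(nat set \<Rightarrow> 'v) set"
    and d \<delta> D bd :: "(nat set \<Rightarrow> 'v) \<Rightarrow> nat set \<Rightarrow> 'v"
    and \<rho> :: "'a \<times> 'a \<Rightarrow> complex"
    and KerD H_D :: "('a \<times> 'a, _) lie_rep"
  assumes G: "lie_group G atlas" "connected (UNIV :: 'g set)" "finite (group_center G)"
    and g0: "lie_algebra_of G atlas br L" "semisimple (scaleR :: real \<Rightarrow> 'a \<Rightarrow> 'a) br"
    and theta: "global_cartan_involution G atlas br L \<Theta> \<theta>"
    and K: "K = {g. \<Theta> g = g}"
    and hermitian: "hermitian_symmetric G atlas br L K \<theta> Pp Pm"
    and kp: "\<kk> = kpart \<theta>" "\<pp> = ppart \<theta>"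
    and B: "B = killing cscale (cbracket br)"
    and V: "gK_module G atlas br L K \<theta> sV \<pi> \<kappa>" "irreducible_gK K sV \<pi> \<kappa>" "unitary_gK K sV \<pi> \<kappa>"
    and u: "inj_on u {..<n}" "\<not> module.dependent cscale (u ` {..<n})"
      "module.span cscale (u ` {..<n}) = Pp"
    and us: "\<And>i. i < n \<Longrightarrow> us i \<in> Pm"
      "\<And>i j. i < n \<Longrightarrow> j < n \<Longrightarrow> B (u i) (us j) = (if i = j then 1 else 0)"
    and W: "W = tensor_space n"
    and d: "d = dirac_d cscale B Pp Pm u us n sV \<pi>"
    and delta: "\<delta> = dirac_delta cscale B Pp Pm u us n sV \<pi>"
    and D: "D = (\<lambda>T. d T + \<delta> T)"
    and boundary: "bd = chain_diff cscale (cbracket br) sV \<pi> u n"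
    and rho: "\<rho> = half_trace_ad cscale (cbracket br) Pm"
    and KerD: "KerD = sub_rep (tensor_scale sV)
      (spin_diag_act cscale (cbracket br) B \<pp> Pp Pm u n sV \<pi>) (ker_on W D)"
    and H_D: "H_D = quotient_rep (tensor_scale sV)
      (spin_diag_act cscale (cbracket br) B \<pp> Pp Pm u n sV \<pi>) (ker_on W D) (D ` W \<inter> ker_on W D)"
  shows
    "direct_sum (tensor_scale sV) W [ker_on W D, d ` W, \<delta> ` W] \<and>
     direct_sum (tensor_scale sV) (ker_on W d) [ker_on W D, d ` W] \<and>
     direct_sum (tensor_scale sV) (ker_on W \<delta>) [ker_on W D, \<delta> ` W] \<and>
     D ` W \<inter> ker_on W D = {0} \<and>
     lie_rep_iso cscale (cbracket br) \<kk> KerD H_D (coset (D ` W \<inter> ker_on W D)) \<and>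
     lie_rep_iso cscale (cbracket br) \<kk> KerD
       (twist \<rho> (cohomology_rep cscale (cbracket br) sV \<pi> Pm))
       (\<lambda>h. coset (cochain_diff (cbracket br) sV \<pi> Pm ` cochains cscale sV Pm)
              (to_cochain sV B Pm u n h)) \<and>
     lie_rep_iso cscale (cbracket br) \<kk> KerD
       (twist \<rho> (homology_rep cscale (cbracket br) sV \<pi> u n))
       (coset (bd ` W)) \<and>
     (\<exists>\<phi>. lie_rep_iso cscale (cbracket br) \<kk>
       (twist \<rho> (cohomology_rep cscale (cbracket br) sV \<pi> Pm))
       (twist \<rho> (homology_rep cscale (cbracket br) sV \<pi> u n)) \<phi>) \<and>
     (\<forall>C \<in> coset (d ` W) ` ker_on W d. \<exists>!h. h \<in> C \<and> h \<in> ker_on W D) \<and>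
     (\<forall>C \<in> coset (\<delta> ` W) ` ker_on W \<delta>. \<exists>!h. h \<in> C \<and> h \<in> ker_on W D)"
proof -
  interpret lie_group G atlas by (rule G(1))
  have la: "real_lie_algebra br" using g0(1) by (simp add: real_lie_algebra_def lie_algebra_of_def)
  have th: "\<Theta> \<in> hom G G" "cartan_involution br \<theta>"
    using theta unfolding global_cartan_involution_def by blast+
  have kfB: "real_lie_algebra.kf br = B" using real_lie_algebra.kf_def[OF la] B by simp
  note sub = fixed_subgroup[OF is_group carrier_UNIV th(1) K]
  interpret harish_chandra_module br \<theta> Pp Pm u us n sV \<pi> K \<kappa> "cAd G atlas L" "\<one>\<^bsub>G\<^esub>" "(\<otimes>\<^bsub>G\<^esub>)" "m_inv G"
  proof (intro harish_chandra_module.intro hermitian_pair.intro cartan.intro la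
      cartan_axioms.intro th(2) hermitian_pair_axioms.intro complex_space.intro harish_chandra_module_axioms.intro)
    note mod = gK_moduleD[OF V(1)]
    show vs: "vector_space sV" by (rule mod(1))
    interpret V: complex_space sV using vs by (rule complex_space.intro)
    note hs = hermitian[unfolded hermitian_symmetric_def]
    note her = hs[THEN conjunct1] hs[THEN conjunct2, THEN conjunct2, THEN conjunct1]
      hs[THEN conjunct2, THEN conjunct2, THEN conjunct2, THEN conjunct1]
      hs[THEN conjunct2, THEN conjunct2, THEN conjunct2, THEN conjunct2]
      hs[THEN conjunct2, THEN conjunct1]
    show "direct_sum cscale (ppart \<theta>) [Pp, Pm]" "Pm = cconj ` Pp"
        "parabolic_with_levi cscale (cbracket br) (kpart \<theta>) Pp" "parabolic_with_levi cscale (cbracket br) (kpart \<theta>) Pm"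
      by (fact her)+
    show "cbracket br x y = 0" if "x \<in> Pp" "y \<in> Pp" for x y using bspec[OF her(5), of Pp] that by blast
    show "cbracket br x y = 0" if "x \<in> Pm" "y \<in> Pm" for x y using bspec[OF her(5), of Pm] that by blast
    show "inj_on u {..<n}" "module.independent cscale (u ` {..<n})" "module.span cscale (u ` {..<n}) = Pp"
      by (fact u)+
    show "us i \<in> Pm" if "i < n" for i by (rule us(1)[OF that])
    show "killing cscale (cbracket br) (u i) (us j) = (if i = j then 1 else 0)" if "i < n" "j < n" for i j
      using us(2)[OF that] by (simp only: B)
    show "V.op_linear (\<pi> X)" for X by (intro V.op_linearI mod(2))
    show "V.op_linear (\<kappa> k)" if "k \<in> K" for k using that by (intro V.op_linearI mod(6))
    show "\<pi> (X + Y) v = \<pi> X v + \<pi> Y v" "\<pi> (cscale c X) v = sV c (\<pi> X v)"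
      "\<pi> (cbracket br X Y) v = \<pi> X (\<pi> Y v) - \<pi> Y (\<pi> X v)" "\<kappa> \<one>\<^bsub>G\<^esub> v = v" for X Y c v
      by (fact mod)+
    show "\<one>\<^bsub>G\<^esub> \<in> K" by (rule sub(1))
    show "k \<otimes>\<^bsub>G\<^esub> k' \<in> K" "\<kappa> (k \<otimes>\<^bsub>G\<^esub> k') v = \<kappa> k (\<kappa> k' v)" if "k \<in> K" "k' \<in> K" for k k' v
      using that by (fact sub(2) mod(8))+
    show "m_inv G k \<in> K" "k \<otimes>\<^bsub>G\<^esub> m_inv G k = \<one>\<^bsub>G\<^esub>" "m_inv G k \<otimes>\<^bsub>G\<^esub> k = \<one>\<^bsub>G\<^esub>" if "k \<in> K" for k
      using that by (fact sub(3,4,5))+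
    show "\<exists>A. finite A \<and> (\<lambda>k. \<kappa> k v) ` K \<subseteq> V.span A" for v
      by (rule mod(9))
    show "\<kappa> k (\<pi> X v) = \<pi> (cAd G atlas L k X) (\<kappa> k v)" if "k \<in> K" for k X v
      using that by (rule mod(10))
    show "\<pi> X v \<in> U" if "V.subspace U" "\<And>k v. k \<in> K \<Longrightarrow> v \<in> U \<Longrightarrow> \<kappa> k v \<in> U" "X \<in> kpart \<theta>" "v \<in> U" for U X v
      using that by (rule K_stable_subspace[OF g0(1) V(1)])
    show "\<exists>v :: 'v. v \<noteq> 0" using V(2) by (simp add: irreducible_gK_def)
    show "U = {0} \<or> U = UNIV" if "V.subspace U" "\<And>X v. v \<in> U \<Longrightarrow> \<pi> X v \<in> U"
      "\<And>k v. k \<in> K \<Longrightarrow> v \<in> U \<Longrightarrow> \<kappa> k v \<in> U" for U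
    proof -
      have "\<forall>X. \<pi> X ` U \<subseteq> U" "\<forall>k\<in>K. \<kappa> k ` U \<subseteq> U" using that(2,3) by blast+
      then show ?thesis using V(2) that(1) unfolding irreducible_gK_def by blast
    qed
  qed
  obtain h where h: "positive_hermitian_form sV h" and h_skew: "\<And>x v w. h (\<pi> (x, 0) v) w = - h v (\<pi> (x, 0) w)"
    using V(3) unfolding unitary_gK_def by blast
  interpret U: unitary_polarized_module cscale "cbracket br" B \<kk> Pp Pm u us n sV \<pi> h cconj
    unfolding kfB[symmetric] kp
  proof unfold_locales
    show "positive_hermitian_form sV h" by (rule h)
    show "cconj (x + y) = cconj x + cconj y" "cconj (cscale c x) = cscale (cnj c) (cconj x)"
      "cconj (cconj x) = x" for x y :: "'a \<times> 'a" and c by (fact cconj_add cconj_scale cconj_cconj)+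
    show "kf (cconj x) (cconj y) = cnj (kf x y)" for x y by (rule kf_cconj)
    show "cconj x \<in> Pm" if "x \<in> Pp" for x using that by (rule cconj_Pp)
    show "cconj x \<in> Pp" if "x \<in> Pm" for x using that by (rule cconj_Pm)
    show "0 < Re (kf x (cconj x))" if "x \<in> Pp" "x \<noteq> 0" for x using that by (intro pp_pos Pp_pp)
    show "h (\<pi> X v) w = - h v (\<pi> (cconj X) w)" for X v w
      by (rule skew_complex[OF h pi_add pi_scale h_skew])
    show "cbracket br x y \<in> kpart \<theta>" if "x \<in> Pm" "y \<in> Pp" for x y
      using that by (intro pp_bracket Pm_pp Pp_pp)
    show "\<exists>C. finite C \<and> A \<subseteq> V.span C \<and> (\<forall>X\<in>kpart \<theta>. \<forall>v\<in>V.span C. \<pi> X v \<in> V.span C) \<and>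
        (\<forall>v\<in>V.span C. (\<Sum>i<n. \<pi> (u i) (\<pi> (us i) v)) \<in> V.span C)" if "finite A" for A
      using that by (rule finite_stable)
  qed
  have PP: "U.PP = \<pp>" using pair_PP unfolding kp U.PP_def pair.PP_def .
  note result = U.harmonic_representatives[unfolded PP, OF W d delta D boundary rho KerD H_D]
  show ?thesis
    by (intro conjI result lie_rep_iso_common_source[OF result(6,7)])
qed

end
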